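(* Let $\Gamma$ be a regular nicely distance-balanced graph with valency $k$, diameter $d$ and constant $\gamma=\gamma(\Gamma)$. Then $\gamma=d+1$ if and only if $\Gamma$ is isomorphic to one of the following graphs: 1. the Petersen graph (with $k=3$ and $d=2$); 2. the complement of the Petersen graph (with $k=6$ and $d=2$); 3. the complete multipartite graph $K_{t\times 3}$ with $t$ parts of cardinality $3$, for some integer $t\ge 2$ (with $k=3(t-1)$ and $d=2$); 4. the Möbius ladder graph on eight vertices (with $k=3$ and $d=2$); 5. the Paley graph on $9$ vertices (with $k=4$ and $d=2$); 6. the $3$-dimensional hypercube $Q_3$ (with $k=3$ and $d=3$); 7. the line graph of the $3$-dimensional hypercube $Q_3$ (with $k=4$ and $d=3$); 8. the icosahedron (with $k=5$ and $d=3$).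
   Context: All graphs are finite, simple, undirected and connected, and have at least one edge (so that $\gamma(\Gamma)$ below is uniquely determined). $V(\Gamma)$ is the vertex set and $d(\cdot,\cdot)$ is the shortest-path distance; the diameter is the maximum distance between two vertices. For adjacent vertices $u,v$ let $W_{u,v}=\{x\in V(\Gamma): d(x,u)<d(x,v)\}$. $\Gamma$ is nicely distance-balanced (NDB) if there is a positive integer $\gamma=\gamma(\Gamma)$ such that $|W_{u,v}|=|W_{v,u}|=\gamma$ for every pair of adjacent vertices $u,v$. $\Gamma$ is regular with valency $k$ if every vertex has exactly $k$ neighbours. The Möbius ladder on eight vertices is the $8$-cycle with each pair of antipodal vertices joined by an edge. The Paley graph on $9$ vertices has the field $\mathbb{F}_9$ as vertex set, two elements being adjacent when their difference is a nonzero square. The icosahedron means the graph (1-skeleton) of the regular icosahedron. *)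

theory Defs
  imports
    "HOL-Analysis.Analysis"
    "HOL-Algebra.Ring"
    "Graph_Theory.Pair_Digraph"
    "Graph_Theory.Shortest_Path"
    "Graph_Theory.Digraph_Isomorphism"
begin

text \<open>
  An undirected simple graph is a symmetric loopfree digraph without parallel arcs, as in the
  locale \<open>pair_graph\<close>: an edge between \<open>u\<close> and \<open>v\<close> is the pair of arcs \<open>(u, v)\<close> and \<open>(v, u)\<close>.
\<close>

section \<open>Nicely distance-balanced graphs\<close>

text \<open>The shortest-path distance of the library, with every arc of weight 1.\<close>

definition graph_dist :: "'a pair_pre_digraph \<Rightarrow> 'a \<Rightarrow> 'a \<Rightarrow> ereal" where
  "graph_dist G u v = wf_digraph.\<mu> (with_proj G) (\<lambda>_. 1) u v"

definition graph_diameter :: "'a pair_pre_digraph \<Rightarrow> ereal" where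
  "graph_diameter G = Max ((\<lambda>(u, v). graph_dist G u v) ` (pverts G \<times> pverts G))"

definition closer :: "'a pair_pre_digraph \<Rightarrow> 'a \<Rightarrow> 'a \<Rightarrow> 'a set" where
  "closer G u v = {x \<in> pverts G. graph_dist G x u < graph_dist G x v}"

definition nicely_distance_balanced :: "'a pair_pre_digraph \<Rightarrow> nat \<Rightarrow> bool" where
  "nicely_distance_balanced G \<gamma> \<longleftrightarrow> \<gamma> > 0 \<and>
     (\<forall>(u, v) \<in> parcs G. card (closer G u v) = \<gamma> \<and> card (closer G v u) = \<gamma>)"

text \<open>By symmetry, the arcs leaving a vertex correspond to its neighbours.\<close>

definition regular_graph :: "'a pair_pre_digraph \<Rightarrow> nat \<Rightarrow> bool" where
  "regular_graph G k \<longleftrightarrow> (\<forall>v \<in> pverts G. out_degree (with_proj G) v = k)"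

definition graph_iso :: "'a pair_pre_digraph \<Rightarrow> 'b pair_pre_digraph \<Rightarrow> bool" where
  "graph_iso G H \<longleftrightarrow> digraph_iso (with_proj G) (with_proj H)"

section \<open>Constructions of graphs\<close>

definition complement_graph :: "'a pair_pre_digraph \<Rightarrow> 'a pair_pre_digraph" where
  "complement_graph G = \<lparr> pverts = pverts G,
     parcs = {(u, v) \<in> pverts G \<times> pverts G. u \<noteq> v \<and> (u, v) \<notin> parcs G} \<rparr>"

text \<open>
  The vertices are the undirected edges, so the two arcs of an edge give the same vertex.
\<close>

definition line_graph :: "'a pair_pre_digraph \<Rightarrow> 'a set pair_pre_digraph" where
  "line_graph G = (let E = {{u, v} | u v. (u, v) \<in> parcs G} in
     \<lparr> pverts = E, parcs = {(e, f) \<in> E \<times> E. e \<noteq> f \<and> e \<inter> f \<noteq> {}} \<rparr>)"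

text \<open>Two vertices are adjacent when the segment joining them is a one-dimensional face.\<close>

definition skeleton :: "'a::euclidean_space set \<Rightarrow> 'a pair_pre_digraph" where
  "skeleton P = \<lparr> pverts = {v. v extreme_point_of P},
     parcs = {(u, v). u extreme_point_of P \<and> v extreme_point_of P \<and> u \<noteq> v \<and>
                closed_segment u v edge_of P} \<rparr>"

definition paley_graph :: "('a, 'b) ring_scheme \<Rightarrow> 'a pair_pre_digraph" where
  "paley_graph F = \<lparr> pverts = carrier F,
     parcs = {(x, y) \<in> carrier F \<times> carrier F. x \<ominus>\<^bsub>F\<^esub> y \<noteq> \<zero>\<^bsub>F\<^esub> \<and>
                (\<exists>z \<in> carrier F. x \<ominus>\<^bsub>F\<^esub> y = z \<otimes>\<^bsub>F\<^esub> z)} \<rparr>"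

section \<open>The graphs of the classification\<close>

text \<open>The Petersen graph, as the Kneser graph on the 2-subsets of a 5-set.\<close>

definition petersen :: "nat set pair_pre_digraph" where
  "petersen = (let V = {A. A \<subseteq> {0..<5} \<and> card A = 2} in
     \<lparr> pverts = V, parcs = {(A, B) \<in> V \<times> V. A \<inter> B = {}} \<rparr>)"

text \<open>\<open>t\<close> parts of cardinality \<open>m\<close>; the first component of a vertex is its part.\<close>

definition complete_multipartite :: "nat \<Rightarrow> nat \<Rightarrow> (nat \<times> nat) pair_pre_digraph" where
  "complete_multipartite t m = (let V = {0..<t} \<times> {0..<m} in
     \<lparr> pverts = V, parcs = {(x, y) \<in> V \<times> V. fst x \<noteq> fst y} \<rparr>)"

definition moebius_ladder8 :: "nat pair_pre_digraph" where
  "moebius_ladder8 = \<lparr> pverts = {0..<8},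
     parcs = {(i, j) \<in> {0..<8} \<times> {0..<8}.
                j = (i + 1) mod 8 \<or> i = (j + 1) mod 8 \<or> j = (i + 4) mod 8} \<rparr>"

text \<open>
  The field with 9 elements, as \<open>\<int>/3[i]\<close> with \<open>i\<^sup>2 = -1\<close>; the pair \<open>(a, b)\<close> stands for \<open>a + b i\<close>.
\<close>

definition F9 :: "(int \<times> int) ring" where
  "F9 = \<lparr> carrier = {0..<3} \<times> {0..<3},
     mult = (\<lambda>(a, b) (c, d). ((a * c - b * d) mod 3, (a * d + b * c) mod 3)),
     one = (1, 0),
     zero = (0, 0),
     add = (\<lambda>(a, b) (c, d). ((a + c) mod 3, (b + d) mod 3)) \<rparr>"

lemma F9_abelian_group: "abelian_group F9"
proof (rule abelian_groupI, goal_cases)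
  case (6 x)
  obtain a b where "x = (a, b)" by (cases x)
  then show ?case
    by (intro bexI[of _ "((- a) mod 3, (- b) mod 3)"]) (simp_all add: F9_def mod_simps)
qed (auto simp: F9_def mod_simps ac_simps)

lemma mod3_mult_simps:
  fixes a b c d :: int
  shows "(a * (b mod 3) - c * (d mod 3)) mod 3 = (a * b - c * d) mod 3"
    and "(a * (b mod 3) + c * (d mod 3)) mod 3 = (a * b + c * d) mod 3"
    and "((b mod 3) * a - (d mod 3) * c) mod 3 = (b * a - d * c) mod 3"
    and "((b mod 3) * a + (d mod 3) * c) mod 3 = (b * a + d * c) mod 3"
  using mod_diff_cong[of "a * (b mod 3)" 3 "a * b" "c * (d mod 3)" "c * d"]
    mod_add_cong[of "a * (b mod 3)" 3 "a * b" "c * (d mod 3)" "c * d"]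
    mod_diff_cong[of "(b mod 3) * a" 3 "b * a" "(d mod 3) * c" "d * c"]
    mod_add_cong[of "(b mod 3) * a" 3 "b * a" "(d mod 3) * c" "d * c"]
  by (simp_all only: mod_mult_right_eq mod_mult_left_eq simp_thms)

lemma F9_comm_monoid: "comm_monoid F9"
proof (rule comm_monoidI, goal_cases)
  case (3 x y z)
  show ?case
    by (cases x, cases y, cases z) (simp add: F9_def mod3_mult_simps, simp add: algebra_simps)
next
  case (5 x y)
  show ?case by (cases x, cases y) (simp add: F9_def ac_simps)
qed (auto simp: F9_def)

lemma F9_cring: "cring F9"
proof (rule cringI[OF F9_abelian_group F9_comm_monoid])
  fix x y z
  show "(x \<oplus>\<^bsub>F9\<^esub> y) \<otimes>\<^bsub>F9\<^esub> z = x \<otimes>\<^bsub>F9\<^esub> z \<oplus>\<^bsub>F9\<^esub> y \<otimes>\<^bsub>F9\<^esub> z"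
    by (cases x, cases y, cases z)
      (simp add: F9_def mod3_mult_simps mod_simps, simp add: algebra_simps)
qed

lemma F9_field: "field F9"
proof (rule cring.cring_fieldI2[OF F9_cring])
  show "\<zero>\<^bsub>F9\<^esub> \<noteq> \<one>\<^bsub>F9\<^esub>" by (simp add: F9_def)
next
  have 3: "{0..<3} = {0, 1, 2 :: int}" by auto
  fix x assume x: "x \<in> carrier F9" "x \<noteq> \<zero>\<^bsub>F9\<^esub>"
  obtain a b where "x = (a, b)" by (cases x)
  with x show "\<exists>y \<in> carrier F9. x \<otimes>\<^bsub>F9\<^esub> y = \<one>\<^bsub>F9\<^esub>"
    unfolding F9_def 3 by (simp, elim conjE disjE) simp_all
qed

lemma card_F9: "card (carrier F9) = 9"
  by (simp add: F9_def)
definition hypercube :: "nat \<Rightarrow> bool list pair_pre_digraph" where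
  "hypercube n = (let V = {xs. length xs = n} in
     \<lparr> pverts = V, parcs = {(xs, ys) \<in> V \<times> V. card {i. i < n \<and> xs ! i \<noteq> ys ! i} = 1} \<rparr>)"

text \<open>
  The regular icosahedron of edge length 2: its 12 vertices are the cyclic permutations of
  \<open>(0, \<plusminus>1, \<plusminus>\<phi>)\<close>, with \<open>\<phi>\<close> the golden ratio.
\<close>

definition regular_icosahedron :: "(real^3) set" where
  "regular_icosahedron = (let \<phi> = (1 + sqrt 5) / 2 in
     convex hull (\<Union>s \<in> {1, -1}. \<Union>t \<in> {1, -1}.
       {vector [0, s, t * \<phi>], vector [s, t * \<phi>, 0], vector [t * \<phi>, 0, s]}))"

definition icosahedron :: "(real^3) pair_pre_digraph" where
  "icosahedron = skeleton regular_icosahedron"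

end

theory Submission
  imports Defs
begin

text \<open>
  Let \<open>D\<close> be the diameter and let \<open>\<gamma> = D + 1\<close>. For an edge \<open>u v\<close> the \<open>D + 1\<close> vertices closer to \<open>u\<close>
  than to \<open>v\<close> lie on the levels \<open>0, \<dots>, D - 1\<close> by their distance from \<open>u\<close>, with only \<open>u\<close> on level 0. If the edge
  begins a geodesic of length \<open>D\<close>, no level is empty on the side of the geodesic, so exactly one
  of them has two vertices and all others have one. This near-uniqueness is the source of all restrictions.

  For \<open>D \<ge> 3\<close> the level with two vertices must be level one: a single vertex on that level makes the edge
  slim, and slim edges are excluded by the local analysis that ends in \<open>slim_end.impossible\<close>. Hence vertices at
  distance \<open>D\<close> are antipodal in a strong sense: every neighbour of one is closer to the other, and the antipode is
  unique. Matching the neighbourhoods of two antipodes excludes \<open>D \<ge> 4\<close> (\<open>anti.D_eq_3\<close>), and antipodes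
  exist everywhere. So every edge has two vertices on level one; for \<open>D = 2\<close> the same follows at once
  from \<open>\<gamma> = 3\<close>.

  Now every edge lies in \<open>k - 3\<close> triangles. Counting the edges between the first and the second
  neighbourhood \<open>G2 u\<close> of a vertex gives \<open>card (G2 u) * (k - 3) \<le> 2 * k\<close>. If \<open>D = 3\<close>, the second
  neighbourhood contains that of the antipode, so \<open>k \<le> 5\<close>, and the valencies 3, 4 and 5 give
  the cube, its line graph and the icosahedron (\<open>tight3.diameter_3\<close>). If \<open>D = 2\<close>, the cardinality of \<open>G2 u\<close> is
  constant; it is 2 for the complete multipartite graphs, and otherwise \<open>k \<le> 6\<close> and the
  local structure determines the graph (\<open>tight2.diameter_2\<close>).

  The concrete graphs are handled through neighbour tables: a graph is isomorphic to one of them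
  exactly if it realizes its table (\<open>iso_realizes\<close>), and valency, diameter and \<open>\<gamma>\<close> are evaluated on the table
  (\<open>params_eq\<close>), which gives the converse. For the icosahedron the edges of the polytope are found from the Gram
  matrix of its vertices (\<open>ico_edge\<close>).
\<close>

section \<open>Distance levels of an edge\<close>

text \<open>
  Distances are compared with 1 throughout, so the numeral is the normal form in the simplifier up to
  the end of the two classifications.
\<close>
declare One_nat_def [simp del] One_nat_def [symmetric, simp]

lemma sum_excess_one:
  fixes c :: "nat \<Rightarrow> nat"
  assumes "(\<Sum>i<n. c i) = Suc n" "\<And>i. i < n ==> c i \<ge> 1"
  obtains l where "l < n" "c l = 2" "\<And>i. i < n ==> i ~= l ==> c i = 1"
proof -
  have "(\<Sum>i<n. c i) = (\<Sum>i<n. (c i - 1) + 1)"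
    using assms(2) by (intro sum.cong) (auto dest!: assms(2))
  also have "\<dots> = (\<Sum>i<n. c i - 1) + n"
    by (simp only: sum.distrib) simp
  finally have "(\<Sum>i<n. c i - 1) = Suc 0" using assms(1) by simp
  then obtain l where l: "l < n" "c l - 1 = Suc 0" "\<forall>i\<in>{..<n}. l ~= i --> c i - 1 = 0"
    unfolding sum_eq_Suc0_iff[OF finite_lessThan] by auto
  show ?thesis
  proof
    show "l < n" "c l = 2" using l by auto
    show "c i = 1" if "i < n" "i ~= l" for i
      using l(3) assms(2)[of i] that by force
  qed
qed

text \<open>
  The combinatorial core works with a distance function on a whole type. Pairs that are not two vertices
  of the graph get the value \<open>2 * D + 2\<close> (and 0 on the diagonal): this is larger than the sum of two
  distances in the graph, so the triangle inequality survives, and no such pair is adjacent, lies on a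
  geodesic or contributes to a set of closer vertices.
\<close>
locale ndb =
  fixes d :: "'a \<Rightarrow> 'a \<Rightarrow> nat" and k D :: nat
  assumes d_eq_0 [simp]: "d x y = 0 \<longleftrightarrow> x = y"
    and d_sym: "d x y = d y x"
    and d_tri: "d x z \<le> d x y + d y z"
    and d_step: "d x y = Suc n ==> Suc n \<le> D ==> \<exists>z. d x z = 1 \<and> d z y = n"
    and d_cases: "d x y \<le> D \<or> d x y = 2 * D + 2"
    and finite_verts: "finite {y. d x y \<le> D}"
    and regular: "d x y = 1 ==> card {z. d x z = 1} = k"
    and balanced: "d x y = 1 ==> card {z. d x z < d y z} = Suc D"
    and D_ge_2: "2 \<le> D"
begin

definition N :: "'a \<Rightarrow> 'a set" where "N x = {z. d x z = 1}"
definition W :: "'a \<Rightarrow> 'a \<Rightarrow> 'a set" where "W x y = {z. d x z < d y z}"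
definition lvl :: "'a \<Rightarrow> 'a \<Rightarrow> nat \<Rightarrow> 'a set" where "lvl x y i = {z. d x z = i \<and> d y z = Suc i}"
definition com :: "'a \<Rightarrow> 'a \<Rightarrow> 'a set" where "com x y = {z. d x z = 1 \<and> d y z = 1}"
abbreviation adj :: "'a \<Rightarrow> 'a \<Rightarrow> bool" where "adj x y \<equiv> d x y = 1"

lemma mem_N: "z \<in> N x \<longleftrightarrow> adj x z" by (simp add: N_def)
lemma mem_W: "z \<in> W x y \<longleftrightarrow> d x z < d y z" by (simp add: W_def)
lemma mem_lvl: "z \<in> lvl x y i \<longleftrightarrow> d x z = i \<and> d y z = Suc i" by (simp add: lvl_def)
lemma mem_com: "z \<in> com x y \<longleftrightarrow> adj x z \<and> adj y z" by (simp add: com_def)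
lemmas mem = mem_N mem_W mem_lvl mem_com

lemma d_self [simp]: "d x x = 0" by simp

lemma d_pos [simp]: "0 < d x y \<longleftrightarrow> x ~= y" using d_eq_0[of x y] by linarith

lemma adj_sym: "adj x y ==> adj y x" using d_sym[of x y] by simp
lemma adj_neq: "adj x y ==> x ~= y" by auto
lemma adj_le: "adj x y ==> d x z \<le> Suc (d y z)" using d_tri[of x z y] by linarith
lemma adj_le': "adj x y ==> d y z \<le> Suc (d x z)" using adj_le[OF adj_sym] .
lemma adj_le2: "adj x y ==> d z x \<le> Suc (d z y)"
  using adj_le[of x y z] by (simp add: d_sym[of z])
lemma adj_le2': "adj x y ==> d z y \<le> Suc (d z x)" using adj_le2[OF adj_sym] .

lemma dist_two: "adj z x ==> adj z y ==> x ~= y ==> \<not> adj x y ==> d x y = 2"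
  using d_tri[of x y z] d_sym[of x z] d_eq_0[of x y] by linarith

lemma d_le_D: "d x y \<le> 2 * D + 1 ==> d x y \<le> D" using d_cases[of x y] by linarith

lemma step: assumes "d x y = Suc n" "n < D" obtains z where "adj x z" "d z y = n"
  using d_step[OF assms(1)] assms(2) by auto

lemma W_le: assumes "adj x y" "z \<in> W x y" shows "d x z < D" "d y z = Suc (d x z)"
proof -
  show *: "d y z = Suc (d x z)" using adj_le'[OF assms(1), of z] assms(2) by (simp add: mem)
  show "d x z < D" using d_cases[of x z] d_cases[of y z] * by linarith
qed

lemma finite_ball: "finite {z. d x z = i \<and> P z}" if "i \<le> D"
  by (rule finite_subset[OF _ finite_verts[of x]]) (use that in auto)
lemma finite_N [simp]: "finite (N x)"
  unfolding N_def using finite_ball[of 1 x "\<lambda>_. True"] D_ge_2 by simp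
lemma finite_com [simp]: "finite (com x y)"
  by (rule finite_subset[OF _ finite_N[of x]]) (auto simp: mem)
lemma card_W: "adj x y ==> card (W x y) = Suc D"
  using balanced unfolding W_def by simp
lemma finite_W: "adj x y ==> finite (W x y)"
  using card_W[of x y] by (metis card.infinite nat.simps(3))
lemma card_N: "adj x y ==> card (N x) = k"
  using regular unfolding N_def by simp
lemma lvl_sub_W: "lvl x y i \<subseteq> W x y" by (auto simp: mem)
lemma finite_lvl [simp]: "adj x y ==> finite (lvl x y i)"
  using finite_W lvl_sub_W finite_subset by metis
lemma lvl_0: "adj x y ==> lvl x y 0 = {x}" by (auto simp: mem dest: adj_sym)

lemma W_step:
  assumes "adj x y" "z \<in> W x y" "z ~= x"
  obtains t where "t \<in> lvl x y 1" "Suc (d t z) = d x z"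
proof -
  obtain n where n: "d x z = Suc n" using assms(3) by (metis d_eq_0 not0_implies_Suc)
  have z: "d x z < D" "d y z = Suc (d x z)" using W_le[OF assms(1,2)] by auto
  obtain t where t: "adj x t" "d t z = n" using step[OF n] z n by auto
  have "d y t ~= 1" using adj_le[of y t z] z n t by auto
  moreover have "y ~= t" using z n t by auto
  moreover have "d y t \<le> 2" using adj_le'[OF assms(1), of t] t by simp
  ultimately have "d y t = 2" using d_eq_0[of y t] by linarith
  then show ?thesis using that[of t] t n by (simp add: mem)
qed

lemma lvl1_not_empty: assumes "adj x y" shows "lvl x y 1 ~= {}"
proof
  assume e: "lvl x y 1 = {}"
  have "z = x" if "z \<in> W x y" for z
    using W_step[OF assms that] e by blast
  then have "W x y \<subseteq> {x}" by blast
  then have "card (W x y) \<le> 1" using card_mono[of "{x}" "W x y"] by simp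
  then show False using card_W[OF assms] D_ge_2 by simp
qed

text \<open>Adjacent vertices are not twins.\<close>
lemma no_twins: "adj x y ==> \<exists>z. adj x z \<and> z ~= y \<and> \<not> adj y z"
  using lvl1_not_empty[of x y] by (force simp: mem)

lemma N_split: "adj x y ==> N x = insert y (com x y \<union> lvl x y 1)"
proof -
  assume a: "adj x y"
  have "z = y \<or> adj y z \<or> d y z = 2" if "adj x z" for z
    using dist_two[of x y z] a that by auto
  then have "z \<in> N x \<longleftrightarrow> z \<in> insert y (com x y \<union> lvl x y 1)" for z
    using a by (fastforce simp: mem)
  then show ?thesis by blast
qed

lemma card_split: "adj x y ==> card (com x y) + card (lvl x y 1) + 1 = k"
proof -
  assume a: "adj x y"
  have "card (N x) = Suc (card (com x y \<union> lvl x y 1))"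
    unfolding N_split[OF a] using a by (subst card_insert_disjoint) (auto simp: mem)
  also have "card (com x y \<union> lvl x y 1) = card (com x y) + card (lvl x y 1)"
    using a by (intro card_Un_disjoint) (auto simp: mem)
  finally show ?thesis using card_N[OF a] by simp
qed

lemma com_commute: "com x y = com y x" by (auto simp: mem)

lemma card_lvl1_commute: "adj x y ==> card (lvl x y 1) = card (lvl y x 1)"
  using card_split[of x y] card_split[of y x] adj_sym com_commute[of x y] by simp

lemma W_levels: "adj x y ==> W x y = (\<Union>i<D. lvl x y i)"
proof -
  assume a: "adj x y"
  have "z \<in> (\<Union>i<D. lvl x y i)" if "z \<in> W x y" for z
    using W_le[OF a that] by (simp add: mem)
  then show ?thesis using lvl_sub_W by blast
qed

lemma geodesic: "d x y = m ==> m \<le> D ==> i \<le> m ==> \<exists>z. d x z = i \<and> d z y = m - i"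
proof (induction i arbitrary: x m)
  case 0 then show ?case by auto
next
  case (Suc i)
  obtain n where n: "m = Suc n" using Suc.prems by (cases m) auto
  obtain z where z: "adj x z" "d z y = n" using step[of x y n] Suc.prems n by auto
  obtain t where t: "d z t = i" "d t y = n - i" using Suc.IH[OF z(2)] Suc.prems n by auto
  have "d x t \<le> Suc i" using adj_le[OF z(1), of t] t by simp
  moreover have "m \<le> d x t + (n - i)" using d_tri[of x y t] t Suc.prems by simp
  ultimately have "d x t = Suc i" using n Suc.prems by simp
  then show ?case using t n by auto
qed

text \<open>An edge \<open>u v\<close> that begins a geodesic of length \<open>D\<close> to \<open>w\<close>.\<close>
definition ecc :: "'a \<Rightarrow> 'a \<Rightarrow> 'a \<Rightarrow> bool" where
  "ecc u v w \<longleftrightarrow> adj u v \<and> d u w = D \<and> Suc (d v w) = D"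

lemma eccD: assumes "ecc u v w" shows "adj u v" "adj v u" "d u w = D" "Suc (d v w) = D"
  using assms adj_sym unfolding ecc_def by auto

lemma ecc_geodesic: assumes "ecc u v w" "i < D"
  obtains z where "z \<in> lvl v u i" "d z w = D - Suc i"
proof -
  note e = eccD[OF assms(1)]
  obtain z where z: "d v z = i" "d z w = D - 1 - i"
    using geodesic[of v w "D - 1" i] e(4) assms(2) by fastforce
  have "d u z \<le> Suc i" using adj_le[OF e(1), of z] z by simp
  moreover have "D \<le> d u z + (D - 1 - i)" using d_tri[of u w z] e z by simp
  ultimately show ?thesis using that[of z] z assms(2) by (simp add: mem)
qed

lemma ecc_levels: assumes "ecc u v w"
  obtains l where "0 < l" "l < D" "card (lvl v u l) = 2" "\<And>i. i < D ==> i ~= l ==> card (lvl v u i) = 1"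
proof -
  note e = eccD[OF assms(1)]
  have "(\<Sum>i<D. card (lvl v u i)) = card (\<Union>i<D. lvl v u i)"
    using e by (subst card_UN_disjoint) (auto simp: mem)
  also have "\<dots> = Suc D" using W_levels[OF e(2)] card_W[OF e(2)] by simp
  finally have s: "(\<Sum>i<D. card (lvl v u i)) = Suc D" .
  have ne: "card (lvl v u i) \<ge> 1" if i: "i < D" for i
  proof -
    obtain z where "z \<in> lvl v u i" using ecc_geodesic[OF assms i] by blast
    then have "0 < card (lvl v u i)" using finite_lvl[OF e(2), of i] card_gt_0_iff by blast
    then show ?thesis by simp
  qed
  obtain l where
    l: "l < D" "card (lvl v u l) = 2" "\<And>i. i < D ==> i ~= l ==> card (lvl v u i) = 1"
    by (rule sum_excess_one[OF s ne]) blast+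
  have "l ~= 0" using l(2) lvl_0[OF e(2)] by (cases "l = 0") auto
  then show ?thesis using that l by auto
qed

lemma ecc_card_lvl1: "ecc u v w ==> card (lvl v u 1) = 1 \<or> card (lvl v u 1) = 2"
proof -
  assume "ecc u v w"
  then obtain l where l: "card (lvl v u l) = 2" "\<And>i. i < D ==> i ~= l ==> card (lvl v u i) = 1"
    using ecc_levels by blast
  show ?thesis using l(1) l(2)[of 1] D_ge_2 by (cases "l = 1") auto
qed

lemma ecc_unique:
  assumes "ecc u v w" "card (lvl v u j) = 2" "j < D" "i < D" "i ~= j" "a \<in> lvl v u i" "b \<in> lvl v u i"
  shows "a = b"
proof -
  obtain l where l: "card (lvl v u l) = 2" "\<And>i. i < D ==> i ~= l ==> card (lvl v u i) = 1"
    using ecc_levels[OF assms(1)] by blast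
  have "l = j" using l(2)[of j] assms by auto
  then have "card (lvl v u i) = 1" using l(2)[of i] assms by auto
  then show ?thesis using assms(6,7) by (metis card_1_singletonE singletonD)
qed

end

section \<open>Edges with a single vertex on level one\<close>

context ndb begin

text \<open>
  In a slim edge \<open>u v\<close> all but one of the other neighbours of \<open>u\<close> are common neighbours of \<open>u\<close> and \<open>v\<close>.
\<close>
definition slim :: "'a \<Rightarrow> 'a \<Rightarrow> 'a \<Rightarrow> 'a \<Rightarrow> bool" where
  "slim u v y x \<longleftrightarrow> adj u v \<and> lvl u v 1 = {y} \<and> lvl v u 1 = {x}"

lemma slim_sym: "slim u v y x ==> slim v u x y"
  using adj_sym unfolding slim_def by blast

lemma slimD: assumes "slim u v y x"
  shows "adj u v" "adj v u" "adj v x" "d u x = 2" "adj u y" "d v y = 2"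
    "lvl u v 1 = {y}" "lvl v u 1 = {x}"
    "N u = insert v (insert y (com u v))" "N v = insert u (insert x (com u v))"
proof -
  show a: "adj u v" "adj v u" "lvl u v 1 = {y}" "lvl v u 1 = {x}"
    using assms adj_sym unfolding slim_def by auto
  have "x \<in> lvl v u 1" "y \<in> lvl u v 1" using a by auto
  then show "adj v x" "d u x = 2" "adj u y" "d v y = 2" by (auto simp: mem)
  show "N u = insert v (insert y (com u v))" "N v = insert u (insert x (com u v))"
    using N_split[OF a(1)] N_split[OF a(2)] a com_commute[of u v] by auto
qed

lemma slim_via: assumes "slim u v y x" "z \<in> W v u" "z ~= v" shows "Suc (d x z) = d v z"
  using W_step[OF slimD(2)[OF assms(1)] assms(2,3)] slimD(8)[OF assms(1)] by (metis singletonD)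

lemma slim_com:
  assumes s: "slim u v y x" and z: "z \<in> com u v" "adj z x"
  shows "adj z y" "W u z = insert u (W v z - {v})"
proof -
  note s' = slimD[OF s]
  have uz: "adj u z" and vz: "adj v z" using z by (auto simp: mem)
  have sub: "t \<in> W u z" if t: "t \<in> W v z" "t ~= v" for t
  proof -
    obtain p where p: "p \<in> lvl v z 1" "Suc (d p t) = d v t" using W_step[OF vz t] by blast
    have "p \<in> N v" using p by (simp add: mem)
    moreover have "p ~= x" "p ~= u" using p z uz adj_sym by (auto simp: mem)
    ultimately have "adj u p" using s'(10) by (auto simp: mem)
    then have "d u t \<le> d v t" using adj_le[of u p t] p by simp
    then show ?thesis using t by (simp add: mem)
  qed
  have "u \<in> W u z" using adj_neq[OF uz] by (simp add: mem)
  then have "insert u (W v z - {v}) \<subseteq> W u z" using sub by blast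
  moreover have "card (insert u (W v z - {v})) = Suc D"
  proof -
    have "u \<notin> W v z" using uz vz s' adj_sym by (auto simp: mem)
    moreover have "v \<in> W v z" using vz adj_sym by (auto simp: mem)
    ultimately show ?thesis using card_W[OF vz] finite_W[OF vz] by simp
  qed
  ultimately show eq: "W u z = insert u (W v z - {v})"
    using card_subset_eq[OF finite_W[OF uz]] card_W[OF uz] by metis
  show "adj z y"
  proof (rule ccontr)
    assume n: "\<not> adj z y"
    have "z ~= y" using vz s' by auto
    then have zy: "d z y = 2" using dist_two[of u z y] uz s' n by auto
    then have "y \<in> W u z" using s' by (simp add: mem)
    moreover have "u ~= y" using s' by auto
    ultimately have "y \<in> W v z" using eq by auto
    then show False using zy s' by (simp add: mem)
  qed
qed

lemma slim_com_iff: "slim u v y x ==> z \<in> com u v ==> adj z x \<longleftrightarrow> adj z y"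
  using slim_com(1)[of u v y x z] slim_com(1)[of v u x y z] slim_sym[of u v y x]
    com_commute[of u v] by auto

lemma slim_extra: assumes s: "slim u v y x"
  obtains g where "W x v = insert g (W v u - {v})" "g \<notin> W v u"
proof -
  note s' = slimD[OF s]
  have xv: "adj x v" using s' adj_sym by blast
  have sub: "W v u - {v} \<subseteq> W x v"
    using slim_via[OF s] by (force simp: mem)
  have "v \<in> W v u" using s' by (auto simp: mem)
  then have c: "card (W v u - {v}) = D" using card_W[OF s'(2)] finite_W[OF s'(2)] by simp
  have "card (W x v - (W v u - {v})) = 1"
    using card_Diff_subset[OF _ sub] finite_W[OF s'(2)] card_W[OF xv] c by simp
  then obtain g where g: "W x v - (W v u - {v}) = {g}" by (rule card_1_singletonE)
  have "v \<notin> W x v" by (simp add: mem)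
  then have "g ~= v" using g by auto
  then show ?thesis using that[of g] g sub by blast
qed

text \<open>In an edge beginning a diametral geodesic with one vertex on level one, the valency exceeds 2.\<close>
lemma ecc_slim_k: assumes e: "ecc u v w" and c: "card (lvl v u 1) = 1" shows "3 \<le> k"
proof -
  note e' = eccD[OF e]
  obtain l where l: "0 < l" "l < D" "card (lvl v u l) = 2" "\<And>i. i < D ==> i ~= l ==> card (lvl v u i) = 1"
    using ecc_levels[OF e] by blast
  have "l ~= 1" using l(3) c by auto
  with l(1) have l2: "2 \<le> l" by simp
  then obtain j where j: "l = Suc (Suc j)" by (metis Suc_le_D numeral_2_eq_2 Suc_le_mono)
  obtain p q where pq: "lvl v u l = {p, q}" "p ~= q" using l(3) by (meson card_2_iff)
  have lb: "Suc j < D" "Suc j ~= l" "j < D" using l j by auto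
  obtain s where s: "lvl v u (Suc j) = {s}" using l(4)[OF lb(1,2)] by (rule card_1_singletonE)
  have pred: "\<exists>t. t \<in> lvl v u i \<and> adj t z" if z: "z \<in> lvl v u (Suc i)" "i < D" for z i
  proof -
    have "d v z = Suc i" "d u z = Suc (Suc i)" using z by (auto simp: mem)
    then obtain t where t: "d v t = i" "d t z = 1" using geodesic[of v z "Suc i" i] z by auto
    have "d u t \<le> Suc i" using adj_le[OF e'(1), of t] t by simp
    moreover have "d u z \<le> d u t + 1" using d_tri[of u z t] t by simp
    ultimately show ?thesis using t \<open>d u z = Suc (Suc i)\<close> by (auto simp: mem)
  qed
  have "p \<in> lvl v u (Suc (Suc j))" "q \<in> lvl v u (Suc (Suc j))" using pq(1) unfolding j by auto
  then have sp: "adj s p" "adj s q" using pred[of p "Suc j"] pred[of q "Suc j"] s lb by (metis singletonD)+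
  have "s \<in> lvl v u (Suc j)" using s by simp
  then obtain t where t: "t \<in> lvl v u j" "adj t s" using pred[of s j] lb(3) by blast
  have "d v p = Suc (Suc j)" using \<open>p \<in> _\<close> unfolding mem by blast
  moreover have "d v q = Suc (Suc j)" using \<open>q \<in> _\<close> unfolding mem by blast
  moreover have "d v t = j" using t unfolding mem by blast
  ultimately have "t ~= p" "t ~= q" by (metis n_not_Suc_n Suc_n_not_le_n le_SucI order_refl)+
  then have "{p, q, t} \<subseteq> N s" "card {p, q, t} = 3" using pq sp adj_sym[OF t(2)] by (auto simp: mem)
  then have "3 \<le> card (N s)" using card_mono[OF finite_N, of "{p, q, t}" s] by simp
  then show ?thesis using card_N[OF sp(1)] by simp
qed

end

text \<open>
  A slim edge that begins a diametral geodesic. The common neighbours of \<open>u\<close> and \<open>v\<close> are split by their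
  adjacency to the vertex \<open>x\<close> that continues the geodesic; each way in which they can fall leads to a
  configuration of constant local shape, and these are excluded one by one.
\<close>
locale slim_end = ndb +
  fixes u v w x y
  assumes ecc: "ecc u v w" and slim: "slim u v y x" and D3: "3 \<le> D"
begin

lemmas s = slimD[OF slim]
lemmas e = eccD[OF ecc]
definition "Z = com u v"
definition "Q = {z \<in> Z. adj z x}"
definition "R = {z \<in> Z. \<not> adj z x}"

lemma finZ: "finite Z" "finite Q" "finite R"
  unfolding Z_def Q_def R_def by auto
lemma ZD: "z \<in> Z ==> adj u z" "z \<in> Z ==> adj v z" "z \<in> Z ==> adj z u" "z \<in> Z ==> adj z v"
  unfolding Z_def mem using adj_sym by auto
lemma Z_neq: "z \<in> Z ==> z ~= x" "z \<in> Z ==> z ~= y" "z \<in> Z ==> z ~= u" "z \<in> Z ==> z ~= v"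
  using ZD s by (auto dest: adj_neq)
lemma Q_y: "z \<in> Q ==> adj z y" and R_y: "z \<in> R ==> \<not> adj z y"
  using slim_com_iff[OF slim] unfolding Q_def R_def Z_def by auto
lemma QR: "Z = Q \<union> R" "Q \<inter> R = {}" unfolding Q_def R_def by auto

lemma k3: "3 \<le> k" using ecc_slim_k[OF ecc] s by simp
lemma cardZ: "card Z + 2 = k" using card_split[OF s(1)] s unfolding Z_def by simp
lemma lvl2_adj: "z \<in> lvl v u 2 ==> adj x z"
proof -
  assume z: "z \<in> lvl v u 2"
  then have "z ~= v" by (auto simp: mem)
  then show "adj x z" using slim_via[OF slim, of z] z by (auto simp: mem)
qed

lemma x3: obtains p where "p \<in> lvl v u 2" "adj x p" "d v p = 2" "d u p = 3"
  using ecc_geodesic[OF ecc, of 2] D3 lvl2_adj by (auto simp: mem)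

lemma x_w: "d x w + 2 = D"
proof -
  obtain z where "z \<in> lvl v u 1" "d z w = D - Suc 1" using ecc_geodesic[OF ecc, of 1] D3 by auto
  then show ?thesis using s D3 by auto
qed

lemma ecc_Q: assumes "q \<in> Q" shows "ecc u q w"
proof -
  have q: "adj q x" "adj u q" using assms ZD unfolding Q_def by auto
  have "d q w \<le> Suc (d x w)" "d u w \<le> Suc (d q w)" using adj_le[OF q(1), of w] adj_le[OF q(2), of w] by auto
  then show ?thesis using q x_w e unfolding ecc_def by simp
qed

lemma R_nonempty: "R ~= {}"
proof
  assume "R = {}"
  then have ZQ: "Z = Q" using QR by auto
  have "Z ~= {}" using cardZ k3 by auto
  then obtain q where q: "q \<in> Q" using ZQ by auto
  obtain p where p: "adj x p" "d v p = 2" "d u p = 3" using x3 by blast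
  have xv: "adj x v" using s adj_sym by blast
  have l: "lvl v x 1 = {u}"
  proof -
    have "z = u" if z: "z \<in> lvl v x 1" for z
    proof -
      have "z \<in> N v" "d x z = 2" using z by (auto simp: mem)
      then have "z = u \<or> z \<in> Z" using s by (auto simp: Z_def)
      moreover have "z \<notin> Z" using ZQ \<open>d x z = 2\<close> adj_sym[of z x] unfolding Q_def by auto
      ultimately show ?thesis by blast
    qed
    moreover have "u \<in> lvl v x 1" using s by (simp add: mem d_sym[of x u])
    ultimately show ?thesis by blast
  qed
  then have "card (lvl x v 1) = 1" using card_lvl1_commute[OF xv] by simp
  moreover have "p \<in> lvl x v 1" using p by (simp add: mem)
  ultimately have "lvl x v 1 = {p}" by (metis card_1_singletonE singletonD)
  then have sl: "slim v x u p" using l s unfolding slim_def by simp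
  have "q \<in> com v x" using q ZD unfolding Q_def by (auto simp: mem dest: adj_sym)
  moreover have "adj q u" using q ZD unfolding Q_def by auto
  ultimately have "adj q p" using slim_com_iff[OF sl] by blast
  then have "d u p \<le> 2" using adj_le[of u q p] q ZD unfolding Q_def by auto
  then show False using p by simp
qed

lemma lvl_vx: "lvl v x 1 = insert u R"
proof -
  have "z \<in> lvl v x 1 \<longleftrightarrow> z \<in> insert u R" for z
  proof -
    have "z \<in> N v \<longleftrightarrow> z = u \<or> z = x \<or> z \<in> Z" using s unfolding Z_def by auto
    moreover have "d x z = 2" if "z \<in> R"
      using that dist_two[of v x z] s ZD Z_neq adj_sym[of x z] unfolding R_def by auto
    moreover have "d x z = 1" if "z \<in> Q" using that adj_sym unfolding Q_def by auto
    moreover have "d x u = 2" using s by (simp add: d_sym[of x u])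
    ultimately show ?thesis using QR s ZD by (auto simp: mem)
  qed
  then show ?thesis by blast
qed

lemma card_lvl_xv: "card (lvl x v 1) = Suc (card R)"
proof -
  have "u \<notin> R" using Z_neq unfolding R_def by auto
  then show ?thesis using card_lvl1_commute[OF s(3)] lvl_vx finZ by simp
qed

lemma lvl_xv_sub: "\<exists>g. lvl x v 1 \<subseteq> insert g (lvl v u 2)"
proof -
  obtain g where g: "W x v = insert g (W v u - {v})" using slim_extra[OF slim] by blast
  have "z \<in> insert g (lvl v u 2)" if z: "z \<in> lvl x v 1" for z
  proof -
    have "z \<in> insert g (W v u)" "d v z = 2" using z g lvl_sub_W by (auto simp: mem)
    then show ?thesis using W_le(2)[OF s(2), of z] by (auto simp: mem)
  qed
  then show ?thesis by blast
qed

lemma card_lvl2: "card R \<le> card (lvl v u 2)" "card (lvl v u 2) \<le> 2"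
proof -
  obtain g where g: "lvl x v 1 \<subseteq> insert g (lvl v u 2)" using lvl_xv_sub by blast
  have "Suc (card R) \<le> card (insert g (lvl v u 2))"
    unfolding card_lvl_xv[symmetric] using s by (intro card_mono[OF _ g]) auto
  also have "\<dots> \<le> Suc (card (lvl v u 2))" by (rule card_insert_le_m1) auto
  finally show "card R \<le> card (lvl v u 2)" by simp
  obtain l where l: "card (lvl v u l) = 2" "\<And>i. i < D ==> i ~= l ==> card (lvl v u i) = 1"
    using ecc_levels[OF ecc] by blast
  show "card (lvl v u 2) \<le> 2" using l(1) l(2)[of 2] D3 by (cases "l = 2") auto
qed

lemma R_few_nonadj: assumes r: "r \<in> R" shows "card {z \<in> Z. z ~= r \<and> \<not> adj r z} \<le> 1"
proof -
  let ?S = "{z \<in> Z. z ~= r \<and> \<not> adj r z}"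
  have rZ: "r \<in> Z" using r QR by auto
  note rr = ZD[OF rZ] Z_neq[OF rZ]
  have nx: "\<not> adj r x" and ny: "\<not> adj r y" using r R_y unfolding R_def by auto
  have two: "d r z = 2" if "z \<in> ?S" for z using that dist_two[of u r z] rr ZD by auto
  have "d u w \<le> Suc (d r w)" "d r w \<le> Suc (d v w)" using adj_le rr by auto
  then consider "d r w = D" | "Suc (d r w) = D" using e by linarith
  then show ?thesis
  proof cases
    case 1
    then have ec: "ecc r v w" using e rr unfolding ecc_def by auto
    have "d r x = 2" using dist_two[of v r x] rr nx s by auto
    then have "\<forall>z\<in>insert x ?S. d v z = 1 \<and> d r z = 2" using s(3) ZD(2) two by blast
    then have "insert x ?S \<subseteq> lvl v r 1" unfolding lvl_def by simp blast
    then have "card (insert x ?S) \<le> card (lvl v r 1)" using card_mono[OF finite_lvl[OF rr(2)]] by blast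
    then have "card (insert x ?S) \<le> 2" using ecc_card_lvl1[OF ec] by auto
    moreover have "x \<notin> ?S" using Z_neq by auto
    ultimately show ?thesis using finZ by simp
  next
    case 2
    then have ec: "ecc u r w" using e rr unfolding ecc_def by auto
    have "d r y = 2" using dist_two[of u r y] rr ny s by auto
    then have "\<forall>z\<in>insert y ?S. d u z = 1 \<and> d r z = 2" using s(5) ZD(1) two by blast
    then have "insert y ?S \<subseteq> lvl u r 1" unfolding lvl_def by simp blast
    then have "card (insert y ?S) \<le> card (lvl u r 1)" using card_mono[OF finite_lvl[OF rr(1)]] by blast
    then have "card (insert y ?S) \<le> 2" using ecc_card_lvl1[OF ec] card_lvl1_commute[OF rr(1)] by auto
    moreover have "y \<notin> ?S" using Z_neq by auto
    ultimately show ?thesis using finZ by simp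
  qed
qed

lemma lvl_uq: assumes q: "q \<in> Q" shows "lvl u q 1 = {z \<in> Z. z ~= q \<and> \<not> adj q z}"
proof -
  have qZ: "q \<in> Z" using q QR by auto
  have "z \<in> lvl u q 1 \<longleftrightarrow> z \<in> {z \<in> Z. z ~= q \<and> \<not> adj q z}" for z
  proof -
    have "z \<in> N u \<longleftrightarrow> z = v \<or> z = y \<or> z \<in> Z" using s unfolding Z_def by auto
    moreover have "d q z = 2" if "z \<in> Z" "z ~= q" "\<not> adj q z"
      using dist_two[of u q z] that ZD qZ by auto
    ultimately show ?thesis using Q_y[OF q] ZD[OF qZ] by (auto simp: mem)
  qed
  then show ?thesis by blast
qed

lemma Q_misses_R: assumes q: "q \<in> Q" shows "\<exists>r\<in>R. \<not> adj q r"
proof (rule ccontr)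
  assume "\<not> ?thesis"
  then have all: "adj q r" if "r \<in> R" for r using that by auto
  have qZ: "q \<in> Z" and qx: "adj q x" using q unfolding Q_def by auto
  note qq = ZD[OF qZ] Z_neq[OF qZ]
  have xq: "adj x q" using qx adj_sym by blast
  have sub: "t \<in> W x q" if t: "t \<in> W v q" "t ~= v" for t
  proof -
    obtain p where p: "p \<in> lvl v q 1" "Suc (d p t) = d v t" using W_step[OF qq(2) t] by blast
    have "p \<in> N v" "d q p = 2" using p by (auto simp: mem)
    moreover have "p ~= x" "p ~= u" using \<open>d q p = 2\<close> qx qq by auto
    ultimately have "p \<in> Z" using s by (auto simp: Z_def)
    then have "adj p x" using all[of p] \<open>d q p = 2\<close> unfolding R_def by auto
    then have "d x t \<le> d v t" using adj_le'[of p x t] p by simp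
    then show ?thesis using t by (simp add: mem)
  qed
  have "x \<in> W x q" using adj_neq[OF xq] by (simp add: mem)
  then have "insert x (W v q - {v}) \<subseteq> W x q" using sub by blast
  moreover have "card (insert x (W v q - {v})) = Suc D"
  proof -
    have "x \<notin> W v q" using qx s by (simp add: mem)
    moreover have "v \<in> W v q" using qq by (simp add: mem)
    ultimately show ?thesis using card_W[OF qq(2)] finite_W[OF qq(2)] by simp
  qed
  ultimately have eq: "W x q = insert x (W v q - {v})"
    using card_subset_eq[OF finite_W[OF xq]] card_W[OF xq] by metis
  obtain p where p: "adj x p" "d v p = 2" "d u p = 3" using x3 by blast
  have "d q p \<le> 2" "3 \<le> Suc (d q p)" using adj_le[OF qx, of p] adj_le[OF qq(1), of p] p by auto
  then have qp: "d q p = 2" by simp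
  then have "p \<in> W x q" using p by (simp add: mem)
  moreover have "p ~= x" using p by auto
  ultimately have "p \<in> W v q" using eq by auto
  then show False using p qp by (simp add: mem)
qed

lemma cases:
  obtains (clique) "Q = {}" "\<And>a b. a \<in> Z ==> b \<in> Z ==> a ~= b ==> adj a b"
  | (diamond) r1 r2 where "Z = {r1, r2}" "r1 ~= r2" "\<not> adj r1 r2" "\<not> adj r1 x" "\<not> adj r2 x"
  | (octa) q r where "Z = {q, r}" "q ~= r" "\<not> adj q r" "adj q x" "\<not> adj r x"
proof (cases "Q = {}")
  case True
  then have ZR: "Z = R" using QR by auto
  have "card Z \<le> 2" using card_lvl2 ZR by simp
  moreover have "card Z ~= 0" using R_nonempty ZR finZ by simp
  ultimately consider "card Z = 1" | "card Z = 2" by linarith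
  then show ?thesis
  proof cases
    case 1
    then show ?thesis using clique[OF True] by (metis card_1_singletonE singletonD)
  next
    case 2
    then obtain r1 r2 where r: "Z = {r1, r2}" "r1 ~= r2" by (meson card_2_iff)
    have "\<not> adj r1 x" "\<not> adj r2 x" using ZR r unfolding R_def by auto
    moreover have "adj a b" if "adj r1 r2" "a \<in> Z" "b \<in> Z" "a ~= b" for a b
      using that r adj_sym by auto
    ultimately show ?thesis using clique[OF True] diamond r by blast
  qed
next
  case False
  then obtain q where q: "q \<in> Q" by auto
  then obtain r where r: "r \<in> R" "\<not> adj q r" using Q_misses_R by blast
  have qZ: "q \<in> Z" and qx: "adj q x" and rZ: "r \<in> Z" using q r QR unfolding Q_def by auto
  have rq: "\<not> adj r q" using r adj_sym by blast
  have qr: "q ~= r" using q r QR by auto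
  have only: "z = q" if "z \<in> Z" "z ~= r" "\<not> adj r z" for z
  proof (rule ccontr)
    assume n: "z ~= q"
    have "{z, q} \<subseteq> {z \<in> Z. z ~= r \<and> \<not> adj r z}" using that qZ rq qr by auto
    from card_mono[OF _ this] show False using R_few_nonadj[OF r(1)] n finZ by simp
  qed
  have "card R ~= 2"
  proof
    assume R2: "card R = 2"
    then obtain r2 where r2: "r2 \<in> R" "r2 ~= r" using r(1) by (metis card_2_iff')
    have r2': "r2 \<in> Z" "r2 ~= q" "\<not> adj r2 x" using r2 q QR unfolding R_def by auto
    have "adj r r2" using only[of r2] r2 r2' by auto
    have ec: "ecc u q w" by (rule ecc_Q[OF q])
    note ec' = eccD[OF ec]
    consider "card (lvl q u 1) = 1" | "card (lvl q u 1) = 2" using ecc_card_lvl1[OF ec] by blast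
    then show False
    proof cases
      case 1
      have "x \<in> lvl q u 1" using qx s by (simp add: mem)
      then have lx: "lvl q u 1 = {x}" using 1 by (metis card_1_singletonE singletonD)
      have "card (lvl u q 1) = 1" using 1 card_lvl1_commute[OF ec'(1)] by simp
      moreover have "r \<in> lvl u q 1" using lvl_uq[OF q] rZ r(2) qr by auto
      ultimately have lr: "lvl u q 1 = {r}" by (metis card_1_singletonE singletonD)
      have sl: "slim u q r x" using lx lr ec' unfolding slim_def by simp
      have "adj q r2" using lvl_uq[OF q] lr r2' r2 by auto
      then have "r2 \<in> com u q" using ZD r2' by (auto simp: mem)
      then have "adj r2 x" using slim_com_iff[OF sl] adj_sym[OF \<open>adj r r2\<close>] by blast
      then show False using r2' by simp
    next
      case 2
      have "lvl v u 2 \<subseteq> lvl q u 2"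
      proof
        fix p assume p: "p \<in> lvl v u 2"
        have "adj x p" "d u p = 3" using lvl2_adj[OF p] p by (auto simp: mem)
        then have "d q p \<le> 2" "3 \<le> Suc (d q p)" using adj_le[OF qx, of p] adj_le[OF ec'(1), of p] by auto
        then show "p \<in> lvl q u 2" using \<open>d u p = 3\<close> by (simp add: mem)
      qed
      moreover have "card (lvl v u 2) = 2" using card_lvl2 R2 by simp
      then obtain a b where "a \<in> lvl v u 2" "b \<in> lvl v u 2" "a ~= b" by (metis card_2_iff')
      ultimately show False using ecc_unique[OF ec 2, of 2 a b] D3 by auto
    qed
  qed
  moreover have "card R \<le> 2" "card R ~= 0" using card_lvl2 R_nonempty finZ by auto
  ultimately have "card R = 1" by linarith
  then have Rr: "R = {r}" using r(1) by (metis card_1_singletonE singletonD)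
  have "q' = q" if q': "q' \<in> Q" for q'
  proof -
    have "\<not> adj q' r" using Q_misses_R[OF q'] Rr by auto
    then show ?thesis using only[of q'] q' r(1) QR adj_sym[of r q'] by auto
  qed
  then have "Q = {q}" using q by blast
  then have "Z = {q, r}" using QR Rr by auto
  moreover have "\<not> adj r x" using r(1) unfolding R_def by auto
  ultimately show ?thesis using octa qr r(2) qx by blast
qed

end

section \<open>Octahedral configurations\<close>

context ndb begin

lemma com_N: "com a b = N a \<inter> N b" by (auto simp: mem)

lemma lvl1_N: "adj a b ==> lvl a b 1 = N a - N b - {b}"
  using N_split[of a b] by (auto simp: mem)

definition octa :: "'a \<Rightarrow> 'a \<Rightarrow> 'a \<Rightarrow> 'a \<Rightarrow> 'a \<Rightarrow> 'a \<Rightarrow> bool" where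
  "octa a b c a' b' c' \<longleftrightarrow> slim a b b' a' \<and> slim b c c' b' \<and> slim c a a' c' \<and>
     com a b = {c, c'} \<and> com b c = {a, a'} \<and> com c a = {b, b'} \<and>
     \<not> adj a' b' \<and> \<not> adj b' c' \<and> \<not> adj c' a' \<and> distinct [a, b, c, a', b', c']"

lemma octa_rot: "octa a b c a' b' c' ==> octa b c a b' c' a'"
  unfolding octa_def by auto

lemma octa_swap: "octa a b c a' b' c' ==> octa b a c b' a' c'"
  unfolding octa_def using slim_sym com_commute[of a b] com_commute[of b c] com_commute[of c a]
    adj_sym[of b' a'] adj_sym[of c' b'] adj_sym[of a' c'] by auto

lemma octa_sides: assumes "octa a b c a' b' c'"
  shows "slim a b b' a'" "slim b c c' b'" "slim c a a' c'" "slim b a a' b'" "slim c b b' c'" "slim a c c' a'"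
  using assms slim_sym unfolding octa_def by blast+

lemma octa_N: assumes "octa a b c a' b' c'"
  shows "N a = {b, c, b', c'}" "N b = {a, c, a', c'}" "N c = {a, b, a', b'}"
  using assms slimD(9)[OF octa_sides(1)[OF assms]] slimD(9)[OF octa_sides(2)[OF assms]]
     slimD(9)[OF octa_sides(3)[OF assms]] unfolding octa_def by auto

lemma octa_adj: assumes o: "octa a b c a' b' c'"
  shows "adj a b" "adj b a" "adj b c" "adj c b" "adj c a" "adj a c"
    "adj b a'" "adj c a'" "adj a b'" "adj c b'" "adj a c'" "adj b c'" "d a a' = 2" "d b b' = 2" "d c c' = 2"
  using slimD(1-5)[OF octa_sides(1)[OF o]] slimD(1-5)[OF octa_sides(2)[OF o]] slimD(1-5)[OF octa_sides(3)[OF o]]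
    slimD(6)[OF octa_sides(1)[OF o]] by auto

text \<open>The part of the graph behind the outer vertex \<open>a'\<close>.\<close>
lemma octa_same_side: assumes o: "octa a b c a' b' c'"
  shows "W b a - {b} = W c a - {c}"
proof -
  have s: "slim b c c' b'" "slim c b b' c'" using octa_sides[OF o] by auto
  have "a \<in> com b c" "a \<in> com c b" using o com_commute[of b c] unfolding octa_def by auto
  then have "W b a = insert b (W c a - {c})" using slim_com(2)[OF s(1), of a] octa_adj(9)[OF o] by blast
  moreover have "b \<notin> W c a" using octa_adj[OF o] by (simp add: mem)
  ultimately show ?thesis by auto
qed

definition beyond :: "'a \<Rightarrow> 'a \<Rightarrow> 'a set" where "beyond a b = W b a - {b}"

lemma beyondD: assumes o: "octa a b c a' b' c'" and z: "z \<in> beyond a b"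
  shows "d a z = Suc (d b z)" "d c z = d b z" "Suc (d a' z) = d b z" "d b z < D" "d b z \<ge> 1"
proof -
  have zb: "z \<in> W b a" "z ~= b" and zc: "z \<in> W c a" "z ~= c"
    using z octa_same_side[OF o] unfolding beyond_def by auto
  note s = octa_sides[OF o]
  have ab: "adj b a" and ac: "adj c a" using slimD(1)[OF s(4)] slimD(1)[OF s(3)] by auto
  show 1: "d a z = Suc (d b z)" "d b z < D" using W_le[OF ab zb(1)] by auto
  show "d c z = d b z" using W_le[OF ac zc(1)] 1 by auto
  show "Suc (d a' z) = d b z" using slim_via[OF s(1) zb] .
  then show "d b z \<ge> 1" by simp
qed

lemma card_beyond: assumes o: "octa a b c a' b' c'" shows "card (beyond a b) = D" "finite (beyond a b)"
proof -
  have ab: "adj b a" using slimD(1)[OF octa_sides(4)[OF o]] .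
  moreover have "b \<in> W b a" using ab by (auto simp: mem)
  ultimately show "card (beyond a b) = D" "finite (beyond a b)"
    using card_W[OF ab] finite_W[OF ab] unfolding beyond_def by auto
qed

lemma beyond_disjoint: assumes o: "octa a b c a' b' c'" shows "beyond a b \<inter> beyond b c = {}"
proof -
  have False if "z \<in> beyond a b" "z \<in> beyond b c" for z
    using beyondD(2)[OF o that(1)] beyondD(1)[OF octa_rot[OF o] that(2)] by simp
  then show ?thesis by blast
qed

text \<open>The vertices closer to \<open>a'\<close> than to \<open>c\<close> are those beyond \<open>a'\<close> and one beyond \<open>c'\<close>.\<close>
lemma octa_extra: assumes o: "octa a b c a' b' c'"
  shows "\<exists>t\<in>beyond c a. W a' c = insert t (beyond a b)"
proof -
  note s = octa_sides[OF o]
  obtain g where g: "W a' c = insert g (W c a - {c})" using slim_extra[OF s(6)] by blast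
  then have g: "W a' c = insert g (beyond a b)" using octa_same_side[OF o] unfolding beyond_def by simp
  have o2: "octa c a b c' a' b'" using octa_rot[OF octa_rot[OF o]] .
  note adjs = octa_adj[OF o]
  have ba': "adj b a'" using adjs by blast
  have "\<not> beyond c a \<subseteq> W b a'"
  proof
    assume sub: "beyond c a \<subseteq> W b a'"
    have "a \<in> W b a'" "b \<in> W b a'" using adjs adj_neq[OF ba'] by (auto simp: mem d_sym[of a' a])
    moreover have nab: "a \<notin> beyond c a" "b \<notin> beyond c a"
      using beyondD(2,5)[OF o2, of a] beyondD(2,5)[OF o2, of b] by auto
    ultimately have "card (insert a (insert b (beyond c a))) \<le> card (W b a')"
      using sub by (intro card_mono finite_W ba') auto
    moreover have "a ~= b" using o unfolding octa_def by auto
    ultimately show False using card_beyond[OF o2] card_W[OF ba'] nab by simp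
  qed
  then obtain t where t: "t \<in> beyond c a" "t \<notin> W b a'" by blast
  have "d a' t \<le> d b t" using t(2) by (simp add: mem)
  then have "t \<in> W a' c" using beyondD(1,2)[OF o2 t(1)] by (simp add: mem)
  moreover have "t \<notin> beyond a b" using beyondD(1)[OF o, of t] beyondD(2)[OF o2 t(1)] by auto
  ultimately have "t = g" using g by auto
  then show ?thesis using t(1) g by blast
qed

lemma octa_cover: assumes o: "octa a b c a' b' c'" and fin: "d a z \<le> D"
  shows "z \<in> {a, b, c} \<union> beyond a b \<union> beyond b c \<union> beyond c a"
proof (rule ccontr)
  assume n: "\<not> ?thesis"
  note s = octa_sides[OF o]
  have o1: "octa b c a b' c' a'" and o2: "octa c a b c' a' b'" using octa_rot[OF octa_rot[OF o]] octa_rot[OF o] by auto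
  have "z \<notin> W b a" "z \<notin> W c b" "z \<notin> W a c"
    using n unfolding beyond_def by auto
  moreover have "z \<notin> W a b" "z \<notin> W b c" "z \<notin> W c a"
    using n octa_same_side[OF o] octa_same_side[OF o1] octa_same_side[OF o2] unfolding beyond_def by auto
  ultimately have eq: "d a z = d b z" "d b z = d c z" by (auto simp: mem)
  have "z ~= a" using n by auto
  then obtain m where m: "d a z = Suc m" by (metis d_eq_0 not0_implies_Suc)
  obtain t where t: "adj a t" "d t z = m" using step[OF m] fin m by auto
  have "t \<in> N a" using t by (simp add: mem)
  moreover have "t ~= b" "t ~= c" using t m eq by auto
  ultimately consider "t = b'" | "t = c'" using octa_N(1)[OF o] by auto
  then show False
  proof cases
    case 1
    have "z \<in> W b' a" using 1 t m by (simp add: mem)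
    then show False using octa_extra[OF o1] n by auto
  next
    case 2
    have "z \<in> W c' a" using 2 t m by (simp add: mem)
    moreover have "octa c b a c' b' a'" using octa_swap[OF o1] .
    then have "\<exists>t\<in>beyond a c. W c' a = insert t (beyond c b)" by (rule octa_extra)
    moreover have "beyond a c = beyond a b" using octa_same_side[OF o] unfolding beyond_def by simp
    moreover have "beyond c b = beyond c a" using octa_same_side[OF o2] unfolding beyond_def by simp
    ultimately show False using n by auto
  qed
qed

lemma octa_same: assumes o: "octa a b c a' b' c'" shows "beyond a c = beyond a b"
  using octa_same_side[OF o] unfolding beyond_def by simp

lemma octa_cross_le: assumes o: "octa a b c a' b' c'"
  and s: "s \<in> beyond a b" and t: "t \<in> beyond b c" and st: "adj s t"
  shows "d a' t \<le> d b s" "d a t \<le> d b s"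
proof -
  have o1: "octa b c a b' c' a'" using octa_rot[OF o] .
  obtain g where g: "W a' c = insert g (beyond a b)" "g \<in> beyond c a" using octa_extra[OF o] by blast
  note S = beyondD[OF o s] and T = beyondD[OF o1 t]
  have "d a' t \<le> d a' s + d s t" by (rule d_tri)
  then show 1: "d a' t \<le> d b s" using st S(3) by linarith
  have "t \<notin> beyond a b" using beyond_disjoint[OF o] t by auto
  moreover have "t \<notin> beyond c a" using beyond_disjoint[OF o1] t by auto
  ultimately have "t \<notin> W a' c" using g by auto
  then show "d a t \<le> d b s" using 1 T(2) by (simp add: mem)
qed

lemma octa_cross: assumes o: "octa a b c a' b' c'"
  shows "\<exists>p q. \<forall>s\<in>beyond a b. \<forall>t\<in>beyond b c. adj s t --> s = p \<and> t = q"
proof -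
  have half: "\<exists>q. \<forall>s\<in>beyond a b. \<forall>t\<in>beyond b c. adj s t --> t = q"
    if o: "octa a b c a' b' c'" for a b c a' b' c'
  proof -
    have o1: "octa b c a b' c' a'" using octa_rot[OF o] .
    have o3: "octa a c b a' c' b'" using octa_swap[OF octa_rot[OF octa_rot[OF o]]] .
    obtain h where h: "W a' b = insert h (beyond a c)" using octa_extra[OF o3] by blast
    have "t = h" if s: "s \<in> beyond a b" and t: "t \<in> beyond b c" and st: "adj s t" for s t
    proof -
      have sw: "t \<in> beyond b a" "s \<in> beyond a c" using s t octa_same[OF o] octa_same[OF o1] by auto
      have "d b s \<le> d a t" using octa_cross_le(2)[OF octa_swap[OF o] sw adj_sym[OF st]] .
      then have "d a' t \<le> d a t" using octa_cross_le[OF o s t st] by simp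
      then have "t \<in> W a' b" using beyondD(1,2)[OF o1 t] by (simp add: mem)
      moreover have "t \<notin> beyond a c" using beyond_disjoint[OF o] t octa_same[OF o] by auto
      ultimately show ?thesis using h by auto
    qed
    then show ?thesis by blast
  qed
  have o1: "octa b c a b' c' a'" using octa_rot[OF o] .
  obtain q where q: "\<forall>s\<in>beyond a b. \<forall>t\<in>beyond b c. adj s t --> t = q" using half[OF o] by blast
  obtain p where p: "\<forall>s\<in>beyond b a. \<forall>t\<in>beyond a c. adj s t --> t = p" using half[OF octa_swap[OF o]] by blast
  have "beyond b a = beyond b c" "beyond a c = beyond a b" using octa_same[OF o] octa_same[OF o1] by auto
  then show ?thesis using p q adj_sym by metis
qed

text \<open>No octahedral configuration carries a diametral geodesic behind an outer vertex.\<close>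
lemma octa_no_ecc: assumes o: "octa a b c a' b' c'" and e: "ecc a b w" and D3: "3 \<le> D" and k: "k = 4"
  shows False
proof -
  note s = octa_sides[OF o]
  have o1: "octa b c a b' c' a'" and o2: "octa c a b c' a' b'" using octa_rot[OF octa_rot[OF o]] octa_rot[OF o] by auto
  have o3: "octa a c b a' c' b'" using octa_swap[OF octa_rot[OF octa_rot[OF o]]] .
  let ?A = "beyond a b"
  have ba: "adj b a" using slimD(2)[OF s(1)] .
  have a'b: "adj b a'" "adj c a'" using slimD(3)[OF s(1)] slimD(5)[OF s(3)] by auto
  obtain P T where P: "\<forall>s\<in>beyond a b. \<forall>t\<in>beyond b c. adj s t --> s = P \<and> t = T" using octa_cross[OF o] by blast
  obtain P' T' where P': "\<forall>s\<in>beyond a c. \<forall>t\<in>beyond c b. adj s t --> s = P' \<and> t = T'" using octa_cross[OF o3] by blast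
  have sw: "beyond a c = ?A" "beyond c b = beyond c a" using octa_same[OF o] octa_same[OF o2] by auto
  define X where "X z = (if z = P then {T} else {}) \<union> (if z = P' then {T'} else {})" for z
  have nb: "N z \<subseteq> (?A \<inter> N z) \<union> X z" if z: "z \<in> ?A" "d b z \<ge> 2" for z
  proof
    fix t assume t: "t \<in> N z"
    then have zt: "adj z t" by (simp add: mem)
    note Z = beyondD[OF o z(1)]
    have "d a t \<le> D" using d_tri[of a t z] zt Z d_le_D[of a t] D3 by simp
    then have "t \<in> {a, b, c} \<union> ?A \<union> beyond b c \<union> beyond c a" by (rule octa_cover[OF o])
    moreover have "t \<notin> {a, b, c}" using Z z zt d_sym[of z t] by auto
    ultimately consider "t \<in> ?A" | "t \<in> beyond b c" | "t \<in> beyond c a" by blast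
    then show "t \<in> (?A \<inter> N z) \<union> X z"
    proof cases
      case 2 then have "z = P \<and> t = T" using P z zt by blast
      then show ?thesis unfolding X_def by auto
    next
      case 3 then have "z = P' \<and> t = T'" using P' z zt unfolding sw by blast
      then show ?thesis unfolding X_def by auto
    qed (use t in auto)
  qed
  have finA: "finite (?A \<inter> N z)" for z by simp
  have cX: "card (X z) \<le> 2" "z ~= P ==> card (X z) \<le> 1" "z ~= P' ==> card (X z) \<le> 1" "finite (X z)" for z
    unfolding X_def by (auto simp: card_insert_if)
  have kz: "4 \<le> card (?A \<inter> N z) + card (X z)" if z: "z \<in> ?A" "d b z \<ge> 2" for z
  proof -
    have "N z ~= {}"
    proof -
      obtain t where "d z t = 1"
        using geodesic[of z b "d b z" 1] z beyondD(4)[OF o z(1)] d_sym[of z b] by auto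
      then show ?thesis by (auto simp: mem)
    qed
    then have "card (N z) = 4" using card_N k by (auto simp: mem)
    then show ?thesis using card_mono[OF _ nb[OF z]] card_Un_le[of "?A \<inter> N z" "X z"] cX(4)[of z] by simp
  qed
  \<comment> \<open>the two vertices of level two\<close>
  have ca'b: "com a' b = {c}"
  proof -
    have "t = c" if "adj a' t" "adj b t" for t
    proof -
      have "t \<in> N b" using that by (simp add: mem)
      moreover have "t ~= a'" "t ~= a" "t ~= c'" using that o slimD(4)[OF s(1)] adj_sym unfolding octa_def
        by (auto simp: d_sym[of a' a])
      ultimately show ?thesis using octa_N(2)[OF o] by auto
    qed
    moreover have "adj a' c" "adj b c" using a'b adj_sym slimD(1)[OF s(2)] by auto
    ultimately have "t \<in> com a' b \<longleftrightarrow> t = c" for t unfolding com_def by blast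
    then show ?thesis by blast
  qed
  have a'b2: "adj a' b" using a'b adj_sym by blast
  have "card (lvl a' b 1) = 2" using card_split[OF a'b2] ca'b k by simp
  then obtain p p' where pp: "lvl a' b 1 = {p, p'}" "p ~= p'" by (meson card_2_iff)
  have Na': "N a' = {b, c, p, p'}" using N_split[OF a'b2] ca'b pp by auto
  have pA: "z \<in> ?A" if z: "z \<in> {p, p'}" for z
  proof -
    have z': "adj a' z" "d b z = 2" using z pp by (auto simp: mem set_eq_iff)
    have zc: "\<not> adj c z"
    proof
      assume "adj c z"
      then have "z \<in> N c" by (simp add: mem)
      moreover have "z ~= a" "z ~= b" "z ~= a'" using z' octa_adj[OF o] by auto
      ultimately have "z = b'" using octa_N(3)[OF o] by auto
      then show False using z' o unfolding octa_def by auto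
    qed
    have "z ~= c" using z' slimD(1)[OF s(2)] by auto
    then have "d c z = 2" using dist_two[of a' c z] z' zc a'b adj_sym by auto
    obtain g where g: "W a' c = insert g ?A" "g \<in> beyond c a" using octa_extra[OF o] by blast
    obtain h where h: "W a' b = insert h ?A" "h \<in> beyond b a" using octa_extra[OF o3] octa_same[OF o] by auto
    have "z \<in> W a' c" "z \<in> W a' b" using z' \<open>d c z = 2\<close> by (auto simp: mem)
    moreover have "g ~= h" using g(2) h(2) beyond_disjoint[OF o1] octa_same[OF o1] by auto
    ultimately show ?thesis using g h by auto
  qed
  have dp: "d b p = 2" "d b p' = 2" using pp by (auto simp: mem set_eq_iff)
  have l2: "{p, p'} \<subseteq> lvl b a 2" using pA beyondD(1)[OF o] dp by (auto simp: mem)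
  obtain l where l: "l < D" "card (lvl b a l) = 2" "\<And>i. i < D ==> i ~= l ==> card (lvl b a i) = 1"
    using ecc_levels[OF e] by metis
  have "card (lvl b a 2) \<ge> 2" using card_mono[OF finite_lvl[OF ba] l2] pp by simp
  then have l': "l = 2" using l(3)[of 2] D3 by (cases "l = 2") auto
  then have L2: "lvl b a 2 = {p, p'}" using card_subset_eq[OF finite_lvl[OF ba] l2] l pp by simp
  have L1: "lvl b a 1 = {a'}" using slimD(8)[OF s(1)] .
  have single: "z = z'" if "z \<in> lvl b a i" "z' \<in> lvl b a i" "i ~= 2" "i < D" for z z' i
    using ecc_unique[OF e l(2) l(1)] that l' by auto
  have inlvl: "z \<in> lvl b a (d b z)" if "z \<in> ?A" for z using beyondD(1)[OF o that] by (simp add: mem)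
  have A2: "z \<in> {p, p'}" if "z \<in> ?A" "d b z = 2" for z using inlvl[OF that(1)] that L2 by simp
  have A1: "z = a'" if "z \<in> ?A" "d b z = 1" for z using inlvl[OF that(1)] that L1 by simp
  have near: "d b t \<le> Suc (d b z)" "d b z \<le> Suc (d b t)" if "t \<in> N z" for t z
    using that adj_le2[of z t b] adj_le2'[of z t b] by (auto simp: mem)
  have wA: "w \<in> ?A" "d b w = D - 1" using eccD[OF e] D3 unfolding beyond_def by (auto simp: mem)
  have irr: "z \<notin> N z" for z by (simp add: mem)
  consider "D = 3" | "D = 4" | "5 \<le> D" using D3 by linarith
  then show False
  proof cases
    case 1
    have "z = P \<and> z = P'" if z: "z \<in> {p, p'}" for z
    proof -
      have "?A \<inter> N z \<subseteq> {a', p, p'} - {z}"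
      proof
        fix t assume t: "t \<in> ?A \<inter> N z"
        have "d b t < 3" "1 \<le> d b t" using beyondD[OF o, of t] t 1 by auto
        then have "d b t = 1 \<or> d b t = 2" by linarith
        then show "t \<in> {a', p, p'} - {z}" using A1[of t] A2[of t] t irr by auto
      qed
      moreover have "a' ~= p" "a' ~= p'" using dp a'b by auto
      then have "card ({a', p, p'} - {z}) = 2" using z pp by auto
      ultimately have "card (?A \<inter> N z) \<le> 2" using card_mono[of "{a', p, p'} - {z}" "?A \<inter> N z"] by simp
      then show ?thesis using kz[of z] pA[OF z] dp z cX[of z] by fastforce
    qed
    then show False using pp by blast
  next
    case 2
    have w3: "d b w = 3" using wA 2 by simp
    have A3: "z = w" if "z \<in> ?A" "d b z = 3" for z
      using single[of z 3 w] inlvl[OF that(1)] inlvl[OF wA(1)] that w3 2 by simp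
    have "?A \<inter> N w \<subseteq> {p, p'}"
    proof
      fix t assume t: "t \<in> ?A \<inter> N w"
      have "d b t < 4" "2 \<le> d b t" using beyondD[OF o, of t] t 2 near[of t w] w3 by auto
      then have "d b t = 2 \<or> d b t = 3" by linarith
      then show "t \<in> {p, p'}" using A2[of t] A3[of t] t irr by auto
    qed
    then have "card (?A \<inter> N w) \<le> 2" using card_mono[of "{p, p'}" "?A \<inter> N w"] pp by simp
    then have wP: "w = P" "w = P'" using kz[OF wA(1)] w3 cX[of w] by fastforce+
    have "p ~= w" using dp w3 by auto
    then have "X p = {}" using wP unfolding X_def by auto
    moreover have "?A \<inter> N p \<subseteq> {a', p', w}"
    proof
      fix t assume t: "t \<in> ?A \<inter> N p"
      have "d b t < 4" "1 \<le> d b t" using beyondD[OF o, of t] t 2 by auto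
      then have "d b t = 1 \<or> d b t = 2 \<or> d b t = 3" by linarith
      then show "t \<in> {a', p', w}" using A1[of t] A2[of t] A3[of t] t irr by auto
    qed
    then have "card (?A \<inter> N p) \<le> 3" using card_mono[of "{a', p', w}" "?A \<inter> N p"]
      by (simp add: card_insert_if split: if_splits)
    ultimately show False using kz[of p] pA dp by simp
  next
    case 3
    have "?A \<inter> N w \<subseteq> lvl b a (D - 2)"
    proof
      fix t assume t: "t \<in> ?A \<inter> N w"
      have "d b t < D" "D - 2 \<le> d b t" using beyondD[OF o, of t] t near[of t w] wA by auto
      moreover have "d b t ~= D - 1"
      proof
        assume "d b t = D - 1"
        then have "t = w" using single[of t "D - 1" w] inlvl[of t] inlvl[OF wA(1)] t wA(2) 3 by simp
        then show False using t irr by blast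
      qed
      ultimately have "d b t = D - 2" by linarith
      then show "t \<in> lvl b a (D - 2)" using inlvl[of t] t by simp
    qed
    then have "card (?A \<inter> N w) \<le> card (lvl b a (D - 2))" using card_mono[OF finite_lvl[OF ba]] by blast
    moreover have "card (lvl b a (D - 2)) = 1" using l(3)[of "D - 2"] l' 3 by simp
    moreover have "2 \<le> d b w" using wA 3 by linarith
    ultimately show False using kz[OF wA(1)] cX(1)[of w] by simp
  qed
qed
end

context slim_end begin

lemma no_octa: assumes Zqr: "Z = {q, r}" "q ~= r" "\<not> adj q r" "adj q x" "\<not> adj r x"
  shows False
proof -
  have qQ: "q \<in> Q" using Zqr unfolding Q_def by auto
  have k4: "k = 4" using cardZ Zqr by simp
  have q: "adj q y" "adj q u" "adj q v" "adj u q" "adj v q" "q ~= x" "q ~= y" "q ~= u" "q ~= v"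
    using Q_y[OF qQ] ZD[of q] Z_neq[of q] Zqr by auto
  have r: "adj u r" "adj v r" "r ~= x" "r ~= y" "r ~= u" "r ~= v" "\<not> adj r y"
    using ZD[of r] Z_neq[of r] R_y[of r] Zqr unfolding R_def by auto
  have uv: "u ~= v" "u ~= x" "u ~= y" "v ~= x" "v ~= y" "x ~= y" using s by (auto dest: adj_neq)
  have Nu: "N u = {v, y, q, r}" and Nv: "N v = {u, x, q, r}" using s(9,10) Zqr unfolding Z_def by auto
  have "{u, v, x, y} \<subseteq> N q" using q Zqr by (simp add: mem)
  moreover have "card {u, v, x, y} = 4" using uv by simp
  moreover have "card (N q) = 4" using card_N[OF q(2)] k4 by simp
  ultimately have Nq: "N q = {u, v, x, y}" using card_subset_eq[OF finite_N, of "{u, v, x, y}" q] by simp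
  have ne: "distinct [u, v, q, x, y, r]" using uv q r Zqr by auto
  have cvq: "com v q = {u, x}" and cqu: "com q u = {v, y}" and cuv: "com u v = {q, r}"
    using ne unfolding com_N Nu Nv Nq by auto
  have "lvl v q 1 = {r}" "lvl q v 1 = {y}" "lvl q u 1 = {x}" and luq: "lvl u q 1 = {r}"
    unfolding lvl1_N[OF q(5)] lvl1_N[OF q(3)] lvl1_N[OF q(2)] lvl1_N[OF q(4)] Nu Nv Nq using ne by auto
  then have sl: "slim v q r y" "slim q u x r" using q unfolding slim_def by auto
  interpret T: slim_end d k D u q w x r
    using ecc_Q[OF qQ] slim_sym[OF sl(2)] D3 by unfold_locales
  have "T.Z = {v, y}" using cqu com_commute[of u q] unfolding T.Z_def by simp
  then have yx: "\<not> adj y x" using T.R_nonempty s(3) unfolding T.R_def by auto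
  have "octa u v q x y r"
    unfolding octa_def using slim sl cuv cvq cqu yx ne r(7) Zqr(5) adj_sym[of x y] adj_sym[of y r] by auto
  then show False using octa_no_ecc[OF _ ecc D3 k4] by blast
qed

end

section \<open>Cliques with one outer neighbour at each vertex\<close>

text \<open>
  Every vertex of the clique \<open>C\<close> has all but one of its neighbours in \<open>C\<close>. Walking outwards along the
  map \<open>h\<close> reproduces the same local shape, and this is incompatible with the constant number of closer
  vertices.
\<close>
locale clique = ndb +
  fixes C :: "'a set" and h :: "'a \<Rightarrow> 'a"
  assumes finC: "finite C" and cardC: "card C = k" and k3: "3 \<le> k"
    and N_C: "c \<in> C ==> N c = insert (h c) (C - {c})" and h_notin: "c \<in> C ==> h c \<notin> C"
begin

lemma adjC: "c \<in> C ==> e \<in> C ==> c ~= e ==> adj c e"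
  using N_C[of c] by (auto simp: mem_N[symmetric])
lemma adj_h: assumes "c \<in> C" shows "adj c (h c)" "adj (h c) c"
proof -
  show "adj c (h c)" using N_C[OF assms] by (auto simp: mem_N[symmetric])
  then show "adj (h c) c" by (rule adj_sym)
qed
lemma N_CD: "c \<in> C ==> adj c x ==> x \<notin> C ==> x = h c"
  using N_C[of c] by (auto simp: mem_N[symmetric])

lemma slimC: assumes "c \<in> C" "e \<in> C" "c ~= e" shows "slim c e (h c) (h e)"
proof -
  have *: "lvl c e 1 = {h c}" if ce: "c \<in> C" "e \<in> C" "c ~= e" for c e
  proof -
    have "x = h c" if x: "x \<in> lvl c e 1" for x
    proof -
      have "x ~= e" "\<not> adj e x" "adj c x" using x by (auto simp: mem)
      moreover have "x \<notin> C" using calculation adjC[OF ce(2)] by blast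
      ultimately show ?thesis using N_CD[OF ce(1)] by blast
    qed
    then show ?thesis using lvl1_not_empty[OF adjC[OF ce]] by blast
  qed
  have "lvl c e 1 = {h c}" "lvl e c 1 = {h e}" using * assms by blast+
  then show ?thesis using adjC[OF assms] unfolding slim_def by simp
qed

lemma d_h: "c \<in> C ==> e \<in> C ==> c ~= e ==> d c (h e) = 2"
  using slimD(4)[OF slimC] .

definition near :: "'a \<Rightarrow> 'a \<Rightarrow> bool" where "near c x \<longleftrightarrow> (\<forall>e\<in>C. d c x \<le> d e x)"
definition B :: "'a \<Rightarrow> 'a set" where "B c = {x. x \<notin> C \<and> d c x \<le> D \<and> near c x}"
definition F :: "'a \<Rightarrow> 'a set" where "F c = {x. d (h c) x < d c x \<and> \<not> near c x}"

lemma C_close: "c \<in> C ==> e \<in> C ==> d c x \<le> Suc (d e x)"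
  using adj_le[OF adjC] by (cases "c = e") auto

lemma BD: assumes "x \<in> B c" shows "x \<notin> C" "d c x \<le> D" "near c x" "\<And>e. e \<in> C ==> d c x \<le> d e x"
  using assms unfolding B_def near_def by auto

lemma far: "c \<in> C ==> e \<in> C ==> near e x ==> \<not> near c x ==> d c x = Suc (d e x)"
  using C_close[of c e x] unfolding near_def by (metis le_antisym not_less_eq_eq order_trans)

lemma B_cover: assumes "c \<in> C" "d c x \<le> D" "x \<notin> C" obtains e where "e \<in> C" "x \<in> B e"
proof -
  obtain e where e: "e \<in> C" "\<forall>f. f \<in> C --> d e x \<le> d f x"
    using ex_has_least_nat[of "\<lambda>e. e \<in> C" c "\<lambda>e. d e x"] assms(1) by blast
  then have "d e x \<le> D" using assms by (meson le_trans)
  then show ?thesis using that[of e] e assms(3) unfolding B_def near_def by blast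
qed

lemma B_level: "c \<in> C ==> e \<in> C ==> x \<in> B c ==> x \<in> B e ==> d c x = d e x"
  using BD(4) le_antisym by meson

lemma B_far: assumes "c \<in> C" "e \<in> C" "x \<in> B e" "x \<notin> B c" shows "d c x = Suc (d e x)"
proof (rule far[OF assms(1,2)])
  show n: "near e x" using BD(3)[OF assms(3)] .
  show "\<not> near c x"
  proof
    assume "near c x"
    then have "d c x \<le> D" using BD(2)[OF assms(3)] assms(2) unfolding near_def by (meson le_trans)
    then show False using assms BD(1)[OF assms(3)] \<open>near c x\<close> unfolding B_def by blast
  qed
qed

lemma B_step: assumes c: "c \<in> C" and x: "x \<in> B c" shows "Suc (d (h c) x) = d c x" "1 \<le> d c x"
proof -
  note X = BD[OF x]
  have "x ~= c" using X c by auto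
  then obtain m where m: "d c x = Suc m" by (metis d_eq_0 not0_implies_Suc)
  obtain t where t: "adj c t" "d t x = m" using step[OF m] X m by auto
  have "t \<notin> C" using X(4)[of t] t m by auto
  then have "t = h c" using N_CD[OF c t(1)] by blast
  then show "Suc (d (h c) x) = d c x" using t m by simp
  show "1 \<le> d c x" using m by simp
qed

lemma W_C: assumes ce: "c \<in> C" "e \<in> C" "c ~= e" shows "W c e - {c} = B c - B e"
proof (intro equalityI subsetI)
  fix x assume x: "x \<in> W c e - {c}"
  note w = W_le[OF adjC[OF ce], of x]
  have 1: "d e x = Suc (d c x)" "d c x < D" using w x by auto
  have "x \<notin> C"
  proof
    assume xC: "x \<in> C"
    then have "d c x = 1" using adjC[OF ce(1) xC] x by blast
    moreover have "x ~= e" using 1 by auto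
    then have "d e x = 1" using adjC[OF ce(2) xC] by blast
    ultimately show False using 1 by simp
  qed
  moreover have "near c x" unfolding near_def using C_close[OF ce(2), of _ x] 1 by simp
  moreover have "\<not> near e x" using 1 ce unfolding near_def by (metis Suc_n_not_le_n)
  ultimately show "x \<in> B c - B e" using 1 unfolding B_def by auto
next
  fix x assume x: "x \<in> B c - B e"
  then have "d e x = Suc (d c x)" using B_far[OF ce(2,1)] by blast
  moreover have "x ~= c" using x ce BD(1) by blast
  ultimately show "x \<in> W c e - {c}" by (simp add: mem)
qed

lemma W_h: assumes c: "c \<in> C" shows "W (h c) c = B c \<union> F c" "B c \<inter> F c = {}"
proof -
  have "x \<in> B c" if x: "x \<in> W (h c) c" "near c x" for x
  proof -
    have 1: "d (h c) x < D" "d c x = Suc (d (h c) x)" using W_le[OF adj_h(2)[OF c] x(1)] by auto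
    have "x \<notin> C"
    proof
      assume "x \<in> C"
      then have "d c x \<le> 1" using adjC[OF c, of x] by (cases "x = c") auto
      then have "x = h c" using 1 by simp
      then show False using \<open>x \<in> C\<close> h_notin[OF c] by blast
    qed
    then show ?thesis using 1 x unfolding B_def by auto
  qed
  moreover have "B c \<subseteq> W (h c) c"
  proof
    fix x assume "x \<in> B c"
    from B_step(1)[OF c this] show "x \<in> W (h c) c" by (simp add: mem)
  qed
  ultimately show "W (h c) c = B c \<union> F c" unfolding F_def by (auto simp: mem)
  show "B c \<inter> F c = {}" unfolding F_def B_def by auto
qed

lemma finBF: assumes "c \<in> C" shows "finite (B c)" "finite (F c)" "card (B c) + card (F c) = Suc D"
proof -
  have "finite (B c \<union> F c)" using finite_W[OF adj_h(2)[OF assms]] W_h[OF assms] by simp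
  then show f: "finite (B c)" "finite (F c)" by auto
  show "card (B c) + card (F c) = Suc D"
    using card_Un_disjoint[OF f W_h(2)[OF assms]] W_h(1)[OF assms] card_W[OF adj_h(2)[OF assms]] by simp
qed

lemma card_B_diff: assumes ce: "c \<in> C" "e \<in> C" "c ~= e" shows "card (B c - B e) = D"
proof -
  have "c \<in> W c e" using ce by (simp add: mem)
  then show ?thesis using card_W[OF adjC[OF ce]] finite_W[OF adjC[OF ce]] unfolding W_C[OF ce, symmetric] by simp
qed

lemma card_BB: assumes ce: "c \<in> C" "e \<in> C" "c ~= e" shows "card (B c \<inter> B e) + card (F c) = 1"
proof -
  have "card (B c) = card (B c - B e) + card (B c \<inter> B e)"
    using card_Diff_subset_Int[of "B c" "B e"] card_mono[of "B c" "B c \<inter> B e"] finBF(1)[OF ce(1)] by simp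
  then show ?thesis using card_B_diff[OF ce] finBF(3)[OF ce(1)] by simp
qed

lemma third: obtains f where "f \<in> C" "f ~= c" "f ~= e"
proof -
  have "\<not> C \<subseteq> {c, e}"
  proof
    assume "C \<subseteq> {c, e}"
    then have "card C \<le> card {c, e}" by (intro card_mono) auto
    also have "\<dots> \<le> 2" by (simp add: card_insert_if)
    finally show False using cardC k3 by simp
  qed
  then show ?thesis using that by blast
qed

lemma F_empty: assumes c0: "c0 \<in> C" shows "F c0 = {}"
proof (rule ccontr)
  assume "F c0 ~= {}"
  then have "0 < card (F c0)" using finBF(2)[OF c0] card_gt_0_iff by blast
  then have "card (F c0) \<ge> 1" by simp
  have F1: "card (F c) = 1" if c: "c \<in> C" for c
  proof (cases "c = c0")
    case True
    obtain e where "e \<in> C" "e ~= c0" using third[of c0 c0] by blast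
    then show ?thesis using True card_BB[OF c0, of e] \<open>card (F c0) \<ge> 1\<close> by auto
  next
    case False
    have "card (B c0 \<inter> B c) = 0" using card_BB[OF c0 c] False \<open>card (F c0) \<ge> 1\<close> by auto
    then show ?thesis using card_BB[OF c c0 False] by (simp add: Int_commute)
  qed
  have disj: "c = e" if "c \<in> C" "e \<in> C" "x \<in> B c" "x \<in> B e" for c e x
  proof (rule ccontr)
    assume ne: "c ~= e"
    have "card (B c \<inter> B e) = 0" using card_BB[OF that(1,2) ne] F1[OF that(1)] by simp
    then show False using finBF(1)[OF that(1)] that by auto
  qed
  have Fmem: "x \<in> F c" if "c \<in> C" "e \<in> C" "x \<in> B e" "c ~= e" "d (h c) x < d c x" for c e x
  proof -
    have "x \<notin> B c" using disj that by blast
    then have "d c x = Suc (d e x)" using B_far that by blast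
    then have "\<not> near c x" using that(2) unfolding near_def by (metis Suc_n_not_le_n)
    then show ?thesis using that unfolding F_def by blast
  qed
  have farB: "d c x = Suc (d e x)" if "c \<in> C" "e \<in> C" "x \<in> B e" "c ~= e" for c e x
    using B_far disj that by blast
  have cross_le: "d (h c) t \<le> d c s" "d e t \<le> d c s"
    if "c \<in> C" "e \<in> C" "c ~= e" "s \<in> B c" "t \<in> B e" "adj s t" for c e s t
  proof -
    show 1: "d (h c) t \<le> d c s" using adj_le2'[of s t "h c"] that(6) B_step[OF that(1,4)] by simp
    show "d e t \<le> d c s" using farB[OF that(1,2,5,3)] adj_le[OF adj_h(1)[OF that(1)], of t] 1 by simp
  qed
  have cross: "d c s = d e t" "t \<in> F c" "s \<in> F e"
    if "c \<in> C" "e \<in> C" "c ~= e" "s \<in> B c" "t \<in> B e" "adj s t" for c e s t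
  proof -
    note l1 = cross_le[OF that] and l2 = cross_le[OF that(2,1) that(3)[symmetric] that(5,4) adj_sym[OF that(6)]]
    show eq: "d c s = d e t" using l1 l2 by simp
    show "t \<in> F c" using Fmem[OF that(1,2,5,3)] farB[OF that(1,2,5,3)] l1 eq by simp
    show "s \<in> F e" using Fmem[OF that(2,1,4) that(3)[symmetric]] farB[OF that(2,1,4) that(3)[symmetric]] l2 eq by simp
  qed
  obtain f where f: "F c0 = {f}" using F1[OF c0] by (rule card_1_singletonE)
  have fW: "f \<in> W (h c0) c0" using f W_h(1)[OF c0] by auto
  have f1: "d c0 f = Suc (d (h c0) f)" "d (h c0) f < D" using W_le[OF adj_h(2)[OF c0] fW] by auto
  have fC: "f \<notin> C"
  proof
    assume "f \<in> C"
    then have "d c0 f \<le> 1" using adjC[OF c0, of f] by (cases "f = c0") auto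
    then have "f = h c0" using f1 by simp
    then show False using \<open>f \<in> C\<close> h_notin[OF c0] by blast
  qed
  obtain e where e: "e \<in> C" "f \<in> B e" using B_cover[OF c0 _ fC] f1 by auto
  have ec: "c0 ~= e" using W_h(2)[OF c0] f e by auto
  define m where "m = d e f"
  have m: "d c0 f = Suc m" "d (h c0) f = m" "1 \<le> m" "m < D"
    using farB[OF c0 e ec] f1 B_step(2)[OF e] unfolding m_def by auto
  have hg: "h g ~= h c0 \<and> \<not> adj g (h c0)" if "g \<in> C" "g ~= c0" for g
    using d_h[OF that(1) c0 that(2)] adj_h(1)[OF that(1)] by auto
  obtain z0 where z0: "z0 \<in> B c0" "z0 \<in> F e"
  proof -
    obtain z where z: "d (h c0) z = m - 1" "d z f = 1" using geodesic[of "h c0" f m "m - 1"] m by auto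
    have dcz: "d c0 z \<le> m" using adj_le[OF adj_h(1)[OF c0], of z] z m by simp
    have zC: "z \<notin> C"
    proof
      assume zC: "z \<in> C"
      then have fz: "f = h z" using N_CD[OF zC _ fC] z by blast
      show False
      proof (cases "z = c0")
        case True then show False using fz m by simp
      next
        case False
        have "m \<le> 1" using BD(4)[OF e(2) zC] z unfolding m_def by simp
        then have "h c0 = z" using z by simp
        then show False using zC h_notin[OF c0] by blast
      qed
    qed
    obtain g where g: "g \<in> C" "z \<in> B g" using B_cover[OF c0 _ zC] dcz m by auto
    show ?thesis
    proof (cases "g = c0")
      case True
      then show ?thesis using that[of z] g cross(3)[OF c0 e(1) ec _ e(2) z(2)] by blast
    next
      case False
      have "m - 1 \<le> d g z"
      proof -
        have "m \<le> d g f" using BD(4)[OF e(2) g(1)] unfolding m_def .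
        then show ?thesis using d_tri[of g f z] z by simp
      qed
      then have "d (h c0) z < d c0 z" using farB[OF c0 g False[symmetric]] z m by simp
      then have "z \<in> F c0" using Fmem[OF c0 g False[symmetric]] by blast
      then show ?thesis using f z by auto
    qed
  qed
  have Fe: "F e = {z0}" using F1[OF e(1)] z0(2) by (metis card_1_singletonE singletonD)
  obtain l where l: "l \<in> C" "l ~= c0" "l ~= e" using third by blast
  have claim: "d c0 x < d (h c0) x" if "x \<in> B l" for x
    using that
  proof (induction "d l x" arbitrary: x rule: less_induct)
    case less
    note xB = less.prems
    note X = BD[OF xB]
    define n where "n = d l x"
    have n1: "1 \<le> n" using B_step(2)[OF l(1) xB] unfolding n_def .
    have cx: "d c0 x = Suc n" using farB[OF c0 l(1) xB l(2)[symmetric]] unfolding n_def .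
    show ?case
    proof (rule ccontr)
      assume "\<not> ?thesis"
      then have "d (h c0) x \<le> Suc n" using cx by simp
      moreover have xf: "x ~= f" using disj[OF l(1) e(1) xB] e l by auto
      have "x \<notin> F c0" using xf f by auto
      then have "\<not> d (h c0) x < d c0 x" using Fmem[OF c0 l(1) xB l(2)[symmetric]] by blast
      ultimately have hx: "d (h c0) x = Suc n" using cx by simp
      have nD: "Suc n \<le> D" using cx d_le_D[of c0 x] X(2) unfolding n_def by simp
      obtain z where z: "d (h c0) z = n" "d z x = 1" using geodesic[OF hx nD, of n] by auto
      have zC: "z \<notin> C"
      proof
        assume zC: "z \<in> C"
        then have xz: "x = h z" using N_CD[OF zC _ X(1)] z by blast
        show False
        proof (cases "z = c0")
          case True then show False using xz hx by simp
        next
          case False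
          have "n \<le> 1" using X(4)[OF zC] z unfolding n_def by simp
          then have "adj (h c0) z" using z n1 by simp
          then show False using hg[OF zC False] adj_sym by blast
        qed
      qed
      have dcz: "d c0 z \<le> Suc n" using adj_le[OF adj_h(1)[OF c0], of z] z by simp
      obtain g where g: "g \<in> C" "z \<in> B g" using B_cover[OF c0 _ zC] dcz nD by auto
      have inF: "z = f \<and> g = e" if "g ~= c0" "n \<le> d g z"
      proof -
        have "d (h c0) z < d c0 z" using farB[OF c0 g that(1)[symmetric]] z that by simp
        then have "z = f" using Fmem[OF c0 g that(1)[symmetric]] f by blast
        then show ?thesis using disj[OF g(1) e(1)] g e by blast
      qed
      consider "g = c0" | "g = l" | "g ~= c0" "g ~= l" by blast
      then show False
      proof cases
        case 1
        then have "x \<in> F c0" using cross(2)[OF c0 l(1) l(2)[symmetric] _ xB z(2)] g by blast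
        then show False using \<open>x \<notin> F c0\<close> by blast
      next
        case 2
        then have "\<not> n \<le> d l z" using inF l by blast
        then have lt: "d l z < d l x" unfolding n_def by simp
        then have "d c0 z < d (h c0) z" using less.hyps[of z] g 2 by blast
        then have "Suc (d l z) < n" using farB[OF c0 g] 2 l z by auto
        moreover have "n \<le> d l z + 1" using d_tri[of l x z] z unfolding n_def by simp
        ultimately show False by simp
      next
        case 3
        have cr: "d g z = n" "x \<in> F g" using cross[OF g(1) l(1) 3(2) g(2) xB z(2)] unfolding n_def by auto
        then have "g = e" using inF 3 by simp
        then have "x = z0" using cr Fe by blast
        then show False using disj[OF c0 l(1) z0(1)] xB l by blast
      qed
    qed
  qed
  have sub: "C \<union> B l \<subseteq> W c0 (h c0)"
  proof
    fix x assume "x \<in> C \<union> B l"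
    moreover have "d c0 x < d (h c0) x" if "x \<in> C"
    proof (cases "x = c0")
      case True then show ?thesis using adj_h(2)[OF c0] by simp
    next
      case False
      then show ?thesis using adjC[OF c0 that] d_h[OF that c0 False] d_sym[of x "h c0"] by auto
    qed
    ultimately show "x \<in> W c0 (h c0)" using claim by (auto simp: mem)
  qed
  have "card (C \<union> B l) = card C + card (B l)"
    using finC finBF(1)[OF l(1)] BD(1) by (intro card_Un_disjoint) auto
  moreover have "card (C \<union> B l) \<le> Suc D"
    using card_mono[OF finite_W[OF adj_h(1)[OF c0]] sub] card_W[OF adj_h(1)[OF c0]] by simp
  ultimately show False using finBF(3)[OF l(1)] F1[OF l(1)] cardC k3 by simp
qed

lemma card_BB1: "c \<in> C ==> e \<in> C ==> c ~= e ==> card (B c \<inter> B e) = 1"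
  using card_BB[of c e] F_empty by simp

lemma BB_unique: "c \<in> C ==> e \<in> C ==> c ~= e ==> x \<in> B c \<inter> B e ==> y \<in> B c \<inter> B e ==> x = y"
  using card_BB1 by (metis card_1_singletonE singletonD)

lemma card_B: assumes "c \<in> C" shows "card (B c) = Suc D" using finBF(3)[OF assms] F_empty[OF assms] by simp

lemma mono: assumes c: "c \<in> C" and s: "s \<in> B c" and st: "adj s t" and t: "t \<notin> B c" "t \<notin> C"
  shows "d c t \<le> d c s"
proof -
  have 1: "d (h c) t \<le> d c s" using adj_le2'[OF st, of "h c"] B_step[OF c s] by simp
  have "d c t \<le> Suc (d c s)" using adj_le2'[OF st] .
  then have "d c t \<le> D" using d_le_D[of c t] BD(2)[OF s] D_ge_2 by simp
  then have n: "\<not> near c t" using t unfolding B_def by blast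
  have "t \<notin> F c" using F_empty[OF c] by blast
  then show ?thesis using n 1 unfolding F_def by simp
qed

lemma multi_N:
  assumes c: "c \<in> C" "e \<in> C" "c ~= e" and x: "x \<in> B c" "x \<in> B e" and z: "adj x z"
  shows "\<exists>g. g \<in> C \<and> x \<in> B g \<and> z \<in> B g \<and> Suc (d g z) = d c x \<and> (\<forall>f. f \<in> C --> z \<in> B f --> f = g)"
proof -
  define m where "m = d c x"
  have me: "d e x = m" using B_level[OF c(1,2) x] unfolding m_def by simp
  have m2: "m \<le> D" "\<And>f. f \<in> C ==> m \<le> d f x" using BD(2,4)[OF x(1)] unfolding m_def by auto
  have zC: "z \<notin> C"
  proof
    assume zC: "z \<in> C"
    then have xz: "x = h z" using N_CD[OF zC adj_sym[OF z] BD(1)[OF x(1)]] by blast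
    have "m \<le> 1" using m2(2)[OF zC] adj_sym[OF z] by simp
    moreover have "m = 2" using d_h[OF c(1) zC] d_h[OF c(2) zC] c(3) xz me unfolding m_def by (cases "c = z") auto
    ultimately show False by simp
  qed
  have "d c z \<le> Suc m" using adj_le2'[OF z] unfolding m_def .
  then have "d c z \<le> D" using d_le_D[of c z] m2 D_ge_2 by simp
  then obtain g where g: "g \<in> C" "z \<in> B g" using B_cover[OF c(1) _ zC] by blast
  have xz: "x ~= z" using z by auto
  have both: "z \<notin> B c \<inter> B e" using BB_unique[OF c, of x z] x xz by blast
  have lt: "d g z < m"
  proof (rule ccontr)
    assume n: "\<not> ?thesis"
    have all: "z \<in> B f" if f: "f \<in> C" "x \<in> B f" "d f x = m" for f
    proof (rule ccontr)
      assume nf: "z \<notin> B f"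
      then have "d f z \<le> m" using mono[OF f(1,2) z nf zC] f by simp
      then show False using B_far[OF f(1) g nf] n by simp
    qed
    show False using both all[OF c(1) x(1)] all[OF c(2) x(2) me] m_def by blast
  qed
  have ge: "m \<le> Suc (d f z)" if "f \<in> C" for f using m2(2)[OF that] adj_le2[OF z, of f] by simp
  have inB: "x \<in> B f" if f: "f \<in> C" "z \<in> B f" for f
  proof -
    have "d f z = d g z" using B_level[OF f(1) g(1) f(2) g(2)] .
    then have "d f x \<le> m" using adj_le2[OF z, of f] lt by simp
    then show ?thesis using BD(1,2,4)[OF x(1)] m2(1) unfolding B_def near_def m_def by (auto intro: le_trans)
  qed
  have uni: "f = g" if f: "f \<in> C" "z \<in> B f" for f
    using BB_unique[OF f(1) g(1) _ , of x z] inB f g xz by blast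
  moreover have "Suc (d g z) = m" using lt ge[OF g(1)] by simp
  ultimately show ?thesis using g inB[OF g] unfolding m_def by blast
qed

lemma h_B: assumes c: "c \<in> C" shows "h c \<in> B c" "e \<in> C ==> h c \<in> B e ==> e = c" "d c (h c) = 1"
proof -
  show 1: "d c (h c) = 1" using adj_h[OF c] by simp
  have "1 \<le> d e (h c)" if "e \<in> C" for e using d_h[OF that c] 1 by (cases "e = c") auto
  then show "h c \<in> B c" using 1 D_ge_2 h_notin[OF c] unfolding B_def near_def by auto
  show "e = c" if "e \<in> C" "h c \<in> B e" using BD(4)[OF that(2) c] d_h[OF that(1) c] 1 by (cases "e = c") auto
qed

lemma N_h: assumes c: "c \<in> C" and z: "adj (h c) z" "z ~= c" shows "z \<in> B c" "d c z = 2"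
proof -
  have zC: "z \<notin> C"
  proof
    assume "z \<in> C"
    then show False using d_h[OF _ c z(2)] adj_sym[OF z(1)] by simp
  qed
  have "\<not> adj c z" using N_CD[OF c _ zC] z by auto
  then show 2: "d c z = 2" using dist_two[OF adj_h(2)[OF c] z(1)] z(2) by simp
  show "z \<in> B c"
  proof (rule ccontr)
    assume "z \<notin> B c"
    then show False using mono[OF c h_B(1)[OF c] z(1) _ zC] 2 h_B(3)[OF c] by simp
  qed
qed

definition P :: "'a \<Rightarrow> 'a set" where "P c = N (h c) - {c}"

lemma P_mem: assumes "c \<in> C" "z \<in> P c" shows "z \<in> B c" "d c z = 2" "adj (h c) z"
  using N_h[OF assms(1)] assms(2) unfolding P_def by (auto simp: mem)
lemma card_P: "c \<in> C ==> Suc (card (P c)) = k"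
proof -
  assume c: "c \<in> C"
  have "c \<in> N (h c)" using adj_h[OF c] by (simp add: mem)
  then show ?thesis using card_N[OF adj_h(2)[OF c]] card_Suc_Diff1[OF finite_N] unfolding P_def by metis
qed

lemma P_level: assumes c: "c \<in> C" and z: "z \<in> B c" "d c z = 2" shows "z \<in> P c"
proof -
  have "d (h c) z = 1" using B_step(1)[OF c z(1)] z(2) by simp
  moreover have "z ~= c" using z by auto
  ultimately show ?thesis unfolding P_def by (simp add: mem)
qed

lemma single_N: assumes c: "c \<in> C" and s: "s \<in> B c" "\<And>e. e \<in> C ==> s \<in> B e ==> e = c" "s ~= h c" and st: "adj s t"
  shows "t \<in> B c"
proof (rule ccontr)
  assume n: "t \<notin> B c"
  note S = BD[OF s(1)]
  have tC: "t \<notin> C"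
  proof
    assume tC: "t \<in> C"
    then have "s = h t" using N_CD[OF tC adj_sym[OF st] S(1)] by blast
    then have "s \<in> B t" using h_B(1)[OF tC] by simp
    then have "t = c" using s(2) tC by blast
    then show False using \<open>s = h t\<close> s(3) by simp
  qed
  have le: "d c t \<le> d c s" using mono[OF c s(1) st n tC] .
  then have "d c t \<le> D" using S(2) by simp
  then obtain g where g: "g \<in> C" "t \<in> B g" using B_cover[OF c _ tC] by blast
  have lt: "d g t < d c s" using B_far[OF c g n] le by simp
  have "s \<notin> B g" using s(2)[OF g(1)] g n by auto
  then have "d g s \<le> d g t" using mono[OF g adj_sym[OF st]] S(1) by blast
  then show False using S(4)[OF g(1)] lt by simp
qed

lemma W_CD: "c \<in> C ==> e \<in> C ==> c ~= e ==> x \<in> lvl c e i ==> 1 \<le> i ==> x \<in> B c \<and> x \<notin> B e"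
proof -
  assume a: "c \<in> C" "e \<in> C" "c ~= e" "x \<in> lvl c e i" "1 \<le> i"
  then have "x \<in> W c e - {c}" by (auto simp: mem)
  then show ?thesis using W_C[OF a(1-3)] by blast
qed
lemma lvl_CI: "c \<in> C ==> e \<in> C ==> c ~= e ==> x \<in> B c ==> x \<notin> B e ==> x \<in> lvl c e (d c x) \<and> d c x < D"
proof -
  assume a: "c \<in> C" "e \<in> C" "c ~= e" "x \<in> B c" "x \<notin> B e"
  have "x \<in> W c e" using W_C[OF a(1-3)] a(4,5) by blast
  then show ?thesis using W_le[OF adjC[OF a(1-3)]] by (simp add: mem)
qed

lemma multi_level2: assumes c: "c \<in> C" "e \<in> C" "c ~= e" and x: "x \<in> B c" "x \<in> B e" "d c x = 2" and g: "g \<in> C"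
  shows "x \<in> B g"
proof -
  let ?G = "{g \<in> C. x \<in> B g}"
  have "N x \<subseteq> h ` ?G"
  proof
    fix z assume "z \<in> N x"
    then have z: "adj x z" by (simp add: mem)
    obtain f where f: "f \<in> C" "x \<in> B f" "z \<in> B f" "Suc (d f z) = d c x" using multi_N[OF c x(1,2) z] by blast
    then have "adj f z" using x(3) by simp
    then have "z = h f" using N_CD[OF f(1) _ BD(1)[OF f(3)]] by blast
    then show "z \<in> h ` ?G" using f by blast
  qed
  moreover have finG: "finite ?G" using finC by simp
  ultimately have "card (N x) \<le> card (h ` ?G)" by (intro card_mono) auto
  also have "\<dots> \<le> card ?G" using finG by (rule card_image_le)
  finally have "card (N x) \<le> card ?G" .
  moreover have "adj x (h c)" using P_level[OF c(1) x(1,3)] adj_sym unfolding P_def by (simp add: mem)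
  then have "card (N x) = card C" using card_N cardC by simp
  ultimately have "?G = C" using card_subset_eq[OF finC, of ?G] card_mono[OF finC, of ?G] by simp
  then show ?thesis using g by blast
qed

lemma pred_B: assumes g: "g \<in> C" "x \<in> B g" "x ~= h g" obtains z where "adj x z" "Suc (d g z) = d g x"
proof -
  note X = BD[OF g(2)]
  have "1 \<le> d g x" using B_step[OF g(1,2)] by simp
  then obtain z where z: "d g z = d g x - 1" "d z x = 1" using geodesic[of g x "d g x" "d g x - 1"] X by auto
  then show ?thesis using that[of z] adj_sym \<open>1 \<le> d g x\<close> by simp
qed

text \<open>A vertex equally near to all of \<open>C\<close> has exactly one neighbour in each direction.\<close>
lemma full_N_unique:
  assumes x: "\<And>c. c \<in> C ==> x \<in> B c" and c: "c \<in> C" and z: "adj x z" "z \<in> B c" and z': "adj x z'" "z' \<in> B c"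
  shows "z = z'"
proof -
  obtain e where e: "e \<in> C" "e ~= c" using third by blast
  have ex: "\<exists>g. g \<in> C \<and> z \<in> B g \<and> Suc (d g z) = d c x \<and> (\<forall>f. f \<in> C --> z \<in> B f --> f = g)" if "z \<in> N x" for z
  proof -
    have "adj x z" using that by (simp add: mem)
    then show ?thesis using multi_N[OF c e(1) e(2)[symmetric] x[OF c] x[OF e(1)]] by metis
  qed
  define \<phi> where "\<phi> z = (SOME g. g \<in> C \<and> z \<in> B g)" for z
  have \<phi>: "\<phi> z = g" if "z \<in> N x" "g \<in> C" "z \<in> B g" for z g
  proof -
    have "\<phi> z \<in> C \<and> z \<in> B (\<phi> z)" unfolding \<phi>_def by (rule someI_ex) (use that in blast)
    then show ?thesis using ex[OF that(1)] that by blast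
  qed
  have "C \<subseteq> \<phi> ` N x"
  proof
    fix g assume g: "g \<in> C"
    have "x ~= h g" using h_B(2)[OF g c] h_B(2)[OF g e(1)] x[OF c] x[OF e(1)] e by auto
    then obtain t where t: "adj x t" "Suc (d g t) = d g x" using pred_B[OF g x[OF g]] by blast
    have tN: "t \<in> N x" using t by (simp add: mem)
    obtain f where f: "f \<in> C" "t \<in> B f" "Suc (d f t) = d c x" using ex[OF tN] by blast
    have "d g t = d f t" using t f B_level[OF c g x[OF c] x[OF g]] by simp
    then have "t \<in> B g" using f(2) unfolding B_def near_def by auto
    then have "\<phi> t = g" using \<phi>[OF tN g] by blast
    then show "g \<in> \<phi> ` N x" using tN by blast
  qed
  then have "card C \<le> card (\<phi> ` N x)" by (intro card_mono) auto
  then have "inj_on \<phi> (N x)" using card_N[OF z(1)] cardC card_image_le[OF finite_N, of \<phi> x]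
    by (intro eq_card_imp_inj_on) auto
  moreover have "\<phi> z = c" "\<phi> z' = c" "z \<in> N x" "z' \<in> N x" using \<phi> z z' c by (auto simp: mem)
  ultimately show ?thesis by (metis inj_onD)
qed

lemma no_ecc: assumes uv: "u \<in> C" "v \<in> C" "u ~= v" and ec: "ecc u v w" and D3: "3 \<le> D" shows False
proof -
  note vu = uv(2,1) uv(3)[symmetric]
  note e = eccD[OF ec]
  obtain l where l: "l < D" "card (lvl v u l) = 2" "\<And>i. i < D ==> i ~= l ==> card (lvl v u i) = 1"
    using ecc_levels[OF ec] by metis
  have L1: "lvl v u 1 = {h v}" using slimD(7)[OF slimC[OF vu]] .
  have hv: "\<not> adj (h v) (h v)" by simp
  show False
  proof (cases "\<exists>x. \<forall>c\<in>C. x \<in> B c")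
    case True
    then obtain x where x: "\<And>c. c \<in> C ==> x \<in> B c" by blast
    have only: "z = x" if "z \<in> B v" "z \<in> B g" "g \<in> C" "g ~= v" for z g
      using BB_unique[OF uv(2) that(3) that(4)[symmetric]] x uv that by blast
    have xh: "x ~= h v" using h_B(2)[OF uv(2,1)] x uv by auto
    have Nsub: "t = x \<or> t \<in> lvl v u (d v t) \<and> d v t < D \<and> t ~= z \<and> d v t \<le> Suc (d v z) \<and> d v z \<le> Suc (d v t)"
      if z: "z \<in> B v" "z ~= x" "z ~= h v" and tN: "t \<in> N z" for z t
    proof -
      have t: "adj z t" using tN by (simp add: mem)
      have tB: "t \<in> B v" using single_N[OF uv(2) z(1) _ z(3) t] only[OF z(1)] z(2) by blast
      show ?thesis
      proof (cases "t = x")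
        case False
        then have "t \<notin> B u" using only[OF tB _ uv(1,3)] by blast
        then have "t \<in> lvl v u (d v t)" "d v t < D" using lvl_CI[OF vu tB] by auto
        moreover have "d v t \<le> Suc (d v z)" "d v z \<le> Suc (d v t)"
          using adj_le2[OF t, of v] adj_le2'[OF t, of v] by auto
        moreover have "t ~= z" using t by auto
        ultimately show ?thesis by blast
      qed simp
    qed
    have top: "k = 3 \<and> adj x w' \<and> (l = D - 1 \<or> l = D - 2) \<and> w' ~= x" if ec': "ecc u v w'" for w'
    proof -
      note e' = eccD[OF ec']
      have wl: "w' \<in> lvl v u (D - 1)" "d v w' = D - 1" using e' D3 by (auto simp: mem)
      have wB: "w' \<in> B v" "w' \<notin> B u" using W_CD[OF vu wl(1)] D3 by auto
      have wx: "w' ~= x" using wB x uv by blast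
      have wh: "w' ~= h v" using h_B(3)[OF uv(2)] wl D3 by auto
      let ?A = "(lvl v u (D - 1) - {w'}) \<union> lvl v u (D - 2)"
      have sub: "N w' \<subseteq> insert x ?A"
      proof
        fix t assume "t \<in> N w'"
        from Nsub[OF wB(1) wx wh this] consider "t = x"
          | "t \<in> lvl v u (d v t)" "d v t < D" "t ~= w'" "d v w' \<le> Suc (d v t)" by blast
        then show "t \<in> insert x ?A"
        proof cases
          case 2
          then have "d v t = D - 1 \<or> d v t = D - 2" using wl(2) by linarith
          then show ?thesis using 2(1,3) by auto
        qed simp
      qed
      have "card ?A \<le> card (lvl v u (D - 1) - {w'}) + card (lvl v u (D - 2))" by (rule card_Un_le)
      moreover have "card (lvl v u (D - 1) - {w'}) = card (lvl v u (D - 1)) - 1" using wl by simp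
      ultimately have cA: "card ?A \<le> (card (lvl v u (D - 1)) - 1) + card (lvl v u (D - 2))" by simp
      have lv: "card (lvl v u (D - 1)) = (if l = D - 1 then 2 else 1)" "card (lvl v u (D - 2)) = (if l = D - 2 then 2 else 1)"
        using l(2) l(3)[of "D - 1"] l(3)[of "D - 2"] D3 by auto
      have finA: "finite ?A" using e' by simp
      have "d w' v = D - 1" "1 \<le> D - 1" using wl(2) d_sym[of w' v] D3 by linarith+
      then obtain t where "d w' t = 1" using geodesic[of w' v "D - 1" 1] by auto
      then have cN: "card (N w') = k" by (rule card_N)
      show ?thesis
      proof (cases "x \<in> N w'")
        case True
        have "k \<le> card (insert x ?A)" using card_mono[OF _ sub] finA cN by simp
        also have "\<dots> \<le> Suc (card ?A)" by (rule card_insert_le_m1) auto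
        finally have "k \<le> Suc ((card (lvl v u (D - 1)) - 1) + card (lvl v u (D - 2)))" using cA by linarith
        then have "k = 3 \<and> (l = D - 1 \<or> l = D - 2)" unfolding lv using k3 D3 by (simp split: if_splits)
        moreover have "adj x w'" using True adj_sym unfolding mem_N by blast
        ultimately show ?thesis using wx by blast
      next
        case False
        then have "N w' \<subseteq> ?A" using sub by blast
        then have "k \<le> card ?A" using card_mono[OF finA] cN by metis
        then show ?thesis using cA lv k3 D3 by (auto split: if_splits)
      qed
    qed
    have k: "k = 3" and xw: "adj x w" and ll: "l = D - 1 \<or> l = D - 2" and wx: "w ~= x" using top[OF ec] by auto
    have wl: "w \<in> lvl v u (D - 1)" "d v w = D - 1" using e D3 by (auto simp: mem)
    have wB: "w \<in> B v" "w \<notin> B u" using W_CD[OF vu wl(1)] D3 by auto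
    have "h v ~= w" using h_B(3)[OF uv(2)] wl D3 by auto
    then have xh': "\<not> adj x (h v)" using full_N_unique[OF x uv(2) _ h_B(1)[OF uv(2)] xw wB(1)] by blast
    have cP: "card (P v) = 2" using card_P[OF uv(2)] k by simp
    have Pl: "P v \<subseteq> lvl v u 2"
    proof
      fix z assume z: "z \<in> P v"
      note Z = P_mem[OF uv(2) z]
      have "z ~= x" using Z xh' adj_sym by blast
      then have "z \<notin> B u" using only[OF Z(1) _ uv(1,3)] by blast
      then show "z \<in> lvl v u 2" using lvl_CI[OF vu Z(1)] Z(2) by simp
    qed
    have "2 \<le> card (lvl v u 2)" using card_mono[OF finite_lvl[OF e(2)] Pl] cP by simp
    then have l2: "l = 2" using l(3)[of 2] D3 by (cases "l = 2") auto
    then have L2: "lvl v u 2 = P v" using card_subset_eq[OF finite_lvl[OF e(2)] Pl] l(2) cP by simp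
    obtain p p' where p: "P v = {p, p'}" "p ~= p'" using cP by (meson card_2_iff)
    consider "D = 3" | "D = 4" using ll l2 D3 by linarith
    then show False
    proof cases
      case 1
      have "ecc u v z" if "z \<in> {p, p'}" for z
      proof -
        have "z \<in> lvl v u 2" using that p L2 by auto
        then show ?thesis using 1 e(1) unfolding ecc_def by (simp add: mem)
      qed
      then have "adj x p" "adj x p'" using top by auto
      moreover have "p \<in> B v" "p' \<in> B v" using P_mem(1)[OF uv(2)] p by auto
      ultimately show False using full_N_unique[OF x uv(2), of p p'] p(2) by blast
    next
      case 2
      have L3: "lvl v u 3 = {w}" using l(3)[of 3] l2 2 wl(1) by (auto elim: card_1_singletonE)
      have Np: "N z = {h v, p, p', w} - {z}" if z: "z \<in> {p, p'}" for z
      proof -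
        have zP: "z \<in> P v" using z p by auto
        note Z = P_mem[OF uv(2) zP]
        have zw: "z ~= w" using Z(2) wl 2 by auto
        have zx: "z ~= x" using Z xh' adj_sym by blast
        have zh: "z ~= h v" using Z by auto
        have "x \<notin> N z" using full_N_unique[OF x uv(2) _ Z(1) xw wB(1)] zw adj_sym by (auto simp: mem)
        moreover have "N z \<subseteq> insert x (lvl v u 1 \<union> lvl v u 2 \<union> lvl v u 3 - {z})"
        proof
          fix t assume "t \<in> N z"
          from Nsub[OF Z(1) zx zh this] consider "t = x"
            | "t \<in> lvl v u (d v t)" "d v t < D" "t ~= z" "d v z \<le> Suc (d v t)" by blast
          then show "t \<in> insert x (lvl v u 1 \<union> lvl v u 2 \<union> lvl v u 3 - {z})"
          proof cases
            case 2
            then have "d v t = 1 \<or> d v t = 2 \<or> d v t = 3" using Z(2) \<open>D = 4\<close> by linarith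
            then show ?thesis using 2(1,3) by auto
          qed simp
        qed
        ultimately have sub: "N z \<subseteq> {h v, p, p', w} - {z}" using L1 L2 L3 p by auto
        have "h v \<notin> {p, p', w}" using P_mem(2)[OF uv(2)] p h_B(3)[OF uv(2)] wl 2 by fastforce
        moreover have "w \<notin> {p, p'}" using P_mem(2)[OF uv(2)] p wl 2 by fastforce
        ultimately have "card ({h v, p, p', w} - {z}) = 3" using z p(2) by auto
        moreover have "card (N z) = 3" using card_N[of z "h v"] Z(3) adj_sym k by auto
        ultimately show ?thesis using card_subset_eq[OF _ sub] by simp
      qed
      have "adj p p'" using Np[of p] p(2) by (auto simp: mem_N[symmetric])
      then obtain t where "adj p t" "t ~= p'" "\<not> adj p' t" using no_twins by blast
      then have "t \<in> N p" "t \<notin> N p'" "t ~= p'" by (auto simp: mem)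
      then show False using Np[of p] Np[of p'] by auto
    qed
  next
    case False
    have not2: "z \<notin> B g" if "c \<in> C" "g \<in> C" "c ~= g" "z \<in> B c" "d c z = 2" for c g z
      using multi_level2[OF that(1,2,3,4) _ that(5)] False by blast
    have Pl: "P c \<subseteq> lvl c g 2" if "c \<in> C" "g \<in> C" "c ~= g" for c g
    proof
      fix z assume z: "z \<in> P c"
      note Z = P_mem[OF that(1) z]
      have "z \<notin> B g" using not2[OF that Z(1,2)] .
      then show "z \<in> lvl c g 2" using lvl_CI[OF that Z(1)] Z(2) by simp
    qed
    have "card (lvl v u 2) \<le> 2" using l(2) l(3)[of 2] D3 by (cases "l = 2") auto
    then have cP': "card (P v) \<le> 2" using card_mono[OF finite_lvl[OF e(2)] Pl[OF vu]] by simp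
    then have k: "k = 3" using card_P[OF uv(2)] k3 by simp
    have cP: "card (P c) = 2" if "c \<in> C" for c using card_P[OF that] k by simp
    obtain r where r: "r \<in> C" "r ~= u" "r ~= v" using third by blast
    have "card {u, v, r} = card C" using uv r cardC k by auto
    then have Ceq: "C = {u, v, r}" using card_subset_eq[OF finC, of "{u, v, r}"] uv r by auto
    have notin3: "\<not> (\<forall>c\<in>{u, v, r}. x \<in> B c)" for x using False Ceq by blast
    have multi_ge: "3 \<le> d c x" if "c \<in> C" "g \<in> C" "c ~= g" "x \<in> B c" "x \<in> B g" for c g x
    proof -
      have "d c x ~= 2" using not2[OF that(1-4)] that(5) by blast
      moreover have "d c x ~= 1"
      proof
        assume "d c x = 1"
        then have "x = h c" using N_CD[OF that(1) _ BD(1)[OF that(4)]] by blast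
        then show False using h_B(2)[OF that(1,2)] that by blast
      qed
      moreover have "1 \<le> d c x" using B_step(2)[OF that(1,4)] .
      ultimately show ?thesis by linarith
    qed
    have ltD: "d c x < D" if "c \<in> C" "g \<in> C" "c ~= g" "x \<in> B c" "x \<in> B g" for c g x
    proof -
      obtain f where f: "f \<in> C" "f ~= c" "f ~= g" using third by blast
      have "C = {c, g, f}" using Ceq that(1-3) f by auto
      then have "x \<notin> B f" using False that by auto
      then show ?thesis using lvl_CI[OF that(1) f(1) f(2)[symmetric] that(4)] by blast
    qed
    have D4: "D = 4"
    proof -
      obtain m where m: "B v \<inter> B r = {m}" using card_BB1[OF uv(2) r(1) r(3)[symmetric]] by (rule card_1_singletonE)
      have mB: "m \<in> B v" "m \<in> B r" using m by auto
      have mu: "m \<notin> B u" using notin3[of m] mB by auto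
      define j where "j = d v m"
      have j: "3 \<le> j" "j < D" using multi_ge[OF uv(2) r(1) r(3)[symmetric] mB] ltD[OF uv(2) r(1) r(3)[symmetric] mB] unfolding j_def by auto
      have rj: "d r m = j" using B_level[OF r(1) uv(2) mB(2,1)] unfolding j_def .
      have ml: "m \<in> lvl v u j" "m \<in> lvl r u j"
        using lvl_CI[OF vu mB(1) mu] lvl_CI[OF r(1) uv(1) r(2) mB(2) mu] rj unfolding j_def by auto
      have two: "card (lvl c u 2) = 2" if vr: "c \<in> {v, r}" and em: "ecc u c m'" for c m'
      proof -
        have c: "c \<in> C" "c ~= u" using vr uv r by auto
        have "2 \<le> card (lvl c u 2)" using card_mono[OF finite_lvl[OF adjC[OF c(1) uv(1) c(2)]] Pl[OF c(1) uv(1) c(2)]] cP[OF c(1)] by simp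
        moreover obtain i where "card (lvl c u i) = 2" "\<And>a. a < D ==> a ~= i ==> card (lvl c u a) = 1"
          using ecc_levels[OF em] by metis
        ultimately show ?thesis using D3 by (cases "i = 2") auto
      qed
      have lv2: "card (lvl v u 2) = 2" using two[of v w] ec by simp
      have mN: "\<exists>g\<in>{v, r}. z \<in> lvl g u (j - 1)" if z: "adj m z" for z
      proof -
        obtain g where g: "g \<in> C" "m \<in> B g" "z \<in> B g" "Suc (d g z) = d v m" "\<forall>f. f \<in> C --> z \<in> B f --> f = g"
          using multi_N[OF uv(2) r(1) r(3)[symmetric] mB z] by blast
        have gu: "g ~= u" using mu g(2) by blast
        then have "z \<notin> B u" using g(5) uv(1) by blast
        then have "z \<in> lvl g u (d g z)" using lvl_CI[OF g(1) uv(1) gu g(3)] by blast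
        moreover have "g \<in> {v, r}" using g(1) gu Ceq by auto
        moreover have "d g z = j - 1" using g(4) unfolding j_def by linarith
        ultimately show ?thesis by metis
      qed
      have jD: "Suc j = D"
      proof (rule ccontr)
        assume "Suc j ~= D"
        then obtain z where z: "z \<in> lvl v u (Suc j)" using ecc_geodesic[OF ec, of "Suc j"] j by auto
        have z': "d v z = Suc j" "d u z = Suc (Suc j)" using z by (auto simp: mem)
        obtain t where t: "d v t = j" "d t z = 1" using geodesic[of v z "Suc j" j] z' j by auto
        have "d u t \<le> Suc j" using adj_le[OF e(1), of t] t by simp
        moreover have "d u z \<le> d u t + 1" using d_tri[of u z t] t by simp
        ultimately have "t \<in> lvl v u j" using t z' by (simp add: mem)
        then have "t = m" using ecc_unique[OF ec lv2, of j t m] ml(1) j by simp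
        then obtain g where g: "g \<in> {v, r}" "z \<in> lvl g u (j - 1)" using mN[of z] t by blast
        have "d u z = Suc (j - 1)" using g(2) unfolding mem by blast
        then show False using z' j by simp
      qed
      have ecv: "ecc u v m" and ecr: "ecc u r m"
        using ml jD adjC uv r unfolding ecc_def by (auto simp: mem)
      have l2: "card (lvl v u 2) = 2" "card (lvl r u 2) = 2" using two ecv ecr by auto
      show "D = 4"
      proof (rule ccontr)
        assume "D ~= 4"
        then have j4: "j - 1 ~= 2" "j - 1 < D" using jD j by auto
        have one: "\<exists>y. lvl g u (j - 1) \<subseteq> {y}" if g: "g \<in> {v, r}" for g
        proof (cases "lvl g u (j - 1) = {}")
          case False
          then obtain y where y: "y \<in> lvl g u (j - 1)" by blast
          have eg: "ecc u g m" "card (lvl g u 2) = 2" using g ecv ecr l2 by auto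
          have "z = y" if "z \<in> lvl g u (j - 1)" for z
            using ecc_unique[OF eg _ j4(2) j4(1) that y] D3 by simp
          then show ?thesis by blast
        qed simp
        obtain y where y: "lvl v u (j - 1) \<subseteq> {y}" using one[of v] by blast
        obtain y' where y': "lvl r u (j - 1) \<subseteq> {y'}" using one[of r] by blast
        have sub: "N m \<subseteq> {y, y'}"
        proof
          fix z assume "z \<in> N m"
          then show "z \<in> {y, y'}" using mN[of z] y y' unfolding mem_N by blast
        qed
        obtain t where "adj m t" using pred_B[OF uv(2) mB(1)] h_B(2)[OF uv(2) r(1)] mB(2) r(3) by blast
        then have "card (N m) = 3" using card_N k by simp
        moreover have "card {y, y'} \<le> 2" by (simp add: card_insert_if)
        ultimately show False using card_mono[OF _ sub] by simp
      qed
    qed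
    have card_B5: "card (B c) = 5" if "c \<in> C" for c using card_B[OF that] D4 by simp
    define T where "T c = (\<exists>p\<in>P c. \<exists>p'\<in>P c. adj p p')" for c
    have Tne: "T c ~= T g" if cg: "c \<in> C" "g \<in> C" "c ~= g" for c g
    proof
      assume eq: "T c = T g"
      obtain x where x: "B c \<inter> B g = {x}" using card_BB1[OF cg] by (rule card_1_singletonE)
      have xB: "x \<in> B c" "x \<in> B g" using x by auto
      obtain f where f: "f \<in> C" "f ~= c" "f ~= g" using third by blast
      have Cf: "C = {c, g, f}" using Ceq cg f by auto
      have x3: "d c x = 3" "d g x = 3"
        using multi_ge[OF cg xB] ltD[OF cg xB] D4 B_level[OF cg(2,1) xB(2,1)] by auto
      have xf: "x \<notin> B f" using False Cf xB by auto
      have Nx: "N x \<subseteq> P c \<union> P g"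
      proof
        fix z assume "z \<in> N x"
        then have z: "adj x z" by (simp add: mem)
        obtain a where a: "a \<in> C" "x \<in> B a" "z \<in> B a" "Suc (d a z) = d c x" using multi_N[OF cg xB z] by blast
        then have "a \<in> {c, g}" using Cf xf by auto
        moreover have "z \<in> P a" using P_level[OF a(1,3)] a(4) x3 by simp
        ultimately show "z \<in> P c \<union> P g" by auto
      qed
      obtain t where "adj x t" using pred_B[OF cg(1) xB(1)] h_B(2)[OF cg(1,2)] xB cg by blast
      then have cNx: "card (N x) = 3" using card_N k by simp
      have disj: "P c \<inter> P g = {}" using not2[OF cg] P_mem cg by blast
      have cPP: "card (P c \<union> P g) = 4" using card_Un_disjoint[OF _ _ disj] cP cg unfolding P_def by auto
      have NP: "N p \<subseteq> {h a, x, y} \<union> (P a - {p})"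
        if a: "a \<in> C" "b \<in> C" "f \<in> C" "a ~= b" "a ~= f" "b ~= f" and x: "x \<in> B a" "x \<in> B b"
          and y: "y \<in> B a" "y \<in> B f" and p: "p \<in> P a" for a b f x y p
      proof -
        have Ca: "C = {a, b, f}" using Ceq a by auto
        have xy: "x ~= y" using False Ca x y by blast
        have l3: "3 \<le> d a x" "3 \<le> d a y" using multi_ge[OF a(1,2,4) x] multi_ge[OF a(1,3,5) y] by auto
        have P2: "d a z = 2" if "z \<in> P a" for z using P_mem(2)[OF a(1) that] .
        have "{h a, x, y} \<inter> P a = {}" using P2 l3 h_B(3)[OF a(1)] by fastforce
        moreover have "h a ~= x" "h a ~= y" using l3 h_B(3)[OF a(1)] by auto
        then have "card {h a, x, y} = 3" using xy by simp
        moreover have "finite (P a)" unfolding P_def by simp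
        ultimately have "card ({h a, x, y} \<union> P a) = 5" using cP[OF a(1)] card_Un_disjoint[of "{h a, x, y}" "P a"] by simp
        moreover have "{h a, x, y} \<union> P a \<subseteq> B a" using x y h_B(1)[OF a(1)] P_mem(1)[OF a(1)] by blast
        ultimately have Ba: "B a = {h a, x, y} \<union> P a"
          using card_subset_eq[OF finBF(1)[OF a(1)]] card_B5[OF a(1)] by metis
        note Q = P_mem[OF a(1) p]
        have "e = a" if "e \<in> C" "p \<in> B e" for e using not2[OF a(1) that(1) _ Q(1,2)] that(2) by blast
        moreover have "p ~= h a" using Q by auto
        ultimately have "t \<in> B a" if "adj p t" for t using single_N[OF a(1) Q(1) _ _ that] by blast
        then have "N p \<subseteq> B a - {p}" by (auto simp: mem)
        then show ?thesis using Ba by blast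
      qed
      have cNp: "card (N p) = 3" "h a \<in> N p" if "a \<in> C" "p \<in> P a" for a p
        using P_mem(3)[OF that] adj_sym card_N[of p "h a"] k by (auto simp: mem)
      have full: "P a \<subseteq> N x" if a: "a \<in> C" "b \<in> C" "f \<in> C" "a ~= b" "a ~= f" "b ~= f" "x \<in> B a" "x \<in> B b"
        and nT: "\<not> T a" for a b f
      proof
        fix p assume p: "p \<in> P a"
        obtain y where "B a \<inter> B f = {y}" using card_BB1[OF a(1,3,5)] by (rule card_1_singletonE)
        then have y: "y \<in> B a" "y \<in> B f" by auto
        have "P a \<inter> N p = {}" using nT p unfolding T_def by (auto simp: mem)
        then have sub: "N p \<subseteq> {h a, x, y}" using NP[OF a y p] by blast
        have "card {h a, x, y} \<le> 3" by (simp add: card_insert_if)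
        then have "N p = {h a, x, y}" using card_seteq[OF _ sub] cNp(1)[OF a(1) p] by simp
        then have "x \<in> N p" by simp
        then show "p \<in> N x" using adj_sym unfolding mem_N by blast
      qed
      have notfull: "\<not> P a \<subseteq> N x" if a: "a \<in> C" "b \<in> C" "f \<in> C" "a ~= b" "a ~= f" "b ~= f" "x \<in> B a" "x \<in> B b"
        and T: "T a" for a b f
      proof
        assume sub: "P a \<subseteq> N x"
        obtain p p' where pp: "p \<in> P a" "p' \<in> P a" "adj p p'" using T unfolding T_def by blast
        obtain y where "B a \<inter> B f = {y}" using card_BB1[OF a(1,3,5)] by (rule card_1_singletonE)
        then have y: "y \<in> B a" "y \<in> B f" by auto
        have Np: "N q = {h a, x, q'}" if q: "q \<in> P a" "q' \<in> P a" "adj q q'" for q q'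
        proof -
          have "adj x q" using sub q by (auto simp: mem_N[symmetric])
          then have xq: "x \<in> N q" using adj_sym by (simp add: mem)
          have "q' \<in> N q" using q by (simp add: mem)
          then have s: "{h a, x, q'} \<subseteq> N q" using cNp(2)[OF a(1) q(1)] xq by blast
          have "d a x ~= 2" "d a x ~= 1" using multi_ge[OF a(1,2,4,7,8)] by auto
          then have "h a ~= x" "x ~= q'" "h a ~= q'" using h_B(3)[OF a(1)] P_mem(2,3)[OF a(1) q(2)] by auto
          then have "card {h a, x, q'} = 3" by simp
          then show ?thesis using card_subset_eq[OF finite_N s] cNp(1)[OF a(1) q(1)] by simp
        qed
        have "N p = {h a, x, p'}" "N p' = {h a, x, p}" using Np[OF pp] Np[OF pp(2,1) adj_sym[OF pp(3)]] by auto
        moreover obtain t where "adj p t" "t ~= p'" "\<not> adj p' t" using no_twins[OF pp(3)] by blast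
        then have "t \<in> N p" "t \<notin> N p'" "t ~= p'" by (auto simp: mem)
        ultimately show False by auto
      qed
      show False
      proof (cases "T c")
        case False
        then have "P c \<union> P g \<subseteq> N x"
          using full[OF cg(1,2) f(1) cg(3) f(2)[symmetric] f(3)[symmetric] xB]
            full[OF cg(2,1) f(1) cg(3)[symmetric] f(3)[symmetric] f(2)[symmetric] xB(2,1)] eq by blast
        then show False using card_mono[OF finite_N, of "P c \<union> P g" x] cPP cNx by simp
      next
        case True
        obtain p where p: "p \<in> P c" "p \<notin> N x"
          using notfull[OF cg(1,2) f(1) cg(3) f(2)[symmetric] f(3)[symmetric] xB True] by blast
        obtain q where q: "q \<in> P g" "q \<notin> N x"
          using notfull[OF cg(2,1) f(1) cg(3)[symmetric] f(3)[symmetric] f(2)[symmetric] xB(2,1)] True eq by blast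
        have fin: "finite (P c \<union> P g)" unfolding P_def by simp
        have "N x \<subseteq> (P c \<union> P g) - {p, q}" using Nx p q by blast
        then have "card (N x) \<le> card ((P c \<union> P g) - {p, q})" using fin by (intro card_mono) auto
        moreover have "p ~= q" using disj p q by blast
        then have "card ((P c \<union> P g) - {p, q}) = 2" using cPP p q by (subst card_Diff_subset) auto
        ultimately show False using cNx by simp
      qed
    qed
    have "T u ~= T v" "T v ~= T r" "T u ~= T r"
      using Tne[OF uv] Tne[OF uv(2) r(1) r(3)[symmetric]] Tne[OF uv(1) r(1) r(2)[symmetric]] by blast+
    then show False by blast
  qed
qed

end

section \<open>The diamond configuration\<close>

text \<open>
  The last surviving shape around a slim edge: valency 4, and the two common neighbours of the edge are
  not adjacent to each other. Both ends of the edge are named in full, so that the distances among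
  finitely many vertices are contradictory.
\<close>
locale diamond_core = ndb +
  fixes u v x y r1 r2 p p' g q q' g' s s' t t'
  assumes D3: "D = 3" and k4: "k = 4"
    and Nu: "N u = {v, y, r1, r2}" and Nv: "N v = {u, x, r1, r2}"
    and Nx: "N x = {v, p, p', g}" and Ny: "N y = {u, q, q', g'}"
    and Nr: "N r1 = {u, v, s, s'}" "N r2 = {u, v, t, t'}"
    and dp: "d v p = 2" "d v p' = 2" "d u p = 3" "d u p' = 3"
    and dq: "d u q = 2" "d u q' = 2" "d v q = 3" "d v q' = 3"
    and dg: "d v g = 2" "d u g' = 2"
    and rp: "d r1 p = 2" "d r1 p' = 3" "d r2 p' = 2" "d r2 p = 3"
    and rq: "d r1 q = 2" "d r1 q' = 3" "d r2 q' = 2" "d r2 q = 3"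
    and Np: "N p \<subseteq> {x, p', g} \<union> N r1" "N p' \<subseteq> {x, p, g} \<union> N r2"
    and Nq: "N q \<subseteq> {y, q', g'} \<union> N r1" "N q' \<subseteq> {y, q, g'} \<union> N r2"
    and dxy: "d u x = 2" "d v y = 2"
    and rx: "\<not> adj r1 x" "\<not> adj r2 x" "\<not> adj r1 y" "\<not> adj r2 y" "\<not> adj r1 r2" "\<not> adj r2 r1"
    and x2: "\<And>z. d v z = 2 ==> d x z \<le> 2" and y2: "\<And>z. d u z = 2 ==> d y z \<le> 2"
begin

lemma mirror: "diamond_core d k D v u y x r1 r2 q q' g' p p' g s s' t t'"
  using ndb_axioms D3 k4 Nu Nv Nx Ny Nr dp dq dg rp rq Np Nq dxy rx x2 y2
  unfolding diamond_core_def diamond_core_axioms_def by (simp add: insert_commute)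

lemma swap: "diamond_core d k D u v x y r2 r1 p' p g q' q g' t t' s s'"
  using ndb_axioms D3 k4 Nu Nv Nx Ny Nr dp dq dg rp rq Np Nq dxy rx x2 y2
  unfolding diamond_core_def diamond_core_axioms_def by (simp add: insert_commute)

lemma N4: "adj a b ==> card (N a) = 4" using card_N k4 by simp

lemma nb: "z \<in> N a \<longleftrightarrow> a \<in> N z" using adj_sym unfolding mem_N by blast

lemma adjs: "adj v x" "adj x p" "adj x p'" "adj x g" "adj u y" "adj r1 s" "adj r1 s'" "adj u v" "adj v r1" "adj u r1" "adj v r2" "adj u r2"
  using Nu Nv Nx Nr unfolding mem_N[symmetric] by auto

lemma ne: "r1 ~= x" "r1 ~= y" "p ~= q" "p ~= q'" "p' ~= q" "p' ~= q'" "p ~= p'" "q ~= q'"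
proof -
  have "adj y q" using Ny unfolding mem_N[symmetric] by auto
  then show "r1 ~= x" "r1 ~= y" using rp rq adjs(2) by auto
  show "p ~= q" "p ~= q'" "p' ~= q" "p' ~= q'" "p ~= p'" "q ~= q'" using dp dq rp rq by auto
qed

lemma memNx: "adj x z \<longleftrightarrow> z \<in> {v, p, p', g}" using Nx unfolding mem_N[symmetric] by simp
lemma memNy: "adj y z \<longleftrightarrow> z \<in> {u, q, q', g'}" using Ny unfolding mem_N[symmetric] by simp
lemma memNv: "adj v z \<longleftrightarrow> z \<in> {u, x, r1, r2}" using Nv unfolding mem_N[symmetric] by simp
lemma memNu: "adj u z \<longleftrightarrow> z \<in> {v, y, r1, r2}" using Nu unfolding mem_N[symmetric] by simp

text \<open>A vertex on level two of \<open>v\<close> is adjacent to \<open>x\<close> or has a common neighbour with it.\<close>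
lemma x_reach: assumes "d v z = 2" "z ~= x" obtains "adj x z" | e where "e \<in> {v, p, p', g}" "adj e z"
proof -
  have "d x z \<le> 2" by (rule x2[OF assms(1)])
  moreover have "d x z ~= 0" using assms by simp
  ultimately consider "d x z = 1" | "d x z = Suc 1" by linarith
  then show ?thesis
  proof cases
    case 2
    then obtain e where "adj x e" "d e z = 1" using d_step[of x z 1] D3 by auto
    then show ?thesis using that memNx by blast
  qed (rule that(1))
qed

lemma y_g: assumes gp: "adj g p" shows "adj g y" "g = g'"
proof -
  have yx: "y ~= x" using dxy adjs by auto
  have py: "\<not> adj y p" using adj_le[OF adjs(5), of p] dp by auto
  have py': "\<not> adj y p'" using adj_le[OF adjs(5), of p'] dp by auto
  show gy: "adj g y"
  proof (rule x_reach[OF dxy(2) yx])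
    assume "adj x y"
    then have "y = v \<or> y = p \<or> y = p' \<or> y = g" unfolding memNx by simp
    moreover have "y ~= v" using dxy by auto
    moreover have "y ~= p" "y ~= p'" using dp adjs(5) by auto
    moreover have "y ~= g" using gp py by blast
    ultimately show ?thesis by blast
  next
    fix e assume e: "e \<in> {v, p, p', g}" "adj e y"
    then have "e ~= v" "e ~= p" "e ~= p'" using dxy(2) py py' adj_sym by auto
    then show ?thesis using e by blast
  qed
  have "g \<in> {u, q, q', g'}" using adj_sym[OF gy] unfolding memNy .
  moreover have "g ~= u" using dg(1) adj_sym[OF adjs(8)] by auto
  moreover have "g ~= q" "g ~= q'" using dg dq by auto
  ultimately show "g = g'" by blast
qed

lemma N_g: assumes "adj g p" "adj g p'" shows "N g = {x, p, p', y}"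
proof -
  have "{x, p, p', y} \<subseteq> N g" using assms y_g adj_sym[OF adjs(4)] unfolding mem_N by (simp add: mem_N)
  moreover have "x ~= p" "x ~= p'" "x ~= y" "p ~= y" "p' ~= y" using dp dxy adjs by auto
  then have "card {x, p, p', y} = 4" using ne by simp
  ultimately show ?thesis using card_subset_eq[OF finite_N, of "{x, p, p', y}" g] N4[OF assms(1)] by simp
qed

lemma N_p_sub: "N p \<subseteq> {x, p', g, s, s'}"
proof
  fix z assume z: "z \<in> N p"
  then have pz: "adj z p" unfolding mem_N by (rule adj_sym)
  have "z ~= u" using pz dp by auto
  moreover have "z ~= v" using pz dp by auto
  ultimately show "z \<in> {x, p', g, s, s'}" using z Np(1) Nr(1) by blast
qed

lemma p_adj_s: "adj s p \<or> adj s' p"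
proof (rule ccontr)
  assume n: "\<not> ?thesis"
  then have "s \<notin> N p" "s' \<notin> N p" using adj_sym unfolding mem_N by blast+
  then have sub: "N p \<subseteq> {x, p', g}" using N_p_sub by blast
  have "card (N p) = 4" using N4[OF adj_sym[OF adjs(2)]] .
  moreover have "card {x, p', g} \<le> 3" by (simp add: card_insert_if)
  ultimately show False using card_mono[OF _ sub] by simp
qed

lemma s_facts: assumes "\<sigma> \<in> {s, s'}"
  shows "adj r1 \<sigma>" "\<sigma> ~= u" "\<sigma> ~= v" "\<sigma> ~= p" "\<sigma> ~= q" "\<sigma> ~= p'" "\<sigma> ~= q'" "\<sigma> ~= x" "\<sigma> ~= y"
    "\<not> adj \<sigma> p'" "\<not> adj \<sigma> q'" "\<not> adj u \<sigma>" "d v \<sigma> = 2"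
proof -
  show a: "adj r1 \<sigma>" using assms adjs by auto
  have "card (N r1) = 4" using N4[OF a] .
  then have "distinct [u, v, s, s']" using Nr(1) by (intro card_distinct) simp
  then show su: "\<sigma> ~= u" and sv: "\<sigma> ~= v" using assms by auto
  show "\<sigma> ~= p" "\<sigma> ~= q" "\<sigma> ~= p'" "\<sigma> ~= q'" using a rp rq by auto
  show sx: "\<sigma> ~= x" and sy: "\<sigma> ~= y" using a rx by auto
  show "\<not> adj \<sigma> p'" using adj_le[OF a, of p'] rp by auto
  show "\<not> adj \<sigma> q'" using adj_le[OF a, of q'] rq by auto
  have sr: "\<sigma> ~= r1" "\<sigma> ~= r2" using a rx by auto
  show "\<not> adj u \<sigma>" using su sv sx sy sr unfolding memNu by auto
  have "\<not> adj v \<sigma>" using su sv sx sy sr unfolding memNv by auto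
  then show "d v \<sigma> = 2" using dist_two[OF adj_sym[OF adjs(9)] a] sv by simp
qed

lemma N_q_sub: "N q \<subseteq> {y, q', g', s, s'}"
  using diamond_core.N_p_sub[OF mirror] .

lemma distinct_s: "s ~= s'"
proof
  assume "s = s'"
  then have "N r1 \<subseteq> {u, v, s}" using Nr by simp
  moreover have "card {u, v, s} \<le> 3" by (simp add: card_insert_if)
  ultimately show False using card_mono[of "{u, v, s}" "N r1"] N4[OF adjs(6)] by simp
qed

lemma alpha: "adj p p'"
proof (rule ccontr)
  assume n: "\<not> ?thesis"
  have n': "\<not> adj p' p" using n adj_sym by blast
  interpret S: diamond_core d k D u v x y r2 r1 p' p g q' q g' t t' s s' by (rule swap)
  have c4: "card {a, b, c, e} \<le> 4" for a b c e :: 'a by (simp add: card_insert_if)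
  have Np: "N p = {x, g, s, s'}"
  proof -
    have "N p \<subseteq> {x, g, s, s'}" using N_p_sub n unfolding mem_N[symmetric] by blast
    then show ?thesis using card_seteq[of "{x, g, s, s'}" "N p"] N4[OF adj_sym[OF adjs(2)]] c4[of x g s s'] by simp
  qed
  have Np': "N p' = {x, g, t, t'}"
  proof -
    have "N p' \<subseteq> {x, g, t, t'}" using S.N_p_sub n' unfolding mem_N[symmetric] by blast
    then show ?thesis using card_seteq[of "{x, g, t, t'}" "N p'"] N4[OF adj_sym[OF adjs(3)]] c4[of x g t t'] by simp
  qed
  have gp: "adj g p" "adj g p'" using Np Np' nb[of g p] nb[of g p'] unfolding mem_N[symmetric] by auto
  note Ng = N_g[OF gp] and gg = y_g(2)[OF gp(1)]
  have "q \<notin> N g" using Ng ne dq dxy adjs by auto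
  then have qg: "g' \<notin> N q" using gg nb by blast
  have Nq: "N q = {y, q', s, s'}"
  proof -
    have "N q \<subseteq> {y, q', s, s'}" using N_q_sub qg by blast
    moreover have "adj q y" using adj_sym memNy by blast
    ultimately show ?thesis using card_seteq[of "{y, q', s, s'}" "N q"] N4 c4[of y q' s s'] by simp
  qed
  have star: "N \<sigma> = {r1, p, q, \<tau>}" if st: "\<sigma> \<in> {s, s'}" "{\<sigma>, \<tau>} = {s, s'}" "\<sigma> ~= \<tau>" for \<sigma> \<tau>
  proof -
    note sf = s_facts[OF st(1)]
    have "\<sigma> \<in> N p" "\<sigma> \<in> N q" using Np Nq st by auto
    then have sp: "adj \<sigma> p" "adj \<sigma> q" using nb unfolding mem_N by blast+
    have "adj q q'" using Nq unfolding mem_N[symmetric] by auto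
    then have sq': "d \<sigma> q' \<le> 2" using adj_le[OF sp(2), of q'] by simp
    have sub: "{\<sigma>, p, q, q'} \<subseteq> W \<sigma> r1" using sp sq' rp rq sf(1) by (auto simp: mem)
    have sr: "adj \<sigma> r1" using sf adj_sym by blast
    have "card {\<sigma>, p, q, q'} = 4" using sf ne by simp
    then have Weq: "W \<sigma> r1 = {\<sigma>, p, q, q'}" using card_subset_eq[OF finite_W[OF sr] sub] card_W[OF sr] D3 by simp
    have "N \<sigma> \<subseteq> {r1, p, q, \<tau>}"
    proof
      fix e assume e: "e \<in> N \<sigma>"
      have "e \<in> insert r1 (com \<sigma> r1 \<union> lvl \<sigma> r1 1)" using e N_split[OF sr] by simp
      then consider "e = r1" | "e \<in> N r1" | "e \<in> W \<sigma> r1"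
        using com_N[of \<sigma> r1] lvl_sub_W[of \<sigma> r1 1] by blast
      then show "e \<in> {r1, p, q, \<tau>}"
      proof cases
        case 2
        have "e ~= \<sigma>" using e by (auto simp: mem)
        moreover have "e ~= u" using e sf(12) nb unfolding mem_N by blast
        moreover have "e ~= v" using e sf(13) nb[of e \<sigma>] unfolding mem_N by auto
        ultimately show ?thesis using 2 Nr(1) st by auto
      next
        case 3
        have "e ~= \<sigma>" "e ~= q'" using e sf(11) by (auto simp: mem)
        then show ?thesis using 3 Weq by auto
      qed simp
    qed
    then show ?thesis using card_seteq[of "{r1, p, q, \<tau>}" "N \<sigma>"] N4[OF sr] c4[of r1 p q \<tau>] by simp
  qed
  have Ns: "N s = {r1, p, q, s'}" "N s' = {r1, p, q, s}" using star[of s s'] star[of s' s] distinct_s by auto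
  then have "adj s s'" unfolding mem_N[symmetric] by simp
  then obtain z where "z \<in> N s" "z ~= s'" "z \<notin> N s'" using no_twins unfolding mem_N by blast
  then show False using Ns by auto
qed

lemma not_both: assumes "\<sigma> \<in> {s, s'}" shows "\<not> (adj \<sigma> p \<and> adj \<sigma> q)"
proof
  assume a: "adj \<sigma> p \<and> adj \<sigma> q"
  note sf = s_facts[OF assms]
  have sr: "adj \<sigma> r1" using sf adj_sym by blast
  have "d \<sigma> p' \<le> 2" using adj_le[of \<sigma> p p'] a alpha by simp
  moreover have "d \<sigma> q' \<le> 2" using adj_le[of \<sigma> q q'] a diamond_core.alpha[OF mirror] by simp
  ultimately have sub: "{\<sigma>, p, p', q, q'} \<subseteq> W \<sigma> r1" using a rp rq sf(1) by (auto simp: mem)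
  have "card {\<sigma>, p, p', q, q'} = 5" using sf ne by simp
  then show False using card_mono[OF finite_W[OF sr] sub] card_W[OF sr] D3 by simp
qed

lemma p_one_s: obtains \<sigma> \<tau> where "{\<sigma>, \<tau>} = {s, s'}" "adj \<sigma> p" "\<not> adj \<tau> p"
proof -
  have q: "adj s q \<or> adj s' q" using diamond_core.p_adj_s[OF mirror] .
  have "\<not> (adj s p \<and> adj s' p)" using not_both[of s] not_both[of s'] q by blast
  then show ?thesis using p_adj_s that[of s s'] that[of s' s] by blast
qed

lemma p_adj_g: "adj g p"
proof (rule ccontr)
  assume n: "\<not> ?thesis"
  obtain \<sigma> \<tau> where st: "{\<sigma>, \<tau>} = {s, s'}" "adj \<sigma> p" "\<not> adj \<tau> p" by (rule p_one_s)
  have "g \<notin> N p" "\<tau> \<notin> N p" using n st nb unfolding mem_N by blast+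
  then have sub: "N p \<subseteq> {x, p', \<sigma>}" using N_p_sub st(1) by blast
  have "card {x, p', \<sigma>} \<le> 3" by (simp add: card_insert_if)
  then show False using card_mono[OF _ sub] N4[OF adj_sym[OF adjs(2)]] by simp
qed

theorem impossible: False
proof -
  have gp: "adj g p" "adj g p'" using p_adj_g diamond_core.p_adj_g[OF swap] by auto
  note Ng = N_g[OF gp]
  obtain \<sigma> \<tau> where st: "{\<sigma>, \<tau>} = {s, s'}" "adj \<sigma> p" "\<not> adj \<tau> p" by (rule p_one_s)
  have "\<tau> \<in> {s, s'}" using st by blast
  note tf = s_facts[OF this]
  have r1g: "r1 \<notin> N g" using Ng ne rp by auto
  have tg: "\<tau> ~= g" using tf(1) r1g nb unfolding mem_N by blast
  show False
  proof (rule x_reach[OF tf(13) tf(8)])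
    assume "adj x \<tau>"
    then show False using tf tg unfolding memNx by auto
  next
    fix e assume e: "e \<in> {v, p, p', g}" "adj e \<tau>"
    have "e ~= v" using e tf(13) by auto
    moreover have "e ~= p" "e ~= p'" using e(2) st(3) tf(10) adj_sym by blast+
    ultimately have "\<tau> \<in> N g" using e by (simp add: mem)
    then show False using Ng tf by auto
  qed
qed

end

context slim_end begin

lemma diamond_exists:
  assumes Zr: "Z = {r1, r2}" "r1 ~= r2" "\<not> adj r1 x" "\<not> adj r2 x"
  shows "\<exists>p p' g. p ~= p' \<and> g ~= p \<and> g ~= p' \<and> lvl v u 2 = {p, p'} \<and> N x = {v, p, p', g} \<and> d v g = 2
    \<and> W x v = insert g (W v u - {v}) \<and> g \<notin> W v u"
proof -
  have RZ: "R = Z" unfolding R_def using Zr by auto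
  have "card R = 2" using RZ Zr by simp
  then have "card (lvl v u 2) = 2" using card_lvl2 by simp
  then obtain p p' where p: "lvl v u 2 = {p, p'}" "p ~= p'" by (meson card_2_iff)
  obtain g where g: "W x v = insert g (W v u - {v})" "g \<notin> W v u" using slim_extra[OF slim] by blast
  have sub: "lvl x v 1 \<subseteq> {g, p, p'}"
  proof
    fix z assume z: "z \<in> lvl x v 1"
    then have "z \<in> insert g (W v u)" "d v z = 2" using g lvl_sub_W[of x v 1] by (auto simp: mem_lvl)
    then show "z \<in> {g, p, p'}" using W_le(2)[OF s(2), of z] p(1) by (auto simp: set_eq_iff mem_lvl)
  qed
  have c3: "card (lvl x v 1) = 3" using card_lvl_xv \<open>card R = 2\<close> by simp
  have "card {g, p, p'} \<le> 3" by (simp add: card_insert_if)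
  then have L: "lvl x v 1 = {g, p, p'}" using card_seteq[OF _ sub] c3 by simp
  then have "g ~= p" "g ~= p'" using c3 p(2) by (auto simp: card_insert_if split: if_splits)
  moreover have "com x v = {}"
  proof -
    have False if z: "z \<in> com x v" for z
    proof -
      have xz: "adj x z" and "z \<in> N v" using z by (auto simp: mem_com mem_N)
      have "adj z x" using adj_sym[OF xz] .
      have "z = u \<or> z = x \<or> z \<in> Z" using \<open>z \<in> N v\<close> s(10) unfolding Z_def by blast
      moreover have "z \<notin> Z" using \<open>adj z x\<close> Zr by auto
      moreover have "z ~= x" using \<open>adj z x\<close> by auto
      moreover have "z ~= u" using \<open>adj z x\<close> s(4) by auto
      ultimately show False by blast
    qed
    then show ?thesis by blast
  qed
  then have "N x = {v, p, p', g}" using N_split[OF adj_sym[OF s(3)]] L by auto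
  moreover have "d v g = 2" using L by (auto simp: set_eq_iff mem_lvl)
  ultimately show ?thesis using p g by blast
qed

lemma no_clique: assumes Q0: "Q = {}" and cl: "\<And>a b. a \<in> Z ==> b \<in> Z ==> a ~= b ==> adj a b" shows False
proof -
  define C where "C = insert u (insert v Z)"
  have finC: "finite C" unfolding C_def using finZ by simp
  have "u ~= v" "u \<notin> Z" "v \<notin> Z" using s(1) Z_neq by (auto dest: adj_neq)
  then have cC: "card C = k" unfolding C_def using finZ cardZ by simp
  have adjC: "adj a b" if "a \<in> C" "b \<in> C" "a ~= b" for a b
    using that cl[of a b] s(1,2) ZD unfolding C_def by blast
  have ex: "\<exists>t. N c = insert t (C - {c}) \<and> t \<notin> C" if c: "c \<in> C" for c
  proof -
    have sub: "C - {c} \<subseteq> N c"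
    proof
      fix b assume "b \<in> C - {c}"
      then show "b \<in> N c" using adjC[OF c, of b] by (auto simp: mem_N)
    qed
    obtain e where "e \<in> C" "e ~= c" using \<open>u ~= v\<close> unfolding C_def by blast
    then have "card (N c) = k" using adjC[OF c] card_N by metis
    moreover have "card (C - {c}) = k - 1" using cC c by simp
    ultimately have "card (N c - (C - {c})) = 1" using card_Diff_subset[OF _ sub] finC k3 by simp
    then obtain t where t: "N c - (C - {c}) = {t}" by (rule card_1_singletonE)
    moreover have "c \<notin> N c" by (simp add: mem)
    ultimately have "t \<notin> C" by auto
    then show ?thesis using t sub by blast
  qed
  define h where "h c = (SOME t. N c = insert t (C - {c}) \<and> t \<notin> C)" for c
  have h: "N c = insert (h c) (C - {c}) \<and> h c \<notin> C" if "c \<in> C" for c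
    unfolding h_def by (rule someI_ex) (rule ex[OF that])
  interpret clique d k D C h using finC cC k3 h by unfold_locales auto
  show False using no_ecc[of u v w] \<open>u ~= v\<close> ecc D3 unfolding C_def by simp
qed

end

locale diamond = slim_end +
  fixes r1 r2 p p' g
  assumes Zr: "Z = {r1, r2}" "r1 ~= r2" "\<not> adj r1 r2" "\<not> adj r1 x" "\<not> adj r2 x"
    and pp: "lvl v u 2 = {p, p'}" "p ~= p'" and Nx: "N x = {v, p, p', g}"
    and gp: "g ~= p" "g ~= p'" "d v g = 2" "W x v = insert g (W v u - {v})" "g \<notin> W v u"
begin

lemma k4: "k = 4" using cardZ Zr by simp
lemma Nuv: "N u = {v, y, r1, r2}" "N v = {u, x, r1, r2}" using s(9,10) Zr unfolding Z_def by auto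

lemma r_props: assumes "r \<in> {r1, r2}"
  shows "adj u r" "adj v r" "\<not> adj r x" "\<not> adj r y" "r ~= x" "r ~= y" "r ~= u" "r ~= v" "adj r u" "adj r v"
proof -
  have rZ: "r \<in> Z" using assms Zr by simp
  show rx: "\<not> adj r x" using assms Zr by auto
  then have "r \<in> R" using rZ unfolding R_def by simp
  then show "\<not> adj r y" by (rule R_y)
  show "adj u r" "adj v r" "adj r u" "adj r v" using ZD[OF rZ] by auto
  show "r ~= x" "r ~= y" "r ~= u" "r ~= v" using Z_neq[OF rZ] by auto
qed

lemma r_single: assumes r: "r \<in> {r1, r2}" and e: "ecc u r w'" and ab: "a \<in> lvl r u i" "b \<in> lvl r u i" "i < D" "i ~= 1"
  shows "a = b"
proof -
  note R = r_props[OF r]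
  obtain r' where r': "r' \<in> {r1, r2}" "r' ~= r" "\<not> adj r r'" using r Zr(2,3) adj_sym[of r2 r1] by blast
  note R' = r_props[OF r'(1)]
  have "d r y = 2" using dist_two[OF R(1) s(5)] R by simp
  moreover have "d r r' = 2" using dist_two[OF R(1) R'(1)] r' by simp
  ultimately have sub: "{y, r'} \<subseteq> lvl u r 1" using s(5) R'(1) by (simp add: mem)
  have "2 \<le> card (lvl u r 1)" using card_mono[OF finite_lvl[OF R(1)] sub] R' by simp
  then have "card (lvl r u 1) = 2" using card_lvl1_commute[OF R(1)] ecc_card_lvl1[OF e] by simp
  then show ?thesis using ecc_unique[OF e _ _ ab(3,4,1,2)] D3 by simp
qed

lemma v_single: assumes "ecc u v w'" "a \<in> lvl v u i" "b \<in> lvl v u i" "i < D" "i ~= 2" shows "a = b"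
  using ecc_unique[OF assms(1) _ _ assms(4,5,2,3)] pp D3 by simp

lemma nbr: assumes e: "ecc u v w'" and z: "adj w' z"
  shows "z \<in> lvl v u (D - 1) \<and> z ~= w' \<or> z \<in> lvl v u (D - 2) \<or> D = 3 \<and> z = g
    \<or> (\<exists>r\<in>{r1, r2}. ecc u r w' \<and> z \<in> lvl r u (D - 2) \<and> d v z = D - 1)"
proof -
  note e' = eccD[OF e]
  have "w' \<in> W v u" using e' by (simp add: mem)
  moreover have "w' ~= v" using e' D3 by auto
  ultimately have xw: "Suc (d x w') = d v w'" using slim_via[OF slim] by blast
  have vz: "d v z \<le> Suc (d v w')" "d v w' \<le> Suc (d v z)" "d u w' \<le> Suc (d u z)" "d x z \<le> Suc (d x w')"
    using adj_le2[OF z, of v] adj_le2'[OF z, of v] adj_le2[OF z, of u] adj_le2'[OF z, of x] by auto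
  have uz: "d u z \<le> Suc (d v z)" using adj_le[OF s(1)] .
  have lt: "d v z < D"
  proof (rule ccontr)
    assume n: "\<not> ?thesis"
    then have "z \<in> W x v" using vz xw e' by (simp add: mem)
    moreover have "z ~= g" using n gp D3 by auto
    ultimately have "z \<in> W v u" using gp by blast
    then show False using W_le(1)[OF s(2)] n by blast
  qed
  show ?thesis
  proof (cases "d u z = Suc (d v z)")
    case True
    then have "z \<in> lvl v u (d v z)" by (simp add: mem)
    moreover have "d v z = D - 1 \<or> d v z = D - 2" using vz lt e' by linarith
    moreover have "z ~= w'" using z by auto
    ultimately show ?thesis by auto
  next
    case False
    then have eq: "d u z = D - 1" "d v z = D - 1" using uz vz lt e' by linarith+
    show ?thesis
    proof (cases "d x z < d v z")
      case True
      then have "z \<in> W x v" by (simp add: mem)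
      moreover have "z \<notin> W v u" using eq by (simp add: mem)
      ultimately have "z = g" using gp by blast
      then show ?thesis using gp eq by auto
    next
      case xz: False
      have "d v z = Suc (D - 2)" "D - 2 < D" using eq D3 by linarith+
      then obtain t where t: "adj v t" "d t z = D - 2" by (rule step)
      have "t \<in> {u, x, r1, r2}" using t(1) Nuv by (simp add: mem_N[symmetric])
      moreover have "t ~= u" "t ~= x" using t eq xz D3 by auto
      ultimately have r: "t \<in> {r1, r2}" by blast
      note R = r_props[OF r]
      have "d t w' \<le> Suc (D - 2)" using adj_le2[OF z, of t] t by simp
      moreover have "d u w' \<le> Suc (d t w')" using adj_le[OF R(1)] .
      ultimately have "ecc u t w'" using e' R D3 unfolding ecc_def by simp
      moreover have "z \<in> lvl t u (D - 2)" using t eq D3 by (simp add: mem)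
      ultimately show ?thesis using r eq by blast
    qed
  qed
qed

lemma card_N4: "ecc u v w' ==> card (N w') = 4"
proof -
  assume e: "ecc u v w'"
  note e' = eccD[OF e]
  have "d w' v = Suc (D - 2)" "Suc (D - 2) \<le> D" using e' D3 d_sym[of w' v] by linarith+
  from d_step[OF this] show ?thesis using card_N k4 by blast
qed

lemma D_le_4: "D \<le> 4"
proof (rule ccontr)
  assume "\<not> ?thesis"
  then have D5: "5 \<le> D" by simp
  note e' = eccD[OF ecc]
  have wl: "w \<in> lvl v u (D - 1)" using e' by (auto simp: mem)
  have one: "\<exists>a. A \<subseteq> {a}" if "\<And>a b. a \<in> A ==> b \<in> A ==> a = b" for A :: "'a set" using that by blast
  obtain a where a: "lvl v u (D - 2) \<subseteq> {a}" using one[of "lvl v u (D - 2)"] v_single[OF ecc, of _ "D - 2"] D5 by fastforce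
  define E where "E r = (if ecc u r w then lvl r u (D - 2) else {})" for r
  have E1: "\<exists>b. E r \<subseteq> {b}" if "r \<in> {r1, r2}" for r
  proof (rule one)
    fix a b assume "a \<in> E r" "b \<in> E r"
    then have "ecc u r w" "a \<in> lvl r u (D - 2)" "b \<in> lvl r u (D - 2)" unfolding E_def by (auto split: if_splits)
    then show "a = b" using r_single[OF that, of w a "D - 2" b] D5 by simp
  qed
  obtain b where b: "E r1 \<subseteq> {b}" using E1[of r1] by blast
  obtain c where c: "E r2 \<subseteq> {c}" using E1[of r2] by blast
  have "N w \<subseteq> {a, b, c}"
  proof
    fix z assume "z \<in> N w"
    then have "adj w z" by (simp add: mem)
    from nbr[OF ecc this] consider "z \<in> lvl v u (D - 1)" "z ~= w" | "z \<in> lvl v u (D - 2)" | "z \<in> E r1" | "z \<in> E r2"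
      using D5 unfolding E_def by auto
    then show "z \<in> {a, b, c}"
    proof cases
      case 1
      then show ?thesis using v_single[OF ecc 1(1) wl] D5 by simp
    qed (use a b c in blast)+
  qed
  moreover have "card {a, b, c} \<le> 3" by (simp add: card_insert_if)
  ultimately show False using card_mono[of "{a, b, c}" "N w"] card_N4[OF ecc] by simp
qed

lemma D_not_4: "D ~= 4"
proof
  assume D4: "D = 4"
  note e' = eccD[OF ecc]
  have wl: "w \<in> lvl v u 3" using e' D4 by (auto simp: mem)
  have one: "\<exists>a. A \<subseteq> {a}" if "\<And>a b. a \<in> A ==> b \<in> A ==> a = b" for A :: "'a set" using that by blast
  define E where "E r = (if ecc u r w then {z \<in> lvl r u 2. d v z = 3} else {})" for r
  have E1: "\<exists>b. E r \<subseteq> {b}" if "r \<in> {r1, r2}" for r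
  proof (rule one)
    fix a b assume "a \<in> E r" "b \<in> E r"
    then have "ecc u r w" "a \<in> lvl r u 2" "b \<in> lvl r u 2" unfolding E_def by (auto split: if_splits)
    then show "a = b" using r_single[OF that, of w a 2 b] D4 by simp
  qed
  have sub: "N w \<subseteq> {p, p'} \<union> E r1 \<union> E r2"
  proof
    fix z assume "z \<in> N w"
    then have "adj w z" by (simp add: mem)
    from nbr[OF ecc this] consider "z \<in> lvl v u 3" "z ~= w" | "z \<in> lvl v u 2" | "z \<in> E r1" | "z \<in> E r2"
      using D4 unfolding E_def by auto
    then show "z \<in> {p, p'} \<union> E r1 \<union> E r2"
    proof cases
      case 1
      then show ?thesis using v_single[OF ecc 1(1) wl] D4 by simp
    qed (use pp in blast)+
  qed
  obtain b where b: "E r1 \<subseteq> {b}" using E1[of r1] by blast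
  obtain c where c: "E r2 \<subseteq> {c}" using E1[of r2] by blast
  have ne: "E r ~= {}" if r: "r \<in> {r1, r2}" for r
  proof
    assume "E r = {}"
    then have "\<exists>a. N w \<subseteq> {p, p', a}" using sub b c r by blast
    then obtain a where "N w \<subseteq> {p, p', a}" by blast
    moreover have "card {p, p', a} \<le> 3" by (simp add: card_insert_if)
    ultimately show False using card_mono[of "{p, p', a}" "N w"] card_N4[OF ecc] by simp
  qed
  have "N w \<subseteq> {p, p', b, c}" using sub b c by blast
  moreover have "card {p, p', b, c} \<le> 4" by (simp add: card_insert_if)
  ultimately have "N w = {p, p', b, c}" using card_seteq[of "{p, p', b, c}" "N w"] card_N4[OF ecc] by simp
  then have pin: "adj w p" "adj w p'" unfolding mem_N[symmetric] by auto
  have pd: "d v t = 2" "d u t = 3" "adj x t" if "t \<in> {p, p'}" for t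
  proof -
    have "t \<in> lvl v u 2" using that pp by simp
    then show "d v t = 2" "d u t = 3" "adj x t" using lvl2_adj by (auto simp: mem_lvl)
  qed
  have far: "d r t ~= 2" if r: "r \<in> {r1, r2}" and t: "t \<in> {p, p'}" for r t
  proof
    assume "d r t = 2"
    then have tl: "t \<in> lvl r u 2" using pd[OF t] by (simp add: mem)
    obtain a where "a \<in> E r" using ne[OF r] by blast
    then have a: "ecc u r w" "a \<in> lvl r u 2" "d v a = 3" unfolding E_def by (auto split: if_splits)
    have "t = a" using r_single[OF r a(1) tl a(2)] D4 by simp
    then show False using a(3) pd[OF t] by simp
  qed
  have Nt: "N t = {x, w, p, p', g} - {t}" if t: "t \<in> {p, p'}" for t
  proof -
    note T = pd[OF t]
    have nr: "\<not> adj r z" if "r \<in> {r1, r2}" "adj t z" for r z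
    proof
      assume "adj r z"
      then have "d r t \<le> 2" using adj_le2'[OF adj_sym[OF that(2)], of r] by simp
      moreover have "3 \<le> Suc (d r t)" using adj_le[OF r_props(1)[OF that(1)], of t] T by simp
      ultimately show False using far[OF that(1) t] by linarith
    qed
    have "N t \<subseteq> {x, w, p, p', g} - {t}"
    proof
      fix z assume "z \<in> N t"
      then have z: "adj t z" by (simp add: mem)
      have zt: "z ~= t" using z by auto
      have vz: "d v z \<le> 3" "2 \<le> Suc (d v z)" "d x z \<le> 2" "3 \<le> Suc (d u z)"
        using adj_le2[OF z, of v] adj_le2'[OF z, of v] adj_le2'[OF z, of x] adj_le2[OF z, of u] T by auto
      consider "d v z = 1" | "d v z = 2" | "d v z = 3" using vz by linarith
      then have "z \<in> {x, w, p, p', g}"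
      proof cases
        case 1
        then have "z \<in> {u, x, r1, r2}" using Nuv(2) by (simp add: mem_N[symmetric])
        moreover have "z ~= u" using vz(4) by auto
        moreover have "z ~= r" if "r \<in> {r1, r2}" for r
        proof
          assume "z = r"
          then have "d u t \<le> 2" using adj_le[OF r_props(1)[OF that], of t] adj_sym[OF z] by simp
          then show False using T by simp
        qed
        ultimately show ?thesis by blast
      next
        case 2
        consider "d u z = 3" | "d u z = 2" using adj_le[OF s(1), of z] vz(4) 2 by linarith
        then show ?thesis
        proof cases
          case 1
          then have "z \<in> lvl v u 2" using 2 by (simp add: mem)
          then show ?thesis using pp by auto
        next
          case u2: 2
          have "z \<notin> W v u" using 2 u2 by (simp add: mem)
          show ?thesis
          proof (cases "d x z < d v z")
            case True
            then have "z \<in> W x v" by (simp add: mem)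
            then show ?thesis using gp \<open>z \<notin> W v u\<close> by blast
          next
            case False
            have "d v z = Suc 1" "1 < D" using 2 D3 by auto
            then obtain e where e: "adj v e" "adj e z" by (rule step)
            then have "e \<in> {u, x, r1, r2}" using Nuv(2) by (simp add: mem_N[symmetric])
            moreover have "e ~= u" "e ~= x" using e u2 2 False by auto
            ultimately show ?thesis using nr[OF _ z] e by blast
          qed
        qed
      next
        case 3
        then have "z \<in> W x v" using vz by (simp add: mem)
        moreover have "z ~= g" using 3 gp by auto
        ultimately have zW: "z \<in> W v u" using gp by blast
        then have "z \<in> lvl v u 3" using W_le(2)[OF s(2) zW] 3 by (simp add: mem)
        then show ?thesis using v_single[OF ecc _ wl] D4 by simp
      qed
      then show "z \<in> {x, w, p, p', g} - {t}" using zt by blast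
    qed
    moreover have "card ({x, w, p, p', g} - {t}) \<le> 4"
    proof -
      have "card {x, w, p, p', g} \<le> 5" by (simp add: card_insert_if)
      moreover have "t \<in> {x, w, p, p', g}" using t by blast
      ultimately show ?thesis using card_Diff_singleton[of t "{x, w, p, p', g}"] by linarith
    qed
    moreover have "card (N t) = 4" using card_N[OF adj_sym[OF T(3)]] k4 by simp
    ultimately show ?thesis using card_seteq[of "{x, w, p, p', g} - {t}" "N t"] by simp
  qed
  have "adj p p'" using Nt[of p] pp(2) unfolding mem_N[symmetric] by simp
  then obtain z where "z \<in> N p" "z ~= p'" "z \<notin> N p'" using no_twins unfolding mem_N by blast
  then show False using Nt[of p] Nt[of p'] by auto
qed

lemma D_eq_3: "D = 3" using D_le_4 D_not_4 D3 by linarith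

lemma p_ecc: assumes "t \<in> {p, p'}" shows "d v t = 2" "d u t = 3" "ecc u v t" "adj x t"
proof -
  have "t \<in> lvl v u 2" using assms pp by simp
  then show "d v t = 2" "d u t = 3" "adj x t" using lvl2_adj by (auto simp: mem_lvl)
  then show "ecc u v t" using D_eq_3 s(1) unfolding ecc_def by simp
qed

lemma p_nbr: assumes t: "t \<in> {p, p'}" and z: "z \<in> N t"
  shows "z \<in> {x, p, p', g} - {t} \<or> (\<exists>r\<in>{r1, r2}. d r t = 2 \<and> z \<in> N r)"
proof -
  have tz: "adj t z" using z by (simp add: mem)
  have D2: "D - 1 = 2" "D - 2 = 1" using D_eq_3 by auto
  consider "z \<in> lvl v u 2" | "z \<in> lvl v u 1" | "z = g" | r where "r \<in> {r1, r2}" "ecc u r t" "z \<in> lvl r u 1"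
    using nbr[OF p_ecc(3)[OF t] tz] unfolding D2 by blast
  then show ?thesis
  proof cases
    case 1
    then show ?thesis using pp tz by auto
  next
    case 2
    then show ?thesis using s(8) tz by auto
  next
    case 3
    then show ?thesis using tz by auto
  next
    case 4
    then have "d r t = 2" "z \<in> N r" using eccD(4)[OF 4(2)] D_eq_3 by (auto simp: mem)
    then show ?thesis using 4(1) by blast
  qed
qed

lemma p_near_r: assumes t: "t \<in> {p, p'}" shows "\<exists>r\<in>{r1, r2}. d r t = 2"
proof (rule ccontr)
  assume "\<not> ?thesis"
  then have "N t \<subseteq> {x, p, p', g} - {t}" using p_nbr[OF t] by blast
  moreover have "card ({x, p, p', g} - {t}) \<le> 3"
  proof -
    have "card {x, p, p', g} \<le> 4" by (simp add: card_insert_if)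
    moreover have "t \<in> {x, p, p', g}" using t by blast
    ultimately show ?thesis using card_Diff_singleton[of t "{x, p, p', g}"] by linarith
  qed
  ultimately have "card (N t) \<le> 3" using card_mono[of "{x, p, p', g} - {t}" "N t"] by simp
  then show False using card_N4[OF p_ecc(3)[OF t]] by simp
qed

lemma r_near_one: assumes r: "r \<in> {r1, r2}" shows "\<not> (d r p = 2 \<and> d r p' = 2)"
proof
  assume a: "d r p = 2 \<and> d r p' = 2"
  then have "ecc u r p" using r_props(1)[OF r] p_ecc(2)[of p] D_eq_3 unfolding ecc_def by simp
  moreover have "p \<in> lvl r u 2" "p' \<in> lvl r u 2" using a p_ecc(2) by (auto simp: mem_lvl)
  ultimately show False using r_single[OF r, of p p 2 p'] pp(2) D_eq_3 by simp
qed

lemma x_two: "d v z = 2 ==> d x z \<le> 2"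
proof (rule ccontr)
  assume z: "d v z = 2" and n: "\<not> d x z \<le> 2"
  then have zW: "z \<in> W v x" by (simp add: mem)
  have "d x r = 2" if "r \<in> {r1, r2}" for r
    using dist_two[OF s(3) r_props(2)[OF that]] r_props[OF that] adj_sym[of x r] by auto
  then have "r \<in> W v x" if "r \<in> {r1, r2}" for r using r_props(2)[OF that] that by (simp add: mem_W)
  moreover have "u \<in> W v x" using s(2,4) d_sym[of x u] by (simp add: mem_W)
  moreover have "v \<in> W v x" using adj_neq[OF s(3)] by (simp add: mem_W)
  ultimately have "{u, v, r1, r2} \<subseteq> W v x" by blast
  then have sub: "{z, u, v, r1, r2} \<subseteq> W v x" using zW by simp
  have "z \<notin> {u, v, r1, r2}" using z s(2) r_props(2)[of r1] r_props(2)[of r2] by auto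
  moreover have "card {u, v, r1, r2} = 4"
    using Zr(2) r_props(7,8)[of r1] r_props(7,8)[of r2] adj_neq[OF s(1)] by auto
  ultimately have "card {z, u, v, r1, r2} = 5" by simp
  then show False using card_mono[OF finite_W[OF s(3)] sub] card_W[OF s(3)] D_eq_3 by simp
qed

text \<open>Each of the two far vertices is close to exactly one of \<open>r1\<close>, \<open>r2\<close>.\<close>
lemma split_r: "\<exists>s1 s2. {s1, s2} = {r1, r2} \<and> d s1 p = 2 \<and> d s2 p' = 2 \<and> d s1 p' = 3 \<and> d s2 p = 3"
proof -
  have three: "d r t = 3" if "r \<in> {r1, r2}" "t \<in> {p, p'}" "d r t ~= 2" for r t
  proof -
    have "3 \<le> Suc (d r t)" using adj_le[OF r_props(1)[OF that(1)], of t] p_ecc[OF that(2)] by simp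
    moreover have "d r t \<le> Suc (d v t)" using adj_le[OF r_props(10)[OF that(1)]] .
    ultimately show ?thesis using that(3) p_ecc[OF that(2)] by linarith
  qed
  obtain a b where ab: "a \<in> {r1, r2}" "d a p = 2" "b \<in> {r1, r2}" "d b p' = 2" using p_near_r[of p] p_near_r[of p'] by blast
  have "d a p' ~= 2" "d b p ~= 2" using r_near_one ab by blast+
  moreover have "a ~= b" using calculation ab by auto
  then have "{a, b} = {r1, r2}" using ab by blast
  ultimately show ?thesis using ab three[of a p'] three[of b p] by blast
qed

lemma N_r: assumes "r \<in> {r1, r2}" shows "\<exists>a b. N r = {u, v, a, b}"
proof -
  note R = r_props[OF assms]
  have uv: "{u, v} \<subseteq> N r" using R by (auto simp: mem)
  have "u ~= v" using s(1) by auto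
  then have "card (N r - {u, v}) = 2" using card_N[OF R(9)] k4 uv by (simp add: card_Diff_subset)
  then obtain a b where "N r - {u, v} = {a, b}" by (meson card_2_iff)
  then show ?thesis using uv by blast
qed

lemma mirror_ecc: "\<exists>q. ecc v u q"
proof -
  have uy: "adj u y" "adj y u" using s(5) adj_sym by auto
  have "com y u = {}"
  proof -
    have False if z: "z \<in> com y u" for z
    proof -
      have yz: "adj y z" "z \<in> N u" using z by (auto simp: mem_com mem_N)
      have "adj z y" using adj_sym[OF yz(1)] .
      then show False using yz Nuv(1) r_props(4) s(6) by auto
    qed
    then show ?thesis by blast
  qed
  then have c3: "card (lvl y u 1) = 3" using card_split[OF uy(2)] k4 by simp
  obtain h where h: "W y u = insert h (W u v - {u})" using slim_extra[OF slim_sym[OF slim]] by blast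
  have "\<not> lvl y u 1 \<subseteq> {h}"
  proof
    assume "lvl y u 1 \<subseteq> {h}"
    then show False using card_mono[of "{h}" "lvl y u 1"] c3 by simp
  qed
  then obtain q where q: "q \<in> lvl y u 1" "q ~= h" by blast
  then have "q \<in> W u v" using h lvl_sub_W[of y u 1] by blast
  then have "d v q = Suc (d u q)" by (rule W_le(2)[OF s(1)])
  then show ?thesis using q(1) D_eq_3 s(2) unfolding ecc_def by (auto simp: mem_lvl)
qed

lemma impossible: False
proof -
  obtain w' where "ecc v u w'" using mirror_ecc by blast
  then interpret M: slim_end d k D v u w' y x using slim_sym[OF slim] D3 by unfold_locales
  have MZ: "M.Z = {r1, r2}" using Zr com_commute[of u v] unfolding M.Z_def Z_def by simp
  have "\<not> adj r1 y" "\<not> adj r2 y" using r_props by auto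
  from M.diamond_exists[OF MZ Zr(2) this]
  obtain q q' g' where Q: "q ~= q'" "g' ~= q" "g' ~= q'" "lvl u v 2 = {q, q'}" "N y = {u, q, q', g'}" "d u g' = 2"
    "W y u = insert g' (W u v - {u})" "g' \<notin> W u v" by metis
  interpret M: diamond d k D v u w' y x r1 r2 q q' g'
    using MZ Zr Q \<open>\<not> adj r1 y\<close> \<open>\<not> adj r2 y\<close> by unfold_locales auto
  obtain s1 s2 where S: "{s1, s2} = {r1, r2}" "d s1 p = 2" "d s2 p' = 2" "d s1 p' = 3" "d s2 p = 3" using split_r by blast
  obtain t1 t2 where T: "{t1, t2} = {r1, r2}" "d t1 q = 2" "d t2 q' = 2" "d t1 q' = 3" "d t2 q = 3" using M.split_r by blast
  have sr: "s1 \<in> {r1, r2}" "s2 \<in> {r1, r2}" "s1 ~= s2" using S(1) Zr(2) by auto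
  obtain a a' where A: "N s1 = {u, v, a, a'}" using N_r[OF sr(1)] by blast
  obtain b b' where B: "N s2 = {u, v, b, b'}" using N_r[OF sr(2)] by blast
  have rr: "{r1, r2} = {s1, s2}" using S(1) by simp
  have ns: "\<not> adj s1 s2" "\<not> adj s2 s1" using S(1) Zr(2,3) adj_sym by (metis doubleton_eq_iff)+
  have N1: "N p \<subseteq> {x, p', g} \<union> N s1" "N p' \<subseteq> {x, p, g} \<union> N s2"
    using p_nbr[of p] p_nbr[of p'] S(2-5) unfolding rr by fastforce+
  have core: "diamond_core d k D u v x y s1 s2 p p' g f f' g' a a' b b'"
    if f: "{f, f'} = {q, q'}" "d s1 f = 2" "d s1 f' = 3" "d s2 f' = 2" "d s2 f = 3" for f f'
  proof
    have fq: "f \<in> {q, q'}" "f' \<in> {q, q'}" using f(1) by auto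
    show "D = 3" "k = 4" using D_eq_3 k4 by auto
    show "N u = {v, y, s1, s2}" "N v = {u, x, s1, s2}" using Nuv rr by auto
    show "N x = {v, p, p', g}" "N y = {u, f, f', g'}" using Nx Q(5) f(1) by auto
    show "N s1 = {u, v, a, a'}" "N s2 = {u, v, b, b'}" using A B by auto
    show "d v p = 2" "d v p' = 2" "d u p = 3" "d u p' = 3" using p_ecc by auto
    show "d u f = 2" "d u f' = 2" "d v f = 3" "d v f' = 3" using M.p_ecc fq by auto
    show "d v g = 2" "d u g' = 2" using gp Q by auto
    show "N p \<subseteq> {x, p', g} \<union> N s1" "N p' \<subseteq> {x, p, g} \<union> N s2" by (fact N1)+
    show "N f \<subseteq> {y, f', g'} \<union> N s1"
    proof
      fix z assume "z \<in> N f"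
      from M.p_nbr[OF fq(1) this] consider "z \<in> {y, q, q', g'} - {f}" | r where "r \<in> {s1, s2}" "d r f = 2" "z \<in> N r"
        unfolding rr by blast
      then show "z \<in> {y, f', g'} \<union> N s1"
      proof cases
        case 1
        then show ?thesis using f(1) by auto
      next
        case 2
        then show ?thesis using f(2-5) by auto
      qed
    qed
    show "N f' \<subseteq> {y, f, g'} \<union> N s2"
    proof
      fix z assume "z \<in> N f'"
      from M.p_nbr[OF fq(2) this] consider "z \<in> {y, q, q', g'} - {f'}" | r where "r \<in> {s1, s2}" "d r f' = 2" "z \<in> N r"
        unfolding rr by blast
      then show "z \<in> {y, f, g'} \<union> N s2"
      proof cases
        case 1
        then show ?thesis using f(1) by auto
      next
        case 2
        then show ?thesis using f(2-5) by auto
      qed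
    qed
    show "d u x = 2" "d v y = 2" using s by auto
    show "\<not> adj s1 x" "\<not> adj s2 x" "\<not> adj s1 y" "\<not> adj s2 y" using r_props sr by auto
  qed (use S f ns x_two M.x_two in auto)
  show False
  proof (cases "t1 = s1")
    case True
    then have "t2 = s2" using S(1) T(1) Zr(2) by (metis doubleton_eq_iff)
    then show False using diamond_core.impossible[OF core[of q q']] T True by simp
  next
    case False
    then have "t1 = s2" "t2 = s1" using S(1) T(1) Zr(2) by (metis doubleton_eq_iff)+
    then show False using diamond_core.impossible[OF core[of q' q]] T by (simp add: insert_commute)
  qed
qed

end

section \<open>Vertices at maximal distance\<close>

context slim_end begin
theorem impossible: False
proof (rule cases)
  assume "Q = {}" "\<And>a b. a \<in> Z ==> b \<in> Z ==> a ~= b ==> adj a b"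
  then show False by (rule no_clique)
next
  fix r1 r2 assume r: "Z = {r1, r2}" "r1 ~= r2" "\<not> adj r1 r2" "\<not> adj r1 x" "\<not> adj r2 x"
  from diamond_exists[OF r(1,2,4,5)] obtain p p' g where
    "p ~= p'" "g ~= p" "g ~= p'" "lvl v u 2 = {p, p'}" "N x = {v, p, p', g}" "d v g = 2"
    "W x v = insert g (W v u - {v})" "g \<notin> W v u" by metis
  then interpret diamond d k D u v w x y r1 r2 p p' g using r by unfold_locales auto
  show False by (rule impossible)
next
  fix q r assume "Z = {q, r}" "q ~= r" "\<not> adj q r" "adj q x" "\<not> adj r x"
  then show False by (rule no_octa)
qed
end

context ndb begin

lemma ecc_lvl1: assumes D3: "3 \<le> D" and e: "ecc u v w" shows "card (lvl v u 1) = 2"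
proof (rule ccontr)
  assume "card (lvl v u 1) ~= 2"
  then have c: "card (lvl v u 1) = 1" using ecc_card_lvl1[OF e] by blast
  note e' = eccD[OF e]
  have "card (lvl u v 1) = 1" using card_lvl1_commute[OF e'(1)] c by simp
  then obtain y where "lvl u v 1 = {y}" by (rule card_1_singletonE)
  moreover obtain x where "lvl v u 1 = {x}" using c by (rule card_1_singletonE)
  ultimately have "slim u v y x" using e' unfolding slim_def by simp
  then interpret slim_end d k D u v w x y using e D3 by unfold_locales
  show False by (rule impossible)
qed

lemma ecc_com: "3 \<le> D ==> ecc u v w ==> card (com u v) + 3 = k"
  using ecc_lvl1[of u v w] card_split[of v u] eccD com_commute[of u v] by auto

lemma ecc_single: "3 \<le> D ==> ecc u v w ==> a \<in> lvl v u i ==> b \<in> lvl v u i ==> 2 \<le> i ==> i < D ==> a = b"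
  using ecc_unique[of u v w 1 i a b] ecc_lvl1[of u v w] by auto

end

locale ndb3 = ndb + assumes D3: "3 \<le> D"
begin

lemma ecc_far: assumes "ecc u v w" "d u w' = D" "Suc (d v w') = D" shows "w' = w"
proof -
  note e = eccD[OF assms(1)]
  have "w \<in> lvl v u (D - 1)" "w' \<in> lvl v u (D - 1)" using e assms(2,3) by (auto simp: mem)
  then show ?thesis using ecc_single[OF D3 assms(1)] D3 by simp
qed

lemma ecc_start: assumes "d u w = D" obtains v where "ecc u v w" "v \<in> N u"
proof -
  have "d u w = Suc (D - 1)" "D - 1 < D" using assms D3 by linarith+
  then obtain v where v: "adj u v" "d v w = D - 1" by (rule step)
  then have "ecc u v w" using assms D3 unfolding ecc_def by simp
  then show ?thesis using that v by (simp add: mem)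
qed

lemma far_adj: assumes "d u w = D" "adj u v" shows "d v w = D \<or> Suc (d v w) = D"
proof -
  have "d u w \<le> Suc (d v w)" "d v w \<le> Suc (d u w)" using adj_le[OF assms(2)] adj_le'[OF assms(2)] by auto
  then show ?thesis using assms(1) d_le_D[of v w] D3 by linarith
qed

lemma adj_far_unique:
  assumes w: "d u w = D" "d u w' = D" "adj w w'" and v: "ecc u v w" "ecc u v2 w" shows "v = v2"
proof -
  have *: "v \<in> lvl w w' (D - 1) \<and> ecc w' w v" if e: "ecc u v w" for v
  proof -
    note e' = eccD[OF e]
    have "Suc (d v w') ~= D" using ecc_far[OF e w(2)] w(3) by auto
    moreover have "d v w' = D \<or> Suc (d v w') = D" using far_adj[OF w(2) e'(1)] .
    ultimately have "d v w' = D" by blast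
    then show ?thesis using e' w(3) d_sym[of v w] d_sym[of v w'] adj_sym[OF w(3)] unfolding ecc_def mem_lvl by auto
  qed
  show ?thesis using ecc_single[OF D3, of w' w v v "D - 1" v2] *[OF v(1)] *[OF v(2)] D3 by simp
qed

text \<open>No two adjacent vertices are both at maximal distance from the same vertex.\<close>
lemma far_not_adj: assumes w: "d u w = D" "d u w' = D" shows "\<not> adj w w'"
proof
  assume a: "adj w w'"
  obtain v where v: "ecc u v w" "v \<in> N u" using ecc_start[OF w(1)] by blast
  note ev = eccD[OF v(1)]
  have k3: "3 \<le> k" using ecc_com[OF D3 v(1)] by simp
  have cu: "card (N u) = k" using card_N ev by blast
  have "\<not> N u \<subseteq> {v}"
  proof
    assume "N u \<subseteq> {v}"
    then show False using card_mono[of "{v}" "N u"] cu k3 by simp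
  qed
  then obtain z where z: "adj u z" "z ~= v" unfolding mem_N[symmetric] by blast
  have "Suc (d z w) ~= D" using adj_far_unique[OF w a v(1)] z w unfolding ecc_def by auto
  then have zw: "d z w = D" using far_adj[OF w(1) z(1)] by blast
  have uz: "d w u = D" "d w z = D" using w(1) zw d_sym[of w] by auto
  define S where "S w = insert w {t \<in> N w. d u t = D}" for w
  have cS: "card (S w) = k \<and> (\<forall>t. d u t = D --> t \<in> S w)"
    if w: "d u w = D" and z: "d w z = D" and uz: "adj u z" for w z
  proof -
    have wu: "d w u = D" using w d_sym[of w u] by simp
    obtain a where a: "ecc w a u" "a \<in> N w" using ecc_start[OF wu] by blast
    have "{t \<in> N w. d u t = D} = N w - {a}"
    proof -
      have "d u t = D \<longleftrightarrow> t ~= a" if t: "t \<in> N w" for t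
      proof
        show "t ~= a" if "d u t = D" using that eccD(4)[OF a(1)] d_sym[of u a] by auto
        assume "t ~= a"
        have wt: "adj w t" using t by (simp add: mem)
        have "Suc (d t u) ~= D"
          using adj_far_unique[OF wu z uz a(1), of t] \<open>t ~= a\<close> wt wu unfolding ecc_def by auto
        then show "d u t = D" using far_adj[OF wu wt] d_sym[of u t] by simp
      qed
      then show ?thesis using a(2) by blast
    qed
    then have "card {t \<in> N w. d u t = D} = k - 1" using a card_N[OF eccD(1)[OF a(1)]] by simp
    moreover have "w \<notin> {t \<in> N w. d u t = D}" by (simp add: mem)
    ultimately have c: "card (S w) = k" using k3 unfolding S_def by simp
    have far: "d u t = D" if "t \<in> S w" for t using that w unfolding S_def by auto
    have "\<exists>v. ecc u v t" if "d u t = D" for t using ecc_start[OF that] by blast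
    then obtain f where f: "\<And>t. d u t = D ==> ecc u (f t) t" by metis
    have inj: "t = t'" if "d u t = D" "d u t' = D" "f t = f t'" for t t'
      using ecc_far[OF f[OF that(2)] that(1)] f[OF that(1)] that(3) unfolding ecc_def by simp
    have fS: "f ` S w \<subseteq> N u" using f far unfolding ecc_def by (auto simp: mem)
    have "inj_on f (S w)" using inj far by (auto intro!: inj_onI)
    then have "card (f ` S w) = card (N u)" using c cu card_image by metis
    then have fN: "f ` S w = N u" using card_subset_eq[OF finite_N fS] by simp
    have "t \<in> S w" if t: "d u t = D" for t
    proof -
      have "f t \<in> N u" using f[OF t] unfolding ecc_def by (simp add: mem)
      then obtain s where "s \<in> S w" "f t = f s" using fN by auto
      then show ?thesis using inj[OF t far[of s]] by simp
    qed
    then show ?thesis using c by blast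
  qed
  have vw': "d v w' = D"
    using ecc_far[OF v(1) w(2)] a far_adj[OF w(2) ev(1)] by auto
  have w'v: "d w' u = D" "d w' v = D" using w(2) vw' d_sym[of w'] by auto
  have S1: "card (S w) = k" "\<And>t. d u t = D ==> t \<in> S w" using cS[OF w(1) uz(2) z(1)] by auto
  have S2: "\<And>t. d u t = D ==> t \<in> S w'" using cS[OF w(2) w'v(2) ev(1)] by blast
  have "S w - {w, w'} \<subseteq> com w w'"
  proof
    fix t assume t: "t \<in> S w - {w, w'}"
    then have "d u t = D" "t \<in> N w" unfolding S_def by auto
    moreover have "t \<in> N w'" using S2[OF \<open>d u t = D\<close>] t unfolding S_def by auto
    ultimately show "t \<in> com w w'" by (simp add: com_N)
  qed
  then have "card (S w - {w, w'}) \<le> card (com w w')" by (intro card_mono) auto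
  moreover have "{w, w'} \<subseteq> S w" "w ~= w'" using S1(2) w a by auto
  then have "card (S w - {w, w'}) = k - 2" using S1(1) by (simp add: card_Diff_subset)
  moreover have "ecc w' w v" using ev vw' adj_sym[OF a] d_sym[of w v] w'v unfolding ecc_def by simp
  then have "card (com w w') + 3 = k" using ecc_com[OF D3] com_commute by metis
  ultimately show False by simp
qed

lemma anti_all: assumes w: "d u w = D" and v: "adj u v" shows "ecc u v w"
proof -
  have "d v w ~= D" using far_not_adj[of w u v] w v d_sym[of w] by auto
  then show ?thesis using far_adj[OF w v] w v unfolding ecc_def by blast
qed

lemma anti_unique: assumes w: "d u w = D" "d u w' = D" shows "w = w'"
proof -
  obtain v where "ecc u v w" using ecc_start[OF w(1)] by blast
  then show ?thesis using ecc_far[of u v w w'] anti_all[OF w(2), of v] w unfolding ecc_def by auto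
qed

end

text \<open>
  Each neighbour of \<open>u\<close> is nearer to \<open>w\<close> than \<open>u\<close> is, and conversely; hence every edge at \<open>u\<close> begins a
  geodesic to \<open>w\<close> and has two vertices on level one and a single vertex on each higher level.
\<close>
locale anti = ndb3 + fixes u w assumes uw: "d u w = D"
begin

lemma wu: "d w u = D" using uw d_sym[of u w] by simp
lemma mirror: "anti d k D w u" using ndb3_axioms wu unfolding anti_def anti_axioms_def by simp

lemma ecc_u: "adj u v ==> ecc u v w" using anti_all[OF uw] .
lemma ecc_w: "adj w y ==> ecc w y u" using anti_all[OF wu] .

lemma k_com: "adj u v ==> card (com u v) + 3 = k" using ecc_com[OF D3 ecc_u] .
lemma lvl1: "adj u v ==> card (lvl v u 1) = 2" using ecc_lvl1[OF D3 ecc_u] .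

lemma single: "adj u v ==> a \<in> lvl v u i ==> b \<in> lvl v u i ==> 2 \<le> i ==> i < D ==> a = b"
  using ecc_single[OF D3 ecc_u] by blast

lemma exists_v: assumes "d u z = Suc i" "Suc i \<le> D" obtains v where "adj u v" "d v z = i" "z \<in> lvl v u i"
  using d_step[OF assms] that assms by (auto simp: mem)

lemma u_nonempty: obtains v where "adj u v"
proof -
  obtain v where "ecc u v w" using ecc_start[OF uw] by blast
  then show ?thesis using that unfolding ecc_def by blast
qed

text \<open>The neighbours of \<open>u\<close> and of \<open>w\<close> are matched by being at distance \<open>D - 2\<close>.\<close>
lemma below_w: assumes v: "adj u v" obtains y where "adj w y" "d v y = D - 2" "y \<in> lvl v u (D - 2)"
proof -
  have "D - 2 < D" using D3 by simp
  then obtain y where y: "y \<in> lvl v u (D - 2)" "d y w = D - Suc (D - 2)" using ecc_geodesic[OF ecc_u[OF v]] by blast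
  moreover have "D - Suc (D - 2) = 1" using D3 by simp
  ultimately show ?thesis using that[of y] adj_sym by (auto simp: mem)
qed

lemma lvl_w: "adj w y ==> Suc (d u y) = D" using eccD(4)[OF ecc_w[of y]] d_sym[of y u] by simp

lemma near_layer: assumes "4 \<le> D" "Suc (d u z) = D" shows "adj w z"
proof -
  have "d u z = Suc (D - 2)" "Suc (D - 2) \<le> D" using assms by linarith+
  then obtain v where v: "adj u v" "z \<in> lvl v u (D - 2)" by (rule exists_v)
  obtain y where y: "adj w y" "y \<in> lvl v u (D - 2)" using below_w[OF v(1)] by blast
  have "z = y" using single[OF v(1) v(2) y(2)] assms(1) by simp
  then show ?thesis using y by simp
qed

lemma match_unique: assumes D4: "4 \<le> D" and y: "adj w y" and v: "adj u v" "d v y = D - 2" "adj u v'" "d v' y = D - 2"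
  shows "v = v'"
proof -
  have "Suc (d v w) = D" "Suc (d v' w) = D" using eccD(4)[OF ecc_u] v by auto
  then have "v \<in> lvl y w (D - 2)" "v' \<in> lvl y w (D - 2)"
    using v d_sym[of y] d_sym[of w] D3 by (auto simp: mem)
  then show ?thesis using anti.single[OF mirror y] D4 by simp
qed

lemma down_nbrs: assumes D4: "4 \<le> D" and y: "adj w y" and v: "adj u v" "d v y = D - 2" and z: "z \<in> lvl y w 1"
  shows "z \<in> lvl v u (D - 3)"
proof -
  have z': "adj y z" "d w z = 2" using z by (auto simp: mem)
  have "d u z ~= D" using anti_unique[OF uw, of z] z' by auto
  moreover have "Suc (d u z) ~= D" using near_layer[OF D4] z' by auto
  moreover have "D \<le> d u z + 2" using d_tri[of u w z] uw z' d_sym[of z w] by simp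
  moreover have "d u z \<le> Suc (d u y)" using adj_le2'[OF z'(1)] .
  ultimately have uz: "d u z = D - 2" using lvl_w[OF y] by linarith
  have "d u z = Suc (D - 3)" "Suc (D - 3) \<le> D" using uz D4 by linarith+
  then obtain v' where v': "adj u v'" "z \<in> lvl v' u (D - 3)" by (rule exists_v)
  have d3: "d v' z = D - 3" using v'(2) by (simp add: mem)
  have "d v' y \<le> D - 2" using adj_le2[OF z'(1), of v'] d3 D4 by simp
  moreover have "d u y \<le> Suc (d v' y)" using adj_le[OF v'(1)] .
  ultimately have "d v' y = D - 2" using lvl_w[OF y] by linarith
  then have "v' = v" using match_unique[OF D4 y v'(1) _ v] by blast
  then show ?thesis using v' by simp
qed

lemma D_le_4: "D \<le> 4"
proof (rule ccontr)
  assume "\<not> D \<le> 4"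
  then have D5: "4 \<le> D" "2 \<le> D - 3" "D - 3 < D" by auto
  obtain v where v: "adj u v" by (rule u_nonempty)
  obtain y where y: "adj w y" "d v y = D - 2" using below_w[OF v] by blast
  obtain z1 z2 where z: "lvl y w 1 = {z1, z2}" "z1 ~= z2" using anti.lvl1[OF mirror y(1)] by (meson card_2_iff)
  have "z1 \<in> lvl v u (D - 3)" "z2 \<in> lvl v u (D - 3)" using down_nbrs[OF D5(1) y(1) v y(2)] z by auto
  then show False using single[OF v _ _ D5(2,3)] z by blast
qed

end

text \<open>The hypothetical case of diameter 4.\<close>
locale anti4 = anti + assumes D4: "D = 4"
begin

abbreviation "X v \<equiv> lvl v u 1"

lemma X_ex: assumes "adj u v" obtains y where "adj w y" "d v y = 2"
  using below_w[OF assms] D4 by auto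

lemma X_uniq: assumes v: "adj u v" and y: "adj w y" "d v y = 2" "adj w y'" "d v y' = 2" shows "y' = y"
proof -
  have "y \<in> lvl v u 2" "y' \<in> lvl v u 2" using y lvl_w[OF y(1)] lvl_w[OF y(3)] D4 by (auto simp: mem)
  then show ?thesis using single[OF v] D4 by simp
qed

lemma X_eq: assumes v: "adj u v" and y: "adj w y" "d v y = 2" shows "lvl y w 1 = X v"
proof -
  have "lvl y w 1 \<subseteq> X v" using down_nbrs[OF _ y(1) v] y(2) D4 by auto
  then show ?thesis
    using card_subset_eq[of "X v" "lvl y w 1"] anti.lvl1[OF mirror y(1)] lvl1[OF v] finite_lvl[OF adj_sym[OF v]] by simp
qed

lemma X_mem: assumes "x \<in> X v" shows "adj v x" "adj x v" "d u x = 2"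
proof -
  show "adj v x" "d u x = 2" using assms by (auto simp: mem)
  then show "adj x v" by (blast dest: adj_sym)
qed

lemma X_down: assumes v: "adj u v" "x \<in> X v" and v': "adj u v'" "adj v' x" shows "v' = v"
proof -
  obtain y where y: "adj w y" "d v y = 2" by (rule X_ex[OF v(1)])
  have "x \<in> lvl y w 1" using X_eq[OF v(1) y] v(2) by simp
  then have "adj y x" by (simp add: mem)
  then have "d v' y \<le> 2" using adj_le[OF v'(2), of y] adj_sym[of y x] by simp
  moreover have "d u y \<le> Suc (d v' y)" using adj_le[OF v'(1)] .
  ultimately have "d v' y = D - 2" using lvl_w[OF y(1)] D4 by linarith
  then show ?thesis using match_unique[OF _ y(1) v'(1) _ v(1)] y(2) D4 by simp
qed

lemma X_disj: "adj u v ==> adj u v' ==> x \<in> X v ==> x \<in> X v' ==> v = v'"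
  using X_down[of v' x v] X_mem(1)[of x v] by blast

lemma X_up: assumes v: "adj u v" "x \<in> X v" and y: "adj w y" "d v y = 2" and y': "adj w y'" "adj y' x" shows "y' = y"
proof -
  have "d v y' \<le> 2" using adj_le[OF X_mem(1)[OF v(2)], of y'] adj_sym[OF y'(2)] by simp
  moreover have "d u y' \<le> Suc (d v y')" using adj_le[OF v(1)] .
  ultimately have "d v y' = 2" using lvl_w[OF y'(1)] D4 by linarith
  then show ?thesis using X_uniq[OF v(1) y y'(1)] by simp
qed

text \<open>A vertex of \<open>X v\<close> has one neighbour below, one above and the others on the middle level.\<close>
definition "lat x = {z \<in> N x. d u z = 2}"

lemma N_X: assumes v: "adj u v" "x \<in> X v" and y: "adj w y" "d v y = 2"
  shows "N x = insert v (insert y (lat x))" "card (lat x) + 2 = k" "adj x y"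
proof -
  have "x \<in> lvl y w 1" using X_eq[OF v(1) y] v(2) by simp
  then have yx: "adj y x" by (simp add: mem)
  then show xy: "adj x y" by (rule adj_sym)
  have uy: "d u y = 3" using lvl_w[OF y(1)] D4 by simp
  note x = X_mem[OF v(2)]
  have "z \<in> insert v (insert y (lat x))" if z: "adj x z" for z
  proof -
    have "d u z \<le> 3" "2 \<le> Suc (d u z)" using adj_le2'[OF z, of u] adj_le2[OF z, of u] x by auto
    then consider "d u z = 1" | "d u z = 2" | "d u z = 3" by linarith
    then show ?thesis
    proof cases
      case 1 then show ?thesis using X_down[OF v 1 adj_sym[OF z]] by simp
    next
      case 2 then show ?thesis using z unfolding lat_def by (simp add: mem)
    next
      case 3
      have "adj w z" using near_layer[of z] 3 D4 by simp
      then show ?thesis using X_up[OF v y _ adj_sym[OF z]] by simp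
    qed
  qed
  then have "z \<in> N x \<longleftrightarrow> z \<in> insert v (insert y (lat x))" for z
    using x(2) xy unfolding lat_def mem_N[symmetric] by auto
  then show Nx: "N x = insert v (insert y (lat x))" by blast
  have "v \<notin> lat x" "y \<notin> lat x" "v ~= y" using v(1) uy unfolding lat_def by auto
  moreover have "finite (lat x)" unfolding lat_def by simp
  ultimately have "card (N x) = card (lat x) + 2" unfolding Nx by simp
  then show "card (lat x) + 2 = k" using card_N[OF x(2)] by simp
qed

lemma far3: assumes v: "adj u v" and y: "adj w y" "d v y = 2" and y': "adj w y'" "y' ~= y" shows "3 \<le> d v y'"
proof -
  have "d u y' \<le> Suc (d v y')" using adj_le[OF v] .
  moreover have "d v y' ~= 2" using X_uniq[OF v y y'(1)] y'(2) by blast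
  ultimately show ?thesis using lvl_w[OF y'(1)] D4 by linarith
qed

lemma bound_k: assumes v: "adj u v" and x: "x \<in> X v" shows "card (lat x - X v) + (k - 3) \<le> 2"
proof -
  obtain y where y: "adj w y" "d v y = 2" by (rule X_ex[OF v])
  note NX = N_X[OF v x y] and xm = X_mem[OF x]
  have uy: "d u y = 3" using lvl_w[OF y(1)] D4 by simp
  let ?L = "lat x - X v" and ?C = "com w y"
  have cC: "card ?C = k - 3" using anti.k_com[OF mirror y(1)] by simp
  have Lv: "d v t = 2 \<and> adj x t \<and> d u t = 2" if "t \<in> ?L" for t
  proof -
    have t: "adj x t" "d u t = 2" "t \<notin> X v" using that unfolding lat_def by (auto simp: mem_N)
    have "d v t \<le> 2" using adj_le[OF xm(1), of t] t by simp
    moreover have "d v t ~= 1" using t by (auto simp: mem)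
    moreover have "d v t ~= 0" using t v by auto
    ultimately show ?thesis using t by linarith
  qed
  have Cv: "d u t = 3 \<and> d x t \<le> 2 \<and> 3 \<le> d v t" if "t \<in> ?C" for t
  proof -
    have t: "adj w t" "adj y t" using that by (auto simp: mem)
    have "t ~= y" using t by auto
    then show ?thesis using far3[OF v y t(1)] lvl_w[OF t(1)] D4 adj_le[OF NX(3), of t] t by auto
  qed
  have xw: "x \<in> W x v" "y \<in> W x v" using xm NX(3) y by (auto simp: mem)
  have "d v w = 3" using eccD(4)[OF ecc_u[OF v]] D4 by simp
  moreover have "d x w \<le> 2" using adj_le[OF NX(3), of w] adj_sym[OF y(1)] by simp
  ultimately have wW: "w \<in> W x v" by (simp add: mem)
  have "?L \<subseteq> W x v" using Lv by (auto simp: mem_W)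
  moreover have "?C \<subseteq> W x v" using Cv by (fastforce simp: mem_W)
  ultimately have sub: "{x, y, w} \<union> (?L \<union> ?C) \<subseteq> W x v" using xw wW by simp
  have fin: "finite ?L" "finite ?C" unfolding lat_def by auto
  have "?L \<inter> ?C = {}" using Lv Cv by fastforce
  then have c1: "card (?L \<union> ?C) = card ?L + (k - 3)" using card_Un_disjoint[OF fin] cC by simp
  have "y ~= w" "x ~= y" "x ~= w" using xm uy uw D4 by auto
  then have c2: "card {x, y, w} = 3" by simp
  have "y \<notin> ?C" "w \<notin> ?C" by (auto simp: mem)
  moreover have "x \<notin> ?C" using Cv xm(3) by force
  moreover have "x \<notin> ?L" "y \<notin> ?L" "w \<notin> ?L" using Lv uy uw D4 by force+
  ultimately have "{x, y, w} \<inter> (?L \<union> ?C) = {}" by blast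
  then have "card ({x, y, w} \<union> (?L \<union> ?C)) = 3 + (card ?L + (k - 3))"
    using card_Un_disjoint[of "{x, y, w}" "?L \<union> ?C"] fin c1 c2 by simp
  then show ?thesis using card_mono[OF finite_W[OF xm(2)] sub] card_W[OF xm(2)] D4 by simp
qed

lemma far_if: "x ~= z ==> z \<notin> N x ==> N x \<inter> N z = {} ==> 3 \<le> d x z"
proof (rule ccontr)
  assume a: "x ~= z" "z \<notin> N x" "N x \<inter> N z = {}" "\<not> 3 \<le> d x z"
  have "d x z ~= 0" "d x z ~= 1" using a by (auto simp: mem_N)
  then have "d x z = Suc 1" "1 < D" using a(4) D3 by linarith+
  then obtain e where "adj x e" "adj e z" by (rule step)
  then have "e \<in> N x" "e \<in> N z" using adj_sym by (auto simp: mem_N)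
  then show False using a by blast
qed

lemma lat_sym: "z \<in> lat x ==> d u x = 2 ==> x \<in> lat z"
  using adj_sym[of x z] unfolding lat_def by (simp add: mem_N)

lemma lat_X: assumes v: "adj u v" and x: "x \<in> X v" and t: "t \<in> lat x" "t \<notin> X v" shows "d v t = 2"
proof -
  have t': "adj x t" "d u t = 2" using t unfolding lat_def by (auto simp: mem_N)
  have "d v t \<le> 2" using adj_le[OF X_mem(1)[OF x], of t] t' by simp
  moreover have "d v t ~= 1" using t t' by (auto simp: mem)
  moreover have "d v t ~= 0" using t' v by auto
  ultimately show ?thesis by linarith
qed

lemma k_le: "k = 3 \<or> k = 4" "adj u v ==> x \<in> X v ==> card (lat x - X v) \<le> 1"
  "k = 4 ==> adj u v ==> x \<in> X v ==> p \<in> X v ==> x ~= p ==> p \<in> lat x"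
proof -
  have *: "k - 3 \<le> card (lat x - X v) \<and> (p \<notin> lat x --> card (lat x) = card (lat x - X v)) \<and> card (lat x) + 2 = k \<and> 3 \<le> k"
    if v: "adj u v" and x: "x \<in> X v" "p \<in> X v" "x ~= p" for v x p
  proof -
    obtain y where y: "adj w y" "d v y = 2" by (rule X_ex[OF v])
    note NX = N_X[OF v x(1) y]
    have Xv: "X v = {x, p}" using lvl1[OF v] x by (auto simp: card_2_iff)
    have "x \<notin> lat x" unfolding lat_def by (simp add: mem_N)
    then have I: "lat x \<inter> X v \<subseteq> {p}" unfolding Xv by auto
    have fin: "finite (lat x)" unfolding lat_def by simp
    have "card (lat x \<inter> X v) \<le> 1" using card_mono[OF _ I] by simp
    moreover have sp: "card (lat x - X v) = card (lat x) - card (lat x \<inter> X v)"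
      using card_Diff_subset_Int[of "lat x" "X v"] fin by simp
    ultimately have "k - 3 \<le> card (lat x - X v)" using NX(2) by linarith
    moreover have "card (lat x) = card (lat x - X v)" if "p \<notin> lat x"
    proof -
      have "lat x - X v = lat x" using I that by blast
      then show ?thesis by simp
    qed
    moreover have "3 \<le> k" using k_com[OF v] by simp
    ultimately show ?thesis using NX(2) by blast
  qed
  have two: "\<exists>p. p \<in> X v \<and> x ~= p" if "adj u v" "x \<in> X v" for v x
    using lvl1[OF that(1)] that(2) by (auto simp: card_2_iff)
  show "k = 3 \<or> k = 4"
  proof -
    obtain v where v: "adj u v" by (rule u_nonempty)
    have "X v ~= {}" using lvl1[OF v] by auto
    then obtain x where x: "x \<in> X v" by blast
    obtain p where "p \<in> X v" "x ~= p" using two[OF v x] by blast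
    then show ?thesis using *[OF v x, of p] bound_k[OF v x] by linarith
  qed
  then have k34: "k = 3 \<or> k = 4" .
  show "card (lat x - X v) \<le> 1" if v: "adj u v" and x: "x \<in> X v"
  proof -
    obtain p where p: "p \<in> X v" "x ~= p" using two[OF v x] by blast
    have fin: "finite (lat x)" unfolding lat_def by simp
    have "card (lat x - X v) \<le> card (lat x)" using fin by (intro card_mono) auto
    then show ?thesis using *[OF v x p] bound_k[OF v x] k34 by linarith
  qed
  show "p \<in> lat x" if k: "k = 4" and v: "adj u v" and x: "x \<in> X v" "p \<in> X v" "x ~= p"
  proof (rule ccontr)
    assume "p \<notin> lat x"
    then show False using *[OF v x] bound_k[OF v x(1)] k by linarith
  qed
qed

text \<open>The lateral neighbours of the two vertices above \<open>v\<close>.\<close>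
lemma lat_pair: assumes v: "adj u v" and Xv: "X v = {x, p}" and ab: "lvl u v 1 = {a, b}"
  shows "\<exists>t1 t2. t1 ~= t2 \<and> lat x - X v = {t1} \<and> lat p - X v = {t2} \<and> {t1, t2} \<subseteq> X a \<union> X b"
proof -
  have abn: "adj u a" "adj u b" "d v a = 2" "d v b = 2" using ab by (auto simp: mem set_eq_iff)
  have cab: "card {a, b} = 2" using ab card_lvl1_commute[OF v] lvl1[OF v] by simp
  then have "a ~= b" by auto
  let ?T = "X a \<union> X b"
  have fT: "finite ?T" using abn adj_sym by simp
  have "X a \<inter> X b = {}" using X_disj[OF abn(1,2)] \<open>a ~= b\<close> by blast
  then have cT: "card ?T = 4" using card_Un_disjoint[of "X a" "X b"] lvl1[OF abn(1)] lvl1[OF abn(2)] abn adj_sym by simp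
  let ?B = "{t \<in> ?T. d v t \<le> 2}" and ?F = "{t \<in> ?T. 3 \<le> d v t}"
  have uT: "d u t = 2" if "t \<in> ?T" for t using that X_mem(3) by blast
  have "?F \<subseteq> W u v" using uT by (fastforce simp: mem_W)
  moreover have "{u, a, b} \<subseteq> W u v" using abn adj_neq[OF v] by (auto simp: mem_W d_sym[of v u])
  ultimately have sub: "{u, a, b} \<union> ?F \<subseteq> W u v" by simp
  have "{u, a, b} \<inter> ?F = {}" using uT abn by force
  moreover have "card {u, a, b} = 3" using \<open>a ~= b\<close> adj_neq[OF abn(1)] adj_neq[OF abn(2)] by simp
  ultimately have "card ({u, a, b} \<union> ?F) = 3 + card ?F" using card_Un_disjoint[of "{u, a, b}" ?F] fT by simp
  then have "card ?F \<le> 2" using card_mono[OF finite_W[OF v] sub] card_W[OF v] D4 by simp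
  moreover have "?T = ?B \<union> ?F" by auto
  then have "card ?T \<le> card ?B + card ?F" using card_Un_le[of ?B ?F] by metis
  ultimately have B2: "2 \<le> card ?B" using cT by linarith
  let ?Lx = "lat x - X v" and ?Lp = "lat p - X v"
  have Bsub: "?B \<subseteq> (?Lx \<union> ?Lp) \<inter> ?T"
  proof
    fix t assume t: "t \<in> ?B"
    then obtain c where c: "c \<in> {a, b}" "t \<in> X c" by blast
    have cu: "adj u c" "d v c = 2" using c abn by auto
    have ut: "d u t = 2" using uT t by blast
    have nv: "\<not> adj v t" using X_down[OF cu(1) c(2) v] cu(2) by auto
    moreover have "v ~= t" using ut v by auto
    moreover have "d v t \<le> 2" using t by simp
    ultimately have "d v t = Suc 1" "1 < D" using D3 d_eq_0[of v t] by (linarith+)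
    then obtain e where e: "adj v e" "adj e t" by (rule step)
    have "e \<in> insert u (com v u \<union> X v)" using e(1) N_split[OF adj_sym[OF v]] by (simp add: mem_N[symmetric])
    moreover have "e ~= u" using e ut by auto
    moreover have "e \<notin> com v u"
    proof
      assume "e \<in> com v u"
      then have "adj u e" "adj v e" by (auto simp: mem_com)
      then have "e = c" using X_down[OF cu(1) c(2) _ e(2)] by blast
      then show False using cu(2) \<open>adj v e\<close> by simp
    qed
    ultimately have "e \<in> X v" by blast
    then have "e \<in> {x, p}" using Xv by simp
    moreover have "t \<in> lat e" using e(2) ut unfolding lat_def by (simp add: mem_N)
    moreover have "t \<notin> X v" using nv by (auto simp: mem)
    ultimately show "t \<in> (?Lx \<union> ?Lp) \<inter> ?T" using t by blast
  qed
  have xX: "x \<in> X v" "p \<in> X v" using Xv by auto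
  have L1: "card ?Lx \<le> 1" "card ?Lp \<le> 1" using k_le(2)[OF v] xX by auto
  have fin: "finite ?Lx" "finite ?Lp" unfolding lat_def by auto
  have "card ?B \<le> card (?Lx \<union> ?Lp)" using Bsub fin by (intro card_mono) auto
  then have "card ?Lx = 1" "card ?Lp = 1" "card (?Lx \<union> ?Lp) = 2" using B2 L1 card_Un_le[of ?Lx ?Lp] by linarith+
  then obtain t1 t2 where t: "?Lx = {t1}" "?Lp = {t2}" by (meson card_1_singletonE)
  have "t1 ~= t2" using \<open>card (?Lx \<union> ?Lp) = 2\<close> t by auto
  have "?B \<subseteq> {t1, t2}" using Bsub t by auto
  moreover have "card {t1, t2} \<le> 2" using \<open>t1 ~= t2\<close> by simp
  ultimately have "?B = {t1, t2}" using card_seteq[of "{t1, t2}" ?B] B2 by simp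
  then have "{t1, t2} \<subseteq> ?T" by blast
  then show ?thesis using t \<open>t1 ~= t2\<close> by blast
qed

lemma k_not_4: "k ~= 4"
proof
  assume k4: "k = 4"
  obtain v where v: "adj u v" by (rule u_nonempty)
  obtain x p where Xv: "X v = {x, p}" "x ~= p" using lvl1[OF v] by (meson card_2_iff)
  have "card (lvl u v 1) = 2" using card_lvl1_commute[OF v] lvl1[OF v] by simp
  then obtain a b where ab: "lvl u v 1 = {a, b}" by (meson card_2_iff)
  have abn: "adj u a" "adj u b" "d v a = 2" "d v b = 2" using ab by (auto simp: mem set_eq_iff)
  obtain t1 t2 where t: "t1 ~= t2" "lat x - X v = {t1}" "lat p - X v = {t2}" "{t1, t2} \<subseteq> X a \<union> X b"
    using lat_pair[OF v Xv(1) ab] by blast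
  have "card (com u v) = 1" using k_com[OF v] k4 by simp
  then obtain v' where v': "com u v = {v'}" by (rule card_1_singletonE)
  then have vv: "adj u v'" "adj v v'" by (auto simp: mem set_eq_iff)
  have "card (com u v') = 1" using k_com[OF vv(1)] k4 by simp
  moreover have "v \<in> com u v'" using v vv adj_sym by (simp add: mem)
  ultimately have cv': "com u v' = {v}" by (metis card_1_singletonE singletonD)
  obtain y where y: "adj w y" "d v y = 2" by (rule X_ex[OF v])
  have uy: "d u y = 3" using lvl_w[OF y(1)] D4 by simp
  have xX: "x \<in> X v" "p \<in> X v" using Xv by auto
  have nX: "\<not> adj v' e" if "adj u c" "e \<in> X c" "c ~= v'" for c e
    using X_down[OF that(1,2) vv(1)] that(3) by blast
  have W1: "x \<in> W v v'" "p \<in> W v v'"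
  proof -
    have "e \<in> W v v'" if e: "e \<in> X v" for e
    proof -
      have "\<not> adj v' e" using nX[OF v e] adj_neq[OF vv(2)] by blast
      moreover have "v' ~= e" using X_mem(3)[OF e] vv by auto
      ultimately show ?thesis using X_mem[OF e] d_eq_0[of v' e] unfolding mem_W by linarith
    qed
    then show "x \<in> W v v'" "p \<in> W v v'" using xX by auto
  qed
  have W2: "y \<in> W v v'"
  proof -
    have "d v' y ~= 2" using match_unique[OF _ y(1) v _ vv(1)] y(2) D4 adj_neq[OF vv(2)] by auto
    moreover have "d u y \<le> Suc (d v' y)" using adj_le[OF vv(1)] .
    ultimately show ?thesis using y uy by (simp add: mem_W)
  qed
  have W3: "t \<in> W v v'" if e: "e \<in> X v" "lat e - X v = {t}" and tT: "t \<in> X a \<union> X b" for e t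
  proof -
    have te: "t \<in> lat e" "t \<notin> X v" using e(2) by auto
    obtain c where c: "c \<in> {a, b}" "t \<in> X c" using tT by blast
    have cu: "adj u c" "d v c = 2" using c(1) abn by auto
    have cv: "c ~= v'" using cu vv by auto
    have vt: "d v t = 2" using lat_X[OF v e(1) te] .
    obtain yc where yc: "adj w yc" "d c yc = 2" by (rule X_ex[OF cu(1)])
    note Nt = N_X[OF cu(1) c(2) yc]
    have et: "e \<in> lat t" using lat_sym[OF te(1) X_mem(3)[OF e(1)]] .
    have "e \<notin> X c" using X_disj[OF cu(1) v _ e(1)] cu by auto
    obtain t' where t': "t' \<in> X c" "t' ~= t" using lvl1[OF cu(1)] c(2) by (auto simp: card_2_iff)
    have "t' \<in> lat t" using k_le(3)[OF k4 cu(1) c(2) t'(1)] t'(2) by blast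
    then have "{e, t'} \<subseteq> lat t" "e ~= t'" using et \<open>e \<notin> X c\<close> t' by auto
    moreover have "card (lat t) = 2" "finite (lat t)" using Nt(2) k4 unfolding lat_def by auto
    ultimately have "lat t = {e, t'}" using card_subset_eq[of "lat t" "{e, t'}"] by simp
    then have N: "N t = {c, yc, e, t'}" using Nt(1) by auto
    have "\<not> adj v' c"
    proof
      assume "adj v' c"
      then have "c \<in> com u v'" using cu by (simp add: mem)
      then show False using cv' cu by simp
    qed
    moreover have "\<not> adj v' yc" using adj_le[OF vv(1), of yc] lvl_w[OF yc(1)] D4 by auto
    moreover have "\<not> adj v' e" "\<not> adj v' t'" "\<not> adj v' t" using nX[OF v e(1)] nX[OF cu(1) t'(1) cv] nX[OF cu(1) c(2) cv] adj_neq[OF vv(2)] by blast+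
    moreover have "v' ~= t" using X_mem(3)[OF c(2)] vv by auto
    ultimately have "3 \<le> d v' t" using N by (intro far_if) (auto simp: mem_N)
    then show ?thesis using vt by (simp add: mem_W)
  qed
  have W4: "t1 \<in> W v v'" "t2 \<in> W v v'" using W3[OF xX(1) t(2)] W3[OF xX(2) t(3)] t(4) by auto
  have "v \<in> W v v'" using vv adj_neq by (simp add: mem_W d_sym[of v' v])
  then have sub: "{v, x, p, y, t1, t2} \<subseteq> W v v'" using W1 W2 W4 by simp
  have ut: "d u t1 = 2" "d u t2 = 2" using t(4) X_mem(3) by auto
  have "t1 \<notin> {x, p}" "t2 \<notin> {x, p}" using t Xv by auto
  moreover have "d u x = 2" "d u p = 2" using X_mem(3) xX by auto
  moreover from this have "v ~= x" "v ~= p" "v ~= y" "v ~= t1" "v ~= t2" "x ~= y" "p ~= y" "y ~= t1" "y ~= t2"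
    using ut v uy by auto
  ultimately have "card {v, x, p, y, t1, t2} = 6" using Xv(2) t(1) by auto
  then show False using card_mono[OF finite_W[OF vv(2)] sub] card_W[OF vv(2)] D4 by simp
qed

lemma k3: "k = 3" using k_le(1) k_not_4 by blast

lemma com_empty: "adj u v ==> com u v = {}"
  using k_com[of v] k3 by simp
lemma com_w_empty: "adj w y ==> com w y = {}"
  using anti.k_com[OF mirror, of y] k3 by simp

lemma lat_one: assumes "adj u v" "x \<in> X v" "t \<in> lat x" shows "lat x = {t}"
proof -
  obtain y where y: "adj w y" "d v y = 2" by (rule X_ex[OF assms(1)])
  have "card (lat x) = 1" using N_X(2)[OF assms(1,2) y] k3 by simp
  then show ?thesis using assms(3) by (metis card_1_singletonE singletonD)
qed

lemma k3_contra:
  assumes v: "adj u v" and ab: "lvl u v 1 = {a, b}" and Xv: "X v = {x, p}" "x ~= p"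
    and t: "lat x = {t1}" "lat p = {t2}" "t1 \<in> X a" "t2 \<in> X b"
    and s: "lat c = {s}" "X b = {t2, c}" "t2 ~= c" "s \<in> X a" "s ~= t1"
  shows False
proof -
  have abn: "adj u a" "adj u b" "d v a = 2" "d v b = 2" using ab by (auto simp: mem set_eq_iff)
  have xX: "x \<in> X v" "p \<in> X v" using Xv by auto
  have cX: "c \<in> X b" using s by simp
  have "a ~= b" using card_lvl1_commute[OF v] lvl1[OF v] ab by auto
  have av: "a ~= v" "b ~= v" using abn by auto
  obtain y where y: "adj w y" "d v y = 2" by (rule X_ex[OF v])
  obtain ya where ya: "adj w ya" "d a ya = 2" by (rule X_ex[OF abn(1)])
  obtain yb where yb: "adj w yb" "d b yb = 2" by (rule X_ex[OF abn(2)])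
  have yy: "y ~= ya" "y ~= yb" "ya ~= yb"
    using match_unique[of y v a] match_unique[of y v b] match_unique[of ya a b] y ya yb v abn av \<open>a ~= b\<close> D4 by auto
  have Nx: "N x = {v, y, t1}" using N_X(1)[OF v xX(1) y] t by simp
  have Np: "N p = {v, y, t2}" using N_X(1)[OF v xX(2) y] t by simp
  have du: "d u x = 2" "d u p = 2" "d u t1 = 2" "d u t2 = 2" "d u s = 2" "d u c = 2"
    using X_mem(3)[OF xX(1)] X_mem(3)[OF xX(2)] X_mem(3)[OF t(3)] X_mem(3)[OF t(4)] X_mem(3)[OF s(4)] X_mem(3)[OF cX] by auto
  have dw: "d u y = 3" "d u ya = 3" "d u yb = 3" using lvl_w[OF y(1)] lvl_w[OF ya(1)] lvl_w[OF yb(1)] D4 by auto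
  have "lat t1 = {x}" using lat_one[OF abn(1) t(3)] lat_sym[of t1 x] t du by simp
  then have Nt1: "N t1 = {a, ya, x}" using N_X(1)[OF abn(1) t(3) ya] by simp
  have "lat t2 = {p}" using lat_one[OF abn(2) t(4)] lat_sym[of t2 p] t du by simp
  then have Nt2: "N t2 = {b, yb, p}" using N_X(1)[OF abn(2) t(4) yb] by simp
  have "lat s = {c}" using lat_one[OF abn(1) s(4)] lat_sym[of s c] s du by simp
  then have Ns: "N s = {a, ya, c}" using N_X(1)[OF abn(1) s(4) ya] by simp
  have Nc: "N c = {b, yb, s}" using N_X(1)[OF abn(2) cX yb] s by simp
  have dj: "e ~= e'" if "e \<in> X g" "e' \<in> X g'" "adj u g" "adj u g'" "g ~= g'" for e e' g g' using X_disj that by blast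
  have va: "e ~= e'" if "e \<in> X v" "e' \<in> X a" for e e' using dj[OF that v abn(1) av(1)[symmetric]] .
  have vb: "e ~= e'" if "e \<in> X v" "e' \<in> X b" for e e' using dj[OF that v abn(2) av(2)[symmetric]] .
  have xab: "e ~= e'" if "e \<in> X a" "e' \<in> X b" for e e' using dj[OF that abn(1,2) \<open>a ~= b\<close>] .
  have dis: "x ~= t1" "x ~= t2" "x ~= s" "x ~= c" "p ~= t1" "p ~= t2" "p ~= s" "p ~= c" "t1 ~= t2" "t1 ~= c" "s ~= t2" "s ~= c"
    using va[OF xX(1) t(3)] vb[OF xX(1) t(4)] va[OF xX(1) s(4)] vb[OF xX(1) cX] va[OF xX(2) t(3)] vb[OF xX(2) t(4)]
      va[OF xX(2) s(4)] vb[OF xX(2) cX] xab[OF t(3,4)] xab[OF t(3) cX] xab[OF s(4) t(4)] xab[OF s(4) cX] by blast+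
  have "\<forall>z\<in>{v, a, b}. d u z = 1" "\<forall>z\<in>{x, p, t1, t2, s, c}. d u z = 2" "\<forall>z\<in>{y, ya, yb}. d u z = 3"
    using v abn du dw by simp_all
  then have "{v, a, b} \<inter> {x, p, t1, t2, s, c} = {}" "{v, a, b} \<inter> {y, ya, yb} = {}" "{x, p, t1, t2, s, c} \<inter> {y, ya, yb} = {}"
    by fastforce+
  then have ne: "v \<notin> {x, p, t1, t2, s, c, y, ya, yb}" "a \<notin> {x, p, t1, t2, s, c, y, ya, yb}" "b \<notin> {x, p, t1, t2, s, c, y, ya, yb}"
    "y \<notin> {x, p, t1, t2, s, c}" "ya \<notin> {x, p, t1, t2, s, c}" "yb \<notin> {x, p, t1, t2, s, c}" by blast+
  have b3: "3 \<le> d x b"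
  proof (rule far_if)
    show "x ~= b" using ne by auto
    show "b \<notin> N x" unfolding Nx using av ne by auto
    have "v \<notin> N b" using abn(4) adj_sym[of b v] by (auto simp: mem_N)
    moreover have "y \<notin> N b" using adj_le[OF abn(2), of y] dw by (auto simp: mem_N)
    moreover have "t1 \<notin> N b" using X_down[OF abn(1) t(3) abn(2)] \<open>a ~= b\<close> by (auto simp: mem_N)
    ultimately show "N x \<inter> N b = {}" using Nx by simp
  qed
  have t3: "3 \<le> d x t2"
  proof (rule far_if)
    show "x ~= t2" using dis by simp
    show "t2 \<notin> N x" unfolding Nx using dis ne by auto
    show "N x \<inter> N t2 = {}" unfolding Nx Nt2 using av yy dis ne by auto
  qed
  have yb3: "3 \<le> d x yb"
  proof (rule far_if)
    show "x ~= yb" using ne by auto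
    show "yb \<notin> N x" unfolding Nx using yy ne by auto
    have "v \<notin> N yb" using adj_le[OF v, of yb] dw adj_sym[of yb v] by (auto simp: mem_N)
    moreover have "y \<notin> N yb" using com_w_empty[OF yb(1)] y by (auto simp: mem set_eq_iff)
    moreover have "yb \<notin> N t1" unfolding Nt1 using yy ne by auto
    then have "t1 \<notin> N yb" using adj_sym[of yb t1] by (auto simp: mem_N)
    ultimately show "N x \<inter> N yb = {}" using Nx by simp
  qed
  have s3: "3 \<le> d x s"
  proof (rule far_if)
    show "x ~= s" using dis by simp
    show "s \<notin> N x" unfolding Nx using dis s(5) ne by auto
    show "N x \<inter> N s = {}" unfolding Nx Ns using av yy dis ne by auto
  qed
  have c4: "4 \<le> d x c"
  proof (rule ccontr)
    assume n: "\<not> 4 \<le> d x c"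
    have "d c x ~= 0" using dis by simp
    then obtain m where m: "d c x = Suc m" "m \<le> 2" using n d_sym[of x c] by (cases "d c x") auto
    obtain e where e: "adj c e" "d e x = m" using step[OF m(1)] m(2) D4 by auto
    then have "e \<in> {b, yb, s}" using Nc by (simp add: mem_N[symmetric])
    then show False using e m b3 yb3 s3 d_sym[of x] by auto
  qed
  have "d v c \<le> 3"
    using adj_le[OF adj_sym[OF v], of c] du by simp
  then have Wc: "c \<in> W v x" using c4 by (simp add: mem_W)
  have Wb: "b \<in> W v x" using abn b3 by (simp add: mem_W)
  have "t2 \<notin> X v" using vb[OF _ t(4)] by blast
  then have "d v t2 = 2" using lat_X[OF v xX(2), of t2] t(2) by simp
  then have Wt: "t2 \<in> W v x" using t3 by (simp add: mem_W)
  have "p \<notin> N x" unfolding Nx using dis ne by auto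
  then have "d x p ~= 1" "d x p ~= 0" using Xv(2) by (auto simp: mem_N)
  then have "2 \<le> d x p" by linarith
  then have Wp: "p \<in> W v x" using X_mem(1)[OF xX(2)] by (simp add: mem_W)
  have Wu: "u \<in> W v x" "v \<in> W v x" using v adj_sym[OF v] du(1) X_mem[OF xX(1)] d_sym[of x u] by (auto simp: mem_W)
  have sub: "{v, u, p, b, t2, c} \<subseteq> W v x" using Wc Wb Wt Wp Wu by simp
  have "v ~= u" "v ~= p" "v ~= b" "v ~= t2" "v ~= c" "u ~= p" "u ~= b" "u ~= t2" "u ~= c" "p ~= b" "b ~= t2" "b ~= c"
    using ne du v abn av by auto
  then have "card {v, u, p, b, t2, c} = 6" using dis s(3) by auto
  then show False using card_mono[OF finite_W[OF X_mem(1)[OF xX(1)]] sub] card_W[OF X_mem(1)[OF xX(1)]] D4 by simp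
qed

theorem impossible4: False
proof -
  obtain v where v: "adj u v" by (rule u_nonempty)
  obtain x p where Xv: "X v = {x, p}" "x ~= p" using lvl1[OF v] by (meson card_2_iff)
  have "card (lvl u v 1) = 2" using card_lvl1_commute[OF v] lvl1[OF v] by simp
  then obtain a b where ab: "lvl u v 1 = {a, b}" "a ~= b" by (meson card_2_iff)
  have abn: "adj u a" "adj u b" "d v a = 2" "d v b = 2" using ab by (auto simp: mem set_eq_iff)
  have Nu: "N u = {v, a, b}" using N_split[OF v] com_empty[OF v] ab by simp
  have xX: "x \<in> X v" "p \<in> X v" using Xv by auto
  have lat1: "lat x = {t}" if "adj u v" "x \<in> X v" "lat x - X v = {t}" for v x t
    using lat_one[OF that(1,2), of t] that(3) by blast
  obtain t1 t2 where t: "t1 ~= t2" "lat x - X v = {t1}" "lat p - X v = {t2}" "{t1, t2} \<subseteq> X a \<union> X b"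
    using lat_pair[OF v Xv(1) ab(1)] by blast
  have lx: "lat x = {t1}" "lat p = {t2}" using lat1[OF v xX(1) t(2)] lat1[OF v xX(2) t(3)] by auto
  have main: False if ab': "{a, b} = {a', b'}" and t1: "t1 \<in> X a'" for a' b'
  proof -
    have abn': "adj u a'" "adj u b'" "a' ~= b'" "a' ~= v" "b' ~= v" "lvl u v 1 = {a', b'}"
      using ab' ab abn by (auto simp: doubleton_eq_iff)
    have Nu': "N u = {v, a', b'}" using Nu ab' by auto
    have eq: "insert b' (lvl u b' 1) = {v, a', b'}" using com_empty[OF abn'(2)] N_split[OF abn'(2)] Nu' by simp
    have "b' \<notin> lvl u b' 1" by (simp add: mem_lvl)
    then have "lvl u b' 1 = insert b' (lvl u b' 1) - {b'}" by simp
    also have "\<dots> = {v, a'}" unfolding eq using abn'(3,5) by auto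
    finally have lb: "lvl u b' 1 = {v, a'}" .
    obtain q q' where Xb: "X b' = {q, q'}" "q ~= q'" using lvl1[OF abn'(2)] by (meson card_2_iff)
    have qX: "q \<in> X b'" "q' \<in> X b'" using Xb by auto
    obtain s1 s2 where s: "s1 ~= s2" "lat q - X b' = {s1}" "lat q' - X b' = {s2}" "{s1, s2} \<subseteq> X v \<union> X a'"
      using lat_pair[OF abn'(2) Xb(1) lb] by blast
    have lq: "lat q = {s1}" "lat q' = {s2}" using lat1[OF abn'(2) qX(1) s(2)] lat1[OF abn'(2) qX(2) s(3)] by auto
    have du: "d u z = 2" if "z \<in> X c" for z c using X_mem(3)[OF that] .
    have latb: "lat s = {z}" if "lat z = {s}" "z \<in> X c" "s \<in> X c'" "adj u c'" for z s c c'
      using lat_one[OF that(4,3)] lat_sym[of s z] that(1) du[OF that(2)] by simp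
    have t1b: "lat t1 = {x}" using latb[OF lx(1) xX(1) t1 abn'(1)] .
    have t2X: "t2 \<in> X a' \<union> X b'" using t(4) ab' by (auto simp: doubleton_eq_iff)
    have t2b: "lat t2 = {p}" using latb[OF lx(2) xX(2)] t2X abn' by blast
    have s1b: "lat s1 = {q}" "lat s2 = {q'}" using latb[OF lq(1) qX(1)] latb[OF lq(2) qX(2)] s(4) v abn' by blast+
    have nq: "q \<notin> X a'" "q' \<notin> X a'" "q \<notin> X v" "q' \<notin> X v" using X_disj abn' qX v by blast+
    have nx: "x \<notin> X a'" "p \<notin> X a'" "x \<notin> X b'" "p \<notin> X b'" using X_disj abn' xX v by blast+
    have sv: "s \<in> X v ==> lat s = {t1} \<or> lat s = {t2}" for s using Xv lx by auto
    have t2b': "t2 \<in> X b'"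
    proof (rule ccontr)
      assume "t2 \<notin> X b'"
      then have "t2 \<in> X a'" using t2X by blast
      then have Xa: "X a' = {t1, t2}" using lvl1[OF abn'(1)] t1 t(1) by (auto simp: card_2_iff)
      have "s1 \<in> X v \<union> X a'" using s by blast
      then have "s1 \<in> {x, p, t1, t2}" using Xv Xa by auto
      then have "{q} \<in> {{t1}, {t2}, {x}, {p}}" using s1b lx t1b t2b by auto
      then show False using nq Xa nx qX by auto
    qed
    obtain c sc where c: "X b' = {t2, c}" "t2 ~= c" "lat c = {sc}" "sc \<in> X v \<union> X a'" "lat sc = {c}"
    proof (cases "q = t2")
      case True
      then show ?thesis using that[of q' s2] Xb lq s s1b by auto
    next
      case False
      then have "q' = t2" using t2b' Xb by auto
      then show ?thesis using that[of q s1] Xb lq s s1b by auto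
    qed
    have "c \<in> X b'" using c by simp
    have "sc \<in> X a'"
    proof (rule ccontr)
      assume "sc \<notin> X a'"
      then have "lat sc = {t1} \<or> lat sc = {t2}" using sv c(4) by blast
      then have "c = t1 \<or> c = t2" using c(5) by auto
      then show False using c(2) X_disj[OF abn'(1,2) t1] \<open>c \<in> X b'\<close> abn'(3) by auto
    qed
    moreover have "sc ~= t1" using t1b c(5) nx \<open>c \<in> X b'\<close> by auto
    ultimately show False
      using k3_contra[OF v abn'(6) Xv lx t1 t2b' c(3,1,2)] by blast
  qed
  show False
  proof (cases "t1 \<in> X a")
    case True then show False using main[of a b] by simp
  next
    case False then show False using main[of b a] t(4) by (simp add: insert_commute)
  qed
qed

end

lemma (in anti) D_eq_3: "D = 3"
proof (rule ccontr)
  assume "D ~= 3"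
  then have "D = 4" using D_le_4 D3 by simp
  then interpret anti4 d k D u w by unfold_locales
  show False by (rule impossible4)
qed

section \<open>Graphs with two level-one vertices at each edge\<close>

text \<open>
  A table lists, row by row, the neighbours of the vertices \<open>0, 1, 2, \<dots>\<close> of a concrete graph. Realizing
  a table is a form of isomorphism that needs no type for the concrete graph; the neighbourhoods \<open>N\<close> are a
  parameter, so that it applies to complements as well.
\<close>
definition realizes :: "nat list list \<Rightarrow> ('a \<Rightarrow> 'a set) \<Rightarrow> 'a set \<Rightarrow> bool" where
  "realizes T N V \<longleftrightarrow> (\<exists>vs. length vs = length T \<and> distinct vs \<and> set vs = V
     \<and> (\<forall>i<length T. N (vs ! i) = (\<lambda>j. vs ! j) ` set (T ! i)))"

definition "cube_table = [[1,2,3],[0,5,6],[0,4,6],[0,4,5],[7,2,3],[7,1,3],[7,1,2],[4,5,6::nat]]"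
definition "cuboctahedron_table = [[1,2,3,4],[0,2,5,7],[0,1,6,8],[0,4,5,9],[0,3,6,10],[1,7,3,9],[2,8,4,10],
   [11,8,1,5],[11,7,2,6],[11,10,3,5],[11,9,4,6],[7,8,9,10::nat]]"
definition "icosahedron_table = [[1,2,3,4,5],[0,5,2,10,6],[0,1,3,6,7],[0,2,4,7,8],[0,3,5,8,9],[0,4,1,9,10],
   [1,2,10,7,11],[2,3,6,8,11],[3,4,7,9,11],[4,5,8,10,11],[5,1,9,6,11],[6,7,8,9,10::nat]]"

lemma realizesI:
  assumes "length vs = length T" "distinct vs" "set vs = V"
    "\<forall>i<length T. N (vs ! i) = (\<lambda>j. vs ! j) ` set (T ! i)"
  shows "realizes T N V"
  using assms unfolding realizes_def by blast

text \<open>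
  The handshake lemma: the pairs of a symmetric irreflexive relation come in twos.
\<close>
lemma even_card_sym:
  assumes "finite A" "\<And>x y. (x, y) \<in> A ==> (y, x) \<in> A" "\<And>x. (x, x) \<notin> A"
  shows "even (card A)"
  using assms
proof (induction "card A" arbitrary: A rule: less_induct)
  case less
  show ?case
  proof (cases "A = {}")
    case False
    then obtain x y where xy: "(x, y) \<in> A" by auto
    then have yx: "(y, x) \<in> A" "x ~= y" using less.prems by auto
    let ?B = "A - {(x, y), (y, x)}"
    have s: "{(x, y), (y, x)} \<subseteq> A" "card {(x, y), (y, x)} = 2" using xy yx by auto
    then have c: "card ?B = card A - 2" using less.prems(1) by (simp add: card_Diff_subset)
    have c2: "2 \<le> card A" using card_mono[OF less.prems(1) s(1)] s(2) by simp
    have "even (card ?B)" using less.prems c c2 by (intro less.hyps) auto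
    then show ?thesis using c c2 by simp
  qed simp
qed

lemma (in anti) anti_nbr: assumes "adj u v" shows "\<exists>w'. d v w' = D"
proof -
  have c: "card (lvl u v 1) = 2" using card_lvl1_commute[OF assms] lvl1[OF assms] by simp
  have "\<not> W u v \<subseteq> insert u (lvl u v 1)"
  proof
    assume "W u v \<subseteq> insert u (lvl u v 1)"
    then have "card (W u v) \<le> card (insert u (lvl u v 1))" using assms by (intro card_mono) auto
    also have "\<dots> \<le> 3" using c by (simp add: card_insert_if assms)
    finally show False using card_W[OF assms] D_eq_3 by simp
  qed
  then obtain z where z: "z \<in> W u v" "z ~= u" "z \<notin> lvl u v 1" by blast
  note wz = W_le[OF assms z(1)]
  have "d u z ~= 0" "d u z ~= 1" using z wz by (auto simp: mem)
  then have "d v z = D" using wz D_eq_3 by linarith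
  then show ?thesis by blast
qed

text \<open>
  A neighbour \<open>v\<close> of a vertex \<open>u\<close> with an antipode has one too, since the \<open>D + 1 = 4\<close> vertices closer to
  \<open>u\<close> than to \<open>v\<close> do not all fit on the levels zero and one. By connectedness every vertex has an antipode.
\<close>
lemma (in anti) anti_everywhere: assumes "d u x \<le> D" shows "\<exists>w'. d x w' = D"
proof -
  have "\<forall>x. d u x = i --> (\<exists>w'. d x w' = D)" if "i \<le> D" for i
    using that
  proof (induction i)
    case 0 then show ?case using uw by auto
  next
    case (Suc i)
    show ?case
    proof (intro allI impI)
      fix x assume x: "d u x = Suc i"
      then obtain z where z: "d u z = i" "d z x = 1" using geodesic[of u x "Suc i" i] Suc.prems by auto
      then obtain w' where "d z w' = D" using Suc by auto
      then interpret Z: anti d k D z w' by unfold_locales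
      show "\<exists>w'. d x w' = D" using Z.anti_nbr z(2) by blast
    qed
  qed
  then show ?thesis using assms by blast
qed

text \<open>
  Both diameters lead to the situation where each edge has exactly two vertices on level one. Then
  every edge lies in \<open>k - 3\<close> triangles, and the numbers of edges between the first and the second
  neighbourhood of a vertex are determined.
\<close>
locale tight = ndb + fixes u0
  assumes two: "d u0 x \<le> D ==> adj x y ==> card (lvl x y 1) = 2" and edge: "\<exists>v. adj u0 v"
begin

definition "V = {x. d u0 x \<le> D}"

lemma finV: "finite V" unfolding V_def by (rule finite_verts)
lemma u0V: "u0 \<in> V" unfolding V_def by simp

lemma V_dist: assumes "x \<in> V" shows "y \<in> V \<longleftrightarrow> d x y \<le> D"
proof
  have xu: "d x u0 \<le> D" using assms d_sym unfolding V_def by simp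
  show "d x y \<le> D" if "y \<in> V"
    using d_tri[of x y u0] d_le_D[of x y] xu that unfolding V_def by auto
  show "y \<in> V" if "d x y \<le> D"
    using d_tri[of u0 y x] d_le_D[of u0 y] assms that unfolding V_def by auto
qed

lemma V_adj: "x \<in> V ==> adj x y ==> y \<in> V" using V_dist[of x y] D_ge_2 by simp
lemma V_N: "x \<in> V ==> N x \<subseteq> V" using V_adj by (auto simp: mem_N)

lemma has_nbr: assumes "x \<in> V" obtains y where "adj x y"
proof (cases "x = u0")
  case True then show ?thesis using edge that by blast
next
  case False
  have "0 < d x u0" using False d_pos[of x u0] by blast
  then have n: "1 \<le> d x u0" by linarith
  have "d u0 x \<le> D" using assms unfolding V_def by blast
  then have n2: "d x u0 \<le> D" unfolding d_sym[of x u0] .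
  obtain z where "adj x z" using geodesic[OF refl n2 n] by blast
  then show ?thesis by (rule that)
qed

lemma cN: "x \<in> V ==> card (N x) = k" using has_nbr card_N by metis
lemma N_eqI: "x \<in> V ==> S \<subseteq> N x ==> card S = k ==> N x = S"
  using card_subset_eq[OF finite_N, of S x] cN by simp

lemma lv2: "x \<in> V ==> adj x y ==> card (lvl x y 1) = 2" using two unfolding V_def by blast
lemma lv2': "x \<in> V ==> adj x y ==> card (lvl y x 1) = 2" using lv2 card_lvl1_commute by metis
lemma ccom: "x \<in> V ==> adj x y ==> card (com x y) + 3 = k" using lv2 card_split[of x y] by simp
lemma k_ge_3: "3 \<le> k" using edge ccom[OF u0V] by fastforce

lemma closed_V: assumes x: "x \<in> V" "x \<in> S" and S: "\<And>y. y \<in> S ==> y \<in> V ==> N y \<subseteq> S" shows "V \<subseteq> S"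
proof -
  have "\<forall>y. d x y = i --> y \<in> S" if "i \<le> D" for i
    using that
  proof (induction i)
    case 0 then show ?case using x by simp
  next
    case (Suc i)
    show ?case
    proof (intro allI impI)
      fix y assume y: "d x y = Suc i"
      then obtain z where z: "d x z = i" "d z y = 1" using geodesic[of x y "Suc i" i] Suc.prems by auto
      then have "z \<in> S" using Suc by simp
      moreover have "z \<in> V" using V_dist[OF x(1)] z Suc.prems by simp
      ultimately have "N z \<subseteq> S" using S by blast
      then show "y \<in> S" using z(2) unfolding mem_N[symmetric] by blast
    qed
  qed
  then show ?thesis using V_dist[OF x(1)] by auto
qed

lemma realize:
  assumes u: "u \<in> V" "u \<in> set vs" and dis: "distinct vs" and dist: "\<forall>z\<in>set vs. d u z \<le> D"
    and N: "map N vs = map (\<lambda>r. (\<lambda>j. vs ! j) ` set r) T" and T: "\<forall>r\<in>set T. \<forall>j\<in>set r. j < length T"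
  shows "realizes T N V"
proof (rule realizesI)
  show len: "length vs = length T" using arg_cong[OF N, of length] by simp
  show eq: "\<forall>i<length T. N (vs ! i) = (\<lambda>j. vs ! j) ` set (T ! i)"
  proof (intro allI impI)
    fix i assume i: "i < length T"
    have "map N vs ! i = N (vs ! i)" using i len by simp
    moreover have "map (\<lambda>r. (\<lambda>j. vs ! j) ` set r) T ! i = (\<lambda>j. vs ! j) ` set (T ! i)" using i by simp
    ultimately show "N (vs ! i) = (\<lambda>j. vs ! j) ` set (T ! i)" using N by simp
  qed
  have "V \<subseteq> set vs"
  proof (rule closed_V[OF u])
    fix y assume "y \<in> set vs"
    then obtain i where i: "i < length T" "y = vs ! i" using len by (metis in_set_conv_nth)
    then have "N y = (\<lambda>j. vs ! j) ` set (T ! i)" using eq by blast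
    moreover have "\<forall>j\<in>set (T ! i). j < length vs" using T nth_mem[OF i(1)] len by simp
    ultimately show "N y \<subseteq> set vs" by auto
  qed
  then show "set vs = V" using dist V_dist[OF u(1)] by blast
qed (rule dis)

definition "G2 u = {z. d u z = 2}"
lemma fin_G2 [simp]: "finite (G2 u)" unfolding G2_def using finite_ball[of 2 u "\<lambda>_. True"] D_ge_2 by simp
lemma mem_G2: "z \<in> G2 u \<longleftrightarrow> d u z = 2" unfolding G2_def by simp

lemma lvl_G2: "lvl v u 1 = N v \<inter> G2 u" by (auto simp: mem_lvl mem_N mem_G2)

lemma G2_pred: assumes "z \<in> G2 u" obtains v where "v \<in> com u z" "adj u v" "adj v z"
proof -
  have "d u z = Suc 1" "1 < D" using assms D_ge_2 by (auto simp: mem_G2)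
  then obtain v where v: "adj u v" "adj v z" by (rule step)
  then show ?thesis using that[of v] adj_sym[OF v(2)] by (simp add: mem_com)
qed

lemma sum_com: assumes u: "u \<in> V" shows "(\<Sum>z\<in>G2 u. card (com u z)) = 2 * k"
proof -
  have "\<forall>v\<in>N u. card {z \<in> G2 u. adj v z} = 2"
  proof
    fix v assume "v \<in> N u"
    then have v: "adj u v" by (simp add: mem)
    have "{z \<in> G2 u. adj v z} = lvl v u 1" unfolding lvl_G2 by (auto simp: mem_N)
    then show "card {z \<in> G2 u. adj v z} = 2" using lv2'[OF u v] by simp
  qed
  then have "(\<Sum>z\<in>G2 u. card {v \<in> N u. adj v z}) = 2 * card (N u)"
    by (intro sum_multicount) auto
  moreover have "{v \<in> N u. adj v z} = com u z" for z
  proof -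
    have "v \<in> {v \<in> N u. adj v z} \<longleftrightarrow> v \<in> com u z" for v
      unfolding mem_Collect_eq mem_N mem_com using adj_sym by blast
    then show ?thesis by blast
  qed
  ultimately show ?thesis using cN[OF u] by simp
qed

lemma com_pos: "z \<in> G2 u ==> 1 \<le> card (com u z)"
proof -
  assume "z \<in> G2 u"
  then obtain v where "v \<in> com u z" by (rule G2_pred)
  then have "0 < card (com u z)" using card_gt_0_iff finite_com by blast
  then show ?thesis by simp
qed

text \<open>
  The neighbours of a vertex \<open>v\<close> between \<open>u\<close> and \<open>z\<close> miss \<open>u\<close> twice and \<open>z\<close> twice, where the two misses
  include \<open>z\<close> and \<open>u\<close> themselves. So \<open>v\<close> shares at least \<open>k - 4\<close> neighbours with both.
\<close>
lemma com_lower: assumes u: "u \<in> V" and z: "z \<in> G2 u" shows "k \<le> card (com u z) + 3"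
proof -
  obtain v where v: "v \<in> com u z" "adj u v" "adj v z" using G2_pred[OF z] by blast
  have vV: "v \<in> V" using V_adj[OF u v(2)] .
  note vu = adj_sym[OF v(2)]
  have A: "card (lvl v u 1) = 2" "card (lvl v z 1) = 2" using lv2[OF vV vu] lv2[OF vV v(3)] by auto
  have zA: "z \<in> lvl v u 1" "u \<in> lvl v z 1" using v z vu d_sym[of z u] by (auto simp: mem mem_G2)
  let ?X = "(lvl v u 1 - {z}) \<union> (lvl v z 1 - {u})"
  have "card ?X \<le> 2" using card_Un_le[of "lvl v u 1 - {z}" "lvl v z 1 - {u}"] A zA by simp
  have sub: "N v \<subseteq> {u, z} \<union> ?X \<union> (com u z - {v})"
  proof
    fix e assume "e \<in> N v"
    then have e: "adj v e" by (simp add: mem)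
    then have "e \<in> insert u (com v u \<union> lvl v u 1)" "e \<in> insert z (com v z \<union> lvl v z 1)"
      using N_split[OF vu] N_split[OF v(3)] by (auto simp: mem_N[symmetric])
    moreover have "e ~= v" using e by auto
    ultimately show "e \<in> {u, z} \<union> ?X \<union> (com u z - {v})" by (auto simp: mem_com)
  qed
  have "card (N v) \<le> card ({u, z} \<union> ?X \<union> (com u z - {v}))" using vu v by (intro card_mono[OF _ sub]) auto
  also have "\<dots> \<le> card {u, z} + card ?X + card (com u z - {v})"
    by (meson add_le_cancel_right card_Un_le order_trans)
  also have "card {u, z} \<le> 2" by (simp add: card_insert_if)
  also have "card (com u z - {v}) = card (com u z) - 1" using v by simp
  finally have "card (N v) \<le> 4 + (card (com u z) - 1)" using \<open>card ?X \<le> 2\<close> by linarith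
  moreover have "1 \<le> card (com u z)" using com_pos[OF z] .
  ultimately show ?thesis using cN[OF vV] by linarith
qed

lemma G2_bound: assumes u: "u \<in> V" shows "card (G2 u) * (k - 3) \<le> 2 * k" "card (G2 u) \<le> 2 * k"
proof -
  have "(\<Sum>z\<in>G2 u. k - 3) \<le> (\<Sum>z\<in>G2 u. card (com u z))"
    using com_lower[OF u] by (intro sum_mono) (auto simp: le_diff_conv)
  then show "card (G2 u) * (k - 3) \<le> 2 * k" using sum_com[OF u] by simp
  have "(\<Sum>z\<in>G2 u. 1) \<le> (\<Sum>z\<in>G2 u. card (com u z))" using com_pos by (intro sum_mono) auto
  then show "card (G2 u) \<le> 2 * k" using sum_com[OF u] by simp
qed

lemma even_V: "even (card V * k)"
proof -
  let ?A = "Sigma V N"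
  have "even (card ?A)"
  proof (rule even_card_sym)
    show "finite ?A" using finV by auto
    show "(y, x) \<in> ?A" if "(x, y) \<in> ?A" for x y using that V_adj adj_sym[of x y] by (auto simp: mem_N)
    show "(x, x) \<notin> ?A" for x by (simp add: mem_N)
  qed
  moreover have "card ?A = (\<Sum>x\<in>V. card (N x))" using finV by (intro card_SigmaI) auto
  moreover have "\<dots> = card V * k" using cN by simp
  ultimately show ?thesis by simp
qed

text \<open>Neighbours of consecutive vertices on a locally pentagonal cycle.\<close>
lemma pentagon_step:
  assumes k5: "k = 5" and V: "u \<in> V" and ub: "adj u b" and cb: "com u b = {a, c}" "a ~= c" "\<not> adj a c"
    and x: "com a b = {u, x}" "x ~= u" and y: "com b c = {u, y}" "y ~= u"
  shows "N b = {u, a, c, x, y}" "x ~= y" "adj x y" "d u x = 2" "d u y = 2"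
proof -
  have bV: "b \<in> V" using V_adj[OF V ub] .
  have ac: "adj u a" "adj b a" "adj u c" "adj b c" using cb(1) by (auto simp: mem_com set_eq_iff)
  have xb: "adj a x" "adj b x" "adj b y" "adj c y" using x y by (auto simp: mem_com set_eq_iff)
  have xnu: "\<not> adj u x"
  proof
    assume "adj u x" then have "x \<in> com u b" using xb by (simp add: mem_com)
    then show False using cb xb(1) by auto
  qed
  have ynu: "\<not> adj u y"
  proof
    assume "adj u y" then have "y \<in> com u b" using xb by (simp add: mem_com)
    then show False using cb xb(4) adj_sym[of c a] by auto
  qed
  note bu = adj_sym[OF ub]
  show ux: "d u x = 2" using dist_two[OF bu xb(2)] x(2) xnu by simp
  show uy: "d u y = 2" using dist_two[OF bu xb(3)] y(2) ynu by simp
  have cc: "card (com b e) = 2" if "adj b e" for e using ccom[OF bV that] k5 by simp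
  have sub: "e \<in> com b f ==> adj b e \<and> adj f e" for e f by (simp add: mem_com)
  show xy: "x ~= y"
  proof
    assume xy: "x = y"
    have "{a, c} \<subseteq> com b x" using ac xb xy adj_sym[of a x] adj_sym[of c x] by (auto simp: mem_com)
    then have cx: "com b x = {a, c}" using card_subset_eq[of "com b x" "{a, c}"] cc[OF xb(2)] cb(2) by simp
    have "card (lvl b u 1) = 2" using lv2'[OF V ub] .
    moreover have "x \<in> lvl b u 1" using xb ux by (simp add: mem)
    ultimately obtain t where t: "t \<in> lvl b u 1" "t ~= x" by (metis card_2_iff')
    have bt: "adj b t" "d u t = 2" using t by (auto simp: mem)
    have "com b t \<subseteq> {a, c}"
    proof
      fix e assume e: "e \<in> com b t"
      then have be: "adj b e" "adj t e" using sub by auto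
      have "e \<in> insert u (com b u \<union> lvl b u 1)" using N_split[OF bu] be by (simp add: mem_N[symmetric])
      moreover have "e ~= u" using be bt adj_sym[of t u] by auto
      moreover have "e \<notin> lvl b u 1"
      proof
        assume "e \<in> lvl b u 1"
        moreover have "e ~= t" using be by auto
        ultimately have "e = x" using t \<open>card (lvl b u 1) = 2\<close> \<open>x \<in> lvl b u 1\<close> by (metis card_2_iff')
        then have "t \<in> com b x" using be bt adj_sym[of t x] by (simp add: mem_com)
        then show False using cx ac bt by auto
      qed
      ultimately show "e \<in> {a, c}" using cb com_commute[of b u] by blast
    qed
    then have "com b t = {a, c}" using card_subset_eq[of "{a, c}" "com b t"] cc[OF bt(1)] cb(2) by simp
    then have "adj t a" by (auto simp: mem_com set_eq_iff)
    then have "t \<in> com a b" using bt adj_sym[of t a] by (simp add: mem_com)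
    then show False using x t bt by auto
  qed
  show Nb: "N b = {u, a, c, x, y}"
  proof (rule N_eqI[OF bV])
    show "{u, a, c, x, y} \<subseteq> N b" using bu ac xb by (simp add: mem_N)
    have "u ~= a" "u ~= c" "x ~= a" "x ~= c" "y ~= a" "y ~= c" using ac ux uy by auto
    then show "card {u, a, c, x, y} = k" using xy x y cb k5 by auto
  qed
  show "adj x y"
  proof (rule ccontr)
    assume n: "\<not> adj x y"
    have "com b x \<subseteq> {a}"
    proof
      fix e assume "e \<in> com b x"
      then have be: "adj b e" "adj x e" using sub by auto
      have "e \<in> {u, a, c, x, y}" using Nb be by (simp add: mem_N[symmetric])
      moreover have "e ~= u" "e ~= x" "e ~= y" using be ux n adj_sym[of x u] by auto
      moreover have "e ~= c"
      proof
        assume "e = c" then have "x \<in> com b c" using xb be adj_sym[of x c] by (simp add: mem_com)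
        then show False using y x(2) xy by auto
      qed
      ultimately show "e \<in> {a}" by blast
    qed
    then show False using card_mono[of "{a}" "com b x"] cc[OF xb(2)] by simp
  qed
qed

lemma com_in_N: "e \<in> com u b ==> adj u b ==> b \<in> com u e \<and> adj u e"
  using adj_sym[of b e] by (simp add: mem_com)

lemma closed_local: assumes k5: "k = 5" and u: "u \<in> V" and S: "S \<subseteq> N u" "\<And>s. s \<in> S ==> com u s \<subseteq> S"
  shows "card S \<le> 2 \<or> S = N u"
proof (rule disjCI)
  assume "S ~= N u"
  then obtain p where p: "p \<in> N u" "p \<notin> S" using S(1) by blast
  then have up: "adj u p" by (simp add: mem)
  have "com u p \<subseteq> N u - S - {p}"
  proof
    fix e assume e: "e \<in> com u p"
    then have "p \<in> com u e" "adj u e" using com_in_N up by blast+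
    then have "e \<notin> S" using S(2) p by blast
    moreover have "e ~= p" using e by (auto simp: mem_com)
    ultimately show "e \<in> N u - S - {p}" using \<open>adj u e\<close> by (simp add: mem)
  qed
  then have "card (com u p) \<le> card (N u - S - {p})" by (intro card_mono) auto
  moreover have "card (N u - S - {p}) = card (N u - S) - 1" using p by (intro card_Diff_singleton) simp
  moreover have "card (N u - S) = card (N u) - card S" using S(1) finite_subset[OF S(1)] by (intro card_Diff_subset) auto
  ultimately show "card S \<le> 2" using ccom[OF u up] cN[OF u] k5 by linarith
qed

lemma five_cycle: assumes k5: "k = 5" and u: "u \<in> V"
  shows "\<exists>a0 a1 a2 a3 a4. N u = {a0, a1, a2, a3, a4} \<and> distinct [a0, a1, a2, a3, a4] \<and> com u a0 = {a4, a1}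
    \<and> com u a1 = {a0, a2} \<and> com u a2 = {a1, a3} \<and> com u a3 = {a2, a4} \<and> com u a4 = {a3, a0}"
proof -
  have c2: "card (com u b) = 2" if "adj u b" for b using ccom[OF u that] k5 by simp
  have other: "\<exists>c. com u b = {a, c} \<and> c ~= a" if b: "adj u b" "a \<in> com u b" for a b
    using c2[OF b(1)] b(2) by (auto simp: card_2_iff)
  have self: "b \<notin> com u b" for b by (simp add: mem_com)
  obtain a0 where a0: "adj u a0" using has_nbr[OF u] by blast
  obtain a4 a1 where A0: "com u a0 = {a4, a1}" "a4 ~= a1" using c2[OF a0] by (meson card_2_iff)
  have a1: "adj u a1" "a0 \<in> com u a1" and a4: "adj u a4" "a0 \<in> com u a4" using com_in_N[of _ u a0] A0 a0 by auto
  obtain a2 where A1: "com u a1 = {a0, a2}" "a2 ~= a0" using other[OF a1] by blast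
  have a2: "adj u a2" "a1 \<in> com u a2" using com_in_N[of _ u a1] A1 a1 by auto
  have n01: "a0 ~= a1" "a0 ~= a4" "a1 ~= a2" using A0 A1 self by blast+
  have n24: "a2 ~= a4"
  proof
    assume eq: "a2 = a4"
    obtain c where "com u a4 = {a0, c}" using other[OF a4] by blast
    then have A4: "com u a4 = {a0, a1}" using a2(2) eq n01 by auto
    have "card {a0, a1, a4} \<le> 2 \<or> {a0, a1, a4} = N u"
      using A0 A1 A4 eq a0 a1 a4 by (intro closed_local[OF k5 u]) (auto simp: mem_N)
    moreover have "card {a0, a1, a4} = 3" using n01 A0 by auto
    ultimately show False using cN[OF u] k5 by simp
  qed
  obtain a3 where A2: "com u a2 = {a1, a3}" "a3 ~= a1" using other[OF a2] by blast
  have a3: "adj u a3" "a2 \<in> com u a3" using com_in_N[of _ u a2] A2 a2 by auto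
  have n23: "a2 ~= a3" using A2 self by blast
  have n30: "a3 ~= a0"
  proof
    assume "a3 = a0" then have "a2 \<in> {a4, a1}" using a3 A0 by simp
    then show False using n24 n01 by blast
  qed
  have n34: "a3 ~= a4"
  proof
    assume eq: "a3 = a4"
    obtain c where "com u a4 = {a0, c}" using other[OF a4] by blast
    then have A4: "com u a4 = {a0, a2}" using a3(2) eq A1 by auto
    have "card {a0, a1, a2, a4} \<le> 2 \<or> {a0, a1, a2, a4} = N u"
      using A0 A1 A2 A4 eq a0 a1 a2 a4 by (intro closed_local[OF k5 u]) (auto simp: mem_N)
    moreover have "card {a0, a1, a2, a4} = 4" using n01 n24 A0 A1 by auto
    ultimately show False using cN[OF u] k5 by simp
  qed
  have dis: "distinct [a0, a1, a2, a3, a4]" using n01 n24 n23 n30 n34 A0 A1 A2 by auto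
  then have "card {a0, a1, a2, a3, a4} = 5" by auto
  then have Nu: "N u = {a0, a1, a2, a3, a4}" using a0 a1 a2 a3 a4 k5 by (intro N_eqI[OF u]) (auto simp: mem_N)
  obtain f where f: "com u a3 = {a2, f}" "f ~= a2" using other[OF a3] by blast
  have f': "adj u f" "a3 \<in> com u f" using com_in_N[of f u a3] f a3 by auto
  have "f \<in> {a0, a1, a2, a3, a4}" using f'(1) Nu by (simp add: mem_N[symmetric])
  moreover have "f ~= a3" using f self by blast
  moreover have "f ~= a0" "f ~= a1" using f'(2) A0 A1 dis by auto
  ultimately have f4: "f = a4" using f by blast
  obtain c where "com u a4 = {a0, c}" using other[OF a4] by blast
  then have "com u a4 = {a3, a0}" using f'(2) f4 n30 by auto
  then show ?thesis using Nu dis A0 A1 A2 f f4 by blast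
qed

end

text \<open>
  In valency 5 every edge lies in two triangles, so the neighbourhood of a vertex is a 2-regular graph on five
  vertices: a pentagon. The second triangle on each of its edges yields the vertices \<open>x0, \<dots>, x4\<close>.
\<close>
locale pent = tight + fixes u a0 a1 a2 a3 a4 x0 x1 x2 x3 x4
  assumes k5: "k = 5" and uV: "u \<in> V" and Nu: "N u = {a0, a1, a2, a3, a4}" and dis: "distinct [a0, a1, a2, a3, a4]"
    and cu: "com u a0 = {a4, a1}" "com u a1 = {a0, a2}" "com u a2 = {a1, a3}" "com u a3 = {a2, a4}" "com u a4 = {a3, a0}"
    and cx: "com a0 a1 = {u, x0}" "com a1 a2 = {u, x1}" "com a2 a3 = {u, x2}" "com a3 a4 = {u, x3}" "com a4 a0 = {u, x4}"
    and xu: "x0 ~= u" "x1 ~= u" "x2 ~= u" "x3 ~= u" "x4 ~= u"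
begin

lemma rot: "pent d k D u0 u a1 a2 a3 a4 a0 x1 x2 x3 x4 x0"
  using tight_axioms k5 uV Nu dis cu cx xu unfolding pent_def pent_axioms_def
  by (simp add: insert_commute) auto

lemma base: "N a1 = {u, a0, a2, x0, x1}" "x0 ~= x1" "adj x0 x1" "d u x0 = 2" "d u x1 = 2"
proof -
  have ua: "adj u a1" using Nu by (simp add: mem_N[symmetric])
  have "\<not> adj a0 a2"
  proof
    assume "adj a0 a2"
    then have "a2 \<in> com u a0" using Nu by (simp add: mem_com mem_N[symmetric])
    then show False using cu dis by auto
  qed
  from pentagon_step[OF k5 uV ua cu(2) _ this cx(1) xu(1) cx(2) xu(2)] dis
  show "N a1 = {u, a0, a2, x0, x1}" "x0 ~= x1" "adj x0 x1" "d u x0 = 2" "d u x1 = 2" by auto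
qed

end

context pent begin

lemmas rot1 = rot
lemmas rot2 = pent.rot[OF rot1]
lemmas rot3 = pent.rot[OF rot2]
lemmas rot4 = pent.rot[OF rot3]

lemma NA: "N a0 = {u, a4, a1, x4, x0}" "N a1 = {u, a0, a2, x0, x1}" "N a2 = {u, a1, a3, x1, x2}"
  "N a3 = {u, a2, a4, x2, x3}" "N a4 = {u, a3, a0, x3, x4}"
  using base(1) pent.base(1)[OF rot1] pent.base(1)[OF rot2] pent.base(1)[OF rot3] pent.base(1)[OF rot4] by auto

lemma xx: "x0 ~= x1" "x1 ~= x2" "x2 ~= x3" "x3 ~= x4" "x4 ~= x0"
   "adj x0 x1" "adj x1 x2" "adj x2 x3" "adj x3 x4" "adj x4 x0"
   "d u x0 = 2" "d u x1 = 2" "d u x2 = 2" "d u x3 = 2" "d u x4 = 2"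
  using base pent.base[OF rot1] pent.base[OF rot2] pent.base[OF rot3] pent.base[OF rot4] by auto

lemma ax: "adj a0 x0" "adj a1 x0" "adj x0 a0" "adj x0 a1" "adj x0 x4"
proof -
  show 1: "adj a0 x0" "adj a1 x0" using NA unfolding mem_N[symmetric] by auto
  show "adj x0 a0" "adj x0 a1" using adj_sym[OF 1(1)] adj_sym[OF 1(2)] by auto
  show "adj x0 x4" using xx(10) by (rule adj_sym)
qed

lemma x0V: "x0 \<in> V" using V_dist[OF uV] xx D_ge_2 by simp

lemma x_far: "x0 ~= x2"
proof
  assume eq: "x0 = x2"
  have ua: "d u a = 1" if "a \<in> {a0, a1, a2, a3}" for a using that Nu by (auto simp: mem_N[symmetric])
  have "adj x0 a2" "adj x0 a3" using pent.ax(3,4)[OF rot2] unfolding eq .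
  then have "{a0, a1, a2, a3, x1} \<subseteq> N x0" using ax(3,4) xx(6) by (simp add: mem_N)
  moreover have "x1 \<notin> {a0, a1, a2, a3}" using ua[of x1] xx(12) by auto
  then have "card {a0, a1, a2, a3, x1} = k" using dis k5 by auto
  ultimately have N0: "N x0 = {a0, a1, a2, a3, x1}" by (rule N_eqI[OF x0V])
  have *: "z = x1" if "adj x0 z" "d u z = 2" for z
  proof -
    have "z \<in> {a0, a1, a2, a3, x1}" using that N0 by (simp add: mem_N[symmetric])
    moreover have "z \<notin> {a0, a1, a2, a3}" using ua[of z] that(2) by auto
    ultimately show ?thesis by blast
  qed
  have "x3 = x1" using *[of x3] xx(8,14) unfolding eq by blast
  moreover have "x4 = x1" using *[of x4] ax(5) xx(15) by blast
  ultimately show False using xx(4) by simp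
qed

lemma x_distinct: "distinct [x0, x1, x2, x3, x4]"
  using x_far pent.x_far[OF rot1] pent.x_far[OF rot2] pent.x_far[OF rot3] pent.x_far[OF rot4] xx by auto

lemma G2: "G2 u = {x0, x1, x2, x3, x4}"
proof -
  have "z \<in> {x0, x1, x2, x3, x4}" if z: "z \<in> G2 u" for z
  proof -
    obtain v where v: "adj u v" "adj v z" using G2_pred[OF z] by blast
    then have "v \<in> {a0, a1, a2, a3, a4}" using Nu by (simp add: mem_N[symmetric])
    then have "z \<in> N a0 \<union> N a1 \<union> N a2 \<union> N a3 \<union> N a4" using v by (auto simp: mem_N)
    moreover have "z \<notin> insert u (N u)" using z by (auto simp: mem_G2 mem_N)
    ultimately show ?thesis unfolding NA Nu by blast
  qed
  moreover have "{x0, x1, x2, x3, x4} \<subseteq> G2 u" using xx by (simp add: mem_G2)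
  ultimately show ?thesis by blast
qed

lemma x_sub: "{a0, a1, x4, x1} \<subseteq> N x0" "card {a0, a1, x4, x1} = 4"
proof -
  show "{a0, a1, x4, x1} \<subseteq> N x0" using ax xx by (auto simp: mem_N)
  have "d u a0 = 1" "d u a1 = 1" using Nu by (auto simp: mem_N[symmetric])
  then have "a0 \<notin> {x4, x1}" "a1 \<notin> {x4, x1}" using xx by auto
  then show "card {a0, a1, x4, x1} = 4" using dis x_distinct by auto
qed

lemma N_x: obtains z where "N x0 = {a0, a1, x4, x1, z}" "z \<notin> {a0, a1, x4, x1}"
proof -
  have "card (N x0 - {a0, a1, x4, x1}) = 1"
    using x_sub card_Diff_subset[OF _ x_sub(1)] cN[OF x0V] k5 by simp
  then obtain z where "N x0 - {a0, a1, x4, x1} = {z}" by (rule card_1_singletonE)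
  then show ?thesis using that[of z] x_sub(1) by blast
qed

text \<open>In diameter 2 the fifth neighbours would form a perfect matching of a pentagram.\<close>
lemma one_diag: assumes "D = 2" shows "adj x0 x2 ~= adj x0 x3"
proof -
  obtain z where z: "N x0 = {a0, a1, x4, x1, z}" "z \<notin> {a0, a1, x4, x1}" by (rule N_x)
  have xz: "adj x0 z" using z by (auto simp: mem_N[symmetric])
  have zV: "z \<in> V" using V_adj[OF x0V xz] .
  have x0G: "x0 \<notin> insert u (N u)" using xx by (auto simp: mem_N)
  have "z ~= u" using xz xx adj_sym[of x0 u] by auto
  moreover have "z \<notin> N u"
  proof
    assume zu: "z \<in> N u"
    then have "z \<in> {a2, a3, a4}" using z Nu by auto
    moreover have "x0 \<in> N z" using adj_sym[OF xz] by (simp add: mem_N)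
    ultimately have "x0 \<in> N a2 \<union> N a3 \<union> N a4" by auto
    then show False using NA x_distinct x0G Nu by auto
  qed
  ultimately have "d u z ~= 0" "d u z ~= 1" by (auto simp: mem_N)
  moreover have "d u z \<le> 2" using zV V_dist[OF uV] assms by simp
  ultimately have "z \<in> G2 u" unfolding mem_G2 by linarith
  moreover have "z ~= x0" using xz by auto
  ultimately have zx: "z = x2 \<or> z = x3" using G2 z(2) by auto
  have "d u x2 = 2" "d u x3 = 2" "d u a0 = 1" "d u a1 = 1" using xx Nu by (auto simp: mem_N[symmetric])
  then have "x2 \<notin> {a0, a1, x4, x1}" "x3 \<notin> {a0, a1, x4, x1}" using x_distinct by auto
  then have "adj x0 x2 \<longleftrightarrow> z = x2" "adj x0 x3 \<longleftrightarrow> z = x3" unfolding mem_N[symmetric] z(1) by auto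
  then show ?thesis using zx x_distinct by auto
qed

lemma D_not_2: "D ~= 2"
proof
  assume D2: "D = 2"
  have s: "adj p q \<longleftrightarrow> adj q p" for p q using adj_sym by blast
  show False
    using one_diag[OF D2] pent.one_diag[OF rot1 D2] pent.one_diag[OF rot2 D2] pent.one_diag[OF rot3 D2] pent.one_diag[OF rot4 D2]
      s[of x0 x2] s[of x1 x3] s[of x2 x4] s[of x3 x0] s[of x4 x1] by blast
qed

lemma icosa: assumes w: "d u w = 3" "D = 3" "N w \<subseteq> G2 u" shows "realizes icosahedron_table N V"
proof -
  have wV: "w \<in> V" using V_dist[OF uV] w by simp
  have "card {x0, x1, x2, x3, x4} = 5" using x_distinct by auto
  then have Nw: "N w = {x0, x1, x2, x3, x4}" using w(3) G2 cN[OF wV] k5 card_subset_eq[of "G2 u" "N w"] by simp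
  have wx: "adj x w" if "x \<in> {x0, x1, x2, x3, x4}" for x using that Nw adj_sym[of w x] by (auto simp: mem_N[symmetric])
  have Nx: "N x0 = {a0, a1, x4, x1, w}"
    if p: "pent d k D u0 u a0 a1 a2 a3 a4 x0 x1 x2 x3 x4" and wx: "adj x0 w" for a0 a1 a2 a3 a4 x0 x1 x2 x3 x4
  proof -
    obtain z where z: "N x0 = {a0, a1, x4, x1, z}" by (rule pent.N_x[OF p]) blast
    have wN: "w \<in> N x0" using wx by (simp add: mem_N)
    have "d u a0 = 1" "d u a1 = 1" using pent.Nu[OF p] by (auto simp: mem_N[symmetric])
    then have "w \<notin> {a0, a1, x4, x1}" using w(1) pent.xx(12,15)[OF p] by auto
    then show ?thesis using z wN by auto
  qed
  have NX: "N x0 = {a0, a1, x4, x1, w}" "N x1 = {a1, a2, x0, x2, w}" "N x2 = {a2, a3, x1, x3, w}"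
    "N x3 = {a3, a4, x2, x4, w}" "N x4 = {a4, a0, x3, x0, w}"
    using Nx[OF pent.rot[OF rot4] wx] Nx[OF rot1 wx] Nx[OF rot2 wx] Nx[OF rot3 wx] Nx[OF rot4 wx] by simp_all
  have lev: "\<forall>a\<in>{a0, a1, a2, a3, a4}. d u a = 1" "\<forall>a\<in>{x0, x1, x2, x3, x4}. d u a = 2"
    using Nu xx by (simp_all add: mem_N[symmetric])
  let ?vs = "[u, a0, a1, a2, a3, a4, x0, x1, x2, x3, x4, w]"
  show ?thesis
  proof (rule realize[OF uV])
    have "{a0, a1, a2, a3, a4} \<inter> {x0, x1, x2, x3, x4} = {}" "u \<notin> {a0, a1, a2, a3, a4}" "u \<notin> {x0, x1, x2, x3, x4}" "u ~= w"
      "w \<notin> {a0, a1, a2, a3, a4}" "w \<notin> {x0, x1, x2, x3, x4}"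
      using lev w(1) by fastforce+
    then show "distinct ?vs" using dis x_distinct by auto
    show "\<forall>z\<in>set ?vs. d u z \<le> D" using lev w by simp
    show "map N ?vs = map (\<lambda>r. (!) ?vs ` set r) icosahedron_table"
      by (simp add: icosahedron_table_def NA NX Nu Nw)
  qed (simp_all add: icosahedron_table_def)
qed

end

lemma (in tight) pent_exists: assumes k5: "k = 5" and u: "u \<in> V"
  shows "\<exists>a0 a1 a2 a3 a4 x0 x1 x2 x3 x4. pent d k D u0 u a0 a1 a2 a3 a4 x0 x1 x2 x3 x4"
proof -
  obtain a0 a1 a2 a3 a4 where A: "N u = {a0, a1, a2, a3, a4}" "distinct [a0, a1, a2, a3, a4]"
    "com u a0 = {a4, a1}" "com u a1 = {a0, a2}" "com u a2 = {a1, a3}" "com u a3 = {a2, a4}" "com u a4 = {a3, a0}"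
    using five_cycle[OF k5 u] by metis
  have ex: "\<exists>x. com a c = {u, x} \<and> x ~= u" if "a \<in> com u c" "c \<in> com u a" for a c
  proof -
    have ac: "adj u a" "adj u c" "adj a c" using that by (auto simp: mem_com)
    have "card (com a c) = 2" using ccom[OF V_adj[OF u ac(1)] ac(3)] k5 by simp
    moreover have "u \<in> com a c" using adj_sym[OF ac(1)] adj_sym[OF ac(2)] by (simp add: mem_com)
    ultimately show ?thesis by (auto simp: card_2_iff)
  qed
  obtain x0 where "com a0 a1 = {u, x0}" "x0 ~= u" using ex[of a0 a1] A by auto
  moreover obtain x1 where "com a1 a2 = {u, x1}" "x1 ~= u" using ex[of a1 a2] A by auto
  moreover obtain x2 where "com a2 a3 = {u, x2}" "x2 ~= u" using ex[of a2 a3] A by auto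
  moreover obtain x3 where "com a3 a4 = {u, x3}" "x3 ~= u" using ex[of a3 a4] A by auto
  moreover obtain x4 where "com a4 a0 = {u, x4}" "x4 ~= u" using ex[of a4 a0] A by auto
  ultimately have "pent d k D u0 u a0 a1 a2 a3 a4 x0 x1 x2 x3 x4"
    using k5 u A by unfold_locales
  then show ?thesis by blast
qed

section \<open>Valency 4 in diameter 2\<close>

definition "paley9_table = [[1,2,3,4],[0,2,5,6],[0,1,7,8],[0,4,5,7],[0,3,6,8],[1,6,3,7],[1,5,4,8],[2,8,3,5],[2,7,4,6::nat]]"

text \<open>
  In valency 4 every edge lies in one triangle, so the neighbourhood of a vertex consists of two disjoint edges.
  The configuration has the symmetries of two edges that may be swapped and reversed; facts are
  proved for the first vertex and transported.
\<close>
locale quad = tight + fixes u a b c e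
  assumes k4: "k = 4" and uV: "u \<in> V" and Nu: "N u = {a, b, c, e}" and dis: "distinct [a, b, c, e]"
    and cu: "com u a = {b}" "com u b = {a}" "com u c = {e}" "com u e = {c}"
begin

lemma swap_ab: "quad d k D u0 u b a c e"
  using tight_axioms k4 uV Nu dis cu unfolding quad_def quad_axioms_def by (simp add: insert_commute) auto
lemma swap_ce: "quad d k D u0 u a b e c"
  using tight_axioms k4 uV Nu dis cu unfolding quad_def quad_axioms_def by (simp add: insert_commute) auto
lemma swap: "quad d k D u0 u c e a b"
  using tight_axioms k4 uV Nu dis cu unfolding quad_def quad_axioms_def by (simp add: insert_commute) auto

abbreviation "L v \<equiv> lvl v u 1"

lemma L_mem: "z \<in> L v \<longleftrightarrow> adj v z \<and> d u z = 2" by (auto simp: mem_lvl)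

lemma tri: assumes "x \<in> V" "adj x y" "adj x z" "adj y z" "adj x z'" "adj y z'" shows "z = z'"
proof -
  have "card (com x y) = 1" using ccom[OF assms(1,2)] k4 by simp
  moreover have "z \<in> com x y" "z' \<in> com x y" using assms by (auto simp: mem_com)
  ultimately show ?thesis by (metis card_1_singletonE singletonD)
qed

lemma adj_u: "adj u a" "adj u b" "adj u c" "adj u e" using Nu by (simp_all add: mem_N[symmetric])
lemma in_V: "a \<in> V" "b \<in> V" "c \<in> V" "e \<in> V" using adj_u V_adj[OF uV] by blast+
lemma ab: "adj a b" using cu(1) by (auto simp: mem_com set_eq_iff)
lemma ab_not: "\<not> adj a c" "\<not> adj a e"
proof -
  have "c \<notin> com u a" "e \<notin> com u a" using cu dis by auto
  then show "\<not> adj a c" "\<not> adj a e" using adj_u by (auto simp: mem_com)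
qed

lemma G2_L: "z \<in> G2 u \<longleftrightarrow> z \<in> L a \<union> L b \<union> L c \<union> L e"
proof
  assume z: "z \<in> G2 u"
  then obtain v where v: "adj u v" "adj v z" using G2_pred by blast
  then have "v \<in> {a, b, c, e}" using Nu by (simp add: mem_N[symmetric])
  then show "z \<in> L a \<union> L b \<union> L c \<union> L e" using v z by (auto simp: L_mem mem_G2)
qed (auto simp: L_mem mem_G2)

lemma N_a: "N a = {u, b} \<union> L a" and card_L: "card (L a) = 2"
proof -
  show "card (L a) = 2" using lv2'[OF uV adj_u(1)] .
  show "N a = {u, b} \<union> L a" using N_split[OF adj_sym[OF adj_u(1)]] cu(1) com_commute[of a u] by auto
qed

lemma L_ab: "L a \<inter> L b = {}"
proof -
  have False if "z \<in> L a" "z \<in> L b" for z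
  proof -
    have "u = z" using tri[OF in_V(1) ab adj_sym[OF adj_u(1)] adj_sym[OF adj_u(2)]] that by (simp add: L_mem)
    then show False using that(1) unfolding L_mem by auto
  qed
  then show ?thesis by blast
qed

lemma L_adj: assumes "p \<in> L a" "q \<in> L a" "p ~= q" shows "adj p q"
proof -
  have ap: "adj a p" using assms by (simp add: L_mem)
  have "card (com a p) = 1" using ccom[OF in_V(1) ap] k4 by simp
  then obtain z where z: "com a p = {z}" by (rule card_1_singletonE)
  then have az: "adj a z" "adj p z" by (auto simp: mem_com set_eq_iff)
  have La: "L a = {p, q}" using card_L assms by (auto simp: card_2_iff)
  have "z \<in> {u, b, p, q}" using az(1) N_a La by (auto simp: mem_N[symmetric])
  moreover have "z ~= p" using az by auto
  moreover have "z ~= u" using az(2) assms(1) d_sym[of p u] by (auto simp: L_mem)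
  moreover have "z ~= b"
  proof
    assume "z = b"
    then have "p \<in> L b" using az assms(1) adj_sym[of p b] by (auto simp: L_mem)
    then show False using L_ab assms by blast
  qed
  ultimately show ?thesis using az by auto
qed

lemma L_V: "z \<in> L v ==> z \<in> V" using V_dist[OF uV] D_ge_2 by (simp add: L_mem)

lemma other_L: assumes "p \<in> L a" obtains q where "q \<in> L a" "q ~= p" "L a = {p, q}"
proof -
  obtain x y where "L a = {x, y}" "x ~= y" using card_L by (meson card_2_iff)
  then show ?thesis using that[of x] that[of y] assms by (auto simp: insert_commute)
qed

lemma L_ac_one: assumes "p \<in> L a" "p \<in> L c" "q \<in> L a" "q \<in> L c" shows "p = q"
proof (rule ccontr)
  assume n: "p ~= q"
  have "adj p q" using L_adj[OF assms(1,3) n] .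
  then have "a = c" using tri[OF L_V[OF assms(1)], of q a c] assms adj_sym[of a p] adj_sym[of c p] adj_sym[of a q] adj_sym[of c q]
    by (auto simp: L_mem)
  then show False using dis by simp
qed

end

lemma (in tight) quad_exists: assumes k4: "k = 4" and u: "u \<in> V"
  shows "\<exists>a b c e. quad d k D u0 u a b c e"
proof -
  have c1: "card (com u x) = 1" if "adj u x" for x using ccom[OF u that] k4 by simp
  have pair: "\<exists>y. com u x = {y} \<and> com u y = {x} \<and> adj u y \<and> x ~= y" if x: "adj u x" for x
  proof -
    obtain y where y: "com u x = {y}" using c1[OF x] by (rule card_1_singletonE)
    then have yx: "y \<in> com u x" by simp
    then have y': "x \<in> com u y" "adj u y" "adj x y" using com_in_N[OF yx x] by (simp_all add: mem_com)
    obtain z where "com u y = {z}" using c1[OF y'(2)] by (rule card_1_singletonE)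
    then show ?thesis using y y' by auto
  qed
  obtain a where a: "adj u a" using has_nbr[OF u] by blast
  obtain b where b: "com u a = {b}" "com u b = {a}" "adj u b" "a ~= b" using pair[OF a] by blast
  have "\<not> N u \<subseteq> {a, b}"
  proof
    assume "N u \<subseteq> {a, b}"
    then have "card (N u) \<le> card {a, b}" by (intro card_mono) auto
    then show False using cN[OF u] k4 b(4) by simp
  qed
  then obtain c where c: "adj u c" "c ~= a" "c ~= b" unfolding mem_N[symmetric] by blast
  obtain e where e: "com u c = {e}" "com u e = {c}" "adj u e" "c ~= e" using pair[OF c(1)] by blast
  have "e ~= a" "e ~= b" using b e c by auto
  then have d: "distinct [a, b, c, e]" using b e c by auto
  then have "N u = {a, b, c, e}" using a b c e k4 by (intro N_eqI[OF u]) (auto simp: mem_N)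
  then have "quad d k D u0 u a b c e" using k4 u d b e by unfold_locales
  then show ?thesis by blast
qed

context quad begin

lemma diam2_common: assumes D2: "D = 2" and xy: "x \<in> V" "y \<in> V" "x ~= y" "\<not> adj x y"
  obtains t where "adj x t" "adj t y"
proof -
  have "d x y \<le> 2" using V_dist[OF xy(1), of y] xy(2) D2 by simp
  moreover have "d x y ~= 0" "d x y ~= 1" using xy by auto
  ultimately have "d x y = Suc 1" "1 < D" using D2 by linarith+
  then show ?thesis using step that by metis
qed

text \<open>A triangle \<open>p c1 m\<close> with \<open>p\<close> above \<open>a\<close> and \<open>c1\<close> above \<open>c\<close> cannot have \<open>m\<close> above \<open>b\<close>.\<close>
lemma no_mb: assumes D2: "D = 2" and disj: "L a \<inter> L c = {}"
  and p: "p \<in> L a" "p' \<in> L a" "p ~= p'" and c1: "c1 \<in> L c" "c2 \<in> L c" "c1 ~= c2"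
  and Np: "N p = {a, p', c1, m}" and Nc: "N c1 = {c, c2, p, m}" and m: "m \<in> L b" and p'e: "p' \<in> L e" and mc: "m ~= c" "m ~= c2"
  shows False
proof -
  note ce_disj = quad.L_ab[OF swap]
  have c2a: "c2 \<notin> L a" using disj c1 by blast
  have "\<not> adj a c2" using c2a c1 by (simp add: L_mem)
  moreover have "a ~= c2" using c1 adj_u by (auto simp: L_mem)
  ultimately obtain t where t: "adj a t" "adj t c2" using diam2_common[OF D2 in_V(1) L_V[OF c1(2)]] by blast
  have La: "L a = {p, p'}" using card_L p by (auto simp: card_2_iff)
  have "t \<in> {u, b, p, p'}" using t N_a La by (auto simp: mem_N[symmetric])
  moreover have "t ~= u" using t c1 by (auto simp: L_mem)
  moreover have "t ~= p"
  proof
    assume "t = p"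
    then have "c2 \<in> {a, p', c1, m}" using t Np by (simp add: mem_N[symmetric])
    then show False using c2a p mc c1 \<open>a ~= c2\<close> by auto
  qed
  moreover have "t ~= p'"
  proof
    assume tp: "t = p'"
    have pe: "p \<notin> L e" using quad.L_ac_one[OF swap_ce p(1) _ p(2) p'e] p(3) by blast
    obtain e' where e': "e' \<in> L e" "e' ~= p'" using quad.other_L[OF quad.swap_ab[OF swap] p'e] by metis
    have pp: "adj p p'" using L_adj[OF p] .
    have "{a, p, e, e'} \<subseteq> N p'" using p p'e adj_sym[OF pp] quad.L_adj[OF quad.swap_ab[OF swap] p'e e'(1)] e'(2) adj_sym[of a p'] adj_sym[of e p']
      by (auto simp: mem_N L_mem)
    moreover have "a ~= p" "a ~= e'" "p ~= e" "e ~= e'" "p ~= e'" "a ~= e" using p e' adj_u pe dis by (auto simp: L_mem)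
    then have "card {a, p, e, e'} = k" using k4 by simp
    ultimately have "N p' = {a, p, e, e'}" by (rule N_eqI[OF L_V[OF p(2)]])
    then have "c2 \<in> {a, p, e, e'}" using t tp by (simp add: mem_N[symmetric])
    moreover have "c2 ~= e" using c1 adj_u by (auto simp: L_mem)
    moreover have "c2 ~= e'" using ce_disj c1 e' by blast
    ultimately show False using c2a p \<open>a ~= c2\<close> by auto
  qed
  ultimately have "t = b" by blast
  then have c2b: "c2 \<in> L b" using t c1 by (auto simp: L_mem)
  have mc2: "adj m c2" using quad.L_adj[OF swap_ab m c2b mc(2)] .
  have "adj c1 c2" "adj c1 m" "adj c1 c" using Nc by (auto simp: mem_N[symmetric])
  then have "c = m" using tri[OF L_V[OF c1(1)], of c2 c m] c1 mc2 adj_sym[of m c2] adj_sym[of c c2] by (simp add: L_mem)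
  then show False using mc by simp
qed

text \<open>
  If the triangles behind \<open>a\<close> and behind \<open>c\<close> were disjoint, diameter 2 would still force short paths between them.
  The vertices on those paths are few, and each possibility closes a second triangle over an edge.
\<close>
lemma L_ac_meet: assumes D2: "D = 2" shows "L a \<inter> L c ~= {}"
proof
  assume disj: "L a \<inter> L c = {}"
  note ce_disj = quad.L_ab[OF swap]
  obtain c1 c2 where c1: "c1 \<in> L c" "c2 \<in> L c" "c1 ~= c2" "c1 \<notin> L b"
  proof -
    obtain x y where xy: "L c = {x, y}" "x ~= y" using quad.card_L[OF swap] by (meson card_2_iff)
    show ?thesis
    proof (cases "x \<in> L b")
      case True
      then have "y \<notin> L b" using quad.L_ac_one[OF swap_ab, of x y] xy by auto
      then show ?thesis using that[of y x] xy by auto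
    next
      case False then show ?thesis using that[of x y] xy by auto
    qed
  qed
  have c1a: "c1 \<notin> L a" using disj c1 by blast
  have nac: "\<not> adj a c1" "a ~= c1" using c1a c1 adj_u by (auto simp: L_mem)
  obtain p where p: "adj a p" "adj p c1" using diam2_common[OF D2 in_V(1) L_V[OF c1(1)] nac(2,1)] by blast
  have "p \<in> {u, b} \<union> L a" using p N_a by (simp add: mem_N[symmetric])
  moreover have "p ~= u" "p ~= b" using p c1 by (auto simp: L_mem)
  ultimately have pL: "p \<in> L a" by blast
  obtain p' where p': "p' \<in> L a" "p' ~= p" "L a = {p, p'}" by (rule other_L[OF pL])
  have cp: "adj c1 p" using adj_sym[OF p(2)] .
  have c1V: "c1 \<in> V" and pV: "p \<in> V" using L_V c1 pL by auto
  have "card (com c1 p) = 1" using ccom[OF c1V cp] k4 by simp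
  then obtain m where "com c1 p = {m}" by (rule card_1_singletonE)
  then have m: "adj c1 m" "adj p m" by (auto simp: mem_com set_eq_iff)
  have pc: "p \<notin> L c" using disj pL by blast
  have c12: "adj c1 c2" using quad.L_adj[OF swap c1(1-3)] .
  have pp: "adj p p'" using L_adj[OF pL p'(1)] p'(2) by simp
  have mc: "m ~= c" using m(2) pc pL adj_sym[of p c] by (auto simp: L_mem)
  have mc2: "m ~= c2"
  proof
    assume "m = c2"
    then have "c = p" using tri[OF c1V c12, of c p] c1 cp m adj_sym[of c c1] adj_sym[of c c2] adj_sym[of p c2] by (auto simp: L_mem)
    then show False using pL adj_u by (auto simp: L_mem)
  qed
  have ma: "m ~= a" using m nac adj_sym[of c1 a] by auto
  have mp': "m ~= p'"
  proof
    assume "m = p'"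
    then have "a = c1" using tri[OF pV pp, of a c1] p p' m pL adj_sym[of a p] adj_sym[of a p'] adj_sym[of c1 p'] by (auto simp: L_mem)
    then show False using nac by simp
  qed
  have Nc: "N c1 = {c, c2, p, m}"
  proof (rule N_eqI[OF c1V])
    show "{c, c2, p, m} \<subseteq> N c1" using c1 c12 cp m adj_sym[of c c1] by (auto simp: mem_N L_mem)
    have "c ~= c2" "c ~= p" "p ~= c2" "p ~= m" using c1 pL adj_u pc m by (auto simp: L_mem)
    then show "card {c, c2, p, m} = k" using mc mc2 k4 by auto
  qed
  have Np: "N p = {a, p', c1, m}"
  proof (rule N_eqI[OF pV])
    show "{a, p', c1, m} \<subseteq> N p" using pp p m adj_sym[OF p(1)] by (auto simp: mem_N)
    have "a ~= p'" using p'(1) by (auto simp: L_mem)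
    moreover have "c1 ~= p'" "a ~= c1" using p'(1) nac c1a by blast+
    moreover have "c1 ~= m" using m(1) by auto
    ultimately have "a ~= p'" "a ~= c1" "c1 ~= p'" "c1 ~= m" by auto
    then show "card {a, p', c1, m} = k" using ma mp' k4 by auto
  qed
  \<comment> \<open>how \<open>b\<close> reaches \<open>c1\<close>\<close>
  have nb: "\<not> adj b c1" "b ~= c1" using c1 adj_u by (auto simp: L_mem)
  obtain t where t: "adj b t" "adj t c1" using diam2_common[OF D2 in_V(2) c1V nb(2,1)] by blast
  have "t \<in> {u, a} \<union> L b" using t quad.N_a[OF swap_ab] by (simp add: mem_N[symmetric])
  moreover have "t ~= u" "t ~= a" using t c1 nac by (auto simp: L_mem)
  ultimately have tb: "t \<in> L b" by blast
  have "t \<in> {c, c2, p, m}" using adj_sym[OF t(2)] Nc by (simp add: mem_N[symmetric])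
  moreover have "t ~= c" using tb adj_u by (auto simp: L_mem)
  moreover have "t ~= p" using tb pL L_ab by blast
  ultimately have tt: "t = c2 \<or> t = m" by blast
  \<comment> \<open>how \<open>e\<close> reaches \<open>p\<close>\<close>
  have me: "m ~= e"
  proof
    assume "m = e"
    then have "c1 \<in> L e" using m c1 adj_sym[of c1 e] by (auto simp: L_mem)
    then show False using ce_disj c1 by blast
  qed
  have ne: "\<not> adj e p"
  proof
    assume "adj e p"
    then have "e \<in> {a, p', c1, m}" using Np adj_sym[of e p] by (simp add: mem_N[symmetric])
    moreover have "e ~= p'" "e ~= c1" using p' c1 adj_u by (auto simp: L_mem)
    ultimately show False using me dis by auto
  qed
  have "e ~= p" using pL adj_u by (auto simp: L_mem)
  then obtain s where s: "adj e s" "adj s p" using diam2_common[OF D2 in_V(4) pV _ ne] by blast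
  have "s \<in> {u, c} \<union> L e" using s quad.N_a[OF quad.swap_ab[OF swap]] by (simp add: mem_N[symmetric])
  moreover have "s ~= u" "s ~= c" using s pL pc by (auto simp: L_mem)
  ultimately have se: "s \<in> L e" by blast
  have "s \<in> {a, p', c1, m}" using adj_sym[OF s(2)] Np by (simp add: mem_N[symmetric])
  moreover have "s ~= a" using se adj_u by (auto simp: L_mem)
  moreover have "s ~= c1" using se c1 ce_disj by blast
  ultimately have ss: "s = p' \<or> s = m" by blast
  have mG: "m \<in> G2 u"
  proof -
    have mV: "m \<in> V" using V_adj[OF c1V m(1)] .
    have "m ~= u" using m c1 d_sym[of c1 u] by (auto simp: L_mem)
    moreover have "\<not> adj u m"
    proof
      assume "adj u m"
      then have "m \<in> {a, b, c, e}" using Nu by (simp add: mem_N[symmetric])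
      moreover have "m ~= b" using m nb adj_sym[of c1 b] by auto
      ultimately show False using ma mc me by blast
    qed
    moreover have "d u m \<le> 2" using V_dist[OF uV, of m] mV D2 by simp
    ultimately have "d u m ~= 0" "d u m ~= 1" "d u m \<le> 2" by auto
    then show ?thesis unfolding mem_G2 by linarith
  qed
  consider "t = m" "s = m" | "t = m" "s = p'" | "t = c2" "s = m" | "t = c2" "s = p'" using tt ss by blast
  then show False
  proof cases
    case 1
    have mV: "m \<in> V" using V_adj[OF c1V m(1)] .
    have bm: "adj b m" "adj e m" using tb se 1 by (auto simp: L_mem)
    have "card (com b m) = 1" using ccom[OF in_V(2) bm(1)] k4 by simp
    then obtain z where "com b m = {z}" by (rule card_1_singletonE)
    then have z: "adj b z" "adj m z" by (auto simp: mem_com set_eq_iff)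
    have "N m = {b, e, c1, p}"
    proof (rule N_eqI[OF mV])
      show "{b, e, c1, p} \<subseteq> N m" using adj_sym[OF bm(1)] adj_sym[OF bm(2)] adj_sym[OF m(1)] adj_sym[OF m(2)] by (auto simp: mem_N)
      have "b ~= p" "e ~= c1" "c1 ~= p" using pL c1 adj_u c1a by (auto simp: L_mem)
      then show "card {b, e, c1, p} = k" using nb \<open>e ~= p\<close> dis k4 by auto
    qed
    then have "z \<in> {b, e, c1, p}" using z by (simp add: mem_N[symmetric])
    moreover have "z ~= e" using z quad.ab_not(2)[OF swap_ab] by auto
    moreover have "z ~= p"
    proof
      assume "z = p" then have "p \<in> L b" using z pL by (auto simp: L_mem)
      then show False using L_ab pL by blast
    qed
    ultimately show False using z nb by auto
  next
    case 2
    show False using no_mb[OF D2 disj pL p'(1) p'(2)[symmetric] c1(1,2,3) Np Nc _ _ mc mc2] tb se 2 by simp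
  next
    case 3
    have disj': "L c \<inter> L a = {}" using disj by blast
    have Np'': "N p = {a, p', c1, m}" "N c1 = {c, c2, p, m}" using Np Nc by auto
    show False using quad.no_mb[OF swap D2 disj' c1(1,2,3) pL p'(1) p'(2)[symmetric] Np''(2) Np''(1) _ _ ma mp'] tb se 3 by simp
  next
    case 4
    have "m \<in> L a \<union> L b \<union> L c \<union> L e" using mG G2_L by blast
    moreover have "m \<notin> L a" using p'(3) mp' m by auto
    moreover have "m \<notin> L c"
    proof
      assume "m \<in> L c"
      moreover have "L c = {c1, c2}" using quad.card_L[OF swap] c1 by (auto simp: card_2_iff)
      ultimately show False using mc2 m by auto
    qed
    moreover have "m \<notin> L b"
    proof
      assume "m \<in> L b"
      then have "adj m c2" using quad.L_adj[OF swap_ab, of m c2] tb 4 mc2 by simp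
      then have "c = m" using tri[OF c1V c12, of c m] c1 m adj_sym[of c c1] adj_sym[of c c2] adj_sym[of m c2] by (auto simp: L_mem)
      then show False using mc by simp
    qed
    moreover have "m \<notin> L e"
    proof
      assume "m \<in> L e"
      then have "adj m p'" using quad.L_adj[OF quad.swap_ab[OF swap], of m p'] se 4 mp' by simp
      then have "a = m" using tri[OF pV pp, of a m] p p' m adj_sym[of a p] adj_sym[of a p'] adj_sym[of m p'] by (auto simp: L_mem)
      then show False using ma by simp
    qed
    ultimately show False by blast
  qed
qed

lemma paley9: assumes D2: "D = 2" shows "realizes paley9_table N V"
proof -
  obtain ac where ac: "ac \<in> L a" "ac \<in> L c" using L_ac_meet[OF D2] by blast
  obtain ae where ae: "ae \<in> L a" "ae \<in> L e" using quad.L_ac_meet[OF swap_ce D2] by blast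
  obtain bc where bc: "bc \<in> L b" "bc \<in> L c" using quad.L_ac_meet[OF swap_ab D2] by blast
  obtain be where be: "be \<in> L b" "be \<in> L e" using quad.L_ac_meet[OF quad.swap_ce[OF swap_ab] D2] by blast
  note ce_disj = quad.L_ab[OF swap]
  have ne: "ac ~= ae" "bc ~= be" "ac ~= bc" "ae ~= be" "ac ~= be" "ae ~= bc"
    using ac ae bc be L_ab ce_disj by blast+
  have L: "L a = {ac, ae}" "L b = {bc, be}" "L c = {ac, bc}" "L e = {ae, be}"
    using card_L quad.card_L[OF swap_ab] quad.card_L[OF swap] quad.card_L[OF quad.swap_ab[OF swap]] ac ae bc be ne
    by (auto simp: card_2_iff)
  have lev: "\<forall>z\<in>{ac, ae, bc, be}. d u z = 2" "\<forall>z\<in>{a, b, c, e}. d u z = 1" using ac ae bc be adj_u by (auto simp: L_mem)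
  have NA: "N a = {u, b, ac, ae}" "N b = {u, a, bc, be}" "N c = {u, e, ac, bc}" "N e = {u, c, ae, be}"
    using N_a quad.N_a[OF swap_ab] quad.N_a[OF swap] quad.N_a[OF quad.swap_ab[OF swap]] L by auto
  have disj: "{a, b, c, e} \<inter> {ac, ae, bc, be} = {}" "u \<notin> {a, b, c, e}" "u \<notin> {ac, ae, bc, be}" using lev by fastforce+
  have A: "adj ac ae" "adj bc be" "adj ac bc" "adj ae be"
    using L_adj[OF ac(1) ae(1) ne(1)] quad.L_adj[OF swap_ab bc(1) be(1) ne(2)] quad.L_adj[OF swap ac(2) bc(2) ne(3)]
      quad.L_adj[OF quad.swap_ab[OF swap] ae(2) be(2) ne(4)] by auto
  have NX: "N ac = {a, ae, c, bc}" "N ae = {a, ac, e, be}" "N bc = {b, be, c, ac}" "N be = {b, bc, e, ae}"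
  proof -
    have *: "N x = {p, y, q, z}" if "x \<in> L p" "x \<in> L q" "adj x y" "adj x z" "y ~= z" "p ~= q" "{p, q} \<subseteq> {a, b, c, e}" "{y, z} \<subseteq> {ac, ae, bc, be}" for x y z p q
    proof (rule N_eqI)
      show "x \<in> V" using L_V that by blast
      have "adj x p" "adj x q" using that adj_sym[of p x] adj_sym[of q x] by (auto simp: L_mem)
      then show "{p, y, q, z} \<subseteq> N x" using that by (simp add: mem_N)
      have "p ~= y" "p ~= z" "y ~= q" "q ~= z" using that disj by auto
      then show "card {p, y, q, z} = k" using that k4 by auto
    qed
    note AS = adj_sym[OF A(1)] adj_sym[OF A(2)] adj_sym[OF A(3)] adj_sym[OF A(4)]
    show "N ac = {a, ae, c, bc}" using *[OF ac A(1,3)] ne dis by auto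
    show "N ae = {a, ac, e, be}" using *[OF ae AS(1) A(4)] ne dis by auto
    show "N bc = {b, be, c, ac}" using *[OF bc A(2) AS(3)] ne dis by auto
    show "N be = {b, bc, e, ae}" using *[OF be AS(2) AS(4)] ne dis by auto
  qed
  let ?vs = "[u, a, b, c, e, ac, ae, bc, be]"
  show ?thesis
  proof (rule realize[OF uV])
    show "distinct ?vs" using dis ne disj by auto
    show "\<forall>z\<in>set ?vs. d u z \<le> D" using lev D2 by simp
    show "map N ?vs = map (\<lambda>r. (!) ?vs ` set r) paley9_table" by (simp add: paley9_table_def NA NX Nu)
  qed (simp_all add: paley9_table_def)
qed

end

section \<open>Classification in diameter 3\<close>

locale tight3 = tight +
  assumes D3: "D = 3" and anti_ex: "x \<in> V ==> \<exists>w. d x w = 3" and anti1: "d x w = 3 ==> d x w' = 3 ==> w = w'"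
begin

lemma N_far: assumes "d x w = 3" "adj w y" shows "d x y = 2"
proof -
  have "d x w \<le> Suc (d x y)" "d x y \<le> Suc (d x w)" using adj_le2[OF assms(2)] adj_le2'[OF assms(2)] by auto
  moreover have "d x y ~= 3" using anti1[OF assms(1)] assms(2) by auto
  moreover have "d x y ~= 4" using d_le_D[of x y] D3 by auto
  ultimately show ?thesis using assms(1) by linarith
qed

lemma N_far': "d x w = 3 ==> adj x y ==> d w y = 2"
  using N_far[of w x y] d_sym[of x w] by simp

lemma V_cases: assumes u: "u \<in> V" "d u w = 3" and z: "z \<in> V"
  shows "z = u \<or> z \<in> N u \<or> z \<in> G2 u \<or> z = w"
proof -
  have "d u z \<le> 3" using V_dist[OF u(1), of z] z D3 by simp
  then consider "d u z = 0" | "d u z = 1" | "d u z = 2" | "d u z = 3" by linarith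
  then show ?thesis by cases (use anti1[OF u(2), of z] in \<open>auto simp: mem_N mem_G2\<close>)
qed

lemma card_V: assumes u: "u \<in> V" shows "card V = k + 2 + card (G2 u)"
proof -
  obtain w where w: "d u w = 3" using anti_ex[OF u] by blast
  have wV: "w \<in> V" using V_dist[OF u, of w] w D3 by simp
  have "z \<in> V" if "z \<in> G2 u" for z using V_dist[OF u, of z] that D3 by (simp add: mem_G2)
  then have "V = {u, w} \<union> (N u \<union> G2 u)" using V_cases[OF u w] u wV V_N[OF u] by blast
  moreover have "card ({u, w} \<union> (N u \<union> G2 u)) = card {u, w} + card (N u \<union> G2 u)"
    using w by (intro card_Un_disjoint) (auto simp: mem_N mem_G2)
  moreover have "card (N u \<union> G2 u) = card (N u) + card (G2 u)"
    by (intro card_Un_disjoint) (auto simp: mem_N mem_G2)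
  moreover have "u ~= w" using w by auto
  then have "card {u, w} = 2" by simp
  ultimately show ?thesis using cN[OF u] by simp
qed

lemma N_sub_G2: "d u w = 3 ==> N w \<subseteq> G2 u" using N_far by (auto simp: mem_N mem_G2)

lemma k_le_5: "k \<le> 5"
proof -
  obtain w where w: "d u0 w = 3" using anti_ex[OF u0V] by blast
  have wV: "w \<in> V" using V_dist[OF u0V, of w] w D3 by simp
  have "card (N w) \<le> card (G2 u0)" using N_sub_G2[OF w] by (intro card_mono) auto
  then have "k * (k - 3) \<le> card (G2 u0) * (k - 3)" using cN[OF wV] by simp
  also have "\<dots> \<le> 2 * k" using G2_bound(1)[OF u0V] .
  finally have "k - 3 \<le> 2" using k_ge_3 by (simp add: mult.commute)
  then show ?thesis by simp
qed

end

text \<open>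
  The antipode \<open>w\<close> carries the same two-triangle shape as \<open>u\<close>. Behind each neighbour \<open>v\<close> of \<open>u\<close> lies one
  triangle, with a vertex \<open>p\<close> adjacent to \<open>w\<close> and a vertex \<open>s\<close> on the equator between \<open>u\<close> and \<open>w\<close>.
\<close>
locale cub = quad + tight3 + fixes w assumes uw: "d u w = 3"
begin

lemma cub_ab: "cub d k D u0 u b a c e w"
  using swap_ab tight3_axioms uw unfolding cub_def cub_axioms_def by blast
lemma cub_ce: "cub d k D u0 u a b e c w"
  using swap_ce tight3_axioms uw unfolding cub_def cub_axioms_def by blast
lemma cub_swap: "cub d k D u0 u c e a b w"
  using swap tight3_axioms uw unfolding cub_def cub_axioms_def by blast

lemma wV: "w \<in> V" using V_dist[OF uV, of w] uw D3 by simp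
lemma near_w: "adj u v ==> d v w = 2" using N_far'[OF uw, of v] d_sym[of v w] by simp

lemma base: "\<exists>s p m. L a = {s, p} \<and> s ~= p \<and> adj w p \<and> \<not> adj w s \<and> N p = {w, m, a, s} \<and> adj w m"
proof -
  have "d a w = Suc 1" "1 < D" using near_w[OF adj_u(1)] D3 by auto
  then obtain p where p: "adj a p" "adj p w" by (rule step)
  have wp: "adj w p" using adj_sym[OF p(2)] .
  have pL: "p \<in> L a" using p N_far[OF uw wp] by (simp add: L_mem)
  obtain s where s: "s \<in> L a" "s ~= p" "L a = {p, s}" by (rule other_L[OF pL])
  have ps: "adj p s" using L_adj[OF pL s(1)] s(2) by simp
  have pV: "p \<in> V" using L_V[OF pL] .
  have sa: "adj s a" using s(1) adj_sym[of a s] by (simp add: L_mem)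
  have nws: "\<not> adj w s"
  proof
    assume "adj w s"
    then have "w = a" using tri[OF pV ps p(2) _ adj_sym[OF p(1)] sa] adj_sym[of w s] by blast
    then show False using near_w[OF adj_u(1)] by simp
  qed
  have "card (com w p) = 1" using ccom[OF wV wp] k4 by simp
  then obtain m where "com w p = {m}" by (rule card_1_singletonE)
  then have m: "adj w m" "adj p m" by (auto simp: mem_com set_eq_iff)
  have "N p = {w, m, a, s}"
  proof (rule N_eqI[OF pV])
    show "{w, m, a, s} \<subseteq> N p" using p m ps adj_sym[OF p(1)] by (simp add: mem_N)
    have "w ~= m" "m ~= s" using m nws by auto
    moreover have "d u a = 1" "d u s = 2" "d u m = 2" using adj_u s N_far[OF uw m(1)] by (auto simp: L_mem)
    then have "a ~= s" "w ~= a" "w ~= s" "m ~= a" using uw by auto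
    ultimately show "card {w, m, a, s} = k" using k4 by auto
  qed
  moreover have "L a = {s, p}" using s(3) by (simp add: insert_commute)
  ultimately show ?thesis using s(2) wp nws m(1) by blast
qed

lemma base_all: assumes "v \<in> N u"
  shows "\<exists>s p m. L v = {s, p} \<and> s ~= p \<and> adj w p \<and> \<not> adj w s \<and> N p = {w, m, v, s} \<and> adj w m"
  using assms base cub.base[OF cub_ab] cub.base[OF cub_swap] cub.base[OF cub.cub_ab[OF cub_swap]]
  unfolding Nu by blast

end

locale cub2 = cub + fixes s p m
  assumes spm: "v \<in> N u ==> L v = {s v, p v} \<and> s v ~= p v \<and> adj w (p v) \<and> \<not> adj w (s v) \<and> N (p v) = {w, m v, v, s v} \<and> adj w (m v)"
begin

lemma cub2_ab: "cub2 d k D u0 u b a c e w s p m"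
  using cub_ab spm unfolding cub2_def cub2_axioms_def by blast
lemma cub2_ce: "cub2 d k D u0 u a b e c w s p m"
  using cub_ce spm unfolding cub2_def cub2_axioms_def by blast
lemma cub2_swap: "cub2 d k D u0 u c e a b w s p m"
  using cub_swap spm unfolding cub2_def cub2_axioms_def by blast

lemma lev: assumes "v \<in> N u"
  shows "adj v (s v)" "adj v (p v)" "adj (s v) v" "adj (p v) v" "d u v = 1" "d u (s v) = 2" "d u (p v) = 2" "s v \<in> V" "p v \<in> V" "adj (s v) (p v)"
    "d w v = 2" "adj u v" "d u (m v) = 2" "adj (p v) (s v)"
proof -
  have "s v \<in> L v" "p v \<in> L v" "s v \<in> N (p v)" using spm[OF assms] by auto
  then show "adj v (s v)" "adj v (p v)" "d u (s v) = 2" "d u (p v) = 2" "s v \<in> V" "p v \<in> V" "adj (p v) (s v)"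
    using L_V by (auto simp: L_mem mem_N)
  then show "adj (s v) v" "adj (p v) v" "adj (s v) (p v)" using adj_sym by blast+
  show "d u v = 1" "adj u v" using assms by (auto simp: mem_N)
  then show "d w v = 2" using N_far'[OF uw] by blast
  show "d u (m v) = 2" using N_far[OF uw] spm[OF assms] by blast
qed

lemma p_adj: assumes v: "v \<in> N u" "v' \<in> N u" and a: "adj (p v') x" "x = v \<or> x = s v"
  shows "x = v' \<or> x = s v'"
proof -
  have "x \<in> {w, m v', v', s v'}" using a(1) spm[OF v(2)] by (auto simp: mem_N[symmetric])
  moreover have "x ~= w" using a(2) lev[OF v(1)] uw by auto
  moreover have "x ~= m v'" using a(2) lev(11)[OF v(1)] spm[OF v(1)] spm[OF v(2)] by auto
  ultimately show ?thesis by blast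
qed

lemma p_inj: assumes "v \<in> N u" "v' \<in> N u" "p v = p v'" shows "v = v'"
  using p_adj[of v v' v] lev[OF assms(1)] lev[OF assms(2)] assms by auto

lemma s_p: "v \<in> N u ==> v' \<in> N u ==> s v ~= p v'" using spm by metis

lemma Nw: "N w = p ` N u"
proof (rule N_eqI[OF wV])
  show "p ` N u \<subseteq> N w" using spm by (auto simp: mem_N)
  have "card (p ` N u) = card (N u)" using p_inj by (intro card_image) (auto simp: inj_on_def)
  then show "card (p ` N u) = k" using cN[OF uV] by simp
qed

lemma G2_sp: assumes "z \<in> G2 u" obtains v where "v \<in> N u" "z = s v \<or> z = p v"
proof -
  obtain v where v: "adj u v" "adj v z" using G2_pred[OF assms] by blast
  then have "v \<in> N u" "z \<in> L v" using assms by (auto simp: mem_N L_mem mem_G2)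
  then show ?thesis using that[of v] spm[of v] by auto
qed

lemma s_nbr: assumes v: "v \<in> N u" and x: "adj (s v) x" and al: "\<forall>v'\<in>N u. v' ~= v --> s v' ~= s v"
  shows "x = v \<or> x = p v \<or> (\<exists>v'\<in>N u. v' ~= v \<and> x = s v')"
proof -
  note l = lev[OF v]
  have "x \<in> V" using V_adj[OF l(8) x] .
  then consider "x = u" | "x \<in> N u" | "x \<in> G2 u" | "x = w" using V_cases[OF uV uw] by blast
  then show ?thesis
  proof cases
    case 1 then show ?thesis using x l d_sym[of "s v" u] by simp
  next
    case 2
    then have "s v \<in> L x" using adj_sym[OF x] l by (simp add: L_mem)
    then have "s v = s x" using spm[OF 2] s_p[OF v 2] by auto
    then show ?thesis using al 2 by metis
  next
    case 3
    then obtain v2 where v2: "v2 \<in> N u" "x = s v2 \<or> x = p v2" by (rule G2_sp)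
    show ?thesis
    proof (cases "x = p v2")
      case True
      then have "s v = v2 \<or> s v = s v2" using p_adj[OF v v2(1), of "s v"] adj_sym[OF x] by blast
      moreover have "s v ~= v2" using l(6) lev(5)[OF v2(1)] by auto
      ultimately show ?thesis using al v2(1) True by metis
    next
      case False
      then have "x = s v2" using v2 by blast
      moreover have "v2 ~= v" using x calculation by auto
      ultimately show ?thesis using v2 by blast
    qed
  next
    case 4 then show ?thesis using x spm[OF v] adj_sym[of "s v" w] by simp
  qed
qed

lemma s_meet_aux:
  assumes v: "v \<in> N u" "v' \<in> N u" "v4 \<in> N u" and dis: "v' ~= v4" "v4 ~= v" "v' ~= v"
    and x: "adj (s v') (s v)" and eq: "s v4 = s v'"
  shows False
proof -
  have sub: "{v', p v', v4, p v4, s v} \<subseteq> N (s v')" using lev[OF v(2)] lev[OF v(3)] x eq by (auto simp: mem_N)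
  have "v' ~= p v'" "v' ~= p v4" "v' ~= s v" "p v' ~= v4" "v4 ~= p v4" "v4 ~= s v"
    using lev[OF v(2)] lev[OF v(3)] lev[OF v(1)] by auto
  moreover have "p v' ~= p v4" using p_inj[OF v(2,3)] dis by blast
  moreover have "s v ~= p v'" "s v ~= p v4" using s_p v by blast+
  ultimately have "card {v', p v', v4, p v4, s v} = 5" using dis by auto
  then have "5 \<le> card (N (s v'))" using card_mono[OF finite_N sub] by simp
  then show False using cN[OF lev(8)[OF v(2)]] k4 by simp
qed

text \<open>
  An equator vertex seen from only one neighbour of \<open>u\<close> would have two further neighbours on the equator;
  the fourth equator vertex then completes a second triangle over an edge.
\<close>
lemma s_meet: assumes v: "v \<in> N u" shows "\<exists>v'\<in>N u. v' ~= v \<and> s v' = s v"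
proof (rule ccontr)
  assume "\<not> ?thesis"
  then have al: "\<forall>v'\<in>N u. v' ~= v --> s v' ~= s v" by blast
  note l = lev[OF v]
  have "v ~= p v" using l by auto
  then have c2: "card (N (s v) - {v, p v}) = 2"
    using cN[OF l(8)] k4 l by (subst card_Diff_subset) (auto simp: mem_N)
  then obtain x y where xy: "N (s v) - {v, p v} = {x, y}" "x ~= y" by (meson card_2_iff)
  then have axy: "adj (s v) x" "adj (s v) y" "x ~= v" "y ~= v" "x ~= p v" "y ~= p v" unfolding mem_N[symmetric] by blast+
  have "{v, p v} \<subseteq> N (s v)" using l by (simp add: mem_N)
  then have Ns: "N (s v) = {v, p v, x, y}" using xy(1) by blast
  obtain v1 where v1: "v1 \<in> N u" "v1 ~= v" "x = s v1" using s_nbr[OF v axy(1) al] axy by blast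
  obtain v2 where v2: "v2 \<in> N u" "v2 ~= v" "y = s v2" using s_nbr[OF v axy(2) al] axy by blast
  have "v1 ~= v2" using xy v1 v2 by blast
  have "\<not> N u \<subseteq> {v, v1, v2}"
  proof
    assume "N u \<subseteq> {v, v1, v2}"
    then have "card (N u) \<le> card {v, v1, v2}" by (intro card_mono) auto
    also have "\<dots> \<le> 3" by (simp add: card_insert_if)
    finally show False using cN[OF uV] k4 by simp
  qed
  then obtain v4 where v4: "v4 \<in> N u" "v4 ~= v" "v4 ~= v1" "v4 ~= v2" by blast
  have n1: "s v4 ~= s v1" using s_meet_aux[OF v v1(1) v4(1)] v4 v1 axy(1) adj_sym[of "s v" "s v1"] by metis
  have n2: "s v4 ~= s v2" using s_meet_aux[OF v v2(1) v4(1)] v4 v2 axy(2) adj_sym[of "s v" "s v2"] by metis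
  have n0: "s v4 ~= s v" using al v4 by blast
  note l4 = lev[OF v4(1)]
  have "N u = {v, v1, v2, v4}" using v v1 v2 v4 \<open>v1 ~= v2\<close> k4 by (intro N_eqI[OF uV]) auto
  then have al4: "\<forall>v'\<in>N u. v' ~= v4 --> s v' ~= s v4" using n0 n1 n2 by auto
  have n4: "\<not> adj (s v4) (s v)"
  proof
    assume "adj (s v4) (s v)"
    then have "s v4 \<in> {v, p v, x, y}" using Ns adj_sym[of "s v4" "s v"] by (simp add: mem_N[symmetric])
    moreover have "s v4 ~= v" using l4 l by auto
    ultimately show False using n1 n2 s_p[OF v4(1) v] v1 v2 by auto
  qed
  have "N (s v4) \<subseteq> {v4, p v4, x, y}"
  proof
    fix z assume "z \<in> N (s v4)"
    then have z: "adj (s v4) z" by (simp add: mem_N)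
    show "z \<in> {v4, p v4, x, y}" using s_nbr[OF v4(1) z al4] n4 z \<open>N u = {v, v1, v2, v4}\<close> v1 v2 by auto
  qed
  moreover have "card {v4, p v4, x, y} \<le> card (N (s v4))" using cN[OF l4(8)] k4 by (simp add: card_insert_if)
  ultimately have N4: "N (s v4) = {v4, p v4, x, y}" by (intro card_seteq) auto
  then have a4: "adj (s v4) x" "adj (s v4) y" by (auto simp: mem_N[symmetric])
  have "card (com (s v) x) = 1" using ccom[OF l(8) axy(1)] k4 by simp
  then obtain z where "com (s v) x = {z}" by (rule card_1_singletonE)
  then have z: "adj (s v) z" "adj x z" by (auto simp: mem_com set_eq_iff)
  have "z \<in> {v, p v, x, y}" using z Ns by (simp add: mem_N[symmetric])
  moreover have "z ~= v"
  proof
    assume "z = v"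
    then have "x \<in> L v" using adj_sym[OF z(2)] lev(6)[OF v1(1)] v1 by (simp add: L_mem)
    then show False using spm[OF v] axy v1 al by auto
  qed
  moreover have "z ~= p v"
  proof
    assume "z = p v"
    then have "s v1 = v \<or> s v1 = s v" using p_adj[OF v1(1) v, of "s v1"] adj_sym[OF z(2)] v1 by blast
    then show False using axy v1 al by auto
  qed
  ultimately have "adj x y" using z by auto
  moreover have "x \<in> V" using v1 lev by blast
  ultimately have "s v = s v4" using tri[of x y "s v" "s v4"] adj_sym[OF axy(1)] adj_sym[OF axy(2)] adj_sym[OF a4(1)] adj_sym[OF a4(2)] by blast
  then show False using n0 by simp
qed

lemma in_Nu: "a \<in> N u" "b \<in> N u" "c \<in> N u" "e \<in> N u" unfolding Nu by auto

lemma s_ab: "s a ~= s b" using L_ab spm[OF in_Nu(1)] spm[OF in_Nu(2)] by auto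

lemma s_be: assumes "s a = s c" shows "s b = s e"
proof -
  obtain v' where v': "v' \<in> N u" "v' ~= b" "s v' = s b" using s_meet[OF in_Nu(2)] by blast
  have "v' ~= a" using v'(3) s_ab by auto
  moreover have "v' ~= c" using v'(3) s_ab assms by auto
  ultimately have "v' = e" using v'(1,2) Nu by auto
  then show ?thesis using v'(3) by simp
qed

lemma N_s: assumes "s a = s c" shows "N (s a) = {a, p a, c, p c}"
proof (rule N_eqI[OF lev(8)[OF in_Nu(1)]])
  note la = lev[OF in_Nu(1)] and lc = lev[OF in_Nu(3)]
  show "{a, p a, c, p c} \<subseteq> N (s a)" using la lc assms by (simp add: mem_N)
  have "a ~= p a" "a ~= p c" "c ~= p a" "c ~= p c" using la lc by auto
  moreover have "p a ~= p c" "a ~= c" using p_inj[OF in_Nu(1,3)] dis by auto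
  ultimately show "card {a, p a, c, p c} = k" using k4 by auto
qed

lemma two_path: assumes "adj x y" "adj y z" shows "d x z ~= 3" using adj_le2'[OF assms(2), of x] assms(1) by simp

lemma m_a: assumes sc: "s a = s c" shows "m a = p b"
proof -
  note A = spm[OF in_Nu(1)] note la = lev[OF in_Nu(1)] and lb = lev[OF in_Nu(2)] and lc = lev[OF in_Nu(3)] and le = lev[OF in_Nu(4)]
  have am: "adj (p a) (m a)" using A by (auto simp: mem_N[symmetric])
  have "m a \<in> p ` N u" using A Nw by (simp add: mem_N[symmetric])
  then have "m a \<in> {p a, p b, p c, p e}" using Nu by auto
  moreover have "m a ~= p a" using am by auto
  moreover have "m a ~= p c"
  proof
    assume eq: "m a = p c"
    have "w = s a" using tri[OF la(9), of "p c" w "s a"] am eq la lc sc A spm[OF in_Nu(3)] adj_sym[of w "p a"] adj_sym[of w "p c"] by metis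
    then show False using la(6) uw by simp
  qed
  moreover have "m a ~= p e"
  proof
    assume eq: "m a = p e"
    obtain t where t: "d a t = 3" using anti_ex[OF in_V(1)] by blast
    have tV: "t \<in> V" using V_dist[OF in_V(1), of t] t D3 by simp
    note au = adj_sym[OF adj_u(1)]
    have n1: "d a v ~= 3" if "v \<in> N u" for v using two_path[OF au lev(12)[OF that]] .
    have "d a (s a) ~= 3" "d a (p a) ~= 3" using la by simp_all
    moreover have "d a (s b) ~= 3" "d a (p b) ~= 3" using two_path[OF ab lb(1)] two_path[OF ab lb(2)] by auto
    moreover have "d a (s c) ~= 3" using la sc by simp
    moreover have "d a (p c) ~= 3" using two_path[OF la(1), of "p c"] lc(10) sc by simp
    moreover have "d a (s e) ~= 3" using two_path[OF ab lb(1)] s_be[OF sc] by simp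
    moreover have "d a (p e) ~= 3" using two_path[OF la(2), of "p e"] am eq by simp
    ultimately have "\<forall>v\<in>N u. d a (s v) ~= 3 \<and> d a (p v) ~= 3" unfolding Nu by blast
    then have "t \<notin> G2 u" using t G2_sp[of t] by metis
    moreover have "t ~= w" using t near_w[OF adj_u(1)] by auto
    moreover have "t ~= u" "t \<notin> N u" using t au n1 by auto
    ultimately show False using V_cases[OF uV uw tV] by blast
  qed
  ultimately show ?thesis by blast
qed

lemma cuboctahedron_aux: assumes sc: "s a = s c" shows "realizes cuboctahedron_table N V"
proof -
  note la = lev[OF in_Nu(1)] and lb = lev[OF in_Nu(2)] and lc = lev[OF in_Nu(3)] and le = lev[OF in_Nu(4)]
  note be = s_be[OF sc]
  have M: "m a = p b" "m b = p a" "m c = p e" "m e = p c"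
    using m_a[OF sc] cub2.m_a[OF cub2.cub2_ce[OF cub2_ab] be] cub2.m_a[OF cub2_swap sc[symmetric]]
      cub2.m_a[OF cub2.cub2_ce[OF cub2.cub2_ab[OF cub2_swap]] be[symmetric]] by auto
  have NA: "N a = {u, b, s a, p a}" "N b = {u, a, s b, p b}" "N c = {u, e, s a, p c}" "N e = {u, c, s b, p e}"
    using N_a quad.N_a[OF swap_ab] quad.N_a[OF swap] quad.N_a[OF quad.swap_ab[OF swap]]
      spm[OF in_Nu(1)] spm[OF in_Nu(2)] spm[OF in_Nu(3)] spm[OF in_Nu(4)] sc be by auto
  have NS: "N (s a) = {a, p a, c, p c}" "N (s b) = {b, p b, e, p e}"
    using N_s[OF sc] cub2.N_s[OF cub2.cub2_ce[OF cub2_ab] be] by auto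
  have NP: "N (p a) = {w, p b, a, s a}" "N (p b) = {w, p a, b, s b}" "N (p c) = {w, p e, c, s a}" "N (p e) = {w, p c, e, s b}"
    using spm[OF in_Nu(1)] spm[OF in_Nu(2)] spm[OF in_Nu(3)] spm[OF in_Nu(4)] M sc be by auto
  have Nw': "N w = {p a, p b, p c, p e}" using Nw Nu by simp
  let ?vs = "[u, a, b, c, e, s a, s b, p a, p b, p c, p e, w]"
  show ?thesis
  proof (rule realize[OF uV])
    have l1: "\<forall>z\<in>{a, b, c, e}. d u z = 1" and l2: "\<forall>z\<in>{s a, s b, p a, p b, p c, p e}. d u z = 2"
      using la lb lc le by auto
    have "{a, b, c, e} \<inter> {s a, s b, p a, p b, p c, p e} = {}" "u \<notin> {a, b, c, e}" "u \<notin> {s a, s b, p a, p b, p c, p e}"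
      "w \<notin> {a, b, c, e}" "w \<notin> {s a, s b, p a, p b, p c, p e}" "u ~= w"
      using l1 l2 uw by fastforce+
    moreover have "distinct [p a, p b, p c, p e]" using p_inj in_Nu dis by auto
    moreover have "s a ~= s b" by (rule s_ab)
    moreover have "{s a, s b} \<inter> {p a, p b, p c, p e} = {}" using s_p in_Nu by auto
    ultimately show "distinct ?vs" using dis by auto
    show "\<forall>z\<in>set ?vs. d u z \<le> D" using l1 l2 uw D3 by simp
    show "map N ?vs = map (\<lambda>r. (!) ?vs ` set r) cuboctahedron_table"
      by (simp add: cuboctahedron_table_def NA NS NP Nu Nw')
  qed (simp_all add: cuboctahedron_table_def)
qed

lemma cuboctahedron: "realizes cuboctahedron_table N V"
proof -
  obtain v where v: "v \<in> N u" "v ~= a" "s v = s a" using s_meet[OF in_Nu(1)] by blast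
  have "v ~= b" using v(3) s_ab by auto
  then have "v = c \<or> v = e" using v Nu by auto
  then show ?thesis using v(3) cuboctahedron_aux cub2.cuboctahedron_aux[OF cub2_ce] by metis
qed

end

context tight3 begin

lemma cuboctahedron: assumes k4: "k = 4" shows "realizes cuboctahedron_table N V"
proof -
  obtain a b c e where "quad d k D u0 u0 a b c e" using quad_exists[OF k4 u0V] by blast
  moreover obtain w where "d u0 w = 3" using anti_ex[OF u0V] by blast
  ultimately have C: "cub d k D u0 u0 a b c e w" using tight3_axioms unfolding cub_def cub_axioms_def by blast
  then obtain s p m where "cub2 d k D u0 u0 a b c e w s p m"
    unfolding cub2_def cub2_axioms_def using cub.base_all[OF C] by metis
  then show ?thesis by (rule cub2.cuboctahedron)
qed

lemma icosahedron: assumes k5: "k = 5" shows "realizes icosahedron_table N V"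
proof -
  obtain w where w: "d u0 w = 3" using anti_ex[OF u0V] by blast
  show ?thesis using pent_exists[OF k5 u0V] pent.icosa[OF _ w D3 N_sub_G2[OF w]] by blast
qed

lemma no_triangle: "k = 3 ==> x \<in> V ==> adj x y ==> com x y = {}" using ccom[of x y] by simp

text \<open>
  With five vertices at distance 2, exactly one of them has two common neighbours with the given vertex.
  The resulting quadrangles partition the ten vertices, which 4 does not divide.
\<close>
lemma not_five: assumes k3: "k = 3" and g: "\<And>u. u \<in> V ==> card (G2 u) = 5" shows False
proof -
  have "\<exists>z. z \<in> G2 u \<and> card (com u z) = 2 \<and> (\<forall>z'\<in>G2 u. z' ~= z --> card (com u z') ~= 2)" if u: "u \<in> V" for u
  proof -
    have sum: "(\<Sum>z\<in>G2 u. card (com u z)) = 6" using sum_com[OF u] k3 by simp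
    have "\<exists>z\<in>G2 u. card (com u z) ~= 1" using sum g[OF u] by (metis (no_types, lifting) card_eq_sum sum.cong numeral_eq_iff semiring_norm(89))
    then obtain z where z: "z \<in> G2 u" "card (com u z) ~= 1" by blast
    have s2: "(\<Sum>z'\<in>G2 u - {z}. card (com u z')) + card (com u z) = 6" using sum sum.remove[OF fin_G2 z(1), of "\<lambda>z. card (com u z)"] by simp
    have "(\<Sum>z'\<in>G2 u - {z}. 1) \<le> (\<Sum>z'\<in>G2 u - {z}. card (com u z'))" using com_pos by (intro sum_mono) auto
    then have s4: "4 \<le> (\<Sum>z'\<in>G2 u - {z}. card (com u z'))" using g[OF u] z by simp
    then have cz: "card (com u z) = 2" using s2 z(2) com_pos[OF z(1)] by linarith
    moreover have False if z': "z' \<in> G2 u" "z' ~= z" "card (com u z') = 2" for z'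
    proof -
      have "(\<Sum>y\<in>G2 u - {z}. card (com u y)) = card (com u z') + (\<Sum>y\<in>G2 u - {z} - {z'}. card (com u y))"
        using z' by (intro sum.remove) auto
      moreover have "(\<Sum>y\<in>G2 u - {z} - {z'}. 1) \<le> (\<Sum>y\<in>G2 u - {z} - {z'}. card (com u y))" using com_pos by (intro sum_mono) auto
      moreover have "(\<Sum>y\<in>G2 u - {z} - {z'}. 1) = (3::nat)" using g[OF u] z z' by simp
      ultimately show False using s2 cz z'(3) by linarith
    qed
    ultimately show ?thesis using z by blast
  qed
  then obtain f where f: "\<And>u. u \<in> V ==> f u \<in> G2 u \<and> card (com u (f u)) = 2 \<and> (\<forall>z'\<in>G2 u. z' ~= f u --> card (com u z') ~= 2)"
    by metis
  have GV: "z \<in> V" if "u \<in> V" "z \<in> G2 u" for u z using V_dist[OF that(1), of z] that(2) D3 by (simp add: mem_G2)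
  have fI: "f u = z" if "u \<in> V" "z \<in> G2 u" "2 \<le> card (com u z)" for u z
  proof -
    have "card (com u z) = 2"
    proof (rule ccontr)
      assume n: "card (com u z) ~= 2"
      then have zf: "z ~= f u" using f[OF that(1)] by auto
      have "(\<Sum>y\<in>G2 u. card (com u y)) = card (com u z) + (\<Sum>y\<in>G2 u - {z}. card (com u y))"
        using that(2) by (intro sum.remove) auto
      moreover have "(\<Sum>y\<in>G2 u - {z}. 1) \<le> (\<Sum>y\<in>G2 u - {z}. card (com u y))" using com_pos by (intro sum_mono) auto
      moreover have "(\<Sum>y\<in>G2 u - {z}. 1) = (4::nat)" using g[OF that(1)] that(2) by simp
      ultimately show False using sum_com[OF that(1)] k3 n that(3) by linarith
    qed
    then show ?thesis using f[OF that(1)] that(2) by metis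
  qed
  have ff: "f (f u) = u" "f u \<in> V" "d u (f u) = 2" if u: "u \<in> V" for u
  proof -
    note fu = f[OF u]
    show fV: "f u \<in> V" using GV[OF u] fu by blast
    show "d u (f u) = 2" using fu by (simp add: mem_G2)
    then have "u \<in> G2 (f u)" using d_sym[of "f u" u] by (simp add: mem_G2)
    then show "f (f u) = u" using fI[OF fV, of u] fu com_commute[of u "f u"] by simp
  qed
  have fp: "q = f p" "q ~= p" if u: "u \<in> V" and pq: "com u (f u) = {p, q}" "p ~= q" for u p q
  proof -
    have a: "adj u p" "adj u q" "adj (f u) p" "adj (f u) q" using pq(1) by (auto simp: mem_com set_eq_iff)
    have "\<not> adj p q" using no_triangle[OF k3 u a(1)] a(2) by (auto simp: mem_com set_eq_iff)
    then have d2: "d p q = 2" using dist_two[OF a(1,2) pq(2)] by simp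
    have "{u, f u} \<subseteq> com p q" using adj_sym[OF a(1)] adj_sym[OF a(2)] adj_sym[OF a(3)] adj_sym[OF a(4)] by (simp add: mem_com)
    then have "card {u, f u} \<le> card (com p q)" by (intro card_mono) auto
    moreover have "u ~= f u" using ff(3)[OF u] by auto
    ultimately have "2 \<le> card (com p q)" by simp
    then show "q = f p" "q ~= p" using fI[OF V_adj[OF u a(1)], of q] d2 pq(2) by (auto simp: mem_G2)
  qed
  define C where "C u = {u, f u} \<union> com u (f u)" for u
  have C4: "card (C u) = 4" "C u \<subseteq> V" "u \<in> C u" if u: "u \<in> V" for u
  proof -
    have "card (C u) = card {u, f u} + card (com u (f u))" unfolding C_def by (intro card_Un_disjoint) (auto simp: mem_com)
    moreover have "u ~= f u" using ff(3)[OF u] by auto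
    ultimately show "card (C u) = 4" using f[OF u] by simp
    show "C u \<subseteq> V" unfolding C_def using u ff(2)[OF u] V_adj[OF u] by (auto simp: mem_com)
    show "u \<in> C u" unfolding C_def by simp
  qed
  have Ceq: "C y = C u" if u: "u \<in> V" and y: "y \<in> C u" for u y
  proof -
    have "card (com u (f u)) = 2" using f[OF u] by blast
    then obtain p q where pq: "com u (f u) = {p, q}" "p ~= q" by (meson card_2_iff)
    have pV: "p \<in> V" "q \<in> V" using V_adj[OF u] pq(1) by (auto simp: mem_com set_eq_iff)
    have fpq: "f p = q" "f q = p" using fp[OF u pq] ff(1)[OF pV(1)] by auto
    have s: "{u, f u} \<subseteq> com p q" using pq(1) adj_sym by (auto simp: mem_com set_eq_iff)
    have "u ~= f u" using ff(3)[OF u] by auto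
    then have "card {u, f u} = 2" by simp
    moreover have "card (com p q) = 2" using f[OF pV(1)] fpq by simp
    ultimately have cpq: "com p q = {u, f u}" using s card_subset_eq[OF finite_com s] by simp
    consider "y = u" | "y = f u" | "y = p" | "y = q" using y pq unfolding C_def by blast
    then show ?thesis
    proof cases
      case 2 then show ?thesis unfolding C_def using ff(1)[OF u] com_commute[of u "f u"] by auto
    next
      case 3 then show ?thesis unfolding C_def using fpq cpq pq by auto
    next
      case 4 then show ?thesis unfolding C_def using fpq cpq pq com_commute[of p q] by auto
    qed auto
  qed
  have "4 * card (C ` V) = card (\<Union>(C ` V))"
  proof (rule card_partition)
    show "finite (\<Union>(C ` V))" by (rule finite_subset[OF _ finV]) (use C4(2) in blast)
    show "card c = 4" if "c \<in> C ` V" for c using that C4(1) by auto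
    show "c1 \<inter> c2 = {}" if "c1 \<in> C ` V" "c2 \<in> C ` V" "c1 ~= c2" for c1 c2
      using that Ceq by blast
  qed (simp add: finV)
  moreover have "\<Union>(C ` V) = V" using C4(2,3) by blast
  moreover have "card V = 10" using card_V[OF u0V] g[OF u0V] k3 by simp
  ultimately have "4 * card (C ` V) = 10" by simp
  then show False by presburger
qed

lemma cube: assumes k3: "k = 3" shows "realizes cube_table N V"
proof -
  have "\<exists>u\<in>V. card (G2 u) ~= 5" using not_five[OF k3] by blast
  then obtain u where u: "u \<in> V" "card (G2 u) ~= 5" by blast
  obtain w where w: "d u w = 3" using anti_ex[OF u(1)] by blast
  have wV: "w \<in> V" using V_dist[OF u(1), of w] w D3 by simp
  have "even (5 + card (G2 u))" using even_V card_V[OF u(1)] k3 by simp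
  moreover have "card (G2 u) \<le> 6" using G2_bound(2)[OF u(1)] k3 by simp
  moreover have ge: "3 \<le> card (G2 u)" using card_mono[OF fin_G2 N_sub_G2[OF w]] cN[OF wV] k3 by simp
  ultimately have "card (G2 u) = 3 \<or> card (G2 u) = 4 \<or> card (G2 u) = 6" "even (5 + card (G2 u))" using u(2) by linarith+
  then have g3: "card (G2 u) = 3" by auto
  then have GN: "G2 u = N w" using card_subset_eq[OF fin_G2 N_sub_G2[OF w]] cN[OF wV] k3 by simp
  have Ny: "N y = insert w (com u y)" if y: "y \<in> G2 u" for y
  proof -
    have wy: "adj w y" using y GN by (simp add: mem_N)
    have yV: "y \<in> V" using V_adj[OF wV wy] .
    have "z \<in> insert w (com u y)" if "z \<in> N y" for z
    proof -
      have yz: "adj y z" using that by (simp add: mem_N)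
      have "z ~= u" using yz y d_sym[of y u] by (auto simp: mem_G2)
      moreover have "z \<notin> G2 u" using no_triangle[OF k3 wV wy] yz GN by (auto simp: mem_N mem_com set_eq_iff)
      ultimately have "z \<in> N u \<or> z = w" using V_cases[OF u(1) w V_adj[OF yV yz]] by blast
      then show "z \<in> insert w (com u y)" using yz by (auto simp: mem_N mem_com)
    qed
    then have "N y \<subseteq> insert w (com u y)" by blast
    moreover have "insert w (com u y) \<subseteq> N y" using adj_sym[OF wy] by (auto simp: mem_N mem_com)
    ultimately show ?thesis by blast
  qed
  have c2: "card (com u y) = 2" if y: "y \<in> G2 u" for y
  proof -
    have "y \<in> V" using y GN V_N[OF wV] by blast
    then have "card (insert w (com u y)) = 3" using cN[of y] Ny[OF y] k3 by simp
    moreover have "w \<notin> com u y" using w by (simp add: mem_com)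
    ultimately show ?thesis by simp
  qed
  obtain a b c where abc: "N u = {a, b, c}" "a ~= b" "b ~= c" "a ~= c" using cN[OF u(1)] k3 by (metis card_3_iff)
  have opp: "\<exists>y. y \<in> G2 u \<and> com u y = N u - {v} \<and> N v = insert u (G2 u - {y})" if v: "v \<in> N u" for v
  proof -
    have uv: "adj u v" using v by (simp add: mem_N)
    have Lv: "card (lvl v u 1) = 2" "lvl v u 1 \<subseteq> G2 u" using lv2'[OF u(1) uv] by (auto simp: lvl_G2)
    have "card (G2 u - lvl v u 1) = 1" using Lv g3 finite_subset[OF Lv(2)] by (simp add: card_Diff_subset)
    then obtain y where y: "G2 u - lvl v u 1 = {y}" by (rule card_1_singletonE)
    then have yG: "y \<in> G2 u" "y \<notin> lvl v u 1" "lvl v u 1 = G2 u - {y}" using Lv(2) by blast+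
    have "v \<notin> com u y" using yG(1,2) adj_sym[of y v] by (auto simp: mem_com mem_lvl mem_G2)
    then have s: "com u y \<subseteq> N u - {v}" by (auto simp: mem_com mem_N)
    have "com u y = N u - {v}" using card_subset_eq[OF _ s] c2[OF yG(1)] cN[OF u(1)] k3 v by simp
    moreover have "N v = insert u (G2 u - {y})"
      using N_split[OF adj_sym[OF uv]] no_triangle[OF k3 u(1) uv] com_commute[of u v] yG(3) by simp
    ultimately show ?thesis using yG by blast
  qed
  obtain a' where a': "a' \<in> G2 u" "com u a' = N u - {a}" "N a = insert u (G2 u - {a'})" using opp abc(1) by blast
  obtain b' where b': "b' \<in> G2 u" "com u b' = N u - {b}" "N b = insert u (G2 u - {b'})" using opp abc(1) by blast
  obtain c' where c': "c' \<in> G2 u" "com u c' = N u - {c}" "N c = insert u (G2 u - {c'})" using opp abc(1) by blast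
  have "a \<in> com u b'" "a \<in> com u c'" "b \<in> com u c'" "a \<notin> com u a'" "b \<notin> com u b'" using a' b' c' abc by auto
  then have ne: "a' ~= b'" "a' ~= c'" "b' ~= c'" by blast+
  have "{a', b', c'} \<subseteq> G2 u" "card {a', b', c'} = 3" using a' b' c' ne by auto
  then have G: "G2 u = {a', b', c'}" using card_subset_eq[OF fin_G2, of "{a', b', c'}" u] g3 by metis
  have NX: "N a' = {w, b, c}" "N b' = {w, a, c}" "N c' = {w, a, b}"
    using Ny[OF a'(1)] Ny[OF b'(1)] Ny[OF c'(1)] a'(2) b'(2) c'(2) abc by auto
  have NA: "N a = {u, b', c'}" "N b = {u, a', c'}" "N c = {u, a', b'}" using a'(3) b'(3) c'(3) G ne by auto
  have Nw: "N w = {a', b', c'}" using GN G by simp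
  let ?vs = "[u, a, b, c, a', b', c', w]"
  show ?thesis
  proof (rule realize[OF u(1)])
    have l1: "\<forall>z\<in>{a, b, c}. d u z = 1" using abc(1) by (auto simp: mem_N[symmetric])
    have l2: "\<forall>z\<in>{a', b', c'}. d u z = 2" using a' b' c' by (auto simp: mem_G2)
    have "{a, b, c} \<inter> {a', b', c'} = {}" "u \<notin> {a, b, c}" "u \<notin> {a', b', c'}" "w \<notin> {a, b, c}" "w \<notin> {a', b', c'}" "u ~= w"
      using l1 l2 w by fastforce+
    then show "distinct ?vs" using abc ne by auto
    show "\<forall>z\<in>set ?vs. d u z \<le> D" using l1 l2 w D3 by simp
    show "map N ?vs = map (\<lambda>r. (!) ?vs ` set r) cube_table" by (simp add: cube_table_def NA NX abc(1) Nw)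
  qed (simp_all add: cube_table_def)
qed

lemma diameter_3: "realizes cube_table N V \<or> realizes cuboctahedron_table N V \<or> realizes icosahedron_table N V"
proof -
  have "k = 3 \<or> k = 4 \<or> k = 5" using k_ge_3 k_le_5 by linarith
  then show ?thesis using cube cuboctahedron icosahedron by blast
qed

end

section \<open>Classification in diameter 2\<close>

definition "petersen_table = [[1,2,3],[0,4,5],[0,6,7],[0,8,9],[1,6,9],[1,7,8],[2,4,8],[2,5,9],[3,6,5],[3,4,7::nat]]"
definition "moebius_table = [[1,7,4],[0,2,5],[1,3,6],[2,4,7],[3,5,0],[4,6,1],[5,7,2],[6,0,3::nat]]"

text \<open>
  Cubic Moore graphs of diameter 2. They arise twice: as the graph itself in valency 3, and as its
  complement in valency 6.
\<close>
locale moore =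
  fixes N :: "'a \<Rightarrow> 'a set" and V :: "'a set"
  assumes NV: "x \<in> V ==> N x \<subseteq> V" and c3: "x \<in> V ==> card (N x) = 3"
    and sym: "x \<in> V ==> y \<in> N x ==> x \<in> N y" and irr: "x \<in> V ==> x \<notin> N x"
    and nbr: "x \<in> V ==> y \<in> N x ==> N x \<inter> N y = {}"
    and non: "x \<in> V ==> y \<in> V ==> x ~= y ==> y \<notin> N x ==> card (N x \<inter> N y) = 1"
begin

lemma fin: "x \<in> V ==> finite (N x)" using c3[of x] by (intro card_ge_0_finite) simp

lemma one: assumes "x \<in> V" "y \<in> V" "x ~= y" "y \<notin> N x" "p \<in> N x" "p \<in> N y" "q \<in> N x" "q \<in> N y" shows "p = q"
proof -
  obtain z where z: "N x \<inter> N y = {z}" using non[OF assms(1-4)] by (rule card_1_singletonE)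
  have "p \<in> N x \<inter> N y" "q \<in> N x \<inter> N y" using assms(5-8) by auto
  then show ?thesis unfolding z by simp
qed

lemma ex: assumes "x \<in> V" "y \<in> V" "x ~= y" "y \<notin> N x" obtains p where "p \<in> N x" "p \<in> N y"
proof -
  obtain z where "N x \<inter> N y = {z}" using non[OF assms] by (rule card_1_singletonE)
  then have "z \<in> N x \<inter> N y" by simp
  then show ?thesis using that by blast
qed

lemma N3: assumes "x \<in> V" "y \<in> N x" "z \<in> N x" "t \<in> N x" "y ~= z" "z ~= t" "y ~= t" shows "N x = {y, z, t}"
proof -
  have "{y, z, t} \<subseteq> N x" "card {y, z, t} = 3" using assms by auto
  then show ?thesis using card_subset_eq[OF fin[OF assms(1)], of "{y, z, t}"] c3[OF assms(1)] by simp
qed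

lemma N2: assumes "x \<in> V" "y \<in> N x" obtains p q where "N x = {y, p, q}" "p ~= q" "y ~= p" "y ~= q"
proof -
  have "card (N x - {y}) = 2" using c3[OF assms(1)] assms(2) by simp
  then obtain p q where "N x - {y} = {p, q}" "p ~= q" by (meson card_2_iff)
  then show ?thesis using that[of p q] assms(2) by blast
qed

lemma petersen: assumes u: "u \<in> V" shows "realizes petersen_table N V"
proof -
  obtain a b c where Nu: "N u = {a, b, c}" "a ~= b" "b ~= c" "a ~= c" using c3[OF u] by (metis card_3_iff)
  have V: "a \<in> V" "b \<in> V" "c \<in> V" using NV[OF u] Nu by auto
  have ua: "u \<in> N a" "u \<in> N b" "u \<in> N c" using sym[OF u] Nu by auto
  have ne: "b \<notin> N a" "c \<notin> N a" "c \<notin> N b" "a \<notin> N b"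
    using nbr[OF u, of a] nbr[OF u, of b] Nu by auto
  obtain a1 a2 where Na: "N a = {u, a1, a2}" "a1 ~= a2" "u ~= a1" "u ~= a2" using N2[OF V(1) ua(1)] .
  have a12: "a1 \<in> V" "a2 \<in> V" "a \<in> N a1" "a \<in> N a2" using NV[OF V(1)] sym[OF V(1)] Na by auto
  have disj: "p \<notin> N y" if "x \<in> V" "y \<in> V" "x ~= y" "y \<notin> N x" "u \<in> N x" "u \<in> N y" "p \<in> N x" "p ~= u" for x y p
    using one[OF that(1-4)] that(5-8) by blast
  have A: "a1 \<notin> N b" "a2 \<notin> N b" "a1 \<notin> N c" "a2 \<notin> N c"
    using disj[OF V(1,2) Nu(2) ne(1) ua(1,2)] disj[OF V(1,3) Nu(4) ne(2) ua(1,3)] Na by auto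
  have nab: "a1 ~= b" "a1 ~= c" "a2 ~= b" "a2 ~= c" using ne Na by auto
  \<comment> \<open>the neighbours of \<open>b\<close> and of \<open>c\<close> are numbered by their adjacency to \<open>a1\<close>\<close>
  obtain b1 where b1: "b1 \<in> N b" "b1 \<in> N a1" using ex[OF V(2) a12(1)] nab A by metis
  obtain c2 where c2: "c2 \<in> N c" "c2 \<in> N a1" using ex[OF V(3) a12(1)] nab A by metis
  have un: "u \<notin> N a1" "u \<notin> N a2" using nbr[OF V(1), of a1] nbr[OF V(1), of a2] ua Na by auto
  have "b1 ~= u" "c2 ~= u" using b1 c2 un by auto
  have "card (N b - {u, b1}) = 1" using c3[OF V(2)] fin[OF V(2)] ua b1 \<open>b1 ~= u\<close> by (subst card_Diff_subset) auto
  then obtain b2 where b2': "N b - {u, b1} = {b2}" by (rule card_1_singletonE)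
  then have Nb: "N b = {u, b1, b2}" "b2 ~= u" "b2 ~= b1" using ua b1 by blast+
  have "card (N c - {u, c2}) = 1" using c3[OF V(3)] fin[OF V(3)] ua c2 \<open>c2 ~= u\<close> by (subst card_Diff_subset) auto
  then obtain c1 where c1': "N c - {u, c2} = {c1}" by (rule card_1_singletonE)
  then have Nc: "N c = {u, c1, c2}" "c1 ~= u" "c1 ~= c2" using ua c2 by blast+
  have B: "b1 \<notin> N a" "b2 \<notin> N a" "b1 \<notin> N c" "b2 \<notin> N c"
    using disj[OF V(2,1) _ ne(4) ua(2,1)] disj[OF V(2,3) Nu(3) ne(3) ua(2,3)] Nu Nb \<open>b1 ~= u\<close> by auto
  have bc: "b1 \<in> V" "b2 \<in> V" "c1 \<in> V" "c2 \<in> V" "b \<in> N b1" "b \<in> N b2" "c \<in> N c1" "c \<in> N c2"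
    using NV[OF V(2)] NV[OF V(3)] sym[OF V(2)] sym[OF V(3)] Nb Nc by auto
  have un2: "u \<notin> N b1" "u \<notin> N b2" "u \<notin> N c1" "u \<notin> N c2"
    using nbr[OF V(2), of b1] nbr[OF V(2), of b2] nbr[OF V(3), of c1] nbr[OF V(3), of c2] ua Nb Nc by auto
  have nbc: "b1 ~= a" "b1 ~= c" "b2 ~= a" "b2 ~= c" "c1 ~= a" "c1 ~= b" "c2 ~= a" "c2 ~= b"
    using ne sym[OF V(3), of a] sym[OF V(3), of b] Nb Nc by auto
  have Cc: "c1 \<notin> N a" "c1 \<notin> N b" "c2 \<notin> N a" "c2 \<notin> N b"
    using disj[OF V(1,3) Nu(4) ne(2) ua(1,3), of c1] disj[OF V(1,3) Nu(4) ne(2) ua(1,3), of c2]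
      disj[OF V(2,3) Nu(3) ne(3) ua(2,3), of c1] disj[OF V(2,3) Nu(3) ne(3) ua(2,3), of c2] Nc \<open>c2 ~= u\<close> by auto
  have levels: "b1 \<notin> {a1, a2, c1, c2}" "b2 \<notin> {a1, a2, c1, c2}" "c1 \<notin> {a1, a2}" "c2 \<notin> {a1, a2}"
    using B Cc Na Nc by auto
  have c2a1: "a1 \<in> N c2" "a1 \<in> N b1" using sym[OF a12(1)] c2 b1 by auto
  have Na1: "N a1 = {a, b1, c2}" using a12 b1 c2 nbc levels by (intro N3) auto
  obtain p where p: "p \<in> N b" "p \<in> N a2" using ex[OF V(2) a12(2)] nab A by metis
  have "p ~= b1"
  proof
    assume "p = b1"
    then have "a2 \<in> N b1" using sym[OF a12(2)] p by blast
    then have "a1 = a2" using one[OF V(1) bc(1) nbc(1)[symmetric] B(1)] c2a1 Na by blast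
    then show False using Na by simp
  qed
  then have b2a2: "b2 \<in> N a2" using p Nb un by auto
  obtain q where q: "q \<in> N c" "q \<in> N a2" using ex[OF V(3) a12(2)] nab A by metis
  have "q ~= c2"
  proof
    assume "q = c2"
    then have "a2 \<in> N c2" using sym[OF a12(2)] q by blast
    then have "a1 = a2" using one[OF V(1) bc(4) nbc(7)[symmetric] Cc(3)] c2a1 Na by blast
    then show False using Na by simp
  qed
  then have c1a2: "c1 \<in> N a2" using q Nc un by auto
  have Na2: "N a2 = {a, b2, c1}" using a12 b2a2 c1a2 nbc levels by (intro N3) auto
  have sa2: "a2 \<in> N b2" "a2 \<in> N c1" using sym[OF a12(2)] b2a2 c1a2 by auto
  obtain r where r: "r \<in> N c" "r \<in> N b1" using ex[OF V(3) bc(1)] B nbc by metis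
  have "r ~= c2" using nbr[OF a12(1) b1(2)] c2 r by auto
  then have r1: "c1 \<in> N b1" using r Nc un2 by auto
  then have Nb1: "N b1 = {b, a1, c1}" using bc c2a1 nab nbc levels by (intro N3) auto
  obtain r' where r': "r' \<in> N c" "r' \<in> N b2" using ex[OF V(3) bc(2)] B nbc by metis
  have "r' ~= c1" using nbr[OF a12(2) b2a2] c1a2 r' by auto
  then have r2: "c2 \<in> N b2" using r' Nc un2 by auto
  then have Nb2: "N b2 = {b, a2, c2}" using bc sa2 nab nbc levels by (intro N3) auto
  have "b1 \<in> N c1" "b2 \<in> N c2" using sym[OF bc(1) r1] sym[OF bc(2) r2] .
  then have NC: "N c1 = {c, b1, a2}" "N c2 = {c, a1, b2}"
    using bc sa2 c2a1 nab nbc levels by (intro N3; auto)+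
  let ?vs = "[u, a, b, c, a1, a2, b1, b2, c1, c2]"
  show ?thesis
  proof (rule realizesI)
    have "u \<notin> {a, b, c}" "a \<notin> {a1, a2}" "b \<notin> {b1, b2}" "c \<notin> {c1, c2}"
      using irr[OF u] irr[OF V(1)] irr[OF V(2)] irr[OF V(3)] unfolding Nu Na Nb Nc by auto
    then show "distinct ?vs" using Nu(2-4) Na(2-4) Nb(2,3) Nc(2,3) nab nbc levels \<open>b1 ~= u\<close> \<open>c2 ~= u\<close> by auto
    show "set ?vs = V"
    proof
      show "set ?vs \<subseteq> V" using u V a12 bc by simp
      show "V \<subseteq> set ?vs"
      proof
        fix z assume z: "z \<in> V"
        show "z \<in> set ?vs"
        proof (cases "z = u \<or> z \<in> N u")
          case True then show ?thesis using Nu by auto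
        next
          case False
          then obtain p where p: "p \<in> N u" "p \<in> N z" using ex[OF u z] by metis
          have "z \<in> N p" using sym[OF z p(2)] .
          then show ?thesis using p(1) Nu Na Nb Nc by auto
        qed
      qed
    qed
    have "map N ?vs = map (\<lambda>r. (!) ?vs ` set r) petersen_table"
      by (simp add: petersen_table_def Nu Na Nb Nc Na1 Na2 Nb1 Nb2 NC)
    then show "\<forall>i<length petersen_table. N (?vs ! i) = (\<lambda>j. ?vs ! j) ` set (petersen_table ! i)"
      by (metis (no_types, lifting) length_map nth_map)
    show "length ?vs = length petersen_table" by (simp add: petersen_table_def)
  qed
qed

end

definition multipartite :: "('a \<Rightarrow> 'a set) \<Rightarrow> 'a set \<Rightarrow> nat \<Rightarrow> bool" where
  "multipartite N V t \<longleftrightarrow> (\<exists>f. bij_betw f V ({0..<t} \<times> {0..<3::nat}) \<and> (\<forall>x\<in>V. \<forall>y\<in>V. y \<in> N x \<longleftrightarrow> fst (f x) ~= fst (f y)))"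

locale tight2 = tight + assumes D2: "D = 2"
begin

lemma G2_V: "u \<in> V ==> z \<in> G2 u ==> z \<in> V" using V_dist[of u z] D2 by (simp add: mem_G2)
lemma G2_sym: "z \<in> G2 u ==> u \<in> G2 z" using d_sym[of u z] by (simp add: mem_G2)

lemma V_cases: assumes u: "u \<in> V" and z: "z \<in> V" shows "z = u \<or> z \<in> N u \<or> z \<in> G2 u"
proof -
  have "d u z \<le> 2" using V_dist[OF u, of z] z D2 by simp
  then consider "d u z = 0" | "d u z = 1" | "d u z = 2" by linarith
  then show ?thesis by cases (auto simp: mem_N mem_G2)
qed

lemma card_V: assumes u: "u \<in> V" shows "card V = k + 1 + card (G2 u)"
proof -
  have "V = {u} \<union> (N u \<union> G2 u)" using V_cases[OF u] u V_N[OF u] G2_V[OF u] by blast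
  moreover have "card ({u} \<union> (N u \<union> G2 u)) = card {u} + card (N u \<union> G2 u)"
    by (intro card_Un_disjoint) (auto simp: mem_N mem_G2)
  moreover have "card (N u \<union> G2 u) = card (N u) + card (G2 u)"
    by (intro card_Un_disjoint) (auto simp: mem_N mem_G2)
  ultimately show ?thesis using cN[OF u] by simp
qed

lemma card_G2: "u \<in> V ==> card (G2 u) = card (G2 u0)" using card_V[of u] card_V[OF u0V] by simp

lemma card_meet: assumes x: "x \<in> V" "adj x y" shows "card (N x \<inter> G2 y) = 2"
  using lv2[OF x] by (simp add: lvl_G2)

lemma G2_split: assumes x: "x \<in> V" "adj x y" shows "card (G2 x \<inter> G2 y) + 2 = card (G2 y)"
proof -
  have "z \<in> N x \<union> G2 x" if "z \<in> G2 y" for z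
    using V_cases[OF x(1) G2_V[OF V_adj[OF x] that]] adj_sym[OF x(2)] that by (auto simp: mem_G2)
  then have "G2 y = (N x \<inter> G2 y) \<union> (G2 x \<inter> G2 y)" by blast
  moreover have "card ((N x \<inter> G2 y) \<union> (G2 x \<inter> G2 y)) = card (N x \<inter> G2 y) + card (G2 x \<inter> G2 y)"
    by (intro card_Un_disjoint) (auto simp: mem_G2 mem_N)
  ultimately have "card (G2 y) = card (N x \<inter> G2 y) + card (G2 x \<inter> G2 y)" by simp
  then show ?thesis using card_meet[OF x] by simp
qed

lemma N_G2: assumes u: "u \<in> V" and z: "z \<in> G2 u" shows "N z = com u z \<union> (N z \<inter> G2 u)"
proof -
  have zV: "z \<in> V" using G2_V[OF u z] .
  have "x \<in> com u z \<union> (N z \<inter> G2 u)" if "x \<in> N z" for x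
  proof -
    have "x \<in> V" using V_N[OF zV] that by blast
    moreover have "x ~= u" using that z d_sym[of z u] by (auto simp: mem_N mem_G2)
    ultimately have "x \<in> N u \<or> x \<in> G2 u" using V_cases[OF u] by blast
    then show ?thesis using that by (auto simp: mem_com mem_N)
  qed
  moreover have "com u z \<subseteq> N z" by (auto simp: mem_com mem_N)
  ultimately show ?thesis by blast
qed

lemma card_N_G2: assumes u: "u \<in> V" and z: "z \<in> G2 u" shows "card (com u z) + card (N z \<inter> G2 u) = k"
proof -
  have "card (com u z \<union> (N z \<inter> G2 u)) = card (com u z) + card (N z \<inter> G2 u)"
    by (intro card_Un_disjoint) (auto simp: mem_com mem_G2)
  then show ?thesis using N_G2[OF u z] cN[OF G2_V[OF u z]] by simp
qed

lemma N_G2_le: assumes u: "u \<in> V" and z: "z \<in> G2 u" shows "N z \<inter> G2 u \<subseteq> G2 u - {z}" "card (N z \<inter> G2 u) \<le> card (G2 u) - 1"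
proof -
  show s: "N z \<inter> G2 u \<subseteq> G2 u - {z}" by (auto simp: mem_N)
  show "card (N z \<inter> G2 u) \<le> card (G2 u) - 1" using card_mono[OF _ s] z by simp
qed

lemma sum_N_G2: assumes u: "u \<in> V" shows "(\<Sum>z\<in>G2 u. card (N z \<inter> G2 u)) + 2 * k = k * card (G2 u)"
proof -
  have "(\<Sum>z\<in>G2 u. card (com u z) + card (N z \<inter> G2 u)) = (\<Sum>z\<in>G2 u. k)"
    by (intro sum.cong refl card_N_G2[OF u])
  then show ?thesis using sum_com[OF u] by (simp add: sum.distrib mult.commute)
qed

lemma G2_dense: assumes u: "u \<in> V" shows "k * card (G2 u) \<le> 2 * k + card (G2 u) * (card (G2 u) - 1)"
proof -
  have "(\<Sum>z\<in>G2 u. card (N z \<inter> G2 u)) \<le> (\<Sum>z\<in>G2 u. card (G2 u) - 1)" using N_G2_le[OF u] by (intro sum_mono)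
  then show ?thesis using sum_N_G2[OF u] by simp
qed

text \<open>In case of equality the vertices at distance 2 from \<open>u\<close> are pairwise adjacent.\<close>
lemma G2_clique:
  assumes u: "u \<in> V" and eq: "k * card (G2 u) = 2 * k + card (G2 u) * (card (G2 u) - 1)"
    and z: "z \<in> G2 u" "z' \<in> G2 u" "z ~= z'"
  shows "adj z z'"
proof -
  have "(\<Sum>z\<in>G2 u. card (N z \<inter> G2 u)) = (\<Sum>z\<in>G2 u. card (G2 u) - 1)" using sum_N_G2[OF u] eq by simp
  then have "card (N z \<inter> G2 u) = card (G2 u) - 1"
    using sum_mono_inv[of "\<lambda>z. card (N z \<inter> G2 u)" "G2 u" "\<lambda>_. card (G2 u) - 1"] N_G2_le[OF u] z by auto
  then have "card (N z \<inter> G2 u) = card (G2 u - {z})" using z by simp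
  then have "N z \<inter> G2 u = G2 u - {z}" using N_G2_le(1)[OF u z(1)] by (intro card_subset_eq) auto
  moreover have "z' \<in> G2 u - {z}" using z by simp
  ultimately have "z' \<in> N z" by blast
  then show ?thesis by (simp add: mem_N)
qed

lemma m_ge_2: "2 \<le> card (G2 u0)"
proof -
  obtain v where v: "adj u0 v" using edge by blast
  have "card (N v \<inter> G2 u0) = 2" using card_meet[OF V_adj[OF u0V v] adj_sym[OF v]] .
  then show ?thesis using card_mono[of "G2 u0" "N v \<inter> G2 u0"] by simp
qed

text \<open>
  The two vertices at distance 2 from \<open>y\<close> are exhausted by the level-one vertices of any edge at \<open>y\<close>. So
  a vertex adjacent to \<open>y\<close> is adjacent to them as well, and being equal or non-adjacent is transitive.
\<close>
lemma multipartite: assumes m: "card (G2 u0) = 2" shows "\<exists>t\<ge>2. multipartite N V t"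
proof -
  define C where "C x = insert x (G2 x)" for x
  have full: "adj x z" if "x \<in> V" "adj x y" "z \<in> G2 y" for x y z
  proof -
    have "card (N x \<inter> G2 y) = card (G2 y)" using card_meet[OF that(1,2)] card_G2[OF V_adj[OF that(1,2)]] m by simp
    then have "N x \<inter> G2 y = G2 y" by (intro card_subset_eq) auto
    then show ?thesis using that by (auto simp: mem_N)
  qed
  have tr: "z \<in> C x" if x: "x \<in> V" and y: "y \<in> C x" and z: "z \<in> C y" for x y z
  proof -
    have yV: "y \<in> V" and zV: "z \<in> V" using G2_V x y z unfolding C_def by blast+
    show ?thesis
    proof (rule ccontr)
      assume n: "z \<notin> C x"
      then have xz: "adj x z" using V_cases[OF x zV] unfolding C_def by (auto simp: mem_N)
      have "y ~= x" "z ~= y" using n y z unfolding C_def by auto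
      then have "y \<in> G2 x" "y \<in> G2 z" using y z G2_sym unfolding C_def by auto
      then show False using full[OF x xz] by (auto simp: mem_G2)
    qed
  qed
  have sy: "x \<in> C y" if "y \<in> C x" for x y using that G2_sym unfolding C_def by blast
  have Ceq: "C x = C y \<longleftrightarrow> y \<in> C x" if "x \<in> V" "y \<in> V" for x y
  proof
    show "C x = C y ==> y \<in> C x" unfolding C_def by blast
    show "C x = C y" if "y \<in> C x" using tr[OF \<open>x \<in> V\<close> that] tr[OF \<open>y \<in> V\<close> sy[OF that]] by blast
  qed
  have cC: "card (C x) = 3" if "x \<in> V" for x using card_G2[OF that] m unfolding C_def by (simp add: mem_G2)
  have finC: "finite (C x)" for x unfolding C_def by simp
  have adjC: "y \<in> N x \<longleftrightarrow> C x ~= C y" if "x \<in> V" "y \<in> V" for x y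
    using V_cases[OF that] Ceq[OF that] unfolding C_def by (auto simp: mem_N mem_G2)
  define Q where "Q = C ` V"
  have finQ: "finite Q" unfolding Q_def using finV by simp
  obtain g where g: "bij_betw g Q {0..<card Q}" using ex_bij_betw_finite_nat[OF finQ] by blast
  have "\<forall>q\<in>Q. \<exists>h. bij_betw h q {0..<3::nat}"
  proof
    fix q assume "q \<in> Q"
    then have "finite q" "card q = 3" using cC finC unfolding Q_def by auto
    then show "\<exists>h. bij_betw h q {0..<3::nat}" using ex_bij_betw_finite_nat by metis
  qed
  then obtain h where h: "\<And>q. q \<in> Q ==> bij_betw (h q) q {0..<3::nat}" by metis
  define f where "f x = (g (C x), h (C x) x)" for x
  have CQ: "C x \<in> Q" if "x \<in> V" for x using that unfolding Q_def by simp
  have ginj: "g (C x) = g (C y) \<longleftrightarrow> C x = C y" if "x \<in> V" "y \<in> V" for x y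
    using inj_on_eq_iff[OF bij_betw_imp_inj_on[OF g] CQ[OF that(1)] CQ[OF that(2)]] .
  have selfC: "x \<in> C x" for x unfolding C_def by simp
  have "bij_betw f V ({0..<card Q} \<times> {0..<3})"
  proof (rule bij_betw_imageI)
    show "inj_on f V"
    proof (rule inj_onI)
      fix x y assume xy: "x \<in> V" "y \<in> V" "f x = f y"
      then have C: "C x = C y" using ginj unfolding f_def by auto
      then have "h (C x) x = h (C x) y" "x \<in> C x" "y \<in> C x" using xy(3) selfC unfolding f_def by auto
      then show "x = y" using h[OF CQ[OF xy(1)]] unfolding bij_betw_def inj_on_def by blast
    qed
    show "f ` V = {0..<card Q} \<times> {0..<3}"
    proof
      show "f ` V \<subseteq> {0..<card Q} \<times> {0..<3}"
      proof
        fix y assume "y \<in> f ` V"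
        then obtain x where x: "x \<in> V" "y = f x" by blast
        have "g (C x) \<in> {0..<card Q}" using g CQ[OF x(1)] unfolding bij_betw_def by blast
        moreover have "h (C x) x \<in> {0..<3}" using h[OF CQ[OF x(1)]] selfC unfolding bij_betw_def by blast
        ultimately show "y \<in> {0..<card Q} \<times> {0..<3}" using x unfolding f_def by simp
      qed
      show "{0..<card Q} \<times> {0..<3} \<subseteq> f ` V"
      proof
        fix y assume y: "y \<in> {0..<card Q} \<times> {0..<3::nat}"
        then obtain i j where ij: "y = (i, j)" "i \<in> {0..<card Q}" "j \<in> {0..<3}" by (rule SigmaE)
        have "i \<in> g ` Q" unfolding bij_betw_imp_surj_on[OF g] by (rule ij(2))
        then obtain q where q: "q \<in> Q" "g q = i" by blast
        have "j \<in> h q ` q" unfolding bij_betw_imp_surj_on[OF h[OF q(1)]] by (rule ij(3))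
        then obtain x where x: "x \<in> q" "h q x = j" by blast
        obtain z where z: "z \<in> V" "q = C z" using q unfolding Q_def by blast
        have xV: "x \<in> V" using x z G2_V unfolding C_def by blast
        have "C x = q" using Ceq[OF z(1) xV] x z by simp
        then have "f x = y" unfolding f_def ij(1) using q(2) x(2) by simp
        then show "y \<in> f ` V" using xV by blast
      qed
    qed
  qed
  moreover have "\<forall>x\<in>V. \<forall>y\<in>V. y \<in> N x \<longleftrightarrow> fst (f x) ~= fst (f y)" using adjC ginj unfolding f_def by simp
  ultimately have M: "multipartite N V (card Q)" unfolding multipartite_def by blast
  obtain v where v: "adj u0 v" using edge by blast
  have vV: "v \<in> V" using V_adj[OF u0V v] .
  have "C u0 ~= C v" using adjC[OF u0V vV] v by (simp add: mem_N)
  then have "card {C u0, C v} = 2" by simp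
  moreover have "card {C u0, C v} \<le> card Q" using CQ u0V vV by (intro card_mono[OF finQ]) auto
  ultimately show ?thesis using M by auto
qed

lemma k3_com: "k = 3 ==> x \<in> V ==> adj x y ==> com x y = {}" using ccom[of x y] by simp

lemma petersen: assumes k3: "k = 3" and m: "card (G2 u0) = 6" shows "realizes petersen_table N V"
proof -
  have c1: "card (com x y) = 1" if x: "x \<in> V" and y: "y \<in> G2 x" for x y
  proof -
    have "(\<Sum>z\<in>G2 x. 1) = (\<Sum>z\<in>G2 x. card (com x z))" using sum_com[OF x] k3 card_G2[OF x] m by simp
    then show ?thesis using sum_mono_inv[of "\<lambda>_. 1" "G2 x" "\<lambda>z. card (com x z)"] com_pos[of _ x] y by fastforce
  qed
  have M: "moore N V"
  proof
    show "N x \<subseteq> V" if "x \<in> V" for x using V_N[OF that] .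
    show "card (N x) = 3" if "x \<in> V" for x using cN[OF that] k3 by simp
    show "x \<in> N y" if "y \<in> N x" for x y using that adj_sym[of x y] by (simp add: mem_N)
    show "x \<notin> N x" for x by (simp add: mem_N)
    show "N x \<inter> N y = {}" if "x \<in> V" "y \<in> N x" for x y using k3_com[OF k3 that(1)] that(2) by (simp add: mem_N com_N)
    show "card (N x \<inter> N y) = 1" if "x \<in> V" "y \<in> V" "x ~= y" "y \<notin> N x" for x y
      using c1[OF that(1), of y] V_cases[OF that(1,2)] that by (auto simp: com_N)
  qed
  show ?thesis by (rule moore.petersen[OF M u0V])
qed

lemma co_petersen: assumes k6: "k = 6" and m: "card (G2 u0) = 3" shows "realizes petersen_table G2 V"
proof -
  have cl: "adj z z'" if "x \<in> V" "z \<in> G2 x" "z' \<in> G2 x" "z ~= z'" for x z z'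
    using G2_clique[OF that(1) _ that(2-4)] card_G2[OF that(1)] m k6 by simp
  have M: "moore G2 V"
  proof
    show "G2 x \<subseteq> V" if "x \<in> V" for x using G2_V[OF that] by blast
    show "card (G2 x) = 3" if "x \<in> V" for x using card_G2[OF that] m by simp
    show "x \<in> G2 y" if "y \<in> G2 x" for x y using G2_sym[OF that] .
    show "x \<notin> G2 x" for x by (simp add: mem_G2)
    show "G2 x \<inter> G2 y = {}" if "x \<in> V" "y \<in> G2 x" for x y
    proof -
      have False if z: "z \<in> G2 x" "z \<in> G2 y" for z
      proof -
        have "y ~= z" using z(2) by (auto simp: mem_G2)
        then show False using cl[OF \<open>x \<in> V\<close> \<open>y \<in> G2 x\<close> z(1)] z(2) by (simp add: mem_G2)
      qed
      then show ?thesis by blast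
    qed
    show "card (G2 x \<inter> G2 y) = 1" if "x \<in> V" "y \<in> V" "x ~= y" "y \<notin> G2 x" for x y
    proof -
      have "adj x y" using V_cases[OF that(1,2)] that by (auto simp: mem_N)
      then show ?thesis using G2_split[OF that(1), of y] card_G2[OF that(2)] m by linarith
    qed
  qed
  show ?thesis by (rule moore.petersen[OF M u0V])
qed

text \<open>
  The graph on the pairs at distance 2 is triangle-free of valency 4, and adjacent vertices share two
  of its neighbours. Two vertices at distance 2 from \<open>v\<close> would then share three.
\<close>
lemma not_6_4: assumes k6: "k = 6" and m: "card (G2 u0) = 4" shows False
proof -
  have cl: "adj z z'" if "x \<in> V" "z \<in> G2 x" "z' \<in> G2 x" "z ~= z'" for x z z'
    using G2_clique[OF that(1) _ that(2-4)] card_G2[OF that(1)] m k6 by simp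
  have two: "card (G2 x \<inter> G2 y) = 2" if "x \<in> V" "adj x y" for x y
    using G2_split[OF that] card_G2[OF V_adj[OF that]] m by simp
  obtain v where v: "adj u0 v" using edge by blast
  have vV: "v \<in> V" using V_adj[OF u0V v] .
  have "card (N u0 \<inter> G2 v) = 2" using card_meet[OF u0V v] .
  then obtain x y where xy: "N u0 \<inter> G2 v = {x, y}" "x ~= y" by (meson card_2_iff)
  then have x: "adj u0 x" "x \<in> G2 v" and y: "adj u0 y" "y \<in> G2 v" by (auto simp: mem_N set_eq_iff)
  have comp: "G2 u0 \<inter> G2 z = G2 u0 - G2 v" if z: "adj u0 z" "z \<in> G2 v" for z
  proof (rule card_subset_eq)
    have "False" if t: "t \<in> G2 z" "t \<in> G2 v" for t
    proof -
      have "z ~= t" using t(1) by (auto simp: mem_G2)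
      then show False using cl[OF vV z(2) t(2)] t(1) by (simp add: mem_G2)
    qed
    then show "G2 u0 \<inter> G2 z \<subseteq> G2 u0 - G2 v" by blast
    have "card (G2 u0 - G2 v) = card (G2 u0 - (G2 u0 \<inter> G2 v))" by (rule arg_cong[of _ _ card]) blast
    also have "\<dots> = card (G2 u0) - card (G2 u0 \<inter> G2 v)" by (intro card_Diff_subset) auto
    finally show "card (G2 u0 \<inter> G2 z) = card (G2 u0 - G2 v)" using two[OF u0V v] two[OF u0V z(1)] m by simp
  qed simp
  have sub: "insert v (G2 u0 - G2 v) \<subseteq> G2 x \<inter> G2 y" using comp[OF x] comp[OF y] G2_sym x(2) y(2) by blast
  have "card (G2 u0 - G2 v) = 2" using comp[OF x] two[OF u0V x(1)] by simp
  moreover have "v \<notin> G2 u0 - G2 v" using v by (auto simp: mem_G2)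
  ultimately have "card (insert v (G2 u0 - G2 v)) = 3" by simp
  moreover have "card (G2 x \<inter> G2 y) = 2" using two[OF V_adj[OF u0V x(1)] cl[OF vV x(2) y(2) xy(2)]] .
  moreover have "card (insert v (G2 u0 - G2 v)) \<le> card (G2 x \<inter> G2 y)" by (intro card_mono[OF _ sub]) simp
  ultimately show False by simp
qed

lemma moebius_aux:
  assumes k3: "k = 3" and u: "u \<in> V" and Nu: "N u = {a, b, c}" and dis: "distinct [a, b, c]" "distinct [x, t, y, s]"
    and L: "N a \<inter> G2 u = {x, t}" "N b \<inter> G2 u = {x, y}" "N c \<inter> G2 u = {y, s}" and G: "G2 u = {x, t, y, s}"
  shows "realizes moebius_table N V"
proof -
  have NA: "N v = insert u (N v \<inter> G2 u)" if "v \<in> N u" for v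
    using N_split[of v u] k3_com[OF k3 u, of v] that adj_sym[of u v] com_commute[of u v] by (auto simp: mem_N lvl_G2)
  have nt: "\<not> adj z z'" if "v \<in> N u" "z \<in> N v \<inter> G2 u" "z' \<in> N v \<inter> G2 u" for v z z'
    using k3_com[OF k3, of v z] that V_N[OF u] by (auto simp: mem_N mem_com set_eq_iff)
  have cm: "v \<in> com u z \<longleftrightarrow> v \<in> N u \<and> z \<in> N v \<inter> G2 u" if "z \<in> G2 u" for v z
    unfolding mem_com mem_N Int_iff using that adj_sym[of v z] adj_sym[of z v] by blast
  have NZ: "N z = S" if z: "z \<in> G2 u" and S: "card S = 3" "\<And>v. v \<in> com u z ==> v \<in> S" "\<And>v. v \<in> G2 u ==> adj z v ==> v \<in> S" for z S
  proof (rule card_seteq)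
    show "N z \<subseteq> S"
    proof
      fix v assume v: "v \<in> N z"
      then have "v \<in> com u z \<or> v \<in> G2 u" using N_G2[OF u z] by blast
      then show "v \<in> S" using S(2,3) v by (auto simp: mem_N)
    qed
    show "card S \<le> card (N z)" using S(1) cN[OF G2_V[OF u z]] k3 by simp
    show "finite S" using S(1) by (intro card_ge_0_finite) simp
  qed
  have lev: "\<forall>z\<in>{a, b, c}. d u z = 1" "\<forall>z\<in>{x, t, y, s}. d u z = 2"
    unfolding Nu[symmetric] G[symmetric] by (simp_all add: mem_N mem_G2)
  have dj: "{a, b, c} \<inter> {x, t, y, s} = {}" using lev by fastforce
  have na: "\<not> adj x t" "\<not> adj t x" "\<not> adj x y" "\<not> adj y x" "\<not> adj y s" "\<not> adj s y"
    using nt[of a x t] nt[of a t x] nt[of b x y] nt[of b y x] nt[of c y s] nt[of c s y] Nu L by auto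
  have cv: "v = a \<and> z \<in> {x, t} \<or> v = b \<and> z \<in> {x, y} \<or> v = c \<and> z \<in> {y, s}" if z: "z \<in> G2 u" and v: "v \<in> com u z" for v z
  proof -
    have zv: "v \<in> {a, b, c}" "z \<in> N v \<inter> G2 u" using cm[OF z] v unfolding Nu by blast+
    from zv(1) consider "v = a" | "v = b" | "v = c" by blast
    then show ?thesis
    proof cases
      case 1 show ?thesis using 1 zv(2)[unfolded 1 L(1)] by simp
    next
      case 2 show ?thesis using 2 zv(2)[unfolded 2 L(2)] by simp
    next
      case 3 show ?thesis using 3 zv(2)[unfolded 3 L(3)] by simp
    qed
  qed
  have zG: "x \<in> G2 u" "t \<in> G2 u" "y \<in> G2 u" "s \<in> G2 u" using G by auto
  have cx: "com u x \<subseteq> {a, b}" "com u t \<subseteq> {a}" "com u y \<subseteq> {b, c}" "com u s \<subseteq> {c}"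
    using cv[OF zG(1)] cv[OF zG(2)] cv[OF zG(3)] cv[OF zG(4)] dis(2) by fastforce+
  have Nx: "N x = {a, b, s}" by (rule NZ) (use cx na G dis dj in auto)
  have Nt: "N t = {a, y, s}" by (rule NZ) (use cx na G dis dj in auto)
  have Ny: "N y = {b, c, t}" by (rule NZ) (use cx na G dis dj in auto)
  have Ns: "N s = {c, x, t}" by (rule NZ) (use cx na G dis dj in auto)
  have NB: "N a = {u, x, t}" "N b = {u, x, y}" "N c = {u, y, s}" using NA[of a] NA[of b] NA[of c] Nu L by auto
  let ?vs = "[u, a, t, y, b, x, s, c]"
  show ?thesis
  proof (rule realize[OF u])
    have "u \<notin> {a, b, c}" "u \<notin> {x, t, y, s}" using lev by fastforce+
    then show "distinct ?vs" using dis dj by auto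
    show "\<forall>z\<in>set ?vs. d u z \<le> D" using lev D2 by simp
    show "map N ?vs = map (\<lambda>r. (!) ?vs ` set r) moebius_table"
      by (simp add: moebius_table_def Nx Nt Ny Ns NB Nu insert_commute)
  qed (simp_all add: moebius_table_def)
qed

lemma moebius: assumes k3: "k = 3" and m: "card (G2 u0) = 4" shows "realizes moebius_table N V"
proof -
  define u where "u = u0"
  have u: "u \<in> V" and g4: "card (G2 u) = 4" unfolding u_def using u0V m by auto
  have sum: "(\<Sum>z\<in>G2 u. card (com u z)) = 6" using sum_com[OF u] k3 by simp
  have sub: "com u z \<subseteq> N u" for z by (auto simp: mem_com mem_N)
  have le3: "card (com u z) \<le> 3" for z using card_mono[OF finite_N sub] cN[OF u] k3 by simp
  have cNG: "card (N z \<inter> G2 u) = 3 - card (com u z)" if "z \<in> G2 u" for z using card_N_G2[OF u that] k3 by simp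
  have n3: "card (com u z) ~= 3" if z: "z \<in> G2 u" for z
  proof
    assume c3: "card (com u z) = 3"
    have Nz: "N z \<inter> G2 u = {}" using cNG[OF z] c3 by (simp add: card_eq_0_iff)
    let ?R = "G2 u - {z}"
    have cR: "card ?R = 3" using g4 z by simp
    have "(\<Sum>z'\<in>?R. card (com u z')) = 3" using sum c3 sum.remove[OF fin_G2 z, of "\<lambda>z. card (com u z)"] by simp
    then have "(\<Sum>z'\<in>?R. 1) = (\<Sum>z'\<in>?R. card (com u z'))" using cR by simp
    then have one: "card (com u z') = 1" if "z' \<in> ?R" for z'
      using sum_mono_inv[of "\<lambda>_. 1" ?R "\<lambda>z. card (com u z)"] com_pos[of _ u] that by fastforce
    have full: "N z' \<inter> G2 u = ?R - {z'}" if z': "z' \<in> ?R" for z'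
    proof (rule card_subset_eq)
      have "\<not> adj z' z" using Nz z' adj_sym[of z' z] by (auto simp: mem_N)
      then show "N z' \<inter> G2 u \<subseteq> ?R - {z'}" by (auto simp: mem_N)
      show "card (N z' \<inter> G2 u) = card (?R - {z'})" using cNG[of z'] one[OF z'] z' cR by simp
    qed simp
    obtain p q r where pqr: "?R = {p, q, r}" "p ~= q" "q ~= r" "p ~= r" using cR by (metis card_3_iff)
    then have "adj p q" "adj p r" "adj q r" using full[of p] full[of q] by (auto simp: mem_N set_eq_iff)
    moreover have "p \<in> V" using G2_V[OF u] pqr(1) by blast
    ultimately show False using k3_com[OF k3, of p q] by (auto simp: mem_com set_eq_iff)
  qed
  have "\<exists>x\<in>G2 u. card (com u x) = 2"
  proof (rule ccontr)
    assume n: "\<not> ?thesis"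
    have "card (com u z) = 1" if "z \<in> G2 u" for z
    proof -
      have "card (com u z) ~= 2" using n that by blast
      then show ?thesis using n3[OF that] le3[of z] com_pos[OF that] by linarith
    qed
    then have "(\<Sum>z\<in>G2 u. card (com u z)) = 4" using g4 by simp
    then show False using sum by simp
  qed
  then obtain x where x: "x \<in> G2 u" "card (com u x) = 2" by blast
  obtain a b where ab: "com u x = {a, b}" "a ~= b" using x(2) by (meson card_2_iff)
  have "{a, b} \<subseteq> N u" using sub ab by metis
  then have "card (N u - {a, b}) = 1" using cN[OF u] k3 ab(2) by (simp add: card_Diff_subset)
  then obtain c where "N u - {a, b} = {c}" by (rule card_1_singletonE)
  then have Nu: "N u = {a, b, c}" "c ~= a" "c ~= b" using \<open>{a, b} \<subseteq> N u\<close> by blast+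
  have L2: "card (N v \<inter> G2 u) = 2" if "v \<in> N u" for v
    using card_meet[of v u] that V_N[OF u] adj_sym[of u v] by (auto simp: mem_N)
  have other: "\<exists>q. N v \<inter> G2 u = {p, q} \<and> p ~= q" if "v \<in> N u" "p \<in> N v" "p \<in> G2 u" for v p
  proof -
    have "card (N v \<inter> G2 u) = 2" using L2[OF that(1)] .
    then obtain x y where xy: "N v \<inter> G2 u = {x, y}" "x ~= y" by (meson card_2_iff)
    have "p \<in> {x, y}" using that(2,3) xy(1) by blast
    then show ?thesis using xy by (auto simp: insert_commute)
  qed
  have cm: "v \<in> com u z \<longleftrightarrow> v \<in> N u \<and> z \<in> N v" for v z unfolding mem_com mem_N using adj_sym[of v z] adj_sym[of z v] by auto
  have xa: "x \<in> N a" "x \<in> N b" "x \<notin> N c" using cm[of _ x] ab Nu by auto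
  obtain t where t: "N a \<inter> G2 u = {x, t}" "x ~= t" using other[of a x] xa x Nu by auto
  obtain y where y: "N b \<inter> G2 u = {x, y}" "x ~= y" using other[of b x] xa x Nu by auto
  have tG: "t \<in> G2 u" "y \<in> G2 u" using t y by blast+
  have cover: "\<exists>v\<in>{a, b, c}. z \<in> N v" if "z \<in> G2 u" for z
  proof -
    obtain v where "v \<in> com u z" using G2_pred[OF \<open>z \<in> G2 u\<close>] by blast
    then show ?thesis using cm[of v z] Nu by blast
  qed
  have nt: "\<not> adj z z'" if "v \<in> N u" "z \<in> N v \<inter> G2 u" "z' \<in> N v \<inter> G2 u" for v z z'
    using k3_com[OF k3, of v z] that V_N[OF u] by (auto simp: mem_N mem_com set_eq_iff)
  have ty: "t ~= y"
  proof
    assume eq: "t = y"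
    obtain p q where pq: "N c \<inter> G2 u = {p, q}" "p ~= q" using L2[of c] Nu by (auto simp: card_2_iff)
    have np: "adj p x" if p: "N c \<inter> G2 u = {p, q}" "p ~= q" for p q
    proof -
      have pG: "p \<in> G2 u" "p \<in> N c" using p by blast+
      have px: "p ~= x" using pG xa by blast
      have pt: "p ~= t"
      proof
        assume "p = t"
        then have "com u t = N u" using cm[of _ t] Nu t y eq pG by auto
        then show False using n3[OF tG(1)] cN[OF u] k3 by simp
      qed
      have "com u p \<subseteq> {c}" using cm[of _ p] Nu t y eq px pt pG by auto
      then have "card (com u p) \<le> 1" using card_mono[of "{c}" "com u p"] by simp
      then have n2: "2 \<le> card (N p \<inter> G2 u)" using cNG[OF pG(1)] by simp
      have qx: "q ~= x" "q \<in> G2 u" "q \<in> N c" using p xa by blast+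
      have qt: "q ~= t"
      proof
        assume "q = t"
        then have "com u t = N u" using cm[of _ t] Nu t y eq qx by auto
        then show False using n3[OF tG(1)] cN[OF u] k3 by simp
      qed
      have "{x, t, p, q} \<subseteq> G2 u" "card {x, t, p, q} = 4" using x tG pG qx px pt qt t(2) p(2) by auto
      then have G: "G2 u = {x, t, p, q}" using card_subset_eq[OF fin_G2, of "{x, t, p, q}" u] g4 by simp
      have "\<not> adj p q" using nt[of c p q] Nu p by auto
      then have s: "N p \<inter> G2 u \<subseteq> {x, t}" using G by (auto simp: mem_N)
      have "N p \<inter> G2 u = {x, t}" using card_seteq[OF _ s] n2 t(2) by simp
      then show ?thesis by (auto simp: mem_N)
    qed
    have "adj p x" "adj q x" using np[OF pq] np[of q p] pq by (auto simp: insert_commute)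
    then have "{a, b, p, q} \<subseteq> N x" using adj_sym[of p x] adj_sym[of q x] ab(1) by (auto simp: mem_N mem_com set_eq_iff)
    moreover have "card {a, b, p, q} = 4"
    proof -
      have "d u a = 1" "d u b = 1" "d u p = 2" "d u q = 2" using Nu pq(1) by (auto simp: mem_N[symmetric] mem_G2[symmetric])
      then have "a ~= p" "a ~= q" "b ~= p" "b ~= q" by auto
      then show ?thesis using ab(2) pq(2) by simp
    qed
    ultimately show False using card_mono[OF finite_N[of x], of "{a, b, p, q}"] cN[OF G2_V[OF u x(1)]] k3 by simp
  qed
  have "card (G2 u - {x, t, y}) = 1" using g4 x tG t y ty by (subst card_Diff_subset) auto
  then obtain s where "G2 u - {x, t, y} = {s}" by (rule card_1_singletonE)
  then have G: "G2 u = {x, t, y, s}" "s ~= x" "s ~= t" "s ~= y" using x tG by blast+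
  have "s \<in> N c" using cover[of s] G t y by blast
  then obtain r where r: "N c \<inter> G2 u = {s, r}" "s ~= r" using other[of c s] G Nu by auto
  have "r \<in> G2 u" "r \<in> N c" using r by blast+
  then have "r = y \<or> r = t" using G xa r by auto
  then show ?thesis
  proof
    assume "r = y"
    then show ?thesis using moebius_aux[OF k3 u Nu(1), of x t y s] ab Nu t y ty G r by (auto simp: insert_commute)
  next
    assume "r = t"
    moreover have "N u = {b, a, c}" using Nu by auto
    ultimately show ?thesis using moebius_aux[OF k3 u, of b a c x y t s] ab Nu t y ty G r by (auto simp: insert_commute)
  qed
qed

text \<open>
  The two bounds on the number of vertices at distance 2 leave the valencies 3, 4, 5 and 6, unless that
  number is 2 and the graph is complete multipartite.
\<close>
lemma diameter_2:
  "realizes petersen_table N V \<or> realizes petersen_table G2 V \<or> (\<exists>t\<ge>2. multipartite N V t)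
   \<or> realizes moebius_table N V \<or> realizes paley9_table N V"
proof (cases "card (G2 u0) = 2")
  case True then show ?thesis using multipartite by blast
next
  case False
  let ?m = "card (G2 u0)"
  have m3: "3 \<le> ?m" using m_ge_2 False by linarith
  have b1: "?m * (k - 3) \<le> 2 * k" and b2: "?m \<le> 2 * k" using G2_bound[OF u0V] by auto
  have b3: "k * ?m \<le> 2 * k + ?m * (?m - 1)" using G2_dense[OF u0V] .
  have k5: "k ~= 5"
  proof
    assume "k = 5"
    then obtain a0 a1 a2 a3 a4 x0 x1 x2 x3 x4 where "pent d k D u0 u0 a0 a1 a2 a3 a4 x0 x1 x2 x3 x4"
      using pent_exists[OF _ u0V] by metis
    then show False using pent.D_not_2 D2 by metis
  qed
  have "k \<le> 6"
  proof (rule ccontr)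
    assume k7: "\<not> k \<le> 6"
    have "?m < 4"
    proof (rule ccontr)
      assume "\<not> ?m < 4"
      then have "4 * (k - 3) \<le> ?m * (k - 3)" by simp
      then show False using b1 k7 by linarith
    qed
    then have "?m = 3" using m3 by simp
    then show False using b3 k7 by simp
  qed
  then consider "k = 3" | "k = 4" | "k = 6" using k_ge_3 k5 by linarith
  then show ?thesis
  proof cases
    case 1
    have "even (4 + ?m)" using even_V card_V[OF u0V] 1 by simp
    moreover have "?m \<in> {3, 4, 5, 6}" using m3 b2 1 by auto
    ultimately have "?m = 4 \<or> ?m = 6" by auto
    then show ?thesis using petersen[OF 1] moebius[OF 1] by blast
  next
    case 2
    then obtain a b c e where Q: "quad d k D u0 u0 a b c e" using quad_exists[OF 2 u0V] by metis
    show ?thesis using quad.paley9[OF Q D2] by blast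
  next
    case 3
    have "?m \<in> {3, 4}" using m3 b1 3 by auto
    then show ?thesis using co_petersen[OF 3] not_6_4[OF 3] by blast
  qed
qed

end

declare One_nat_def [simp] One_nat_def [symmetric, simp del]

section \<open>Distances and isomorphisms of graphs\<close>

definition nbrs :: "'a pair_pre_digraph \<Rightarrow> 'a \<Rightarrow> 'a set" where "nbrs G x = {y. (x, y) \<in> parcs G}"

definition gd :: "'a pair_pre_digraph \<Rightarrow> 'a \<Rightarrow> 'a \<Rightarrow> nat" where
  "gd G x y = (LEAST n. (x, y) \<in> parcs G ^^ n)"

lemma (in wf_digraph) awalk_cost_one: "awalk_cost (\<lambda>_. 1) p = real (length p)"
  by (induction p) simp_all

lemma (in pair_wf_digraph) awalk_relpow:
  "(\<exists>p. awalk u p v \<and> length p = n) \<longleftrightarrow> u \<in> pverts G \<and> (u, v) \<in> parcs G ^^ n"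
proof (induction n arbitrary: u)
  case 0
  have "(\<exists>p. awalk u p v \<and> length p = 0) \<longleftrightarrow> awalk u [] v" by auto
  then show ?case by (auto simp: awalk_Nil_iff)
next
  case (Suc n)
  have "(\<exists>p. awalk u p v \<and> length p = Suc n) \<longleftrightarrow> (\<exists>e p. awalk u (e # p) v \<and> length p = n)"
    by (metis length_Suc_conv)
  also have "\<dots> \<longleftrightarrow> (\<exists>z. (u, z) \<in> parcs G \<and> (\<exists>p. awalk z p v \<and> length p = n))"
    unfolding awalk_Cons_iff by auto
  also have "\<dots> \<longleftrightarrow> (\<exists>z. (u, z) \<in> parcs G \<and> (z, v) \<in> parcs G ^^ n)"
    unfolding Suc.IH using in_arcsD2 by fastforce
  also have "\<dots> \<longleftrightarrow> u \<in> pverts G \<and> (u, v) \<in> parcs G ^^ Suc n"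
    using in_arcsD1 relpow_Suc_D2 relpow_Suc_I2 by (metis fst_conv)
  finally show ?case .
qed

locale conn_graph = pair_graph + assumes conn: "Digraph_Component.connected (with_proj G)"
begin

abbreviation "R \<equiv> parcs G"
abbreviation "V \<equiv> pverts G"

lemma arc_V: "(x, y) \<in> R ==> x \<in> V \<and> y \<in> V" using in_arcsD1 in_arcsD2 by fastforce
lemma arc_sym: "(x, y) \<in> R ==> (y, x) \<in> R" using arcs_symmetric by blast
lemma arc_irr: "(x, x) \<notin> R" using no_loops' by blast

lemma reach: assumes "x \<in> V" "y \<in> V" obtains n where "(x, y) \<in> R ^^ n"
proof -
  have "symmetric (with_proj G)" by (rule sym_arcs)
  then have "x \<rightarrow>\<^sup>*\<^bsub>with_proj G\<^esub> y"
    using conn assms reachable_mk_symmetric_eq unfolding connected_def strongly_connected_def by simp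
  then obtain p where "awalk x p y" unfolding reachable_awalk by blast
  then have "(x, y) \<in> R ^^ length p" using awalk_relpow[of x y "length p"] by blast
  then show ?thesis using that by blast
qed

lemma gd_walk: assumes "x \<in> V" "y \<in> V" shows "(x, y) \<in> R ^^ gd G x y"
  using reach[OF assms] unfolding gd_def by (metis LeastI)

lemma gd_le: "(x, y) \<in> R ^^ n ==> gd G x y \<le> n" unfolding gd_def by (rule Least_le)

lemma dist_gd: assumes "x \<in> V" "y \<in> V" shows "graph_dist G x y = ereal (real (gd G x y))"
proof -
  have eq: "graph_dist G x y = (INF p\<in>{p. awalk x p y}. ereal (real (length p)))"
    unfolding graph_dist_def \<mu>_def awalk_cost_one ..
  obtain p where p: "awalk x p y" "length p = gd G x y" using awalk_relpow[of x y] gd_walk[OF assms] assms by blast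
  show ?thesis unfolding eq
  proof (rule antisym)
    show "(INF p\<in>{p. awalk x p y}. ereal (real (length p))) \<le> ereal (real (gd G x y))"
      using p by (intro INF_lower2[of p]) auto
    have "gd G x y \<le> length q" if "awalk x q y" for q using awalk_relpow[of x y "length q"] gd_le that by blast
    then show "ereal (real (gd G x y)) \<le> (INF p\<in>{p. awalk x p y}. ereal (real (length p)))"
      by (intro INF_greatest) auto
  qed
qed

lemma gd_0: assumes "x \<in> V" "y \<in> V" shows "gd G x y = 0 \<longleftrightarrow> x = y"
  using gd_walk[OF assms] gd_le[of x y 0] by auto

lemma gd_1: assumes "x \<in> V" "y \<in> V" shows "gd G x y = 1 \<longleftrightarrow> (x, y) \<in> R"
proof
  show "gd G x y = 1 ==> (x, y) \<in> R" using gd_walk[OF assms] by simp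
  assume a: "(x, y) \<in> R"
  then have "gd G x y \<le> 1" "x ~= y" using gd_le[of x y 1] arc_irr by auto
  then show "gd G x y = 1" using gd_0[OF assms] by linarith
qed

lemma gd_tri: assumes "x \<in> V" "y \<in> V" "z \<in> V" shows "gd G x z \<le> gd G x y + gd G y z"
proof -
  have "(x, z) \<in> R ^^ gd G x y O R ^^ gd G y z" using gd_walk assms by blast
  then show ?thesis using gd_le by (simp add: relpow_add)
qed

lemma walk_rev: "(x, y) \<in> R ^^ n ==> (y, x) \<in> R ^^ n"
proof (induction n arbitrary: x)
  case (Suc n)
  then obtain z where "(x, z) \<in> R" "(z, y) \<in> R ^^ n" by (meson relpow_Suc_D2)
  then show ?case using Suc.IH arc_sym by auto
qed simp

lemma gd_sym: assumes "x \<in> V" "y \<in> V" shows "gd G x y = gd G y x"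
  using gd_le walk_rev gd_walk assms by (metis antisym)

lemma gd_step: assumes "x \<in> V" "y \<in> V" "gd G x y = Suc n"
  obtains z where "(x, z) \<in> R" "gd G z y = n"
proof -
  have "(x, y) \<in> R ^^ Suc n" using gd_walk[OF assms(1,2)] assms(3) by simp
  then obtain z where z: "(x, z) \<in> R" "(z, y) \<in> R ^^ n" by (meson relpow_Suc_D2)
  have "gd G z y \<le> n" using gd_le z by blast
  moreover have "gd G x y \<le> 1 + gd G z y" using gd_tri[OF assms(1) _ assms(2), of z] gd_1[OF assms(1), of z] z arc_V[OF z(1)] by simp
  ultimately show ?thesis using that[OF z(1)] assms(3) by simp
qed

lemma fin_V: "finite V" using finite_verts by simp

lemma closer_gd: assumes "u \<in> V" "v \<in> V" shows "closer G u v = {x \<in> V. gd G x u < gd G x v}"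
  unfolding closer_def using assms dist_gd by auto

lemma diameter_gd:
  assumes "graph_diameter G = ereal (real d)" "V ~= {}"
  shows "x \<in> V ==> y \<in> V ==> gd G x y \<le> d" and "\<exists>x\<in>V. \<exists>y\<in>V. gd G x y = d"
proof -
  let ?A = "(\<lambda>(u, v). graph_dist G u v) ` (V \<times> V)"
  have fin: "finite ?A" "?A ~= {}" using fin_V assms(2) by auto
  have M: "Max ?A = ereal (real d)" using assms(1) unfolding graph_diameter_def .
  show "gd G x y \<le> d" if "x \<in> V" "y \<in> V" for x y
  proof -
    have "graph_dist G x y \<in> ?A" using that by (intro image_eqI[of _ _ "(x, y)"]) auto
    then have "graph_dist G x y \<le> ereal (real d)" using Max_ge[OF fin(1)] M by metis
    then show ?thesis using dist_gd[OF that] by simp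
  qed
  have "ereal (real d) \<in> ?A" using Max_in[OF fin] M by simp
  then obtain x y where "x \<in> V" "y \<in> V" "graph_dist G x y = ereal (real d)" by auto
  then show "\<exists>x\<in>V. \<exists>y\<in>V. gd G x y = d" using dist_gd by fastforce
qed

lemma regular_nbrs: assumes "regular_graph G k" "x \<in> V" shows "card (nbrs G x) = k"
proof -
  have "out_arcs (with_proj G) x = Pair x ` nbrs G x" unfolding out_arcs_def nbrs_def by auto
  then have "card (nbrs G x) = out_degree (with_proj G) x"
    unfolding out_degree_def by (simp add: card_image inj_on_def)
  then show ?thesis using assms unfolding regular_graph_def by simp
qed

lemma nbrs_V: "nbrs G x \<subseteq> V" unfolding nbrs_def using arc_V by blast

lemma iso_iff: "graph_iso G H \<longleftrightarrow> (\<exists>f. inj_on f V \<and> pverts H = f ` V \<and> parcs H = map_prod f f ` R)"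
proof
  assume "graph_iso G H"
  then obtain h where h: "digraph_isomorphism h" "with_proj H = app_iso h (with_proj G)"
    unfolding graph_iso_def digraph_iso_def by blast
  let ?f = "iso_verts h"
  have t: "iso_tail h = fst" "iso_head h = snd" "pverts H = ?f ` V" "parcs H = iso_arcs h ` R"
    using h(2) unfolding with_proj_def app_iso_def by simp_all
  have "iso_arcs h a = map_prod ?f ?f a" if "a \<in> R" for a
    using h(1) that t unfolding digraph_isomorphism_def by (auto simp: prod_eq_iff)
  then have "iso_arcs h ` R = map_prod ?f ?f ` R" by (intro image_cong) auto
  then show "\<exists>f. inj_on f V \<and> pverts H = f ` V \<and> parcs H = map_prod f f ` R"
    using t h(1) unfolding digraph_isomorphism_def by auto
next
  assume "\<exists>f. inj_on f V \<and> pverts H = f ` V \<and> parcs H = map_prod f f ` R"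
  then obtain f where f: "inj_on f V" "pverts H = f ` V" "parcs H = map_prod f f ` R" by blast
  define h where "h = \<lparr> iso_verts = f, iso_arcs = map_prod f f, iso_head = snd, iso_tail = fst \<rparr>"
  have "inj_on (map_prod f f) R"
    by (rule inj_on_subset[OF map_prod_inj_on[OF f(1) f(1)]]) (use arc_V in auto)
  then have "digraph_isomorphism h" unfolding digraph_isomorphism_def h_def using f(1) wf_digraph_axioms by auto
  moreover have "with_proj H = app_iso h (with_proj G)"
    unfolding h_def app_iso_def with_proj_def using f by simp
  ultimately show "graph_iso G H" unfolding graph_iso_def digraph_iso_def by blast
qed

lemma iso_nbrs: assumes H: "parcs H \<subseteq> pverts H \<times> pverts H"
  shows "graph_iso G H \<longleftrightarrow> (\<exists>f. bij_betw f V (pverts H) \<and> (\<forall>x\<in>V. nbrs H (f x) = f ` nbrs G x))"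
proof -
  have "parcs H = map_prod f f ` R \<longleftrightarrow> (\<forall>x\<in>V. nbrs H (f x) = f ` nbrs G x)" if f: "inj_on f V" "pverts H = f ` V" for f
  proof
    assume eq: "parcs H = map_prod f f ` R"
    show "\<forall>x\<in>V. nbrs H (f x) = f ` nbrs G x"
    proof
      fix x assume x: "x \<in> V"
      have "y \<in> nbrs H (f x) \<longleftrightarrow> y \<in> f ` nbrs G x" for y
      proof
        assume "y \<in> nbrs H (f x)"
        then obtain a b where ab: "(a, b) \<in> R" "f a = f x" "y = f b" unfolding nbrs_def eq by auto
        then have "a = x" using f(1) x arc_V[OF ab(1)] by (simp add: inj_on_def)
        then show "y \<in> f ` nbrs G x" using ab unfolding nbrs_def by auto
      next
        assume "y \<in> f ` nbrs G x"
        then show "y \<in> nbrs H (f x)" unfolding nbrs_def eq by force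
      qed
      then show "nbrs H (f x) = f ` nbrs G x" by blast
    qed
  next
    assume eq: "\<forall>x\<in>V. nbrs H (f x) = f ` nbrs G x"
    have "(a, b) \<in> parcs H \<longleftrightarrow> (a, b) \<in> map_prod f f ` R" for a b
    proof
      assume ab: "(a, b) \<in> parcs H"
      then obtain x where x: "x \<in> V" "a = f x" using H f(2) by blast
      then have "b \<in> f ` nbrs G x" using ab eq unfolding nbrs_def by blast
      then show "(a, b) \<in> map_prod f f ` R" using x unfolding nbrs_def by force
    next
      assume "(a, b) \<in> map_prod f f ` R"
      then obtain x y where xy: "(x, y) \<in> R" "a = f x" "b = f y" by auto
      then have "b \<in> nbrs H a" using eq arc_V[OF xy(1)] unfolding nbrs_def by blast
      then show "(a, b) \<in> parcs H" unfolding nbrs_def by simp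
    qed
    then show "parcs H = map_prod f f ` R" by auto
  qed
  then show ?thesis unfolding iso_iff bij_betw_def by metis
qed

end

definition valid :: "nat list list \<Rightarrow> bool" where "valid T \<longleftrightarrow> (\<forall>r\<in>set T. \<forall>j\<in>set r. j < length T)"

lemma valid_nth: "valid T ==> i < length T ==> j \<in> set (T ! i) ==> j < length T" unfolding valid_def by auto

lemma realizes_bij:
  assumes "valid T"
  shows "realizes T N V \<longleftrightarrow> (\<exists>h. bij_betw h {..<length T} V \<and> (\<forall>i<length T. N (h i) = h ` set (T ! i)))"
proof
  assume "realizes T N V"
  then obtain vs where vs: "length vs = length T" "distinct vs" "set vs = V" "\<forall>i<length T. N (vs ! i) = (\<lambda>j. vs ! j) ` set (T ! i)"
    unfolding realizes_def by blast
  then show "\<exists>h. bij_betw h {..<length T} V \<and> (\<forall>i<length T. N (h i) = h ` set (T ! i))"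
    using bij_betw_nth[OF vs(2), of "{..<length T}" V] by (intro exI[of _ "\<lambda>j. vs ! j"]) simp
next
  assume "\<exists>h. bij_betw h {..<length T} V \<and> (\<forall>i<length T. N (h i) = h ` set (T ! i))"
  then obtain h where h: "bij_betw h {..<length T} V" "\<forall>i<length T. N (h i) = h ` set (T ! i)" by blast
  let ?vs = "map h [0..<length T]"
  have "inj_on h {0..<length T}" "h ` {0..<length T} = V" using h(1) unfolding bij_betw_def by (simp_all add: atLeast0LessThan)
  then have "distinct ?vs" "set ?vs = V" by (simp_all add: distinct_map)
  moreover have "N (?vs ! i) = (\<lambda>j. ?vs ! j) ` set (T ! i)" if "i < length T" for i
  proof -
    have "(\<lambda>j. ?vs ! j) ` set (T ! i) = h ` set (T ! i)" using valid_nth[OF assms that] by (intro image_cong) auto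
    then show ?thesis using h(2) that by simp
  qed
  ultimately show "realizes T N V" by (intro realizesI[of ?vs]) auto
qed

lemma (in conn_graph) iso_realizes:
  assumes H: "parcs H \<subseteq> pverts H \<times> pverts H" and T: "valid T" "realizes T (nbrs H) (pverts H)"
  shows "graph_iso G H \<longleftrightarrow> realizes T (nbrs G) V"
proof
  obtain h where h: "bij_betw h {..<length T} (pverts H)" "\<forall>i<length T. nbrs H (h i) = h ` set (T ! i)"
    using T realizes_bij by metis
  have row: "set (T ! i) \<subseteq> {..<length T}" if "i < length T" for i using valid_nth[OF T(1) that] by auto
  {
    assume "graph_iso G H"
    then obtain f where f: "bij_betw f V (pverts H)" "\<forall>x\<in>V. nbrs H (f x) = f ` nbrs G x" using iso_nbrs[OF H] by metis
    let ?g = "the_inv_into V f"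
    have g: "bij_betw ?g (pverts H) V" using bij_betw_the_inv_into[OF f(1)] .
    have fg: "f (?g y) = y" if "y \<in> pverts H" for y using f_the_inv_into_f_bij_betw[OF f(1)] that by blast
    have gf: "?g (f x) = x" if "x \<in> V" for x using the_inv_into_f_f[OF bij_betw_imp_inj_on[OF f(1)] that] .
    have "nbrs G ((?g \<circ> h) i) = (?g \<circ> h) ` set (T ! i)" if i: "i < length T" for i
    proof -
      have hi: "h i \<in> pverts H" using h(1) i unfolding bij_betw_def by blast
      then have gi: "?g (h i) \<in> V" using g unfolding bij_betw_def by blast
      have "f ` nbrs G (?g (h i)) = h ` set (T ! i)" using f(2) gi fg[OF hi] h(2) i by metis
      then have "?g ` f ` nbrs G (?g (h i)) = ?g ` h ` set (T ! i)" by simp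
      moreover have "?g ` f ` nbrs G (?g (h i)) = nbrs G (?g (h i))"
        using gf nbrs_V[of "?g (h i)"] by (force simp: image_image)
      ultimately show ?thesis by (simp add: image_comp)
    qed
    then show "realizes T (nbrs G) V"
      unfolding realizes_bij[OF T(1)] using bij_betw_trans[OF h(1) g] by blast
  }
  assume "realizes T (nbrs G) V"
  then obtain h' where h': "bij_betw h' {..<length T} V" "\<forall>i<length T. nbrs G (h' i) = h' ` set (T ! i)"
    using T(1) realizes_bij by metis
  let ?g = "the_inv_into {..<length T} h'"
  have g: "bij_betw ?g V {..<length T}" using bij_betw_the_inv_into[OF h'(1)] .
  have gh: "?g (h' i) = i" if "i < length T" for i using the_inv_into_f_f[OF bij_betw_imp_inj_on[OF h'(1)], of i] that by simp
  have "nbrs H ((h \<circ> ?g) x) = (h \<circ> ?g) ` nbrs G x" if x: "x \<in> V" for x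
  proof -
    obtain i where i: "i < length T" "x = h' i" using h'(1) x unfolding bij_betw_def by auto
    have "?g ` h' ` set (T ! i) = set (T ! i)" using gh row[OF i(1)] by (force simp: image_image)
    then have "h ` ?g ` h' ` set (T ! i) = nbrs H (h i)" using h(2) i(1) by simp
    moreover have "nbrs G x = h' ` set (T ! i)" using h'(2) i by simp
    moreover have "(h \<circ> ?g) x = h i" using gh i by simp
    ultimately show ?thesis unfolding image_comp[symmetric] by simp
  qed
  then show "graph_iso G H" unfolding iso_nbrs[OF H] using bij_betw_trans[OF g h(1)] by blast
qed

section \<open>Parameters of the graphs of the classification\<close>

text \<open>
  Truncated at 3, which is the largest distance in the graphs concerned.
\<close>
definition tdist :: "nat list list \<Rightarrow> nat \<Rightarrow> nat \<Rightarrow> nat" where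
  "tdist T i j = (if i = j then 0 else if j \<in> set (T ! i) then 1
     else if \<exists>z\<in>set (T ! i). j \<in> set (T ! z) then 2 else 3)"

definition params :: "nat list list \<Rightarrow> nat \<Rightarrow> nat \<Rightarrow> bool" where
  "params T k d \<longleftrightarrow> valid T \<and> T ~= [] \<and> T ! 0 ~= [] \<and> length (remdups (T ! 0)) = k
     \<and> list_all (\<lambda>i. list_all (\<lambda>j. tdist T i j \<le> d \<and> (tdist T i j = 3 --> (\<exists>z\<in>set (T ! i). tdist T z j = 2))) [0..<length T]) [0..<length T]
     \<and> list_ex (\<lambda>j. tdist T 0 j = d) [0..<length T]
     \<and> length (filter (\<lambda>j. tdist T j 0 < tdist T j (hd (T ! 0))) [0..<length T]) = Suc d"

text \<open>
  Any diameter and any \<open>\<gamma>\<close> are isomorphism invariants, so it suffices to evaluate them once on the table. As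
  \<open>\<gamma>\<close> is assumed constant, a single edge is enough to read it off.
\<close>
lemma (in conn_graph) params_eq:
  assumes T: "params T k' d'" "realizes T (nbrs G) V"
    and G: "regular_graph G k" "graph_diameter G = ereal (real d)" "nicely_distance_balanced G \<gamma>"
  shows "k = k' \<and> d = d' \<and> \<gamma> = d + 1"
proof -
  note P = T(1)[unfolded params_def list_all_iff list_ex_iff]
  have val: "valid T" and T0: "0 < length T" "T ! 0 ~= []" using P length_greater_0_conv by blast+
  have lk: "length (remdups (T ! 0)) = k'"
    and lf: "length (filter (\<lambda>j. tdist T j 0 < tdist T j (hd (T ! 0))) [0..<length T]) = Suc d'" using P by blast+
  have bound: "tdist T i j \<le> d'" and three: "tdist T i j = 3 ==> \<exists>z\<in>set (T ! i). tdist T z j = 2"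
    if "i < length T" "j < length T" for i j
  proof -
    have "i \<in> set [0..<length T]" "j \<in> set [0..<length T]" using that by simp_all
    then show "tdist T i j \<le> d'" "tdist T i j = 3 ==> \<exists>z\<in>set (T ! i). tdist T z j = 2" using P by blast+
  qed
  obtain h where h: "bij_betw h {..<length T} V" "\<And>i. i < length T ==> nbrs G (h i) = h ` set (T ! i)"
    using T(2) realizes_bij[OF val] by metis
  have inj: "h i = h j \<longleftrightarrow> i = j" if "i < length T" "j < length T" for i j
    using inj_on_eq_iff[OF bij_betw_imp_inj_on[OF h(1)], of i j] that by simp
  have hV: "h i \<in> V" if "i < length T" for i using bij_betwE[OF h(1)] that by blast
  have sV: "\<exists>i<length T. x = h i" if "x \<in> V" for x using that bij_betw_imp_surj_on[OF h(1)] by auto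
  have arc: "(h i, h j) \<in> R \<longleftrightarrow> j \<in> set (T ! i)" if "i < length T" "j < length T" for i j
  proof -
    have "h j \<in> nbrs G (h i) \<longleftrightarrow> (\<exists>j'\<in>set (T ! i). h j = h j')" unfolding h(2)[OF that(1)] by auto
    then show ?thesis using inj[OF that(2) valid_nth[OF val that(1)]] unfolding nbrs_def by auto
  qed
  have two: "gd G (h i) (h j) = 2 \<longleftrightarrow> tdist T i j = 2"
    and small: "gd G (h i) (h j) = 0 \<longleftrightarrow> tdist T i j = 0" "gd G (h i) (h j) = 1 \<longleftrightarrow> tdist T i j = 1"
    if ij: "i < length T" "j < length T" for i j
  proof -
    note V = hV[OF ij(1)] hV[OF ij(2)]
    show s: "gd G (h i) (h j) = 0 \<longleftrightarrow> tdist T i j = 0" "gd G (h i) (h j) = 1 \<longleftrightarrow> tdist T i j = 1"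
      using gd_0[OF V] gd_1[OF V] inj[OF ij] arc[OF ij] arc_irr[of "h i"] unfolding tdist_def by auto
    show "gd G (h i) (h j) = 2 \<longleftrightarrow> tdist T i j = 2"
    proof
      assume g2: "gd G (h i) (h j) = 2"
      then obtain z where z: "(h i, z) \<in> R" "gd G z (h j) = 1" using gd_step[OF V, of 1] by auto
      obtain z' where z': "z' < length T" "z = h z'" using sV arc_V[OF z(1)] by blast
      have "z' \<in> set (T ! i)" "j \<in> set (T ! z')"
        using z z' arc ij gd_1[OF hV[OF z'(1)] V(2)] by auto
      moreover have "tdist T i j ~= 0" "tdist T i j ~= 1" using s g2 by auto
      ultimately show "tdist T i j = 2" unfolding tdist_def by (auto split: if_splits)
    next
      assume t2: "tdist T i j = 2"
      then obtain z where z: "z \<in> set (T ! i)" "j \<in> set (T ! z)" unfolding tdist_def by (auto split: if_splits)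
      have zl: "z < length T" using valid_nth[OF val ij(1) z(1)] .
      have "(h i, h z) \<in> R" "(h z, h j) \<in> R" using arc z zl ij by auto
      then have "gd G (h i) (h j) \<le> 2" using gd_le[of "h i" "h j" 2] by (auto simp: numeral_2_eq_2)
      moreover have "gd G (h i) (h j) ~= 0" "gd G (h i) (h j) ~= 1" using s t2 by auto
      ultimately show "gd G (h i) (h j) = 2" by linarith
    qed
  qed
  have dist: "gd G (h i) (h j) = tdist T i j" if ij: "i < length T" "j < length T" for i j
  proof (cases "tdist T i j = 3")
    case False
    then have "tdist T i j = 0 \<or> tdist T i j = 1 \<or> tdist T i j = 2" unfolding tdist_def by (auto split: if_splits)
    then show ?thesis using two[OF ij] small[OF ij] by auto
  next
    case True
    then obtain z where z: "z \<in> set (T ! i)" "tdist T z j = 2" using three[OF ij] by blast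
    have zl: "z < length T" using valid_nth[OF val ij(1) z(1)] .
    have "gd G (h i) (h z) = 1" using gd_1[OF hV[OF ij(1)] hV[OF zl]] arc[OF ij(1) zl] z by simp
    then have "gd G (h i) (h j) \<le> 3" using gd_tri[OF hV[OF ij(1)] hV[OF zl] hV[OF ij(2)]] two[OF zl ij(2)] z by simp
    moreover have "gd G (h i) (h j) ~= 0" "gd G (h i) (h j) ~= 1" "gd G (h i) (h j) ~= 2"
      using small[OF ij] two[OF ij] True by auto
    ultimately show ?thesis using True by linarith
  qed
  have V0: "h 0 \<in> V" using hV T0 by blast
  have "card (nbrs G (h 0)) = k" using regular_nbrs[OF G(1) V0] .
  moreover have "card (h ` set (T ! 0)) = card (set (T ! 0))"
    using inj valid_nth[OF val T0(1)] by (intro card_image) (auto simp: inj_on_def)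
  ultimately have k: "k = k'" using h(2)[OF T0(1)] lk by (simp add: length_remdups_card_conv)
  have "V ~= {}" using V0 by blast
  note D = diameter_gd[OF G(2) this]
  obtain x y where xy: "x \<in> V" "y \<in> V" "gd G x y = d" using D(2) by blast
  obtain i j where "i < length T" "x = h i" "j < length T" "y = h j" using sV[OF xy(1)] sV[OF xy(2)] by blast
  then have "d \<le> d'" using dist[of i j] bound[of i j] xy(3) by simp
  moreover obtain j0 where j0: "j0 \<in> set [0..<length T]" "tdist T 0 j0 = d'" using P by blast
  have "j0 < length T" using j0(1) by simp
  then have "d' \<le> d" using D(1)[OF V0 hV, of j0] dist[of 0 j0] T0 j0(2) by simp
  ultimately have d: "d = d'" by simp
  let ?b = "hd (T ! 0)"
  have b: "?b \<in> set (T ! 0)" using T0 by simp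
  then have bl: "?b < length T" using valid_nth[OF val T0(1)] by blast
  have "(h 0, h ?b) \<in> R" using arc[OF T0(1) bl] b by blast
  then have "card (closer G (h 0) (h ?b)) = \<gamma>" using G(3) unfolding nicely_distance_balanced_def by blast
  moreover have "closer G (h 0) (h ?b) = h ` {j. j < length T \<and> tdist T j 0 < tdist T j ?b}"
      proof -
    have "x \<in> closer G (h 0) (h ?b) \<longleftrightarrow> x \<in> h ` {j. j < length T \<and> tdist T j 0 < tdist T j ?b}" for x
    proof
      assume "x \<in> closer G (h 0) (h ?b)"
      then have x: "x \<in> V" "gd G x (h 0) < gd G x (h ?b)" unfolding closer_gd[OF V0 hV[OF bl]] by auto
      obtain j where j: "j < length T" "x = h j" using sV[OF x(1)] by blast
      then have "tdist T j 0 < tdist T j ?b" using x(2) dist[OF j(1) T0(1)] dist[OF j(1) bl] by simp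
      then show "x \<in> h ` {j. j < length T \<and> tdist T j 0 < tdist T j ?b}" using j by blast
    next
      assume "x \<in> h ` {j. j < length T \<and> tdist T j 0 < tdist T j ?b}"
      then obtain j where j: "j < length T" "tdist T j 0 < tdist T j ?b" "x = h j" by blast
      then have "gd G x (h 0) < gd G x (h ?b)" using dist[OF j(1) T0(1)] dist[OF j(1) bl] by simp
      then show "x \<in> closer G (h 0) (h ?b)" unfolding closer_gd[OF V0 hV[OF bl]] using hV[OF j(1)] j(3) by blast
    qed
    then show ?thesis by blast
  qed
  moreover have "card (h ` {j. j < length T \<and> tdist T j 0 < tdist T j ?b}) = card {j. j < length T \<and> tdist T j 0 < tdist T j ?b}"
    using inj by (intro card_image) (auto simp: inj_on_def)
  moreover have "{j. j < length T \<and> tdist T j 0 < tdist T j ?b} = set (filter (\<lambda>j. tdist T j 0 < tdist T j ?b) [0..<length T])" by auto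
  then have "card {j. j < length T \<and> tdist T j 0 < tdist T j ?b} = Suc d'" using lf by (simp only: distinct_card distinct_filter distinct_upt)
  ultimately have "\<gamma> = d + 1" using d by simp
  then show ?thesis using k d by simp
qed

definition co :: "nat list list \<Rightarrow> nat list list" where
  "co T = map (\<lambda>i. filter (\<lambda>j. j ~= i \<and> j \<notin> set (T ! i)) [0..<length T]) [0..<length T]"

lemma valid_co: "valid (co T)" unfolding valid_def co_def by auto
lemma length_co: "length (co T) = length T" unfolding co_def by simp

lemma realizes_co: assumes T: "valid T" "realizes T N V" shows "realizes (co T) (\<lambda>x. V - {x} - N x) V"
proof -
  obtain h where h: "bij_betw h {..<length T} V" "\<And>i. i < length T ==> N (h i) = h ` set (T ! i)"
    using T(2) realizes_bij[OF T(1)] by metis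
  have "V - {h i} - N (h i) = h ` set (co T ! i)" if i: "i < length T" for i
  proof -
    have s: "set (T ! i) \<subseteq> {..<length T}" using valid_nth[OF T(1) i] by auto
    have inj: "inj_on h {..<length T}" and V: "V = h ` {..<length T}" using h(1) unfolding bij_betw_def by auto
    have "V - {h i} - N (h i) = h ` {..<length T} - h ` {i} - h ` set (T ! i)" using V h(2)[OF i] by simp
    also have "\<dots> = h ` ({..<length T} - {i} - set (T ! i))"
      using inj_on_image_set_diff[OF inj, of "{..<length T}" "{i}"] inj_on_image_set_diff[OF inj, of "{..<length T} - {i}" "set (T ! i)"] i s by auto
    also have "{..<length T} - {i} - set (T ! i) = set (co T ! i)" using i unfolding co_def by auto
    finally show ?thesis .
  qed
  then show ?thesis unfolding realizes_bij[OF valid_co] length_co using h(1) by blast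
qed

lemma realizes_cong: "(\<And>x. x \<in> V ==> N x = N' x) ==> realizes T N V \<longleftrightarrow> realizes T N' V"
  unfolding realizes_def by (metis nth_mem)

lemma params_tables:
  "params cube_table 3 3" "params cuboctahedron_table 4 3" "params icosahedron_table 5 3"
  "params petersen_table 3 2" "params (co petersen_table) 6 2" "params moebius_table 3 2" "params paley9_table 4 2"
  by code_simp+

lemma tables_valid:
  "valid cube_table" "valid cuboctahedron_table" "valid icosahedron_table"
  "valid petersen_table" "valid moebius_table" "valid paley9_table"
  using params_tables unfolding params_def by auto

section \<open>From graphs to distance functions\<close>

locale ndb_graph = conn_graph +
  fixes k D :: nat
  assumes reg: "regular_graph G k" and dia: "graph_diameter G = ereal (real D)"
    and nice: "nicely_distance_balanced G (D + 1)" and arcs: "parcs G ~= {}"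
begin

definition dd :: "'a \<Rightarrow> 'a \<Rightarrow> nat" where
  "dd x y = (if x \<in> V \<and> y \<in> V then gd G x y else if x = y then 0 else 2 * D + 2)"

lemma V_ne: "V ~= {}" using arcs arc_V by fastforce

lemma gd_le_D: "x \<in> V ==> y \<in> V ==> gd G x y \<le> D" using diameter_gd(1)[OF dia V_ne] .

lemma dd_gd: "x \<in> V ==> y \<in> V ==> dd x y = gd G x y" unfolding dd_def by simp

lemma dd_V: "x \<in> V ==> dd x y \<le> 2 * D + 1 \<longleftrightarrow> y \<in> V"
  using gd_le_D[of x y] unfolding dd_def by auto

lemma dd_arc: "dd x y = 1 \<longleftrightarrow> (x, y) \<in> R"
  using gd_1[of x y] arc_V[of x y] unfolding dd_def by auto

lemma closer_dd: assumes "(x, y) \<in> R" shows "closer G x y = {z. dd x z < dd y z}"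
proof -
  have xy: "x \<in> V" "y \<in> V" using arc_V[OF assms] by auto
  have "z \<in> closer G x y \<longleftrightarrow> dd x z < dd y z" for z
  proof (cases "z \<in> V")
    case True then show ?thesis unfolding closer_gd[OF xy] using xy gd_sym dd_gd by simp
  next
    case False
    then have "dd x z = 2 * D + 2" "dd y z = 2 * D + 2" unfolding dd_def using xy by auto
    then show ?thesis unfolding closer_gd[OF xy] using False by simp
  qed
  then show ?thesis by blast
qed

lemma nice_card: "(x, y) \<in> R ==> card (closer G x y) = D + 1"
  using nice unfolding nicely_distance_balanced_def by blast

text \<open>In diameter 1 the graph is complete, and the edges would have \<open>\<gamma> = 1\<close>.\<close>
lemma D_ge_2: "2 \<le> D"
proof -
  obtain x y where xy: "(x, y) \<in> R" using arcs by auto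
  have V: "x \<in> V" "y \<in> V" using arc_V[OF xy] by auto
  have D1: "1 \<le> D" using gd_1[OF V] xy gd_le_D[OF V] by simp
  have False if "D = 1"
  proof -
    have "closer G x y \<subseteq> {x}"
    proof
      fix z assume z: "z \<in> closer G x y"
      then have zV: "z \<in> V" and "gd G z x < gd G z y" unfolding closer_gd[OF V] by auto
      then have "gd G z x = 0" using gd_le_D[OF zV V(2)] that by simp
      then show "z \<in> {x}" using gd_0[OF zV V(1)] by simp
    qed
    then have "card (closer G x y) \<le> 1" using card_mono[of "{x}"] by simp
    then show False using nice_card[OF xy] that by simp
  qed
  then have "D ~= 1" by blast
  then show ?thesis using D1 by linarith
qed

lemma ndb_dd: "ndb dd k D"
proof
  show "dd x y = 0 \<longleftrightarrow> x = y" for x y unfolding dd_def using gd_0[of x y] by auto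
  show "dd x y = dd y x" for x y unfolding dd_def using gd_sym[of x y] by auto
  show "dd x z \<le> dd x y + dd y z" for x y z
  proof (cases "x \<in> V \<and> z \<in> V")
    case True
    then show ?thesis using gd_tri[of x y z] gd_le_D[of x z] unfolding dd_def by auto
  next
    case False then show ?thesis unfolding dd_def by auto
  qed
  show "\<exists>z. dd x z = 1 \<and> dd z y = n" if "dd x y = Suc n" "Suc n \<le> D" for x y n
  proof -
    have V: "x \<in> V" "y \<in> V" using that unfolding dd_def by (auto split: if_splits)
    have "gd G x y = Suc n" using that(1) dd_gd[OF V] by simp
    then obtain z where z: "(x, z) \<in> R" "gd G z y = n" using gd_step[OF V] by blast
    then show ?thesis using dd_arc dd_gd[OF _ V(2), of z] arc_V[OF z(1)] by blast
  qed
  show "dd x y \<le> D \<or> dd x y = 2 * D + 2" for x y using gd_le_D[of x y] unfolding dd_def by auto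
  show "finite {y. dd x y \<le> D}" for x
    by (rule finite_subset[of _ "insert x V"]) (use fin_V in \<open>auto simp: dd_def split: if_splits\<close>)
  show "card {z. dd x z = 1} = k" if "dd x y = 1" for x y
    using regular_nbrs[OF reg, of x] arc_V[of x y] that unfolding dd_arc nbrs_def by blast
  show "card {z. dd x z < dd y z} = Suc D" if "dd x y = 1" for x y
    using nice_card[of x y] closer_dd[of x y] that unfolding dd_arc by simp
qed (rule D_ge_2)

sublocale M: ndb dd k D by (rule ndb_dd)

lemma M_N: "M.N x = nbrs G x" unfolding M.N_def nbrs_def dd_arc ..

lemma ball: "x \<in> V ==> {y. dd x y \<le> D} = V" using dd_V[of x] gd_le_D[of x] dd_gd[of x] by fastforce

lemma lvl_two: assumes D2: "D = 2" and "(x, y) \<in> R" shows "card (M.lvl x y 1) = 2"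
proof -
  have a: "dd x y = 1" using assms dd_arc by blast
  have "{..<D} = {0, 1}" using D2 by auto
  then have W: "M.W x y = insert x (M.lvl x y 1)" using M.W_levels[OF a] M.lvl_0[OF a] by simp
  have "x \<notin> M.lvl x y 1" by (simp add: M.mem_lvl)
  then have "card (M.W x y) = Suc (card (M.lvl x y 1))" unfolding W using M.finite_lvl[OF a] by simp
  then show ?thesis using M.card_W[OF a] D2 by simp
qed

lemma diameter_two:
  assumes D2: "D = 2"
  shows "realizes petersen_table (nbrs G) V \<or> realizes (co petersen_table) (nbrs G) V
    \<or> (\<exists>t\<ge>2. multipartite (nbrs G) V t) \<or> realizes moebius_table (nbrs G) V \<or> realizes paley9_table (nbrs G) V"
proof -
  obtain x y where xy: "(x, y) \<in> R" using arcs by auto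
  then have xV: "x \<in> V" using arc_V by blast
  have "tight2 dd k D x"
    using lvl_two[OF D2] xy D2 dd_arc by unfold_locales blast+
  then interpret T: tight2 dd k D x .
  have TV: "T.V = V" unfolding T.V_def using ball[OF xV] .
  have N: "M.N = nbrs G" using M_N by blast
  have "V - {z} - T.G2 z = nbrs G z" if "z \<in> V" for z
  proof -
    have "w \<in> V - {z} - T.G2 z \<longleftrightarrow> w \<in> nbrs G z" for w
    proof (cases "w \<in> V")
      case True
      then show ?thesis using T.V_cases[of z w] that unfolding TV N[symmetric] by (auto simp: T.mem_G2 M.mem_N)
    next
      case False then show ?thesis using nbrs_V by blast
    qed
    then show ?thesis by blast
  qed
  then have "realizes (co petersen_table) (nbrs G) V" if "realizes petersen_table T.G2 V"
    using realizes_co[OF tables_valid(4) that] realizes_cong[of V "\<lambda>x. V - {x} - T.G2 x" "nbrs G"] by blast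
  then show ?thesis using T.diameter_2 unfolding TV N by blast
qed

lemma diameter_more:
  assumes D3: "3 \<le> D"
  shows "realizes cube_table (nbrs G) V \<or> realizes cuboctahedron_table (nbrs G) V \<or> realizes icosahedron_table (nbrs G) V"
proof -
  interpret A: ndb3 dd k D using D3 by unfold_locales
  obtain u w where uw: "u \<in> V" "w \<in> V" "gd G u w = D" using diameter_gd(2)[OF dia V_ne] by blast
  then have "dd u w = D" using dd_gd by simp
  then interpret B: anti dd k D u w by unfold_locales
  have D: "D = 3" by (rule B.D_eq_3)
  have two: "card (M.lvl x y 1) = 2" if x: "dd u x \<le> D" "dd x y = 1" for x y
  proof -
    obtain w' where w': "dd x w' = D" using B.anti_everywhere[OF x(1)] by blast
    interpret C: anti dd k D x w' using w' by unfold_locales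
    show ?thesis using C.lvl1[OF x(2)] M.card_lvl1_commute[OF x(2)] by simp
  qed
  obtain v where v: "dd u v = 1" using B.u_nonempty by blast
  have "tight dd k D u"
  proof (unfold_locales, goal_cases)
    case (1 x y) then show ?case using two by blast
  next
    case 2 then show ?case using v by blast
  qed
  then interpret T0: tight dd k D u .
  have "tight3 dd k D u"
  proof (unfold_locales, goal_cases)
    case 1 show ?case by (rule D)
  next
    case (2 x)
    then have "dd u x \<le> D" unfolding T0.V_def by simp
    then show ?case using B.anti_everywhere[of x] unfolding D by blast
  next
    case (3 x w w') then show ?case using A.anti_unique[of x w w'] D by simp
  qed
  then interpret T: tight3 dd k D u .
  have TV: "T0.V = V" unfolding T0.V_def using ball[OF uw(1)] .
  have N: "M.N = nbrs G" using M_N by blast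
  show ?thesis using T.diameter_3 unfolding TV N .
qed

end


section \<open>Recognizing the graphs of the classification\<close>

lemma realizes_vs:
  assumes len: "length vs = length T" and dis: "distinct vs" and V: "set vs = pverts H"
    and wf: "parcs H \<subseteq> pverts H \<times> pverts H" and val: "valid T"
    and adj: "\<And>i j. i < length T ==> j < length T ==> (vs ! i, vs ! j) \<in> parcs H \<longleftrightarrow> j \<in> set (T ! i)"
  shows "realizes T (nbrs H) (pverts H)"
proof (rule realizesI[OF len dis V], intro allI impI)
  fix i assume i: "i < length T"
  have "y \<in> nbrs H (vs ! i) \<longleftrightarrow> y \<in> (\<lambda>j. vs ! j) ` set (T ! i)" for y
  proof
    assume y: "y \<in> nbrs H (vs ! i)"
    then have "y \<in> set vs" using wf V unfolding nbrs_def by auto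
    then obtain j where "j < length T" "y = vs ! j" using len by (metis in_set_conv_nth)
    then show "y \<in> (\<lambda>j. vs ! j) ` set (T ! i)" using y adj[OF i] unfolding nbrs_def by auto
  next
    assume "y \<in> (\<lambda>j. vs ! j) ` set (T ! i)"
    then show "y \<in> nbrs H (vs ! i)" using adj[OF i] valid_nth[OF val i] unfolding nbrs_def by auto
  qed
  then show "nbrs H (vs ! i) = (\<lambda>j. vs ! j) ` set (T ! i)" by blast
qed

lemma all_less_iff: "(\<forall>i<n. P i) \<longleftrightarrow> list_all P [0..<n]" by (auto simp: list_all_iff)

definition "petersen_verts = [{0, 1}, {2, 3}, {2, 4}, {3, 4}, {0, 4}, {1, 4}, {1, 3}, {0, 3}, {0, 2}, {1, 2 :: nat}]"

lemma petersen_realizes: "realizes petersen_table (nbrs petersen) (pverts petersen)"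
proof (rule realizes_vs[of petersen_verts])
  let ?V = "{A. A \<subseteq> {0..<5} \<and> card A = 2}"
  have 5: "{0..<5} = {0, 1, 2, 3, 4 :: nat}" by auto
  have "A \<in> set petersen_verts" if A: "A \<in> ?V" for A
  proof -
    obtain x y where xy: "A = {x, y}" "x ~= y" using A by (auto simp: card_2_iff)
    then have "x \<in> {0, 1, 2, 3, 4}" "y \<in> {0, 1, 2, 3, 4}" using A unfolding 5 by auto
    then show ?thesis using xy by (elim insertE emptyE) (simp_all add: petersen_verts_def insert_commute)
  qed
  moreover have "set petersen_verts \<subseteq> ?V" unfolding petersen_verts_def by auto
  ultimately have V: "set petersen_verts = ?V" by blast
  then show "set petersen_verts = pverts petersen" unfolding petersen_def by (simp add: Let_def)
  show "parcs petersen \<subseteq> pverts petersen \<times> pverts petersen" unfolding petersen_def by (auto simp: Let_def)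
  have chk: "\<forall>i<10. \<forall>j<10. petersen_verts ! i \<inter> petersen_verts ! j = {} \<longleftrightarrow> j \<in> set (petersen_table ! i)"
    unfolding all_less_iff by code_simp
  have len: "length petersen_verts = 10" "length petersen_table = 10" unfolding petersen_verts_def petersen_table_def by simp_all
  show "(petersen_verts ! i, petersen_verts ! j) \<in> parcs petersen \<longleftrightarrow> j \<in> set (petersen_table ! i)"
    if "i < length petersen_table" "j < length petersen_table" for i j
  proof -
    have "petersen_verts ! i \<in> ?V" "petersen_verts ! j \<in> ?V" using that len nth_mem V by metis+
    then show ?thesis using chk that len unfolding petersen_def by (simp add: Let_def)
  qed
  show "length petersen_verts = length petersen_table" using len by simp
  show "distinct petersen_verts" by code_simp
qed (rule tables_valid)

lemma co_petersen_realizes: "realizes (co petersen_table) (nbrs (complement_graph petersen)) (pverts (complement_graph petersen))"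
proof -
  let ?V = "pverts petersen"
  have "pverts (complement_graph petersen) = ?V" unfolding complement_graph_def by simp
  moreover have "?V - {x} - nbrs petersen x = nbrs (complement_graph petersen) x" if "x \<in> ?V" for x
    using that unfolding nbrs_def complement_graph_def by auto
  ultimately show ?thesis using realizes_co[OF tables_valid(4) petersen_realizes]
    realizes_cong[of ?V "\<lambda>x. ?V - {x} - nbrs petersen x" "nbrs (complement_graph petersen)"] by simp
qed

lemma moebius_realizes: "realizes moebius_table (nbrs moebius_ladder8) (pverts moebius_ladder8)"
proof (rule realizes_vs[of "[0..<8]"])
  have len: "length moebius_table = 8" unfolding moebius_table_def by simp
  then show "length [0..<8] = length moebius_table" by simp
  show "set [0..<8] = pverts moebius_ladder8" unfolding moebius_ladder8_def by simp
  show "parcs moebius_ladder8 \<subseteq> pverts moebius_ladder8 \<times> pverts moebius_ladder8" unfolding moebius_ladder8_def by auto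
  have chk: "\<forall>i<8. \<forall>j<8. (j = (i + 1) mod 8 \<or> i = (j + 1) mod 8 \<or> j = (i + 4) mod 8) \<longleftrightarrow> j \<in> set (moebius_table ! i)"
    unfolding all_less_iff by code_simp
  show "([0..<8] ! i, [0..<8] ! j) \<in> parcs moebius_ladder8 \<longleftrightarrow> j \<in> set (moebius_table ! i)"
    if "i < length moebius_table" "j < length moebius_table" for i j
    using chk that len unfolding moebius_ladder8_def by simp
qed (simp_all add: tables_valid)

definition paley_verts :: "(int \<times> int) list" where
  "paley_verts = [(0, 0), (0, 1), (0, 2), (1, 0), (2, 0), (1, 1), (2, 1), (1, 2), (2, 2)]"

lemma F9_minus: assumes "x \<in> carrier F9" "y \<in> carrier F9"
  shows "x \<ominus>\<^bsub>F9\<^esub> y = ((fst x - fst y) mod 3, (snd x - snd y) mod 3)"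
proof -
  let ?m = "((- fst y) mod 3, (- snd y) mod 3)"
  have "?m \<in> carrier F9" by (simp add: F9_def)
  moreover have "?m \<oplus>\<^bsub>F9\<^esub> y = \<zero>\<^bsub>F9\<^esub>" by (cases y) (simp add: F9_def mod_simps)
  ultimately have "\<ominus>\<^bsub>F9\<^esub> y = ?m" using abelian_group.minus_equality[OF F9_abelian_group] assms(2) by metis
  then show ?thesis unfolding a_minus_def by (cases x) (simp add: F9_def mod_simps)
qed

lemma paley_realizes: "realizes paley9_table (nbrs (paley_graph F9)) (pverts (paley_graph F9))"
proof (rule realizes_vs[of paley_verts])
  have 3: "{0..<3} = {0, 1, 2 :: int}" by auto
  have C: "carrier F9 = {0, 1, 2} \<times> {0, 1, 2}" unfolding F9_def 3 by simp
  have V: "set paley_verts = carrier F9" unfolding C paley_verts_def by auto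
  then show "set paley_verts = pverts (paley_graph F9)" unfolding paley_graph_def by simp
  show "parcs (paley_graph F9) \<subseteq> pverts (paley_graph F9) \<times> pverts (paley_graph F9)" unfolding paley_graph_def by auto
  have sq: "(\<exists>z\<in>carrier F9. p = z \<otimes>\<^bsub>F9\<^esub> z) \<longleftrightarrow> p \<in> {(0, 0), (1, 0), (2, 0), (0, 1), (0, 2)}" for p
    unfolding C by (auto simp: F9_def)
  have z: "\<zero>\<^bsub>F9\<^esub> = (0, 0)" by (simp add: F9_def)
  have len: "length paley_verts = 9" "length paley9_table = 9" unfolding paley_verts_def paley9_table_def by simp_all
  have chk: "\<forall>i<9. \<forall>j<9. ((fst (paley_verts ! i) - fst (paley_verts ! j)) mod 3, (snd (paley_verts ! i) - snd (paley_verts ! j)) mod 3)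
      \<in> set [(1, 0), (2, 0), (0, 1), (0, 2)] \<longleftrightarrow> j \<in> set (paley9_table ! i)"
    unfolding all_less_iff by code_simp
  show "(paley_verts ! i, paley_verts ! j) \<in> parcs (paley_graph F9) \<longleftrightarrow> j \<in> set (paley9_table ! i)"
    if "i < length paley9_table" "j < length paley9_table" for i j
  proof -
    have m: "paley_verts ! i \<in> carrier F9" "paley_verts ! j \<in> carrier F9" using that len nth_mem V by metis+
    have "(paley_verts ! i, paley_verts ! j) \<in> parcs (paley_graph F9) \<longleftrightarrow>
      ((fst (paley_verts ! i) - fst (paley_verts ! j)) mod 3, (snd (paley_verts ! i) - snd (paley_verts ! j)) mod 3) \<in> set [(1, 0), (2, 0), (0, 1), (0, 2)]"
      unfolding paley_graph_def using m by (auto simp: F9_minus[OF m] sq z)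
    then show ?thesis using chk that len by simp
  qed
  show "length paley_verts = length paley9_table" using len by simp
  show "distinct paley_verts" unfolding paley_verts_def by simp
qed (rule tables_valid)

definition "cube_verts = [[False, False, False], [False, False, True], [False, True, False], [True, False, False],
  [True, True, False], [True, False, True], [False, True, True], [True, True, True]]"

lemma cube_realizes: "realizes cube_table (nbrs (hypercube 3)) (pverts (hypercube 3))"
proof (rule realizes_vs[of cube_verts])
  have "xs \<in> set cube_verts" if "length xs = 3" for xs :: "bool list"
  proof -
    obtain a b c where "xs = [a, b, c]" using \<open>length xs = 3\<close> by (auto simp: numeral_3_eq_3 length_Suc_conv)
    then show ?thesis unfolding cube_verts_def by (cases a; cases b; cases c) simp_all
  qed
  moreover have "set cube_verts \<subseteq> {xs. length xs = 3}" unfolding cube_verts_def by simp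
  ultimately have V: "set cube_verts = {xs. length xs = 3}" by blast
  then show "set cube_verts = pverts (hypercube 3)" unfolding hypercube_def by (simp add: Let_def)
  show "parcs (hypercube 3) \<subseteq> pverts (hypercube 3) \<times> pverts (hypercube 3)" unfolding hypercube_def by (auto simp: Let_def)
  have len: "length cube_verts = 8" "length cube_table = 8" unfolding cube_verts_def cube_table_def by simp_all
  have cd: "card {i. i < 3 \<and> P i} = length (filter P [0, 1, 2])" for P :: "nat \<Rightarrow> bool"
  proof -
    have u: "[0, 1, 2] = [0..<3::nat]" by code_simp
    have "{i. i < 3 \<and> P i} = set (filter P [0..<3])" by auto
    moreover have "card (set (filter P [0..<3])) = length (filter P [0..<3])"
      by (intro distinct_card distinct_filter distinct_upt)
    ultimately show ?thesis unfolding u by (simp only:)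
  qed
  have chk: "\<forall>i<8. \<forall>j<8. length (filter (\<lambda>l. (cube_verts ! i) ! l ~= (cube_verts ! j) ! l) [0, 1, 2]) = 1 \<longleftrightarrow> j \<in> set (cube_table ! i)"
    unfolding all_less_iff by code_simp
  show "(cube_verts ! i, cube_verts ! j) \<in> parcs (hypercube 3) \<longleftrightarrow> j \<in> set (cube_table ! i)"
    if "i < length cube_table" "j < length cube_table" for i j
  proof -
    have "cube_verts ! i \<in> {xs. length xs = 3}" "cube_verts ! j \<in> {xs. length xs = 3}" using that len nth_mem V by metis+
    then have "(cube_verts ! i, cube_verts ! j) \<in> parcs (hypercube 3) \<longleftrightarrow>
      length (filter (\<lambda>l. (cube_verts ! i) ! l ~= (cube_verts ! j) ! l) [0, 1, 2]) = 1"
      unfolding hypercube_def cd[symmetric] by (simp add: Let_def)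
    then show ?thesis using chk that len by metis
  qed
  show "length cube_verts = length cube_table" using len by simp
  show "distinct cube_verts" unfolding cube_verts_def by simp
qed (rule tables_valid)

definition cube_edges :: "(nat \<times> nat) list" where
  "cube_edges = [(0, 1), (0, 2), (0, 3), (1, 6), (1, 5), (2, 6), (3, 5), (2, 4), (3, 4), (6, 7), (5, 7), (4, 7)]"

lemma line_graph_realizes:
  "realizes cuboctahedron_table (nbrs (line_graph (hypercube 3))) (pverts (line_graph (hypercube 3)))"
proof -
  let ?H = "hypercube 3"
  obtain h where h: "bij_betw h {..<length cube_table} (pverts ?H)" "\<And>i. i < length cube_table ==> nbrs ?H (h i) = h ` set (cube_table ! i)"
    using cube_realizes realizes_bij[OF tables_valid(1)] by metis
  have l8: "length cube_table = 8" and l12: "length cuboctahedron_table = 12" "length cube_edges = 12"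
    unfolding cube_table_def cuboctahedron_table_def cube_edges_def by simp_all
  have inj: "inj_on h {..<8}" using h(1) l8 unfolding bij_betw_def by simp
  define e where "e = (\<lambda>(i, j). {i, j :: nat})"
  define vs where "vs = map (\<lambda>p. h ` e p) cube_edges"
  have e8: "e p \<subseteq> {..<8}" if "p \<in> set cube_edges" for p using that unfolding cube_edges_def e_def by auto
  have edges: "\<forall>i<8. \<forall>j\<in>set (cube_table ! i). e (i, j) \<in> e ` set cube_edges"
    unfolding all_less_iff e_def by code_simp
  have edges': "\<forall>p\<in>set cube_edges. snd p \<in> set (cube_table ! fst p)" by code_simp
  have E: "{{u, v} | u v. (u, v) \<in> parcs ?H} = set vs"
  proof
    show "{{u, v} | u v. (u, v) \<in> parcs ?H} \<subseteq> set vs"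
    proof clarify
      fix u v assume uv: "(u, v) \<in> parcs ?H"
      then have "u \<in> pverts ?H" unfolding hypercube_def by (auto simp: Let_def)
      then obtain i where i: "i < 8" "u = h i" using h(1) l8 unfolding bij_betw_def by auto
      then have "v \<in> h ` set (cube_table ! i)" using uv h(2) l8 unfolding nbrs_def by auto
      then obtain j where j: "j \<in> set (cube_table ! i)" "v = h j" by blast
      have "e (i, j) \<in> e ` set cube_edges" using edges i(1) j(1) by blast
      then obtain p where p: "p \<in> set cube_edges" "e (i, j) = e p" by blast
      have "{u, v} = h ` e (i, j)" using i j by (simp add: e_def)
      then have "{u, v} = h ` e p" using p(2) by simp
      then show "{u, v} \<in> set vs" using p(1) unfolding vs_def by auto
    qed
    show "set vs \<subseteq> {{u, v} | u v. (u, v) \<in> parcs ?H}"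
    proof
      fix x assume "x \<in> set vs"
      then obtain i j where p: "(i, j) \<in> set cube_edges" "x = {h i, h j}" unfolding vs_def e_def by auto
      then have "i < 8" "j \<in> set (cube_table ! i)" using e8[OF p(1)] edges' unfolding e_def by auto
      then have "h j \<in> nbrs ?H (h i)" using h(2) l8 by auto
      then show "x \<in> {{u, v} | u v. (u, v) \<in> parcs ?H}" using p unfolding nbrs_def by auto
    qed
  qed
  have L: "pverts (line_graph ?H) = set vs" "parcs (line_graph ?H) = {(e, f) \<in> set vs \<times> set vs. e ~= f \<and> e \<inter> f ~= {}}"
    unfolding line_graph_def E by (simp_all add: Let_def)
  have himg: "h ` A = h ` B \<longleftrightarrow> A = B" "h ` A \<inter> h ` B = h ` (A \<inter> B)" if "A \<subseteq> {..<8}" "B \<subseteq> {..<8}" for A B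
    using inj_on_image_eq_iff[OF inj that] inj_on_image_Int[OF inj that] by auto
  have chk: "\<forall>i<12. \<forall>j<12. (e (cube_edges ! i) ~= e (cube_edges ! j) \<and> e (cube_edges ! i) \<inter> e (cube_edges ! j) ~= {}) \<longleftrightarrow> j \<in> set (cuboctahedron_table ! i)"
    unfolding all_less_iff e_def by code_simp
  have chk2: "distinct (map e cube_edges)" unfolding e_def by code_simp
  show ?thesis
  proof (rule realizes_vs[of vs])
    show "length vs = length cuboctahedron_table" unfolding vs_def using l12 by simp
    show "distinct vs" using chk2 himg(1)[OF e8 e8] unfolding vs_def by (auto simp: distinct_map inj_on_def)
    show "set vs = pverts (line_graph ?H)" using L by simp
    show "parcs (line_graph ?H) \<subseteq> pverts (line_graph ?H) \<times> pverts (line_graph ?H)" using L by auto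
    show "(vs ! i, vs ! j) \<in> parcs (line_graph ?H) \<longleftrightarrow> j \<in> set (cuboctahedron_table ! i)"
      if "i < length cuboctahedron_table" "j < length cuboctahedron_table" for i j
    proof -
      have ij: "i < 12" "j < 12" using that l12 by auto
      have n: "vs ! i = h ` e (cube_edges ! i)" "vs ! j = h ` e (cube_edges ! j)" using ij l12 unfolding vs_def by simp_all
      have s: "e (cube_edges ! i) \<subseteq> {..<8}" "e (cube_edges ! j) \<subseteq> {..<8}" using e8 ij l12 by auto
      have "vs ! i \<in> set vs" "vs ! j \<in> set vs" using ij l12 unfolding vs_def by simp_all
      then have "(vs ! i, vs ! j) \<in> parcs (line_graph ?H) \<longleftrightarrow> e (cube_edges ! i) ~= e (cube_edges ! j) \<and> e (cube_edges ! i) \<inter> e (cube_edges ! j) ~= {}"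
        unfolding L(2) using himg[OF s] n by auto
      then show ?thesis using chk ij by blast
    qed
  qed (rule tables_valid)
qed

section \<open>The skeleton of the icosahedron\<close>

definition phi :: real where "phi = (1 + sqrt 5) / 2"

lemma phi_sq: "phi * phi = phi + 1" unfolding phi_def by (simp add: field_simps)
lemma phi_gt: "1 < phi" unfolding phi_def by (simp add: less_divide_eq real_less_rsqrt)

definition ico_pts :: "(real^3) list" where
  "ico_pts = [vector [0, 1, phi], vector [1, phi, 0], vector [phi, 0, 1], vector [0, - 1, phi], vector [- phi, 0, 1],
    vector [- 1, phi, 0], vector [phi, 0, - 1], vector [1, - phi, 0], vector [- 1, - phi, 0], vector [- phi, 0, - 1],
    vector [0, 1, - phi], vector [0, - 1, - phi]]"

definition "ico_anti = [11, 8, 9, 10, 6, 7, 4, 5, 1, 2, 3, 0 :: nat]"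

definition gram :: "nat \<Rightarrow> nat \<Rightarrow> real" where
  "gram i j = (if i = j then phi + 2 else if j \<in> set (icosahedron_table ! i) then phi
     else if j = ico_anti ! i then - (phi + 2) else - phi)"

lemma inner3: "(vector [a, b, c] :: real^3) \<bullet> vector [a', b', c'] = a * a' + b * b' + c * c'"
  by (simp add: inner_vec_def sum_3)

lemma ico_length: "length ico_pts = 12" "length icosahedron_table = 12" "length ico_anti = 12"
  unfolding ico_pts_def icosahedron_table_def ico_anti_def by simp_all

lemma gram_eq: assumes "i < 12" "j < 12" shows "ico_pts ! i \<bullet> ico_pts ! j = gram i j"
proof -
  obtain p where p: "p = phi" by blast
  have pp: "p * p = p + 1" unfolding p by (rule phi_sq)
  have "list_all (\<lambda>i. list_all (\<lambda>j. ico_pts ! i \<bullet> ico_pts ! j = gram i j) [0,1,2,3,4,5,6,7,8,9,10,11]) [0,1,2,3,4,5,6,7,8,9,10,11::nat]"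
    unfolding ico_pts_def gram_def icosahedron_table_def ico_anti_def p[symmetric] by (simp add: inner3 pp)
  moreover have "[0,1,2,3,4,5,6,7,8,9,10,11] = [0..<12::nat]" by code_simp
  then have "i \<in> set [0,1,2,3,4,5,6,7,8,9,10,11]" "j \<in> set [0,1,2,3,4,5,6,7,8,9,10,11]" using assms by (simp_all only: set_upt atLeastLessThan_iff le0 simp_thms)
  ultimately show ?thesis unfolding list_all_iff by blast
qed

lemma ico_hull: "regular_icosahedron = convex hull (set ico_pts)"
proof -
  have "(\<Union>s \<in> {1, -1}. \<Union>t \<in> {1, -1}. {vector [0, s, t * phi], vector [s, t * phi, 0], vector [t * phi, 0, s]}) = set ico_pts"
    unfolding ico_pts_def by auto
  then show ?thesis unfolding regular_icosahedron_def Let_def phi_def[symmetric] by simp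
qed

lemma gram_bounds: "i ~= j ==> gram i j \<le> phi" "gram i i = phi + 2"
  using phi_gt unfolding gram_def by auto

text \<open>
  The points of a finite set where a linear functional attains its maximum span a face of the convex hull.
\<close>
lemma supporting_face:
  fixes S :: "'a::euclidean_space set"
  assumes S: "finite S" and le: "\<And>x. x \<in> S ==> a \<bullet> x \<le> b"
  shows "convex hull {x \<in> S. a \<bullet> x = b} face_of convex hull S"
proof -
  let ?H = "{x. a \<bullet> x = b}"
  have "convex hull S \<subseteq> {x. a \<bullet> x \<le> b}" by (rule hull_minimal) (use le in \<open>auto simp: convex_halfspace_le\<close>)
  then have F: "(convex hull S \<inter> ?H) face_of convex hull S"
    by (intro face_of_Int_supporting_hyperplane_le) auto
  then obtain S' where S': "S' \<subseteq> S" "convex hull S \<inter> ?H = convex hull S'"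
    using face_of_convex_hull_subset[OF finite_imp_compact[OF S] F] by metis
  have "S' \<subseteq> {x \<in> S. a \<bullet> x = b}" using S' hull_subset[of S' convex] by blast
  then have "convex hull S' \<subseteq> convex hull {x \<in> S. a \<bullet> x = b}" by (rule hull_mono)
  moreover have "convex hull {x \<in> S. a \<bullet> x = b} \<subseteq> convex hull S \<inter> ?H"
    by (rule hull_minimal) (auto simp: hull_inc convex_Int convex_hyperplane)
  ultimately show ?thesis using F S' by simp
qed

definition "ico_common i j = list_ex (\<lambda>a. list_ex (\<lambda>b. a \<in> set (icosahedron_table ! j) \<and> b \<in> set (icosahedron_table ! j)
    \<and> b \<in> set (icosahedron_table ! a)) (icosahedron_table ! i)) (icosahedron_table ! i)"

lemma ico_check:
  "\<forall>i<12. \<forall>j<12. (j \<in> set (icosahedron_table ! i) \<longleftrightarrow> i \<in> set (icosahedron_table ! j)) \<and> i \<notin> set (icosahedron_table ! i)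
     \<and> i ~= ico_anti ! i \<and> ico_anti ! i < 12 \<and> ico_anti ! i \<notin> set (icosahedron_table ! i) \<and> ico_anti ! (ico_anti ! i) = i
     \<and> (i = j \<or> j \<in> set (icosahedron_table ! i) \<or> j = ico_anti ! i \<or> ico_common i j)"
  unfolding all_less_iff by code_simp

lemma gram_anti: assumes "i < 12" shows "ico_pts ! (ico_anti ! i) = - (ico_pts ! i)"
proof -
  let ?j = "ico_anti ! i"
  have j: "?j < 12" "?j ~= i" "?j \<notin> set (icosahedron_table ! i)" "ico_anti ! ?j = i" "i \<notin> set (icosahedron_table ! ?j)"
    using ico_check assms by metis+
  let ?x = "ico_pts ! i + ico_pts ! ?j"
  have "?x \<bullet> ?x = gram i i + gram i ?j + gram ?j i + gram ?j ?j"
    using gram_eq assms j(1) by (simp add: inner_add_left inner_add_right)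
  also have "\<dots> = 0" using j unfolding gram_def by simp
  finally have "?x = 0" by simp
  then show ?thesis by (simp add: eq_neg_iff_add_eq_0 add.commute)
qed

text \<open>
  The two common neighbours of vertices at graph distance 2 satisfy a linear relation with them, since the Gram
  matrix makes the norm of the difference vanish.
\<close>
lemma gram_middle:
  assumes ij: "i < 12" "j < 12" and n: "i ~= j" "j \<notin> set (icosahedron_table ! i)" "j ~= ico_anti ! i"
  obtains a b where "a < 12" "b < 12" "ico_pts ! a + ico_pts ! b = phi *\<^sub>R (ico_pts ! i + ico_pts ! j)"
proof -
  have val: "x < 12" if "y < 12" "x \<in> set (icosahedron_table ! y)" for x y using valid_nth[OF tables_valid(3)] ico_length that by simp
  have "ico_common i j" using ico_check ij n by blast
  then obtain a b where a: "a \<in> set (icosahedron_table ! i)" "a \<in> set (icosahedron_table ! j)" and b: "b \<in> set (icosahedron_table ! i)" "b \<in> set (icosahedron_table ! j)"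
    and ab: "b \<in> set (icosahedron_table ! a)" unfolding ico_common_def list_ex_iff by blast
  have l: "a < 12" "b < 12" using val ij a b by blast+
  have irr: "x \<notin> set (icosahedron_table ! x)" if "x < 12" for x using ico_check that by blast
  have sym: "y \<in> set (icosahedron_table ! x) \<longleftrightarrow> x \<in> set (icosahedron_table ! y)" if "x < 12" "y < 12" for x y using ico_check that by blast
  have g: "gram x y = phi" if "x < 12" "y \<in> set (icosahedron_table ! x)" for x y
    using irr[OF that(1)] that unfolding gram_def by auto
  have ji: "j \<notin> set (icosahedron_table ! i)" "i \<notin> set (icosahedron_table ! j)" "i ~= ico_anti ! j"
    using n sym[OF ij] ico_check ij by metis+
  have G: "gram a b = phi" "gram b a = phi" "gram a i = phi" "gram a j = phi" "gram b i = phi" "gram b j = phi"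
    "gram i a = phi" "gram j a = phi" "gram i b = phi" "gram j b = phi" "gram i j = - phi" "gram j i = - phi"
    "gram a a = phi + 2" "gram b b = phi + 2" "gram i i = phi + 2" "gram j j = phi + 2"
    using g[OF l(1) ab] g[of b a] g[of a i] g[of a j] g[of b i] g[of b j] g[OF ij(1) a(1)] g[OF ij(2) a(2)] g[OF ij(1) b(1)] g[OF ij(2) b(2)]
      sym l ij a b ab n ji by (auto simp: gram_def)
  let ?x = "ico_pts ! a + ico_pts ! b - phi *\<^sub>R (ico_pts ! i + ico_pts ! j)"
  have "?x \<bullet> ?x = gram a a + gram a b + gram b a + gram b b - phi * (gram a i + gram a j + gram b i + gram b j)
     - phi * (gram i a + gram j a + gram i b + gram j b) + phi * phi * (gram i i + gram i j + gram j i + gram j j)"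
    using gram_eq l ij by (simp add: inner_add_left inner_add_right inner_diff_left inner_diff_right algebra_simps)
  also have "\<dots> = 4 * phi + 4 - 4 * (phi * phi)" unfolding G by (simp add: algebra_simps)
  also have "\<dots> = 0" unfolding phi_sq by simp
  finally have "?x = 0" by simp
  then show ?thesis using that[OF l] by simp
qed

lemma ico_inj: assumes "i < 12" "j < 12" "ico_pts ! i = ico_pts ! j" shows "i = j"
proof (rule ccontr)
  assume "i ~= j"
  then show False using gram_eq[OF assms(1,2)] gram_eq[OF assms(2,2)] gram_bounds(1)[of i j] gram_bounds(2)[of j] assms(3) by simp
qed

lemma ico_set: "x \<in> set ico_pts \<longleftrightarrow> (\<exists>i<12. x = ico_pts ! i)" using ico_length by (metis in_set_conv_nth)

lemma ico_extreme: "x extreme_point_of regular_icosahedron \<longleftrightarrow> x \<in> set ico_pts"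
proof
  show "x extreme_point_of regular_icosahedron ==> x \<in> set ico_pts" unfolding ico_hull by (rule extreme_point_of_convex_hull)
  assume "x \<in> set ico_pts"
  then obtain i where i: "i < 12" "x = ico_pts ! i" using ico_set by blast
  have le: "x \<bullet> y \<le> phi + 2" "x \<bullet> y = phi + 2 \<longleftrightarrow> y = x" if "y \<in> set ico_pts" for y
  proof -
    have "\<exists>j<12. y = ico_pts ! j" using that unfolding ico_set .
    then obtain j where j: "j < 12" "y = ico_pts ! j" by blast
    have g: "x \<bullet> y = gram i j" using gram_eq[OF i(1) j(1)] i j by simp
    have "x \<bullet> y \<le> phi + 2 \<and> (x \<bullet> y = phi + 2 \<longleftrightarrow> y = x)"
    proof (cases "i = j")
      case True
      then have "y = x" using i j by simp
      moreover have "x \<bullet> y = phi + 2" using g gram_bounds(2) True by simp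
      ultimately show ?thesis by simp
    next
      case False
      then have "y ~= x" using ico_inj[OF i(1) j(1)] i j by auto
      then show ?thesis using g gram_bounds(1)[OF False] by simp
    qed
    then show "x \<bullet> y \<le> phi + 2" "x \<bullet> y = phi + 2 \<longleftrightarrow> y = x" by blast+
  qed
  have "convex hull {y \<in> set ico_pts. x \<bullet> y = phi + 2} face_of convex hull (set ico_pts)" using le by (intro supporting_face) auto
  moreover have "{y \<in> set ico_pts. x \<bullet> y = phi + 2} = {x}" using le \<open>x \<in> set ico_pts\<close> by auto
  ultimately have "{x} face_of convex hull (set ico_pts)" by simp
  then show "x extreme_point_of regular_icosahedron" unfolding ico_hull using face_of_singleton by blast
qed

text \<open>
  A face containing the centre contains with it every pair of opposite vertices.
\<close>
lemma ico_zero_not_in_edge: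
  assumes F: "closed_segment u v face_of regular_icosahedron" and uv: "u \<in> set ico_pts" "v \<in> set ico_pts"
  shows "0 \<notin> closed_segment u v"
proof
  assume z: "0 \<in> closed_segment u v"
  have all: "x \<in> {u, v}" if x: "x \<in> set ico_pts" for x
  proof -
    obtain i where i: "i < 12" "x = ico_pts ! i" using x ico_set by blast
    have mx: "- x \<in> set ico_pts" using gram_anti[OF i(1)] i ico_check ico_set by metis
    have "x ~= 0"
    proof
      assume "x = 0"
      then show False using gram_eq[OF i(1) i(1)] gram_bounds(2)[of i] i(2) phi_gt by simp
    qed
    have "x ~= - x"
    proof
      assume "x = - x"
      then have "x \<bullet> x = - (x \<bullet> x)" by (metis inner_minus_left)
      then show False using \<open>x ~= 0\<close> by simp
    qed
    have "0 = midpoint x (- x)" by (simp add: midpoint_def)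
    then have "0 \<in> open_segment x (- x)" using midpoint_in_open_segment[of x "- x"] \<open>x ~= - x\<close> by simp
    moreover have "x \<in> regular_icosahedron" "- x \<in> regular_icosahedron" unfolding ico_hull using x mx by (auto intro: hull_inc)
    ultimately have "x \<in> closed_segment u v" using F z unfolding face_of_def by blast
    moreover have "x \<notin> open_segment u v"
      using x ico_extreme uv unfolding extreme_point_of_def by (meson)
    ultimately show ?thesis unfolding open_segment_def by blast
  qed
  have "ico_pts ! 0 \<in> {u, v}" "ico_pts ! 1 \<in> {u, v}" "ico_pts ! 2 \<in> {u, v}"
    by (intro all; use ico_length in simp)+
  then show False using ico_inj[of 0 1] ico_inj[of 0 2] ico_inj[of 1 2] by auto
qed

text \<open>
  For adjacent vertices the functional \<open>u + v\<close> is maximal exactly on the edge. Otherwise the midpoint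
  of \<open>u\<close> and \<open>v\<close> is the centre or lies strictly between the centre and another point of the icosahedron,
  so that a face containing the segment would contain the centre.
\<close>
lemma ico_edge: assumes ij: "i < 12" "j < 12" "i ~= j"
  shows "closed_segment (ico_pts ! i) (ico_pts ! j) edge_of regular_icosahedron \<longleftrightarrow> j \<in> set (icosahedron_table ! i)"
proof
  let ?u = "ico_pts ! i" and ?v = "ico_pts ! j"
  have uv: "?u \<in> set ico_pts" "?v \<in> set ico_pts" "?u ~= ?v" using ij ico_set ico_inj by blast+
  have sym: "gram x y = gram y x" if "x < 12" "y < 12" for x y using gram_eq that by (metis inner_commute)
  {
    assume adj: "j \<in> set (icosahedron_table ! i)"
    have "i \<in> set (icosahedron_table ! j)" using ico_check ij adj by blast
    then have g: "gram i j = phi" "gram j i = phi" using adj ij(3) unfolding gram_def by auto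
    have le: "(?u + ?v) \<bullet> y \<le> 2 * phi + 2" "(?u + ?v) \<bullet> y = 2 * phi + 2 \<longleftrightarrow> y \<in> {?u, ?v}" if "y \<in> set ico_pts" for y
    proof -
      have "\<exists>l<12. y = ico_pts ! l" using that unfolding ico_set .
      then obtain l where l: "l < 12" "y = ico_pts ! l" by blast
      have s: "(?u + ?v) \<bullet> y = gram i l + gram j l" using gram_eq ij l by (simp add: inner_add_left)
      consider "l = i" | "l = j" | "l ~= i" "l ~= j" by blast
      then have "(?u + ?v) \<bullet> y \<le> 2 * phi + 2 \<and> ((?u + ?v) \<bullet> y = 2 * phi + 2 \<longleftrightarrow> y \<in> {?u, ?v})"
      proof cases
        case 1 then show ?thesis using s g gram_bounds(2)[of i] l by simp
      next
        case 2 then show ?thesis using s g gram_bounds(2)[of j] l by simp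
      next
        case 3
        then have "y \<notin> {?u, ?v}" using ico_inj l ij by blast
        moreover have "gram i l \<le> phi" "gram j l \<le> phi" using gram_bounds(1) 3 by metis+
        ultimately show ?thesis using s by auto
      qed
      then show "(?u + ?v) \<bullet> y \<le> 2 * phi + 2" "(?u + ?v) \<bullet> y = 2 * phi + 2 \<longleftrightarrow> y \<in> {?u, ?v}" by blast+
    qed
    have "convex hull {y \<in> set ico_pts. (?u + ?v) \<bullet> y = 2 * phi + 2} face_of convex hull (set ico_pts)"
      using le by (intro supporting_face) auto
    moreover have "{y \<in> set ico_pts. (?u + ?v) \<bullet> y = 2 * phi + 2} = {?u, ?v}" using le uv by auto
    ultimately have "closed_segment ?u ?v face_of regular_icosahedron" unfolding ico_hull segment_convex_hull by simp
    moreover have "aff_dim (closed_segment ?u ?v) = 1" using uv(3) unfolding segment_convex_hull aff_dim_convex_hull by simp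
    ultimately show "closed_segment ?u ?v edge_of regular_icosahedron" unfolding edge_of_def by blast
  }
  assume "closed_segment ?u ?v edge_of regular_icosahedron"
  then have F: "closed_segment ?u ?v face_of regular_icosahedron" unfolding edge_of_def by blast
  note nz = ico_zero_not_in_edge[OF F uv(1,2)]
  let ?m = "midpoint ?u ?v"
  show "j \<in> set (icosahedron_table ! i)"
  proof (rule ccontr)
    assume n: "j \<notin> set (icosahedron_table ! i)"
    show False
    proof (cases "j = ico_anti ! i")
      case True
      then have "?m = 0" using gram_anti[OF ij(1)] by (simp add: midpoint_def)
      then show False using nz midpoint_in_closed_segment[of ?u ?v] by simp
    next
      case False
      then obtain a b where ab: "a < 12" "b < 12" "ico_pts ! a + ico_pts ! b = phi *\<^sub>R (?u + ?v)" using gram_middle[OF ij n] by metis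
      let ?c = "midpoint (ico_pts ! a) (ico_pts ! b)"
      have P: "x \<in> regular_icosahedron" if "x \<in> set ico_pts" for x unfolding ico_hull using that by (rule hull_inc)
      have conv: "convex regular_icosahedron" unfolding ico_hull by (rule convex_convex_hull)
      have pa: "ico_pts ! a \<in> regular_icosahedron" "ico_pts ! b \<in> regular_icosahedron" using ab ico_set P by blast+
      have cP: "?c \<in> regular_icosahedron"
        using closed_segment_subset[OF pa conv] midpoint_in_closed_segment by blast
      have "- ?u \<in> regular_icosahedron" using gram_anti[OF ij(1)] ico_check ij(1) ico_set P by metis
      then have zP: "0 \<in> regular_icosahedron"
        using closed_segment_subset[OF P[OF uv(1)] _ conv, of "- ?u"] midpoint_in_closed_segment[of ?u "- ?u"] by (auto simp: midpoint_def)
      have cm: "?c = phi *\<^sub>R ?m" unfolding midpoint_def ab(3) by (simp add: ac_simps)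
      then have mc: "?m = (1 - 1 / phi) *\<^sub>R 0 + (1 / phi) *\<^sub>R ?c" using phi_gt by simp
      have mseg: "?m \<in> closed_segment ?u ?v" by (rule midpoint_in_closed_segment)
      then have "?m ~= 0" using nz by metis
      then have "0 ~= ?c" using cm phi_gt by simp
      moreover have "0 < 1 / phi" "1 / phi < 1" using phi_gt by simp_all
      ultimately have "?m \<in> open_segment 0 ?c" unfolding in_segment(2) using mc by blast
      then have "0 \<in> closed_segment ?u ?v" using F zP cP mseg unfolding face_of_def by blast
      then show False using nz by blast
    qed
  qed
qed

lemma icosahedron_realizes: "realizes icosahedron_table (nbrs icosahedron) (pverts icosahedron)"
proof (rule realizes_vs[of ico_pts])
  show "length ico_pts = length icosahedron_table" using ico_length by simp
  show "distinct ico_pts" unfolding distinct_conv_nth using ico_inj ico_length by metis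
  show V: "set ico_pts = pverts icosahedron" unfolding icosahedron_def skeleton_def using ico_extreme by auto
  show "parcs icosahedron \<subseteq> pverts icosahedron \<times> pverts icosahedron" unfolding icosahedron_def skeleton_def by auto
  show "(ico_pts ! i, ico_pts ! j) \<in> parcs icosahedron \<longleftrightarrow> j \<in> set (icosahedron_table ! i)"
    if "i < length icosahedron_table" "j < length icosahedron_table" for i j
  proof -
    have ij: "i < 12" "j < 12" using that ico_length by auto
    have "ico_pts ! i extreme_point_of regular_icosahedron" "ico_pts ! j extreme_point_of regular_icosahedron" using ico_extreme ico_set ij by blast+
    then have *: "(ico_pts ! i, ico_pts ! j) \<in> parcs icosahedron \<longleftrightarrow> ico_pts ! i ~= ico_pts ! j \<and> closed_segment (ico_pts ! i) (ico_pts ! j) edge_of regular_icosahedron"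
      unfolding icosahedron_def skeleton_def by auto
    have "i \<notin> set (icosahedron_table ! i)" using ico_check ij by blast
    then show ?thesis using * ico_edge[OF ij] ico_inj[OF ij] by (cases "i = j") auto
  qed
qed (rule tables_valid)

section \<open>Complete multipartite graphs\<close>

lemma image_sub_eq_iff: "A \<subseteq> f ` S ==> B \<subseteq> f ` S ==> A = B \<longleftrightarrow> (\<forall>y\<in>S. f y \<in> A \<longleftrightarrow> f y \<in> B)"
  by blast

lemma (in conn_graph) iso_multipartite: "graph_iso G (complete_multipartite t 3) \<longleftrightarrow> multipartite (nbrs G) V t"
proof -
  let ?K = "complete_multipartite t 3" and ?W = "{0..<t} \<times> {0..<3::nat}"
  have K: "pverts ?K = ?W" "parcs ?K = {(x, y) \<in> ?W \<times> ?W. fst x ~= fst y}"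
    unfolding complete_multipartite_def by (simp_all add: Let_def)
  have sub: "parcs ?K \<subseteq> pverts ?K \<times> pverts ?K" using K by auto
  have "(\<forall>x\<in>V. nbrs ?K (f x) = f ` nbrs G x) \<longleftrightarrow> (\<forall>x\<in>V. \<forall>y\<in>V. y \<in> nbrs G x \<longleftrightarrow> fst (f x) ~= fst (f y))"
    if f: "bij_betw f V ?W" for f
  proof -
    have "nbrs ?K (f x) = f ` nbrs G x \<longleftrightarrow> (\<forall>y\<in>V. y \<in> nbrs G x \<longleftrightarrow> fst (f x) ~= fst (f y))" if x: "x \<in> V" for x
    proof -
      have fW: "f ` V = ?W" and inj: "inj_on f V" using f unfolding bij_betw_def by auto
      have fx: "f x \<in> ?W" using fW x by blast
      have mem: "f y \<in> nbrs ?K (f x) \<longleftrightarrow> fst (f x) ~= fst (f y)" if "y \<in> V" for y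
      proof -
        have "f y \<in> ?W" using fW that by blast
        then show ?thesis unfolding nbrs_def K using fx by simp
      qed
      have mem': "f y \<in> f ` nbrs G x \<longleftrightarrow> y \<in> nbrs G x" if "y \<in> V" for y
        using inj_on_image_mem_iff[OF inj that nbrs_V] .
      have "nbrs ?K (f x) \<subseteq> ?W" unfolding nbrs_def K by auto
      then have s: "nbrs ?K (f x) \<subseteq> f ` V" "f ` nbrs G x \<subseteq> f ` V" using image_mono[OF nbrs_V, of f x] unfolding fW by auto
      have "nbrs ?K (f x) = f ` nbrs G x \<longleftrightarrow> (\<forall>y\<in>V. f y \<in> nbrs ?K (f x) \<longleftrightarrow> f y \<in> f ` nbrs G x)"
        by (rule image_sub_eq_iff[OF s])
      then show ?thesis using mem mem' by blast
    qed
    then show ?thesis by blast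
  qed
  then show ?thesis unfolding iso_nbrs[OF sub] multipartite_def K(1) by blast
qed

text \<open>
  Vertices of the same part are at distance 2. The vertices closer to \<open>u\<close> than to an adjacent \<open>v\<close> are \<open>u\<close> and the two
  other vertices in the part of \<open>v\<close>.
\<close>
lemma (in conn_graph) multipartite_params:
  assumes t: "2 \<le> t" and M: "multipartite (nbrs G) V t"
    and G: "regular_graph G k" "graph_diameter G = ereal (real d)" "nicely_distance_balanced G \<gamma>"
  shows "k = 3 * (t - 1) \<and> d = 2 \<and> \<gamma> = d + 1"
proof -
  let ?W = "{0..<t} \<times> {0..<3::nat}"
  obtain f where f: "bij_betw f V ?W" "\<forall>x\<in>V. \<forall>y\<in>V. y \<in> nbrs G x \<longleftrightarrow> fst (f x) ~= fst (f y)" using M unfolding multipartite_def by blast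
  let ?g = "the_inv_into V f"
  have g: "bij_betw ?g ?W V" using bij_betw_the_inv_into[OF f(1)] .
  have gW: "?g p \<in> V" "f (?g p) = p" if "p \<in> ?W" for p
    using bij_betwE[OF g] that f_the_inv_into_f_bij_betw[OF f(1)] by blast+
  have gex: "\<exists>p\<in>?W. x = ?g p" if "x \<in> V" for x using that bij_betw_imp_surj_on[OF g] by blast
  have inj: "?g p = ?g q \<longleftrightarrow> p = q" if "p \<in> ?W" "q \<in> ?W" for p q using inj_on_eq_iff[OF bij_betw_imp_inj_on[OF g] that] .
  have arc: "(?g p, ?g q) \<in> R \<longleftrightarrow> fst p ~= fst q" if "p \<in> ?W" "q \<in> ?W" for p q
    using f(2) gW[OF that(1)] gW[OF that(2)] unfolding nbrs_def by auto
  have dist: "gd G (?g p) (?g q) = (if p = q then 0 else if fst p ~= fst q then 1 else 2)" if pq: "p \<in> ?W" "q \<in> ?W" for p q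
  proof -
    note V = gW(1)[OF pq(1)] gW(1)[OF pq(2)]
    consider "p = q" | "fst p ~= fst q" | "p ~= q" "fst p = fst q" by blast
    then show ?thesis
    proof cases
      case 1 then show ?thesis using gd_0[OF V] by simp
    next
      case 2 then show ?thesis using gd_1[OF V] arc[OF pq] by auto
    next
      case 3
      define r :: "nat \<times> nat" where "r = (if fst p = 0 then 1 else 0, 0)"
      have r: "r \<in> ?W" "fst p ~= fst r" "fst r ~= fst q" using t 3 unfolding r_def by auto
      have "(?g p, ?g r) \<in> R" "(?g r, ?g q) \<in> R" using arc pq r by auto
      then have "gd G (?g p) (?g q) \<le> 2" using gd_le[of "?g p" "?g q" 2] by (auto simp: numeral_2_eq_2)
      moreover have "gd G (?g p) (?g q) ~= 0" "gd G (?g p) (?g q) ~= 1" using gd_0[OF V] gd_1[OF V] arc[OF pq] inj[OF pq] 3 by auto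
      ultimately show ?thesis using 3 by auto
    qed
  qed
  have o: "(0, 0) \<in> ?W" "(0, 1) \<in> ?W" "(1, 0) \<in> ?W" using t by auto
  have "nbrs G (?g (0, 0)) = ?g ` ({1..<t} \<times> {0..<3})"
  proof -
    have "y \<in> nbrs G (?g (0, 0)) \<longleftrightarrow> y \<in> ?g ` ({1..<t} \<times> {0..<3})" for y
    proof
      assume y: "y \<in> nbrs G (?g (0, 0))"
      then obtain p where p: "p \<in> ?W" "y = ?g p" using gex nbrs_V by blast
      then have "fst p ~= 0" using y arc[OF o(1) p(1)] unfolding nbrs_def by simp
      then have "p \<in> {1..<t} \<times> {0..<3}" using p by (auto simp: mem_Times_iff)
      then show "y \<in> ?g ` ({1..<t} \<times> {0..<3})" using p by blast
    next
      assume "y \<in> ?g ` ({1..<t} \<times> {0..<3})"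
      then obtain p where p: "p \<in> {1..<t} \<times> {0..<3}" "y = ?g p" by blast
      then have "p \<in> ?W" "fst p ~= 0" by (auto simp: mem_Times_iff)
      then show "y \<in> nbrs G (?g (0, 0))" using arc[OF o(1), of p] p unfolding nbrs_def by simp
    qed
    then show ?thesis by blast
  qed
  moreover have "card (?g ` ({1..<t} \<times> {0..<3})) = card ({1..<t} \<times> {0..<3::nat})"
    by (rule card_image[OF inj_on_subset[OF bij_betw_imp_inj_on[OF g]]]) auto
  ultimately have k: "k = 3 * (t - 1)" using regular_nbrs[OF G(1) gW(1)[OF o(1)]] by simp
  have "V ~= {}" using gW(1)[OF o(1)] by blast
  note D = diameter_gd[OF G(2) this]
  obtain x y where xy: "x \<in> V" "y \<in> V" "gd G x y = d" using D(2) by blast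
  then obtain p q where "p \<in> ?W" "q \<in> ?W" "x = ?g p" "y = ?g q" using gex by metis
  then have "d \<le> 2" using dist[of p q] xy(3) by (simp split: if_splits)
  moreover have "2 \<le> d" using dist[OF o(1,2)] D(1)[OF gW(1)[OF o(1)] gW(1)[OF o(2)]] by simp
  ultimately have d: "d = 2" by simp
  have "(?g (0, 0), ?g (1, 0)) \<in> R" using arc[OF o(1,3)] by simp
  then have "card (closer G (?g (0, 0)) (?g (1, 0))) = \<gamma>" using G(3) unfolding nicely_distance_balanced_def by blast
  moreover have "closer G (?g (0, 0)) (?g (1, 0)) = ?g ` {(0, 0), (1, 1), (1, 2)}"
  proof -
    have iff: "gd G (?g p) (?g (0, 0)) < gd G (?g p) (?g (1, 0)) \<longleftrightarrow> p \<in> {(0, 0), (1, 1), (1, 2)}" if p: "p \<in> ?W" for p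
    proof -
      obtain a b where ab: "p = (a, b)" "b = 0 \<or> b = 1 \<or> b = 2" using p by (cases p) (auto simp: numeral_3_eq_3 less_Suc_eq)
      then show ?thesis using dist[OF p o(1)] dist[OF p o(3)] by auto
    qed
    have s: "{(0, 0), (1, 1), (1, 2)} \<subseteq> ?W" using t by auto
    have "y \<in> closer G (?g (0, 0)) (?g (1, 0)) \<longleftrightarrow> y \<in> ?g ` {(0, 0), (1, 1), (1, 2)}" for y
    proof
      assume "y \<in> closer G (?g (0, 0)) (?g (1, 0))"
      then show "y \<in> ?g ` {(0, 0), (1, 1), (1, 2)}"
        unfolding closer_gd[OF gW(1)[OF o(1)] gW(1)[OF o(3)]] using gex iff by blast
    next
      assume "y \<in> ?g ` {(0, 0), (1, 1), (1, 2)}"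
      then obtain p where "p \<in> {(0, 0), (1, 1), (1, 2)}" "y = ?g p" by blast
      then show "y \<in> closer G (?g (0, 0)) (?g (1, 0))"
        unfolding closer_gd[OF gW(1)[OF o(1)] gW(1)[OF o(3)]] using iff s gW(1) by blast
    qed
    then show ?thesis by blast
  qed
  moreover have "card (?g ` {(0, 0), (1, 1), (1, 2)}) = card {(0, 0), (1, 1), (1, 2) :: nat \<times> nat}"
    by (rule card_image[OF inj_on_subset[OF bij_betw_imp_inj_on[OF g]]]) (use t in auto)
  ultimately have "\<gamma> = 3" by simp
  then show ?thesis using k d by simp
qed


section \<open>The classification\<close>

theorem theorem1p1:
  fixes G :: "'a pair_pre_digraph" and k d \<gamma> :: nat
  assumes "pair_graph G"
    and "Digraph_Component.connected (with_proj G)"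
    and "parcs G \<noteq> {}"
    and "regular_graph G k"
    and "graph_diameter G = ereal (real d)"
    and "nicely_distance_balanced G \<gamma>"
  shows "(\<gamma> = d + 1 \<longleftrightarrow>
            graph_iso G petersen
          \<or> graph_iso G (complement_graph petersen)
          \<or> (\<exists>t\<ge>2. graph_iso G (complete_multipartite t 3))
          \<or> graph_iso G moebius_ladder8
          \<or> graph_iso G (paley_graph F9)
          \<or> graph_iso G (hypercube 3)
          \<or> graph_iso G (line_graph (hypercube 3))
          \<or> graph_iso G icosahedron)
       \<and> (graph_iso G petersen \<longrightarrow> k = 3 \<and> d = 2)
       \<and> (graph_iso G (complement_graph petersen) \<longrightarrow> k = 6 \<and> d = 2)
       \<and> (\<forall>t\<ge>2. graph_iso G (complete_multipartite t 3) \<longrightarrow> k = 3 * (t - 1) \<and> d = 2)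
       \<and> (graph_iso G moebius_ladder8 \<longrightarrow> k = 3 \<and> d = 2)
       \<and> (graph_iso G (paley_graph F9) \<longrightarrow> k = 4 \<and> d = 2)
       \<and> (graph_iso G (hypercube 3) \<longrightarrow> k = 3 \<and> d = 3)
       \<and> (graph_iso G (line_graph (hypercube 3)) \<longrightarrow> k = 4 \<and> d = 3)
       \<and> (graph_iso G icosahedron \<longrightarrow> k = 5 \<and> d = 3)"
proof -
  interpret conn_graph G using assms(1,2) by (simp add: conn_graph_def conn_graph_axioms_def)
  have iso:
    "graph_iso G petersen \<longleftrightarrow> realizes petersen_table (nbrs G) V"
    "graph_iso G (complement_graph petersen) \<longleftrightarrow> realizes (co petersen_table) (nbrs G) V"
    "graph_iso G moebius_ladder8 \<longleftrightarrow> realizes moebius_table (nbrs G) V"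
    "graph_iso G (paley_graph F9) \<longleftrightarrow> realizes paley9_table (nbrs G) V"
    "graph_iso G (hypercube 3) \<longleftrightarrow> realizes cube_table (nbrs G) V"
    "graph_iso G (line_graph (hypercube 3)) \<longleftrightarrow> realizes cuboctahedron_table (nbrs G) V"
    "graph_iso G icosahedron \<longleftrightarrow> realizes icosahedron_table (nbrs G) V"
    by (intro iso_realizes tables_valid valid_co petersen_realizes co_petersen_realizes moebius_realizes
        paley_realizes cube_realizes line_graph_realizes icosahedron_realizes;
      auto simp: petersen_def complement_graph_def moebius_ladder8_def paley_graph_def hypercube_def line_graph_def
        icosahedron_def skeleton_def Let_def)+
  note par = params_eq[OF _ _ assms(4-6)]
  have P: "realizes petersen_table (nbrs G) V \<Longrightarrow> k = 3 \<and> d = 2 \<and> \<gamma> = d + 1"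
    "realizes (co petersen_table) (nbrs G) V \<Longrightarrow> k = 6 \<and> d = 2 \<and> \<gamma> = d + 1"
    "realizes moebius_table (nbrs G) V \<Longrightarrow> k = 3 \<and> d = 2 \<and> \<gamma> = d + 1"
    "realizes paley9_table (nbrs G) V \<Longrightarrow> k = 4 \<and> d = 2 \<and> \<gamma> = d + 1"
    "realizes cube_table (nbrs G) V \<Longrightarrow> k = 3 \<and> d = 3 \<and> \<gamma> = d + 1"
    "realizes cuboctahedron_table (nbrs G) V \<Longrightarrow> k = 4 \<and> d = 3 \<and> \<gamma> = d + 1"
    "realizes icosahedron_table (nbrs G) V \<Longrightarrow> k = 5 \<and> d = 3 \<and> \<gamma> = d + 1"
    using par[OF params_tables(4)] par[OF params_tables(5)] par[OF params_tables(6)] par[OF params_tables(7)]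
      par[OF params_tables(1)] par[OF params_tables(2)] par[OF params_tables(3)] by blast+
  have M: "k = 3 * (t - 1) \<and> d = 2 \<and> \<gamma> = d + 1" if "2 \<le> t" "multipartite (nbrs G) V t" for t
    using multipartite_params[OF that assms(4-6)] .
  have main: "realizes petersen_table (nbrs G) V \<or> realizes (co petersen_table) (nbrs G) V
      \<or> (\<exists>t\<ge>2. multipartite (nbrs G) V t) \<or> realizes moebius_table (nbrs G) V \<or> realizes paley9_table (nbrs G) V
      \<or> realizes cube_table (nbrs G) V \<or> realizes cuboctahedron_table (nbrs G) V \<or> realizes icosahedron_table (nbrs G) V"
    if "\<gamma> = d + 1"
  proof -
    interpret ndb_graph G k d using assms that by unfold_locales simp_all
    have "d = 2 \<or> 3 \<le> d" using D_ge_2 by linarith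
    then show ?thesis using diameter_two diameter_more by blast
  qed
  show ?thesis unfolding iso iso_multipartite using main P M by (intro conjI iffI allI impI) blast+
qed

end
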